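(* Let $\beta\le1$. Suppose that as $N\to\infty$, $\epsilon=o(1)$, $\epsilon^{d/2}N=\Omega(\log N)$, and, if $\beta\neq0$, that the estimated density $\hat p$ satisfies $\sup_{x\in\mathcal{M}}\frac{|\hat p(x)-p(x)|}{p(x)}<\varepsilon_p<0.1$ with $\varepsilon_p=o(1)$. Then for any $f\in C^\infty(\mathcal{M})$, when $N$ is sufficiently large, with probability $>1-2N^{-10}$, with $c_\beta:=\max\{1.1^{-\beta-1},0.9^{-\beta-1}\}$, $$E_{N,\epsilon}(f,f)=\mathcal{E}_{p^{2-2\beta}}(f,f)\big(1+O^{[1]}(\beta c_\beta\varepsilon_p)\big)+O^{[f,p,\beta]}(\epsilon)+O^{[1]}\!\left(\sqrt{\frac{\log N}{N\epsilon^{d/2}}\int_{\mathcal{M}}|\nabla f|^4p^{2-4\beta}\,dV}\right).$$ In particular, when $\beta=0$, $$E_{N,\epsilon}(f,f)=\mathcal{E}_{p^{2}}(f,f)+O^{[f,p]}(\epsilon)+O^{[1]}\!\left(\sqrt{\frac{\log N}{N\epsilon^{d/2}}\int_{\mathcal{M}}|\nabla f|^4p^{2}\,dV}\right).$$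
   Context: $\mathcal{M}$ is a $d$-dimensional $C^\infty$ compact manifold without boundary, isometrically embedded in $\mathbb{R}^D$ ($\|\cdot\|$ is the Euclidean norm of $\mathbb{R}^D$), with Riemannian volume measure $dV$ and manifold gradient $\nabla$. $p\in C^\infty(\mathcal{M})$ is a probability density with respect to $dV$ with $0<p_{min}\le p\le p_{max}<\infty$. Kernel: $k_0:[0,\infty)\to\mathbb{R}$ is continuous on $[0,\infty)$, $C^4$ on $(0,\infty)$, $k_0\ge0$, $\|k_0\|_\infty>0$, and there are $a,a_l>0$ with $|k_0^{(l)}(\xi)|\le a_le^{-a\xi}$ for all $\xi>0$, $l=0,\dots,4$. $m_2:=\frac1d\int_{\mathbb{R}^d}|u|^2k_0(|u|^2)\,du$. Data: $X=\{x_i\}_{i=1}^N$ are i.i.d. from $p$. $\hat p$ is an estimate of $p$ computed from a separate dataset independent of $X$, treated as a fixed (non-random) function on $\mathcal M$ by conditioning, with $\hat p(x_i)>0$ for all $i$; probability is over $X$. $\epsilon>0$, $\hat p$, $\varepsilon_p$ may vary with $N$. When $\beta=0$ no $\hat p$ is needed. Fixed-bandwidth graph Dirichlet form: $$W^{(\beta)}_{ij}=k_0\!\left(\frac{\|x_i-x_j\|^2}{\epsilon}\right)\frac{1}{\hat p(x_i)^\beta\hat p(x_j)^\beta},\qquad E_{N,\epsilon}(f,f)=\frac{1}{\epsilon m_2}\frac1{N^2}\sum_{i,j=1}^N\epsilon^{-d/2}W^{(\beta)}_{ij}(f(x_i)-f(x_j))^2.$$ For a positive density $q$ on $\mathcal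 M$, $\mathcal{E}_q(f,f)=\int_{\mathcal{M}}q|\nabla f|^2\,dV$. Asymptotic notation: $f=O(g)$ means $|f|\le C|g|$ in the limit; $f=o(g)$ means $|f|/g\to0$; $f=\Omega(g)$ (for $f,g>0$) means $f/g\to\infty$. Superscripts such as $^{[f,p,\beta]}$ list what the constant may depend on, $^{[1]}$ meaning an absolute constant; dependence on $\mathcal{M}$ (including $d$) and $k_0$ is always allowed. *)

theory Defs
  imports "HOL-Probability.Probability" "HOL-Library.Landau_Symbols"
begin

section \<open>Smooth maps between Euclidean spaces\<close>

text \<open>Only meant for open \<open>S\<close>, since \<^const>\<open>frechet_derivative\<close> is taken at full neighbourhoods.\<close>

primrec C_k_on :: "nat \<Rightarrow> 'a::euclidean_space set \<Rightarrow> ('a \<Rightarrow> 'b::euclidean_space) \<Rightarrow> bool" where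
  "C_k_on 0 S f \<longleftrightarrow> continuous_on S f"
| "C_k_on (Suc k) S f \<longleftrightarrow>
     (\<forall>x\<in>S. f differentiable (at x)) \<and>
     (\<forall>v. C_k_on k S (\<lambda>x. frechet_derivative f (at x) v))"

definition C_inf_on :: "'a::euclidean_space set \<Rightarrow> ('a \<Rightarrow> 'b::euclidean_space) \<Rightarrow> bool" where
  "C_inf_on S f \<longleftrightarrow> (\<forall>k. C_k_on k S f)"


section \<open>Embedded submanifolds with the induced Riemannian metric\<close>

text \<open>
  An isometrically embedded compact manifold is identified with its image \<open>M\<close> in the ambient
  space \<open>real ^ 'D\<close>; its Riemannian metric is then the restriction of the Euclidean inner product.
  The intrinsic dimension is \<open>CARD('d)\<close>: charts are given by their inverses, the local
  parametrizations \<open>\<phi>\<close> from open subsets of \<open>real ^ 'd\<close>.  Where \<open>'d\<close> cannot be read off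
  the other arguments it is passed as \<open>TYPE('d)\<close>.
\<close>

definition local_param ::
  "(real ^ 'D::finite) set \<Rightarrow> (real ^ 'd::finite) set \<Rightarrow> (real ^ 'd \<Rightarrow> real ^ 'D) \<Rightarrow> bool" where
  "local_param M U \<phi> \<longleftrightarrow>
     open U \<and> C_inf_on U \<phi> \<and>
     (\<forall>u\<in>U. inj (frechet_derivative \<phi> (at u))) \<and>
     openin (top_of_set M) (\<phi> ` U) \<and>
     (\<exists>\<psi>. homeomorphism U (\<phi> ` U) \<phi> \<psi>)"

definition compact_smooth_manifold :: "'d::finite itself \<Rightarrow> (real ^ 'D::finite) set \<Rightarrow> bool" where
  "compact_smooth_manifold _ M \<longleftrightarrow>
     compact M \<and>
     (\<forall>x\<in>M. \<exists>(U :: (real ^ 'd) set) \<phi>. local_param M U \<phi> \<and> x \<in> \<phi> ` U)"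

definition smooth_function ::
  "'d::finite itself \<Rightarrow> (real ^ 'D::finite) set \<Rightarrow> (real ^ 'D \<Rightarrow> real) \<Rightarrow> bool" where
  "smooth_function _ M f \<longleftrightarrow>
     (\<forall>(U :: (real ^ 'd) set) \<phi>. local_param M U \<phi> \<longrightarrow> C_inf_on U (f \<circ> \<phi>))"

definition tangent_space ::
  "'d::finite itself \<Rightarrow> (real ^ 'D::finite) set \<Rightarrow> real ^ 'D \<Rightarrow> (real ^ 'D) set" where
  "tangent_space _ M x =
     {v. \<exists>(U :: (real ^ 'd) set) \<phi> u h.
           local_param M U \<phi> \<and> u \<in> U \<and> \<phi> u = x \<and> v = frechet_derivative \<phi> (at u) h}"

text \<open>The Riemannian gradient: the tangent vector representing the differential of \<open>f\<close>,
  i.e. \<open>\<langle>grad f, w\<rangle> = df(w)\<close> for all tangent vectors \<open>w = d\<phi>(h)\<close>, where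
  \<open>df(d\<phi>(h)) = d(f \<circ> \<phi>)(h)\<close>.\<close>

definition manifold_grad ::
  "'d::finite itself \<Rightarrow> (real ^ 'D::finite) set \<Rightarrow> (real ^ 'D \<Rightarrow> real) \<Rightarrow> real ^ 'D \<Rightarrow> real ^ 'D" where
  "manifold_grad T M f x =
     (THE v. v \<in> tangent_space T M x \<and>
        (\<forall>(U :: (real ^ 'd) set) \<phi> u h. local_param M U \<phi> \<and> u \<in> U \<and> \<phi> u = x \<longrightarrow>
           v \<bullet> frechet_derivative \<phi> (at u) h = frechet_derivative (f \<circ> \<phi>) (at u) h))"

definition metric_tensor ::
  "(real ^ 'd::finite \<Rightarrow> real ^ 'D::finite) \<Rightarrow> real ^ 'd \<Rightarrow> real ^ 'd ^ 'd" where
  "metric_tensor \<phi> u =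
     (\<chi> i j. frechet_derivative \<phi> (at u) (axis i 1) \<bullet> frechet_derivative \<phi> (at u) (axis j 1))"

text \<open>The Riemannian volume is the unique Borel measure on \<open>M\<close> given by
  \<open>dV = sqrt (det g) du\<close> in every chart.\<close>

definition riemannian_volume ::
  "'d::finite itself \<Rightarrow> (real ^ 'D::finite) set \<Rightarrow> (real ^ 'D) measure \<Rightarrow> bool" where
  "riemannian_volume _ M V \<longleftrightarrow>
     space V = M \<and> sets V = sets (restrict_space borel M) \<and>
     (\<forall>(U :: (real ^ 'd) set) \<phi> A.
        local_param M U \<phi> \<and> A \<in> sets borel \<and> A \<subseteq> \<phi> ` U \<longrightarrow>
        emeasure V A =
          (\<integral>\<^sup>+ u. ennreal (sqrt (det (metric_tensor \<phi> u))) * indicator {u \<in> U. \<phi> u \<in> A} u \<partial>lborel))"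

definition smooth_density ::
  "'d::finite itself \<Rightarrow> (real ^ 'D::finite) set \<Rightarrow> (real ^ 'D) measure \<Rightarrow> (real ^ 'D \<Rightarrow> real) \<Rightarrow> bool" where
  "smooth_density T M V p \<longleftrightarrow>
     smooth_function T M p \<and> (\<integral>x. p x \<partial>V) = 1 \<and>
     (\<exists>p_min p_max. 0 < p_min \<and> (\<forall>x\<in>M. p_min \<le> p x \<and> p x \<le> p_max))"

definition manifold_dirichlet ::
  "'d::finite itself \<Rightarrow> (real ^ 'D::finite) set \<Rightarrow> (real ^ 'D) measure \<Rightarrow> (real ^ 'D \<Rightarrow> real) \<Rightarrow>
   (real ^ 'D \<Rightarrow> real) \<Rightarrow> real" where
  "manifold_dirichlet T M V q f = (\<integral>x. q x * (norm (manifold_grad T M f x))\<^sup>2 \<partial>V)"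


section \<open>Kernels and the graph Dirichlet form\<close>

text \<open>Kernels are only evaluated on the nonnegative reals.\<close>

definition admissible_kernel :: "(real \<Rightarrow> real) \<Rightarrow> bool" where
  "admissible_kernel k0 \<longleftrightarrow>
     continuous_on {0..} k0 \<and>
     (\<forall>l<4. \<forall>\<xi>>0. ((deriv ^^ l) k0) differentiable (at \<xi>)) \<and>
     continuous_on {0<..} ((deriv ^^ 4) k0) \<and>
     (\<forall>\<xi>\<ge>0. 0 \<le> k0 \<xi>) \<and>
     (SUP \<xi>\<in>{0..}. ereal \<bar>k0 \<xi>\<bar>) > 0 \<and>
     (\<exists>a>0. \<exists>al :: nat \<Rightarrow> real. \<forall>l\<le>4. al l > 0 \<and>
        (\<forall>\<xi>>0. \<bar>(deriv ^^ l) k0 \<xi>\<bar> \<le> al l * exp (- a * \<xi>)))"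

definition kernel_m2 :: "'d::finite itself \<Rightarrow> (real \<Rightarrow> real) \<Rightarrow> real" where
  "kernel_m2 _ k0 =
     1 / real CARD('d) * (\<integral>u. (norm (u :: real ^ 'd))\<^sup>2 * k0 ((norm u)\<^sup>2) \<partial>lborel)"

text \<open>For \<open>\<beta> = 0\<close> the density estimate \<open>ph\<close> must not enter at all, whereas
  \<open>0 powr 0 = 0\<close>; hence the case distinction.\<close>

definition graph_weight ::
  "(real \<Rightarrow> real) \<Rightarrow> real \<Rightarrow> (real ^ 'D::finite \<Rightarrow> real) \<Rightarrow> real \<Rightarrow> real ^ 'D \<Rightarrow> real ^ 'D \<Rightarrow> real" where
  "graph_weight k0 \<beta> ph \<epsilon> x y =
     k0 ((norm (x - y))\<^sup>2 / \<epsilon>) *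
     (if \<beta> = 0 then 1 else 1 / (ph x powr \<beta> * ph y powr \<beta>))"

definition graph_dirichlet ::
  "'d::finite itself \<Rightarrow> (real \<Rightarrow> real) \<Rightarrow> real \<Rightarrow> (real ^ 'D::finite \<Rightarrow> real) \<Rightarrow> real \<Rightarrow> nat \<Rightarrow>
   (nat \<Rightarrow> real ^ 'D) \<Rightarrow> (real ^ 'D \<Rightarrow> real) \<Rightarrow> real" where
  "graph_dirichlet T k0 \<beta> ph \<epsilon> N x f =
     1 / (\<epsilon> * kernel_m2 T k0) * (1 / (real N)\<^sup>2) *
     (\<Sum>i<N. \<Sum>j<N. \<epsilon> powr (- real CARD('d) / 2) *
        graph_weight k0 \<beta> ph \<epsilon> (x i) (x j) * (f (x i) - f (x j))\<^sup>2)"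

definition iid_samples :: "(real ^ 'D::finite) measure \<Rightarrow> (real ^ 'D \<Rightarrow> real) \<Rightarrow> nat \<Rightarrow>
   (nat \<Rightarrow> real ^ 'D) measure" where
  "iid_samples V p N = PiM {..<N} (\<lambda>_. density V (\<lambda>x. ennreal (p x)))"

text \<open>Inner-probability reading: \<open>Q\<close> holds on a measurable event of probability \<open>> r\<close>.  This
  agrees with \<open>P(Q) > r\<close> for measurable \<open>Q\<close> and is also meaningful when the given
  density estimate is not assumed to be measurable.\<close>

definition holds_with_prob_gt :: "'w measure \<Rightarrow> real \<Rightarrow> ('w \<Rightarrow> bool) \<Rightarrow> bool" where
  "holds_with_prob_gt P r Q \<longleftrightarrow> (\<exists>A\<in>sets P. measure P A > r \<and> (\<forall>\<omega>\<in>A. Q \<omega>))"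

definition c_factor :: "real \<Rightarrow> real" where
  "c_factor \<beta> = max (1.1 powr (- \<beta> - 1)) (0.9 powr (- \<beta> - 1))"

end

theory Submission
  imports Defs
begin

text \<open>
  Bias. In a chart around the base point, substitute w = u + d z with d the square root of the
  bandwidth. The rescaled integrand G satisfies G(d, u, -z) = G(-d, u, z), so an expansion of first
  order in d with quadratic remainder, valid for both signs of d, is enough: the linear term is odd
  in z and integrates to zero, which leaves an error of the order of the bandwidth uniformly in the
  base point, and no partition of unity is needed because the estimate is pointwise. The leading
  term is computed by an isometry of the tangent space with the coordinate space and the rotation
  invariance of the kernel. Measurability and boundedness of the gradient norm come for free, since
  its square is a limit of these averages.

  Fluctuation. The pairs (i, j) with i + j in a fixed class modulo N form a matching, hence the
  corresponding terms are independent and obey a Bernstein inequality; the union bound over the N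
  classes costs only a factor N. When the fourth moment of the gradient vanishes, f is locally
  constant and the Dirichlet form is deterministically as small as the bandwidth. Replacing p by its
  estimate changes every (nonnegative) term by a relative error of the order
  of the relative error of that estimate.
\<close>

section \<open>Directional Taylor expansions\<close>

text \<open>The constants of the relative error and of the fluctuation are fixed before p, f and
  \<beta>, so the fluctuation has to be measured by its true variance. For this reason the bias
  estimate allows any even power n and any decaying kernel: with the squared kernel and fourth
  powers it shows that the second moment of one summand is
  \<open>m4 * I4 / (m2\<^sup>2 * d ^ CARD('d))\<close> up to a correction smaller by a factor of
  order d^2, where \<open>I4\<close> is the integral under the square root. Doubling the main term
  absorbs the correction, but only if \<open>I4\<close> is positive; this forces the separate case
  \<open>I4 = 0\<close>.

  The Bernstein bound also needs summands of size at most a constant times d^(-dim). Bounding the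
  squared difference of f by a constant would lose a further d^(-2); the Lipschitz bound on f
  together with the decay of the kernel recovers it.

  The comparison with the estimated density is a deterministic inequality between two graph forms at
  the same sample points. It therefore holds on the event found for p, which is the same for every
  estimate.\<close>

definition dirder :: "('a::euclidean_space \<Rightarrow> real) \<Rightarrow> 'a \<Rightarrow> 'a \<Rightarrow> real" where
  "dirder F v = (\<lambda>x. frechet_derivative F (at x) v)"

text \<open>Only repeated derivatives in one direction are needed: on the line through x in
  direction z they are the ordinary derivatives of a function of one variable.\<close>

definition dirders :: "nat \<Rightarrow> ('a::euclidean_space \<Rightarrow> real) \<Rightarrow> 'a \<Rightarrow> 'a \<Rightarrow> real" where
  "dirders m F z = ((\<lambda>G. dirder G z) ^^ m) F"

lemma dirders_0 [simp]: "dirders 0 F z = F"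
  by (simp add: dirders_def)

lemma dirders_Suc: "dirders (Suc m) F z = dirder (dirders m F z) z"
  by (simp add: dirders_def)

text \<open>\<open>C_k_on\<close> speaks about the derivative taken first, whereas differentiating
  along a line appends one at the end. The inductions need the first form, the chain rule the
  second.\<close>

lemma dirders_Suc2: "dirders (Suc m) F z = dirders m (dirder F z) z"
  using funpow_swap1[of "\<lambda>G. dirder G z" m F] by (simp add: dirders_def)

section \<open>Calculus of \<open>C_k_on\<close> and of iterated directional derivatives\<close>

lemma C_k_on_Suc_dirder:
  "C_k_on (Suc k) S F \<longleftrightarrow> (\<forall>x\<in>S. F differentiable (at x)) \<and> (\<forall>v. C_k_on k S (dirder F v))"
  by (simp add: dirder_def)

lemma C_k_on_continuous: "C_k_on k S f \<Longrightarrow> continuous_on S f"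
  by (cases k) (auto intro!: continuous_at_imp_continuous_on differentiable_imp_continuous_within)

lemma C_k_on_lower: "C_k_on (Suc k) S f \<Longrightarrow> C_k_on k S f"
  by (induction k arbitrary: f)
     (auto intro!: continuous_at_imp_continuous_on differentiable_imp_continuous_within)

lemma C_k_on_le: "C_k_on k S f \<Longrightarrow> m \<le> k \<Longrightarrow> C_k_on m S f"
proof (induction k)
  case (Suc k)
  then show ?case using C_k_on_lower[of k S f] by (cases "m = Suc k") (auto simp del: C_k_on.simps(2))
qed auto

lemma frechet_derivative_cong_open:
  assumes "open U" "x \<in> U" "\<And>y. y \<in> U \<Longrightarrow> f y = g y"
  shows "frechet_derivative f (at x) = frechet_derivative g (at x)"
proof -
  have "(f has_derivative D) (at x) \<longleftrightarrow> (g has_derivative D) (at x)" for D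
    by (intro iffI; erule has_derivative_transform_within_open[OF _ assms(1,2)]) (auto simp: assms(3))
  then show ?thesis by (simp add: frechet_derivative_def)
qed

lemma differentiable_cong_open:
  assumes "open U" "x \<in> U" "\<And>y. y \<in> U \<Longrightarrow> f y = g y"
  shows "f differentiable (at x) \<longleftrightarrow> g differentiable (at x)"
proof -
  have "(f has_derivative D) (at x) \<longleftrightarrow> (g has_derivative D) (at x)" for D
    by (intro iffI; erule has_derivative_transform_within_open[OF _ assms(1,2)]) (auto simp: assms(3))
  then show ?thesis by (simp add: differentiable_def)
qed

lemma C_k_on_cong:
  assumes "open U" "\<And>y. y \<in> U \<Longrightarrow> f y = g y"
  shows "C_k_on k U f \<longleftrightarrow> C_k_on k U g"
  using assms(2)
proof (induction k arbitrary: f g)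
  case 0
  then show ?case by (auto cong: continuous_on_cong)
next
  case (Suc k)
  have 1: "frechet_derivative f (at x) = frechet_derivative g (at x)" if "x \<in> U" for x
    using frechet_derivative_cong_open[OF assms(1) that] Suc.prems by blast
  have 2: "f differentiable (at x) \<longleftrightarrow> g differentiable (at x)" if "x \<in> U" for x
    using differentiable_cong_open[OF assms(1) that] Suc.prems by blast
  have 3: "C_k_on k U (\<lambda>x. frechet_derivative f (at x) v) = C_k_on k U (\<lambda>x. frechet_derivative g (at x) v)" for v
    by (rule Suc.IH) (simp add: 1)
  show ?case using 2 3 by simp
qed

lemma frechet_derivative_inner:
  assumes "f differentiable (at x)"
  shows "frechet_derivative (\<lambda>x. f x \<bullet> b) (at x) v = frechet_derivative f (at x) v \<bullet> b"
proof -
  have "(f has_derivative frechet_derivative f (at x)) (at x)"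
    using assms frechet_derivative_works by blast
  then have "((\<lambda>x. f x \<bullet> b) has_derivative (\<lambda>v. frechet_derivative f (at x) v \<bullet> b)) (at x)"
    by (rule has_derivative_inner_left)
  then show ?thesis
    by (subst frechet_derivative_at[symmetric]) (assumption, rule refl)
qed

lemma C_k_on_inner:
  assumes "open U" "C_k_on k U f"
  shows "C_k_on k U (\<lambda>x. f x \<bullet> b)"
  using assms(2)
proof (induction k arbitrary: f)
  case 0
  then show ?case by (auto intro!: continuous_intros)
next
  case (Suc k)
  have "C_k_on k U (\<lambda>x. frechet_derivative (\<lambda>x. f x \<bullet> b) (at x) v)" for v
    using C_k_on_cong[OF assms(1), of "\<lambda>x. frechet_derivative (\<lambda>x. f x \<bullet> b) (at x) v" "\<lambda>x. frechet_derivative f (at x) v \<bullet> b" k]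
      Suc.IH[of "\<lambda>x. frechet_derivative f (at x) v"] Suc.prems frechet_derivative_inner by fastforce
  moreover have "(\<lambda>x. f x \<bullet> b) differentiable (at x)" if "x \<in> U" for x
    using Suc.prems that by (auto intro!: differentiable_inner)
  ultimately show ?case by simp
qed

lemma C_k_on_dirders:
  "C_k_on (m + k) U F \<Longrightarrow> C_k_on k U (dirders m F z)"
  by (induction m arbitrary: F) (auto simp: dirders_Suc2 C_k_on_Suc_dirder simp del: C_k_on.simps(2))

lemma dirders_cong:
  assumes "open U" "\<And>y. y \<in> U \<Longrightarrow> F y = G y" "x \<in> U"
  shows "dirders m F z x = dirders m G z x"
  using assms(2,3)
proof (induction m arbitrary: F G x)
  case (Suc m)
  have *: "dirder F z y = dirder G z y" if "y \<in> U" for y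
  proof -
    have "frechet_derivative F (at y) = frechet_derivative G (at y)"
      by (rule frechet_derivative_cong_open[OF assms(1) that]) (rule Suc.prems(1))
    then show ?thesis by (simp add: dirder_def)
  qed
  show ?case unfolding dirders_Suc2 by (rule Suc.IH) (use * Suc.prems in auto)
qed auto

lemma dirders_sum:
  assumes "open U" "finite B" "\<And>b. b \<in> B \<Longrightarrow> C_k_on k U (G b)" "x \<in> U"
  shows "dirders k (\<lambda>x. \<Sum>b\<in>B. c b * G b x) z x = (\<Sum>b\<in>B. c b * dirders k (G b) z x)"
  using assms(3,4)
proof (induction k arbitrary: G x)
  case (Suc k)
  have "dirder (\<lambda>x. \<Sum>b\<in>B. c b * G b x) z y = (\<Sum>b\<in>B. c b * dirder (G b) z y)" if "y \<in> U" for y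
  proof -
    have "((\<lambda>x. \<Sum>b\<in>B. c b * G b x) has_derivative (\<lambda>v. \<Sum>b\<in>B. c b * frechet_derivative (G b) (at y) v)) (at y)"
      using Suc.prems(1) that
      by (intro has_derivative_sum has_derivative_mult_right) (auto simp: frechet_derivative_works[symmetric])
    then show ?thesis
      unfolding dirder_def by (subst frechet_derivative_at[symmetric]) (assumption, rule refl)
  qed
  then have "dirders (Suc k) (\<lambda>x. \<Sum>b\<in>B. c b * G b x) z x = dirders k (\<lambda>y. \<Sum>b\<in>B. c b * dirder (G b) z y) z x"
    unfolding dirders_Suc2 by (intro dirders_cong[OF assms(1)]) (use Suc.prems in auto)
  also have "\<dots> = (\<Sum>b\<in>B. c b * dirders k (dirder (G b) z) z x)"
    using Suc.prems by (intro Suc.IH) (auto simp: dirder_def)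
  finally show ?case by (simp add: dirders_Suc2)
qed auto

lemma dirder_basis_sum:
  assumes "F differentiable (at x)"
  shows "dirder F z x = (\<Sum>b\<in>Basis. (z \<bullet> b) * dirder F b x)"
proof -
  have l: "linear (frechet_derivative F (at x))"
    using assms linear_frechet_derivative by blast
  have "frechet_derivative F (at x) z = frechet_derivative F (at x) (\<Sum>b\<in>Basis. (z \<bullet> b) *\<^sub>R b)"
    by (simp add: euclidean_representation)
  also have "\<dots> = (\<Sum>b\<in>Basis. (z \<bullet> b) * frechet_derivative F (at x) b)"
    by (simp add: linear_sum[OF l] linear_cmul[OF l])
  finally show ?thesis by (simp add: dirder_def)
qed

text \<open>The direction z ranges over an unbounded set, so compactness in x alone is not enough.
  Expanding the first derivative in the basis trades one order for a factor of at most
  \<open>norm z\<close> and leaves finitely many functions to the induction hypothesis.\<close>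

lemma dirders_bound:
  assumes "open U" "C_k_on k U F" "compact K" "K \<subseteq> U"
  shows "\<exists>C\<ge>0. \<forall>z. \<forall>x\<in>K. \<bar>dirders k F z x\<bar> \<le> C * norm z ^ k"
  using assms(2)
proof (induction k arbitrary: F)
  case 0
  then have "compact (F ` K)"
    using assms continuous_on_subset by (auto intro!: compact_continuous_image)
  then have "bounded (F ` K)" by (rule compact_imp_bounded)
  then obtain C where "\<forall>y\<in>F ` K. norm y \<le> C"
    unfolding bounded_iff by blast
  then have "\<forall>x\<in>K. \<bar>F x\<bar> \<le> \<bar>C\<bar>" by force
  then show ?case by (intro exI[of _ "\<bar>C\<bar>"]) simp
next
  case (Suc k)
  have "\<exists>C\<ge>0. \<forall>z. \<forall>x\<in>K. \<bar>dirders k (dirder F b) z x\<bar> \<le> C * norm z ^ k" for b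
    using Suc by (auto simp: dirder_def)
  then obtain C where C: "\<And>b. C b \<ge> 0" "\<And>b z x. x \<in> K \<Longrightarrow> \<bar>dirders k (dirder F b) z x\<bar> \<le> C b * norm z ^ k"
    by metis
  have "\<bar>dirders (Suc k) F z x\<bar> \<le> (\<Sum>b\<in>Basis. C b) * norm z ^ Suc k" if "x \<in> K" for z x
  proof -
    have "dirders (Suc k) F z x = dirders k (\<lambda>x. \<Sum>b\<in>Basis. (z \<bullet> b) * dirder F b x) z x"
      unfolding dirders_Suc2 using Suc.prems assms that
      by (intro dirders_cong[OF assms(1)]) (auto intro!: dirder_basis_sum)
    also have "\<dots> = (\<Sum>b\<in>Basis. (z \<bullet> b) * dirders k (dirder F b) z x)"
      using Suc.prems assms(4) that by (intro dirders_sum[OF assms(1)]) (auto simp: dirder_def)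
    also have "\<bar>\<dots>\<bar> \<le> (\<Sum>b\<in>Basis. norm z * (C b * norm z ^ k))"
      by (intro order_trans[OF sum_abs] sum_mono)
         (auto simp: abs_mult intro!: mult_mono C that Basis_le_norm)
    finally show ?thesis by (simp add: sum_distrib_right sum_distrib_left algebra_simps)
  qed
  then show ?case by (intro exI[of _ "\<Sum>b\<in>Basis. C b"]) (auto intro!: sum_nonneg C)
qed

lemma DERIV_dirders_line:
  assumes "C_k_on (Suc m) U F" "u + t *\<^sub>R z \<in> U"
  shows "((\<lambda>t. dirders m F z (u + t *\<^sub>R z)) has_real_derivative dirders (Suc m) F z (u + t *\<^sub>R z)) (at t)"
proof -
  let ?G = "dirders m F z"
  have "C_k_on 1 U ?G" using C_k_on_dirders[of m 1 U F z] assms by simp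
  then have "(?G has_derivative frechet_derivative ?G (at (u + t *\<^sub>R z))) (at (u + t *\<^sub>R z))"
    using assms frechet_derivative_works by auto
  moreover have "((\<lambda>t. u + t *\<^sub>R z) has_derivative (\<lambda>h. h *\<^sub>R z)) (at t)"
    by (auto intro!: derivative_eq_intros)
  ultimately have "((\<lambda>t. ?G (u + t *\<^sub>R z)) has_derivative (\<lambda>h. frechet_derivative ?G (at (u + t *\<^sub>R z)) (h *\<^sub>R z))) (at t)"
    using has_derivative_compose by blast
  moreover have "linear (frechet_derivative ?G (at (u + t *\<^sub>R z)))"
    using \<open>C_k_on 1 U ?G\<close> assms(2) by (auto intro!: linear_frechet_derivative)
  then have "(\<lambda>h. frechet_derivative ?G (at (u + t *\<^sub>R z)) (h *\<^sub>R z)) = (*) (dirders (Suc m) F z (u + t *\<^sub>R z))"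
    by (simp add: fun_eq_iff linear_cmul dirders_Suc dirder_def)
  ultimately show ?thesis
    by (simp only: has_field_derivative_def)
qed

text \<open>The one-variable Taylor theorem on the symmetric interval of radius |d| treats both
  signs of d at once. About t only |t| \<le> |d| is kept, which suffices because derivatives are
  later bounded on whole balls.\<close>

lemma dirders_taylor:
  assumes "C_k_on (Suc n) U F" "u \<in> U" "\<And>t. \<bar>t\<bar> \<le> \<bar>d\<bar> \<Longrightarrow> u + t *\<^sub>R z \<in> U" "d \<noteq> 0"
  shows "\<exists>t. \<bar>t\<bar> \<le> \<bar>d\<bar> \<and> F (u + d *\<^sub>R z) = (\<Sum>m<Suc n. dirders m F z u / fact m * d ^ m)
            + dirders (Suc n) F z (u + t *\<^sub>R z) / fact (Suc n) * d ^ Suc n"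
proof -
  let ?diff = "\<lambda>m t. dirders m F z (u + t *\<^sub>R z)"
  have "\<forall>m t. m < Suc n \<and> - \<bar>d\<bar> \<le> t \<and> t \<le> \<bar>d\<bar> \<longrightarrow> DERIV (?diff m) t :> ?diff (Suc m) t"
    using assms(1,3) by (intro allI impI DERIV_dirders_line[of _ U]) (auto intro: C_k_on_le simp del: C_k_on.simps(2))
  then have "\<exists>t. (if d < 0 then d < t \<and> t < 0 else 0 < t \<and> t < d) \<and>
    F (u + d *\<^sub>R z) = (\<Sum>m<Suc n. ?diff m 0 / fact m * (d-0) ^ m) + ?diff (Suc n) t / fact (Suc n) * (d-0) ^ Suc n"
    using assms(4) by (intro Taylor[where a = "- \<bar>d\<bar>" and b = "\<bar>d\<bar>"]) auto
  then obtain t where t: "if d < 0 then d < t \<and> t < 0 else 0 < t \<and> t < d"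
    "F (u + d *\<^sub>R z) = (\<Sum>m<Suc n. ?diff m 0 / fact m * (d-0) ^ m) + ?diff (Suc n) t / fact (Suc n) * (d-0) ^ Suc n"
    by blast
  have "\<bar>t\<bar> \<le> \<bar>d\<bar>" using t(1) by (auto split: if_splits)
  then show ?thesis using t(2) by (intro exI[of _ t]) simp
qed

section \<open>Second-order expansions in the bandwidth\<close>

text \<open>A Gaussian with a polynomial factor: under multiplication the degrees and the rates add
  up. Smooth factors are carried with rate c = 0; the decay of a product comes from its kernel
  factor alone.\<close>

definition wt :: "real \<Rightarrow> nat \<Rightarrow> real \<Rightarrow> 'a::euclidean_space \<Rightarrow> real" where
  "wt C m c z = C * (1 + norm z) ^ m * exp (- c * (norm z)\<^sup>2)"

text \<open>Here d ranges over both signs, which the cancellation of the linear term by symmetry needs.\<close>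

definition expand :: "'u set \<Rightarrow> real \<Rightarrow> real \<Rightarrow> (real \<Rightarrow> 'u \<Rightarrow> 'a::euclidean_space \<Rightarrow> real) \<Rightarrow> ('u \<Rightarrow> 'a \<Rightarrow> real) \<Rightarrow> bool" where
  "expand K \<rho> c X X0 \<longleftrightarrow> (\<exists>X1 C m. C \<ge> 0 \<and> (\<forall>u\<in>K. \<forall>z d. d \<noteq> 0 \<and> \<bar>d\<bar> \<le> 1 \<and> \<bar>d\<bar> * norm z < \<rho> \<longrightarrow>
      \<bar>X0 u z\<bar> \<le> wt C m c z \<and> \<bar>X1 u z\<bar> \<le> wt C m c z \<and>
      \<bar>X d u z - X0 u z - d * X1 u z\<bar> \<le> d\<^sup>2 * wt C m c z))"

section \<open>Algebra of expansions\<close>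

lemma wt_nonneg [simp]: "C \<ge> 0 \<Longrightarrow> 0 \<le> wt C m c z"
  by (simp add: wt_def)

lemma wt_mono: "0 \<le> C \<Longrightarrow> C \<le> C' \<Longrightarrow> m \<le> m' \<Longrightarrow> wt C m c z \<le> wt C' m' c z"
  unfolding wt_def by (intro mult_right_mono mult_mono power_increasing) auto

lemma wt_mult: "wt C m c z * wt C' m' c' z = wt (C * C') (m + m') (c + c') z"
  by (simp add: wt_def power_add exp_add[symmetric] algebra_simps)

lemma wt_add: "wt C m c z + wt C' m c z = wt (C + C') m c z"
  by (simp add: wt_def algebra_simps)

lemma wt_scale: "k * wt C m c z = wt (k * C) m c z"
  by (simp add: wt_def)

lemma expandI:
  assumes "C \<ge> 0"
    and "\<And>u z d. u \<in> K \<Longrightarrow> d \<noteq> 0 \<Longrightarrow> \<bar>d\<bar> \<le> 1 \<Longrightarrow> \<bar>d\<bar> * norm z < \<rho> \<Longrightarrow> \<bar>X0 u z\<bar> \<le> wt C m c z"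
    and "\<And>u z d. u \<in> K \<Longrightarrow> d \<noteq> 0 \<Longrightarrow> \<bar>d\<bar> \<le> 1 \<Longrightarrow> \<bar>d\<bar> * norm z < \<rho> \<Longrightarrow> \<bar>X1 u z\<bar> \<le> wt C m c z"
    and "\<And>u z d. u \<in> K \<Longrightarrow> d \<noteq> 0 \<Longrightarrow> \<bar>d\<bar> \<le> 1 \<Longrightarrow> \<bar>d\<bar> * norm z < \<rho> \<Longrightarrow> 
      \<bar>X d u z - X0 u z - d * X1 u z\<bar> \<le> d\<^sup>2 * wt C m c z"
  shows "expand K \<rho> c X X0"
  unfolding expand_def using assms by (intro exI[of _ X1] exI[of _ C] exI[of _ m]) blast

lemma expandE:
  assumes "expand K \<rho> c X X0"
  obtains X1 C m where "C \<ge> 0"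
    and "\<And>u z d. u \<in> K \<Longrightarrow> d \<noteq> 0 \<Longrightarrow> \<bar>d\<bar> \<le> 1 \<Longrightarrow> \<bar>d\<bar> * norm z < \<rho> \<Longrightarrow> \<bar>X0 u z\<bar> \<le> wt C m c z"
    and "\<And>u z d. u \<in> K \<Longrightarrow> d \<noteq> 0 \<Longrightarrow> \<bar>d\<bar> \<le> 1 \<Longrightarrow> \<bar>d\<bar> * norm z < \<rho> \<Longrightarrow> \<bar>X1 u z\<bar> \<le> wt C m c z"
    and "\<And>u z d. u \<in> K \<Longrightarrow> d \<noteq> 0 \<Longrightarrow> \<bar>d\<bar> \<le> 1 \<Longrightarrow> \<bar>d\<bar> * norm z < \<rho> \<Longrightarrow> 
      \<bar>X d u z - X0 u z - d * X1 u z\<bar> \<le> d\<^sup>2 * wt C m c z"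
  using assms unfolding expand_def by blast

lemma expand_const: "expand K \<rho> 0 (\<lambda>d u z. k) (\<lambda>u z. k)"
  by (rule expandI[where C = "\<bar>k\<bar>" and m = 0 and ?X1.0 = "\<lambda>u z. 0"]) (auto simp: wt_def)

lemma expand_add:
  fixes X Y :: "real \<Rightarrow> 'u \<Rightarrow> 'a::euclidean_space \<Rightarrow> real"
  assumes "expand K \<rho> c X X0" "expand K \<rho> c Y Y0"
  shows "expand K \<rho> c (\<lambda>d u z. X d u z + Y d u z) (\<lambda>u z. X0 u z + Y0 u z)"
proof -
  obtain X1 C m where X: "C \<ge> 0"
    "\<And>u z d. u \<in> K \<Longrightarrow> d \<noteq> 0 \<Longrightarrow> \<bar>d\<bar> \<le> 1 \<Longrightarrow> \<bar>d\<bar> * norm z < \<rho> \<Longrightarrow> \<bar>X0 u z\<bar> \<le> wt C m c z"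
    "\<And>u z d. u \<in> K \<Longrightarrow> d \<noteq> 0 \<Longrightarrow> \<bar>d\<bar> \<le> 1 \<Longrightarrow> \<bar>d\<bar> * norm z < \<rho> \<Longrightarrow> \<bar>X1 u z\<bar> \<le> wt C m c z"
    "\<And>u z d. u \<in> K \<Longrightarrow> d \<noteq> 0 \<Longrightarrow> \<bar>d\<bar> \<le> 1 \<Longrightarrow> \<bar>d\<bar> * norm z < \<rho> \<Longrightarrow> 
      \<bar>X d u z - X0 u z - d * X1 u z\<bar> \<le> d\<^sup>2 * wt C m c z"
    by (rule expandE[OF assms(1)]) blast
  obtain Y1 C' m' where Y: "C' \<ge> 0"
    "\<And>u z d. u \<in> K \<Longrightarrow> d \<noteq> 0 \<Longrightarrow> \<bar>d\<bar> \<le> 1 \<Longrightarrow> \<bar>d\<bar> * norm z < \<rho> \<Longrightarrow> \<bar>Y0 u z\<bar> \<le> wt C' m' c z"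
    "\<And>u z d. u \<in> K \<Longrightarrow> d \<noteq> 0 \<Longrightarrow> \<bar>d\<bar> \<le> 1 \<Longrightarrow> \<bar>d\<bar> * norm z < \<rho> \<Longrightarrow> \<bar>Y1 u z\<bar> \<le> wt C' m' c z"
    "\<And>u z d. u \<in> K \<Longrightarrow> d \<noteq> 0 \<Longrightarrow> \<bar>d\<bar> \<le> 1 \<Longrightarrow> \<bar>d\<bar> * norm z < \<rho> \<Longrightarrow> 
      \<bar>Y d u z - Y0 u z - d * Y1 u z\<bar> \<le> d\<^sup>2 * wt C' m' c z"
    by (rule expandE[OF assms(2)]) blast
  have le: "wt C m c z + wt C' m' c z \<le> wt (C + C') (max m m') c z" for z :: 'a
    using wt_mono[of C C m "max m m'" c z] wt_mono[of C' C' m' "max m m'" c z] X(1) Y(1)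
    by (simp add: wt_add[symmetric])
  show ?thesis
  proof (rule expandI[where C = "C + C'" and m = "max m m'" and ?X1.0 = "\<lambda>u z. X1 u z + Y1 u z"])
    fix u and z :: 'a and d :: real assume *: "u \<in> K" "d \<noteq> 0" "\<bar>d\<bar> \<le> 1" "\<bar>d\<bar> * norm z < \<rho>"
    show "\<bar>X0 u z + Y0 u z\<bar> \<le> wt (C + C') (max m m') c z"
      using X(2)[OF *] Y(2)[OF *] le[of z] by linarith
    show "\<bar>X1 u z + Y1 u z\<bar> \<le> wt (C + C') (max m m') c z"
      using X(3)[OF *] Y(3)[OF *] le[of z] by linarith
    have "\<bar>X d u z + Y d u z - (X0 u z + Y0 u z) - d * (X1 u z + Y1 u z)\<bar> \<le> d\<^sup>2 * wt C m c z + d\<^sup>2 * wt C' m' c z"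
      using X(4)[OF *] Y(4)[OF *] by (simp add: abs_le_iff algebra_simps)
    also have "\<dots> \<le> d\<^sup>2 * wt (C + C') (max m m') c z"
      unfolding distrib_left[symmetric] by (intro mult_left_mono le) auto
    finally show "\<bar>X d u z + Y d u z - (X0 u z + Y0 u z) - d * (X1 u z + Y1 u z)\<bar> \<le> d\<^sup>2 * wt (C + C') (max m m') c z" .
  qed (use X Y in auto)
qed

lemma second_order_product:
  fixes x y x0 y0 x1 y1 d A B :: real
  assumes x: "\<bar>x - x0 - d * x1\<bar> \<le> d\<^sup>2 * A" "\<bar>x0\<bar> \<le> A" "\<bar>x1\<bar> \<le> A"
    and y: "\<bar>y - y0 - d * y1\<bar> \<le> d\<^sup>2 * B" "\<bar>y0\<bar> \<le> B" "\<bar>y1\<bar> \<le> B" and d: "\<bar>d\<bar> \<le> 1"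
  shows "\<bar>x * y - x0 * y0 - d * (x0 * y1 + x1 * y0)\<bar> \<le> d\<^sup>2 * (6 * (A * B))"
proof -
  define r where "r = x - x0 - d * x1"
  define s where "s = y - y0 - d * y1"
  have r: "\<bar>r\<bar> \<le> d\<^sup>2 * A" and s: "\<bar>s\<bar> \<le> d\<^sup>2 * B" using x y by (auto simp: r_def s_def)
  have A: "0 \<le> A" "0 \<le> B" using x y by auto
  have d2: "d\<^sup>2 \<le> 1" using d by (simp add: abs_square_le_1)
  \<comment> \<open>Origin of the 6: after the terms of order 0 and 1 are removed, six products
    remain. Each is at most d^2 A B, the cubic and quartic ones because |d| \<le> 1.\<close>
  have eq: "x * y - x0 * y0 - d * (x0 * y1 + x1 * y0) = d\<^sup>2 * (x1 * y1) + x0 * s + d * x1 * s + r * y0 + d * r * y1 + r * s"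
    by (simp add: r_def s_def algebra_simps power2_eq_square)
  have 1: "\<bar>d\<^sup>2 * (x1 * y1)\<bar> \<le> d\<^sup>2 * (A * B)"
    unfolding abs_mult using x y A by (intro mult_mono) auto
  have 2: "\<bar>x0 * s\<bar> \<le> A * (d\<^sup>2 * B)"
    unfolding abs_mult using x s A by (intro mult_mono) auto
  have 3: "\<bar>d * x1 * s\<bar> \<le> 1 * A * (d\<^sup>2 * B)"
    unfolding abs_mult using x s A d by (intro mult_mono) auto
  have 4: "\<bar>r * y0\<bar> \<le> (d\<^sup>2 * A) * B"
    unfolding abs_mult using y r A by (intro mult_mono) auto
  have 5: "\<bar>d * r * y1\<bar> \<le> 1 * (d\<^sup>2 * A) * B"
    unfolding abs_mult using y r A d by (intro mult_mono) auto
  have "\<bar>r * s\<bar> \<le> (d\<^sup>2 * A) * (d\<^sup>2 * B)"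
    unfolding abs_mult using r s A by (intro mult_mono) auto
  also have "\<dots> \<le> (d\<^sup>2 * A) * (1 * B)"
    using A d2 by (intro mult_left_mono mult_right_mono) auto
  finally have 6: "\<bar>r * s\<bar> \<le> (d\<^sup>2 * A) * B" by simp
  have "\<bar>x * y - x0 * y0 - d * (x0 * y1 + x1 * y0)\<bar> \<le>
     \<bar>d\<^sup>2 * (x1 * y1)\<bar> + \<bar>x0 * s\<bar> + \<bar>d * x1 * s\<bar> + \<bar>r * y0\<bar> + \<bar>d * r * y1\<bar> + \<bar>r * s\<bar>"
    unfolding eq by linarith
  also have "\<dots> \<le> d\<^sup>2 * (6 * (A * B))"
    using 1 2 3 4 5 6 by (simp add: algebra_simps)
  finally show ?thesis .
qed

lemma expand_mult:
  fixes X Y :: "real \<Rightarrow> 'u \<Rightarrow> 'a::euclidean_space \<Rightarrow> real"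
  assumes "expand K \<rho> c X X0" "expand K \<rho> c' Y Y0"
  shows "expand K \<rho> (c + c') (\<lambda>d u z. X d u z * Y d u z) (\<lambda>u z. X0 u z * Y0 u z)"
proof -
  obtain X1 C m where X: "C \<ge> 0"
    "\<And>u z d. u \<in> K \<Longrightarrow> d \<noteq> 0 \<Longrightarrow> \<bar>d\<bar> \<le> 1 \<Longrightarrow> \<bar>d\<bar> * norm z < \<rho> \<Longrightarrow> \<bar>X0 u z\<bar> \<le> wt C m c z"
    "\<And>u z d. u \<in> K \<Longrightarrow> d \<noteq> 0 \<Longrightarrow> \<bar>d\<bar> \<le> 1 \<Longrightarrow> \<bar>d\<bar> * norm z < \<rho> \<Longrightarrow> \<bar>X1 u z\<bar> \<le> wt C m c z"
    "\<And>u z d. u \<in> K \<Longrightarrow> d \<noteq> 0 \<Longrightarrow> \<bar>d\<bar> \<le> 1 \<Longrightarrow> \<bar>d\<bar> * norm z < \<rho> \<Longrightarrow> 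
      \<bar>X d u z - X0 u z - d * X1 u z\<bar> \<le> d\<^sup>2 * wt C m c z"
    by (rule expandE[OF assms(1)]) blast
  obtain Y1 C' m' where Y: "C' \<ge> 0"
    "\<And>u z d. u \<in> K \<Longrightarrow> d \<noteq> 0 \<Longrightarrow> \<bar>d\<bar> \<le> 1 \<Longrightarrow> \<bar>d\<bar> * norm z < \<rho> \<Longrightarrow> \<bar>Y0 u z\<bar> \<le> wt C' m' c' z"
    "\<And>u z d. u \<in> K \<Longrightarrow> d \<noteq> 0 \<Longrightarrow> \<bar>d\<bar> \<le> 1 \<Longrightarrow> \<bar>d\<bar> * norm z < \<rho> \<Longrightarrow> \<bar>Y1 u z\<bar> \<le> wt C' m' c' z"
    "\<And>u z d. u \<in> K \<Longrightarrow> d \<noteq> 0 \<Longrightarrow> \<bar>d\<bar> \<le> 1 \<Longrightarrow> \<bar>d\<bar> * norm z < \<rho> \<Longrightarrow> 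
      \<bar>Y d u z - Y0 u z - d * Y1 u z\<bar> \<le> d\<^sup>2 * wt C' m' c' z"
    by (rule expandE[OF assms(2)]) blast
  have W: "wt (6 * (C * C')) (m + m') (c + c') z = 6 * (wt C m c z * wt C' m' c' z)" for z :: 'a
    by (simp only: wt_mult) (simp add: wt_scale)
  show ?thesis
  proof (rule expandI[where C = "6 * (C * C')" and m = "m + m'" and ?X1.0 = "\<lambda>u z. X0 u z * Y1 u z + X1 u z * Y0 u z"])
    fix u and z :: 'a and d :: real assume *: "u \<in> K" "d \<noteq> 0" "\<bar>d\<bar> \<le> 1" "\<bar>d\<bar> * norm z < \<rho>"
    let ?A = "wt C m c z" and ?B = "wt C' m' c' z"
    have nn: "0 \<le> ?A * ?B" using X Y by simp
    have p: "\<bar>x * y\<bar> \<le> ?A * ?B" if "\<bar>x\<bar> \<le> ?A" "\<bar>y\<bar> \<le> ?B" for x y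
      unfolding abs_mult using that X Y by (intro mult_mono) auto
    show "\<bar>X0 u z * Y0 u z\<bar> \<le> wt (6 * (C * C')) (m + m') (c + c') z"
      using p[OF X(2)[OF *] Y(2)[OF *]] nn unfolding W by linarith
    show "\<bar>X0 u z * Y1 u z + X1 u z * Y0 u z\<bar> \<le> wt (6 * (C * C')) (m + m') (c + c') z"
      using p[OF X(2)[OF *] Y(3)[OF *]] p[OF X(3)[OF *] Y(2)[OF *]] nn unfolding W by linarith
    show "\<bar>X d u z * Y d u z - X0 u z * Y0 u z - d * (X0 u z * Y1 u z + X1 u z * Y0 u z)\<bar> \<le> d\<^sup>2 * wt (6 * (C * C')) (m + m') (c + c') z"
      unfolding W by (rule second_order_product) (use X(2-4)[OF *] Y(2-4)[OF *] * in auto)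
  qed (use X Y in auto)
qed

lemma expand_sum:
  assumes "finite B" "\<And>b. b \<in> B \<Longrightarrow> expand K \<rho> 0 (X b) (X0 b)"
  shows "expand K \<rho> 0 (\<lambda>d u z. \<Sum>b\<in>B. X b d u z) (\<lambda>u z. \<Sum>b\<in>B. X0 b u z)"
  using assms
proof (induction B rule: finite_induct)
  case empty
  then show ?case using expand_const[of _ _ 0] by simp
next
  case (insert b B)
  then show ?case using expand_add[of K \<rho> 0 "X b" "X0 b"] by simp
qed

lemma expand_prod:
  assumes "finite B" "\<And>b. b \<in> B \<Longrightarrow> expand K \<rho> 0 (X b) (X0 b)"
  shows "expand K \<rho> 0 (\<lambda>d u z. \<Prod>b\<in>B. X b d u z) (\<lambda>u z. \<Prod>b\<in>B. X0 b u z)"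
  using assms
proof (induction B rule: finite_induct)
  case empty
  then show ?case using expand_const[of _ _ 1] by simp
next
  case (insert b B)
  then show ?case using expand_mult[of K \<rho> 0 "X b" "X0 b" 0] by simp
qed

lemma expand_power:
  assumes "expand K \<rho> 0 X X0"
  shows "expand K \<rho> 0 (\<lambda>d u z. X d u z ^ n) (\<lambda>u z. X0 u z ^ n)"
  using expand_prod[of "{..<n}" K \<rho> "\<lambda>_. X" "\<lambda>_. X0"] assms by simp

text \<open>The hypotheses ask for a bound on the Taylor remainder of H with a candidate derivative
  \<open>H1\<close>, not for differentiability, because the kernel need not be differentiable at 0.
  The bounds are Gaussian in z, so that the decay of H at \<open>X0 u z\<close> becomes decay in
  z.\<close>

lemma expand_compose:
  fixes X :: "real \<Rightarrow> 'u \<Rightarrow> 'a::euclidean_space \<Rightarrow> real"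
  assumes X: "expand K \<rho> 0 X X0" and C: "C \<ge> 0"
    and H0: "\<And>u z d. u \<in> K \<Longrightarrow> d \<noteq> 0 \<Longrightarrow> \<bar>d\<bar> \<le> 1 \<Longrightarrow> \<bar>d\<bar> * norm z < \<rho> \<Longrightarrow> \<bar>H (X0 u z)\<bar> \<le> C * exp (- c * (norm z)\<^sup>2)"
    and H1: "\<And>u z d. u \<in> K \<Longrightarrow> d \<noteq> 0 \<Longrightarrow> \<bar>d\<bar> \<le> 1 \<Longrightarrow> \<bar>d\<bar> * norm z < \<rho> \<Longrightarrow> \<bar>H1 (X0 u z)\<bar> \<le> C * exp (- c * (norm z)\<^sup>2)"
    and H2: "\<And>u z d. u \<in> K \<Longrightarrow> d \<noteq> 0 \<Longrightarrow> \<bar>d\<bar> \<le> 1 \<Longrightarrow> \<bar>d\<bar> * norm z < \<rho> \<Longrightarrow>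
      \<bar>H (X d u z) - H (X0 u z) - H1 (X0 u z) * (X d u z - X0 u z)\<bar> \<le> C * exp (- c * (norm z)\<^sup>2) * (X d u z - X0 u z)\<^sup>2"
  shows "expand K \<rho> c (\<lambda>d u z. H (X d u z)) (\<lambda>u z. H (X0 u z))"
proof -
  obtain X1 B m where X: "B \<ge> 0"
    "\<And>u z d. u \<in> K \<Longrightarrow> d \<noteq> 0 \<Longrightarrow> \<bar>d\<bar> \<le> 1 \<Longrightarrow> \<bar>d\<bar> * norm z < \<rho> \<Longrightarrow> \<bar>X0 u z\<bar> \<le> wt B m 0 z"
    "\<And>u z d. u \<in> K \<Longrightarrow> d \<noteq> 0 \<Longrightarrow> \<bar>d\<bar> \<le> 1 \<Longrightarrow> \<bar>d\<bar> * norm z < \<rho> \<Longrightarrow> \<bar>X1 u z\<bar> \<le> wt B m 0 z"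
    "\<And>u z d. u \<in> K \<Longrightarrow> d \<noteq> 0 \<Longrightarrow> \<bar>d\<bar> \<le> 1 \<Longrightarrow> \<bar>d\<bar> * norm z < \<rho> \<Longrightarrow> 
      \<bar>X d u z - X0 u z - d * X1 u z\<bar> \<le> d\<^sup>2 * wt B m 0 z"
    by (rule expandE[OF X]) blast
  \<comment> \<open>The increment of X is at most 2 |d| A, and its square yields the summand 4 B^2;
    B comes from the linear coefficient and the remainder of X, and 1 from H itself.\<close>
  let ?D = "C * (4 * B\<^sup>2 + B + 1)"
  have D: "?D \<ge> 0" using C X(1) by simp
  define e where "e z = C * exp (- c * (norm z)\<^sup>2)" for z :: 'a
  define A where "A z = wt B m 0 z" for z :: 'a
  have e0: "e z \<ge> 0" for z using C by (simp add: e_def)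
  have A0: "A z \<ge> 0" for z using X(1) by (simp add: A_def)
  have A1: "e z * (4 * (A z)\<^sup>2 + A z + 1) \<le> wt ?D (2 * m) c z" for z :: 'a
  proof -
    define y where "y = (1 + norm z) ^ m"
    have y: "1 \<le> y" by (simp add: y_def)
    have y2: "(1 + norm z) ^ (2 * m) = y\<^sup>2" by (simp add: y_def power_mult[symmetric] mult.commute)
    have "1 \<le> y\<^sup>2" "y \<le> y\<^sup>2" using y self_le_power[of y 2] by auto
    then have "B * y \<le> B * y\<^sup>2" using X(1) by (intro mult_left_mono)
    then have "4 * (B * y)\<^sup>2 + B * y + 1 \<le> (4 * B\<^sup>2 + B + 1) * y\<^sup>2"
      using \<open>1 \<le> y\<^sup>2\<close> by (simp add: algebra_simps power_mult_distrib)
    then have "e z * (4 * (B * y)\<^sup>2 + B * y + 1) \<le> e z * ((4 * B\<^sup>2 + B + 1) * y\<^sup>2)"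
      using e0 by (intro mult_left_mono)
    then show ?thesis unfolding A_def wt_def y2 e_def y_def[symmetric] by (simp add: mult_ac)
  qed
  have le1: "e z \<le> wt ?D (2 * m) c z" "e z * A z \<le> wt ?D (2 * m) c z" for z :: 'a
  proof -
    have "0 \<le> e z * A z" "0 \<le> e z * (4 * (A z)\<^sup>2)" using e0 A0 by simp_all
    then show "e z \<le> wt ?D (2 * m) c z" "e z * A z \<le> wt ?D (2 * m) c z"
      using A1[of z] e0[of z] unfolding distrib_left by linarith+
  qed
  have le2: "e z * (4 * (A z)\<^sup>2 + A z) \<le> wt ?D (2 * m) c z" for z :: 'a
    using A1[of z] e0[of z] unfolding distrib_left by linarith
  show ?thesis
  proof (rule expandI[where C = ?D and m = "2 * m" and ?X1.0 = "\<lambda>u z. H1 (X0 u z) * X1 u z"])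
    fix u and z :: 'a and d :: real assume *: "u \<in> K" "d \<noteq> 0" "\<bar>d\<bar> \<le> 1" "\<bar>d\<bar> * norm z < \<rho>"
    show "\<bar>H (X0 u z)\<bar> \<le> wt ?D (2 * m) c z"
      using H0[OF *] le1(1)[of z] by (simp add: e_def)
    have "\<bar>H1 (X0 u z) * X1 u z\<bar> \<le> e z * A z"
      unfolding abs_mult e_def A_def using H1[OF *] X(3)[OF *] C by (intro mult_mono) auto
    then show "\<bar>H1 (X0 u z) * X1 u z\<bar> \<le> wt ?D (2 * m) c z"
      using le1(2)[of z] by simp
    let ?moved = "X d u z" and ?base = "X0 u z"
    have dd: "d\<^sup>2 \<le> \<bar>d\<bar>" using *(3) by (metis abs_ge_zero mult_left_le power2_abs power2_eq_square)
    have dA: "\<bar>d * X1 u z\<bar> \<le> \<bar>d\<bar> * A z"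
      unfolding abs_mult using X(3)[OF *] by (intro mult_left_mono) (auto simp: A_def)
    have d2A: "d\<^sup>2 * A z \<le> \<bar>d\<bar> * A z"
      using dd A0 by (rule mult_right_mono)
    have "\<bar>?moved - ?base\<bar> \<le> \<bar>?moved - ?base - d * X1 u z\<bar> + \<bar>d * X1 u z\<bar>"
      by linarith
    also have "\<dots> \<le> 2 * \<bar>d\<bar> * A z"
      using X(4)[OF *] dA d2A by (simp add: A_def)
    finally have "(?moved - ?base)\<^sup>2 \<le> (2 * \<bar>d\<bar> * A z)\<^sup>2"
      by (rule power2_le_iff_abs_le[THEN iffD2, rotated]) (use A0 in simp)
    then have sq: "(?moved - ?base)\<^sup>2 \<le> 4 * d\<^sup>2 * (A z)\<^sup>2"
      by (simp add: power_mult_distrib)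
    have "\<bar>H ?moved - H ?base - H1 ?base * (?moved - ?base)\<bar> \<le> e z * (4 * d\<^sup>2 * (A z)\<^sup>2)"
      using H2[OF *] mult_left_mono[OF sq e0[of z]] by (simp add: e_def)
    moreover have "\<bar>H1 ?base * (?moved - ?base - d * X1 u z)\<bar> \<le> e z * (d\<^sup>2 * A z)"
    proof -
      have h: "\<bar>H1 ?base\<bar> \<le> e z" "\<bar>?moved - ?base - d * X1 u z\<bar> \<le> d\<^sup>2 * A z"
        using H1[OF *] X(4)[OF *] by (simp_all only: e_def A_def)
      show ?thesis unfolding abs_mult[of "H1 _"] by (rule mult_mono[OF h e0 abs_ge_zero])
    qed
    moreover have "H ?moved - H ?base - d * (H1 ?base * X1 u z) = (H ?moved - H ?base - H1 ?base * (?moved - ?base)) + H1 ?base * (?moved - ?base - d * X1 u z)"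
      by (simp add: algebra_simps)
    ultimately have "\<bar>H ?moved - H ?base - d * (H1 ?base * X1 u z)\<bar> \<le> e z * (4 * d\<^sup>2 * (A z)\<^sup>2) + e z * (d\<^sup>2 * A z)"
      by linarith
    also have "\<dots> = d\<^sup>2 * (e z * (4 * (A z)\<^sup>2 + A z))" by (simp add: algebra_simps)
    also have "\<dots> \<le> d\<^sup>2 * wt ?D (2 * m) c z" using le2 by (intro mult_left_mono) auto
    finally show "\<bar>H ?moved - H ?base - d * (H1 ?base * X1 u z)\<bar> \<le> d\<^sup>2 * wt ?D (2 * m) c z" .
  qed (use D in auto)
qed

lemma expand_cong:
  assumes "expand K \<rho> c X X0"
    and "\<And>u z d. u \<in> K \<Longrightarrow> d \<noteq> 0 \<Longrightarrow> \<bar>d\<bar> \<le> 1 \<Longrightarrow> \<bar>d\<bar> * norm z < \<rho> \<Longrightarrow> X d u z = Y d u z"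
    and "\<And>u z. u \<in> K \<Longrightarrow> X0 u z = Y0 u z"
  shows "expand K \<rho> c Y Y0"
  using assms unfolding expand_def by metis

section \<open>Expansions of powers, kernels and smooth functions\<close>

lemma second_order_real:
  fixes f f1 f2 :: "real \<Rightarrow> real"
  assumes "\<And>t. min x y \<le> t \<Longrightarrow> t \<le> max x y \<Longrightarrow> (f has_real_derivative f1 t) (at t)"
    and "\<And>t. min x y \<le> t \<Longrightarrow> t \<le> max x y \<Longrightarrow> (f1 has_real_derivative f2 t) (at t)"
    and "\<And>t. min x y \<le> t \<Longrightarrow> t \<le> max x y \<Longrightarrow> \<bar>f2 t\<bar> \<le> B"
  shows "\<bar>f y - f x - f1 x * (y - x)\<bar> \<le> B * (y - x)\<^sup>2"
proof (cases "y = x")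
  case False
  let ?diff = "\<lambda>m::nat. if m = 0 then f else if m = 1 then f1 else f2"
  have "\<exists>t. (if y < x then y < t \<and> t < x else x < t \<and> t < y) \<and>
    f y = (\<Sum>m<2. ?diff m x / fact m * (y-x) ^ m) + ?diff 2 t / fact 2 * (y-x) ^ 2"
    using False assms by (intro Taylor[where a = "min x y" and b = "max x y"]) (auto simp: less_2_cases_iff)
  then obtain t where t: "min x y \<le> t" "t \<le> max x y"
    "f y = (\<Sum>m<2. ?diff m x / fact m * (y-x) ^ m) + ?diff 2 t / fact 2 * (y-x) ^ 2"
  proof (elim exE conjE, goal_cases)
    case (1 t)
    then show ?case by (intro 1(1)[of t]) (auto split: if_splits)
  qed
  then have "f y - f x - f1 x * (y - x) = f2 t / 2 * (y-x)\<^sup>2"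
    by (simp add: numeral_2_eq_2)
  moreover have "\<bar>f2 t / 2\<bar> \<le> B" using assms(3)[OF t(1,2)] by simp
  ultimately show ?thesis
    by (simp only: abs_mult abs_power2) (intro mult_right_mono, auto)
qed auto

text \<open>Needed for powers of the density and, with s = 1/2, for the square root of the metric
  determinant. The exponent may have either sign: a power is monotone, so on [lo, hi] it is at most
  the sum of its two endpoint values, and likewise for its derivatives.\<close>

lemma expand_powr:
  fixes X :: "real \<Rightarrow> 'u \<Rightarrow> 'a::euclidean_space \<Rightarrow> real"
  assumes X: "expand K \<rho> 0 X X0" and lo: "0 < lo"
    and b: "\<And>u z d. u \<in> K \<Longrightarrow> d \<noteq> 0 \<Longrightarrow> \<bar>d\<bar> \<le> 1 \<Longrightarrow> \<bar>d\<bar> * norm z < \<rho> \<Longrightarrow> X d u z \<in> {lo..hi} \<and> X0 u z \<in> {lo..hi}"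
  shows "expand K \<rho> 0 (\<lambda>d u z. X d u z powr s) (\<lambda>u z. X0 u z powr s)"
proof -
  have pb: "x powr r \<le> lo powr r + hi powr r" if "x \<in> {lo..hi}" for x r :: real
  proof (cases "r \<ge> 0")
    case True
    then have "x powr r \<le> hi powr r" using that lo by (intro powr_mono2) auto
    then show ?thesis by (simp add: add_increasing)
  next
    case False
    then have "x powr r \<le> lo powr r" using that lo by (intro powr_mono2') auto
    then show ?thesis by (simp add: add_increasing2)
  qed
  define P where "P r = lo powr r + hi powr r" for r
  have P0: "P r \<ge> 0" for r by (simp add: P_def)
  define C where "C = P s + \<bar>s\<bar> * P (s-1) + \<bar>s * (s-1)\<bar> * P (s-2)"
  have C: "C \<ge> 0" "P s \<le> C" "\<bar>s\<bar> * P (s-1) \<le> C" "\<bar>s * (s-1)\<bar> * P (s-2) \<le> C"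
    using P0 by (simp_all add: C_def)
  show ?thesis
  proof (rule expand_compose[OF X C(1), where ?H1.0 = "\<lambda>x. s * x powr (s-1)"])
    fix u and z :: 'a and d :: real assume *: "u \<in> K" "d \<noteq> 0" "\<bar>d\<bar> \<le> 1" "\<bar>d\<bar> * norm z < \<rho>"
    note bb = b[OF *]
    show "\<bar>X0 u z powr s\<bar> \<le> C * exp (- 0 * (norm z)\<^sup>2)"
      using pb[of "X0 u z" s] bb C(2) by (simp add: P_def)
    have "\<bar>s\<bar> * (X0 u z powr (s-1)) \<le> \<bar>s\<bar> * P (s-1)"
      using pb bb by (intro mult_left_mono) (auto simp: P_def)
    then show "\<bar>s * X0 u z powr (s-1)\<bar> \<le> C * exp (- 0 * (norm z)\<^sup>2)"
      using C(3) by (simp add: abs_mult)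
    have "\<bar>X d u z powr s - X0 u z powr s - (s * X0 u z powr (s-1)) * (X d u z - X0 u z)\<bar> \<le> C * (X d u z - X0 u z)\<^sup>2"
    proof (rule second_order_real[where ?f2.0 = "\<lambda>x. s * ((s-1) * x powr (s - 2))"])
      fix t assume t: "min (X0 u z) (X d u z) \<le> t" "t \<le> max (X0 u z) (X d u z)"
      then have t': "t \<in> {lo..hi}" using bb by auto
      then have t0: "t > 0" using lo by auto
      show "((\<lambda>x. x powr s) has_real_derivative s * t powr (s-1)) (at t)"
        by (intro has_real_derivative_powr t0)
      have "((\<lambda>x. x powr (s-1)) has_real_derivative (s-1) * t powr (s-1-1)) (at t)"
        by (intro has_real_derivative_powr t0)
      from DERIV_cmult[OF this, of s]
      show "((\<lambda>x. s * x powr (s-1)) has_real_derivative s * ((s-1) * t powr (s-2))) (at t)"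
        by (simp add: algebra_simps)
      have "\<bar>s * (s-1)\<bar> * (t powr (s-2)) \<le> \<bar>s * (s-1)\<bar> * P (s-2)"
        using pb[OF t'] by (intro mult_left_mono) (auto simp: P_def)
      then show "\<bar>s * ((s-1) * t powr (s-2))\<bar> \<le> C"
        using C(4) by (simp add: abs_mult mult.assoc)
    qed
    then show "\<bar>X d u z powr s - X0 u z powr s - (s * X0 u z powr (s-1)) * (X d u z - X0 u z)\<bar> \<le> C * exp (- 0 * (norm z)\<^sup>2) * (X d u z - X0 u z)\<^sup>2"
      by simp
  qed
qed

text \<open>Two derivatives on the open half line are what a second-order expansion consumes; at 0
  only continuity is available. The class contains an admissible kernel together with its square, so
  one bias estimate serves both mean and second moment.\<close>

definition decaying_kernel :: "(real \<Rightarrow> real) \<Rightarrow> real \<Rightarrow> real \<Rightarrow> bool" where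
  "decaying_kernel \<kappa> a B \<longleftrightarrow> a > 0 \<and> B \<ge> 0 \<and> continuous_on {0..} \<kappa> \<and>
    (\<exists>\<kappa>1 \<kappa>2. \<forall>\<xi>>0. (\<kappa> has_real_derivative \<kappa>1 \<xi>) (at \<xi>) \<and> (\<kappa>1 has_real_derivative \<kappa>2 \<xi>) (at \<xi>) \<and>
       \<bar>\<kappa> \<xi>\<bar> \<le> B * exp (- a * \<xi>) \<and> \<bar>\<kappa>1 \<xi>\<bar> \<le> B * exp (- a * \<xi>) \<and> \<bar>\<kappa>2 \<xi>\<bar> \<le> B * exp (- a * \<xi>))"

text \<open>At the endpoint 0 the bound is inherited from the right by continuity.\<close>

lemma decaying_kernel_bound:
  assumes "decaying_kernel \<kappa> a B" "\<xi> \<ge> 0"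
  shows "\<bar>\<kappa> \<xi>\<bar> \<le> B * exp (- a * \<xi>)"
proof (cases "\<xi> = 0")
  case True
  have c: "continuous_on {0..} \<kappa>" using assms by (simp add: decaying_kernel_def)
  then have "(\<kappa> \<longlongrightarrow> \<kappa> 0) (at_right 0)"
    by (auto simp: continuous_on_def intro: tendsto_within_subset)
  then have l: "((\<lambda>\<xi>. \<bar>\<kappa> \<xi>\<bar>) \<longlongrightarrow> \<bar>\<kappa> 0\<bar>) (at_right 0)"
    by (rule tendsto_rabs)
  have r: "((\<lambda>\<xi>. B * exp (- a * \<xi>)) \<longlongrightarrow> B * exp (- a * 0)) (at_right 0)"
    by (intro tendsto_intros)
  have "\<bar>\<kappa> 0\<bar> \<le> B * exp (- a * 0)"
    by (rule tendsto_le[OF _ r l])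
       (use assms(1) in \<open>auto simp: decaying_kernel_def eventually_at_right_less intro!: eventually_mono[OF eventually_at_right_less]\<close>)
  then show ?thesis using True by simp
next
  case False
  then show ?thesis using assms unfolding decaying_kernel_def by auto
qed

text \<open>For z \<noteq> 0 both arguments are at least \<open>l * (norm z)\<^sup>2\<close>, so the
  segment between them avoids the point 0, where smoothness may fail; for z = 0 both arguments are 0
  and there is no remainder. The same lower bound turns exponential decay in the argument into
  Gaussian decay in z.\<close>

lemma expand_kernel:
  fixes X :: "real \<Rightarrow> 'u \<Rightarrow> 'a::euclidean_space \<Rightarrow> real"
  assumes \<kappa>: "decaying_kernel \<kappa> a B" and X: "expand K \<rho> 0 X X0" and l: "l > 0"
    and b: "\<And>u z d. u \<in> K \<Longrightarrow> d \<noteq> 0 \<Longrightarrow> \<bar>d\<bar> \<le> 1 \<Longrightarrow> \<bar>d\<bar> * norm z < \<rho> \<Longrightarrow> X d u z \<ge> l * (norm z)\<^sup>2 \<and> X0 u z \<ge> l * (norm z)\<^sup>2"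
    and z0: "\<And>u d. u \<in> K \<Longrightarrow> X d u 0 = 0" "\<And>u. u \<in> K \<Longrightarrow> X0 u 0 = 0"
  shows "expand K \<rho> (a * l) (\<lambda>d u z. \<kappa> (X d u z)) (\<lambda>u z. \<kappa> (X0 u z))"
proof -
  obtain \<kappa>1 \<kappa>2 where k: "\<And>\<xi>. \<xi> > 0 \<Longrightarrow> (\<kappa> has_real_derivative \<kappa>1 \<xi>) (at \<xi>)"
    "\<And>\<xi>. \<xi> > 0 \<Longrightarrow> (\<kappa>1 has_real_derivative \<kappa>2 \<xi>) (at \<xi>)"
    "\<And>\<xi>. \<xi> > 0 \<Longrightarrow> \<bar>\<kappa>1 \<xi>\<bar> \<le> B * exp (- a * \<xi>)" "\<And>\<xi>. \<xi> > 0 \<Longrightarrow> \<bar>\<kappa>2 \<xi>\<bar> \<le> B * exp (- a * \<xi>)"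
    and a: "a > 0" and B: "B \<ge> 0"
    using \<kappa> unfolding decaying_kernel_def by blast
  have ex: "B * exp (- a * \<xi>) \<le> B * exp (- (a * l) * (norm z)\<^sup>2)" if "\<xi> \<ge> l * (norm z)\<^sup>2" for \<xi> and z :: 'a
    using mult_left_mono[OF that, of a] a B by (intro mult_left_mono) (auto simp: algebra_simps)
  show ?thesis
  \<comment> \<open>The value 0 for the derivative at argument 0 is a mere default: that argument
    occurs only for z = 0, where it gets multiplied by a vanishing increment.\<close>
  proof (rule expand_compose[OF X B, where ?H1.0 = "\<lambda>x. if x > 0 then \<kappa>1 x else 0"])
    fix u and z :: 'a and d :: real assume *: "u \<in> K" "d \<noteq> 0" "\<bar>d\<bar> \<le> 1" "\<bar>d\<bar> * norm z < \<rho>"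
    note bb = b[OF *]
    have "0 \<le> l * (norm z)\<^sup>2" using l by simp
    then have nn: "X0 u z \<ge> 0" using bb by linarith
    show "\<bar>\<kappa> (X0 u z)\<bar> \<le> B * exp (- (a * l) * (norm z)\<^sup>2)"
      using decaying_kernel_bound[OF \<kappa> nn] ex[of z "X0 u z"] bb by linarith
    show "\<bar>if X0 u z > 0 then \<kappa>1 (X0 u z) else 0\<bar> \<le> B * exp (- (a * l) * (norm z)\<^sup>2)"
      using k(3)[of "X0 u z"] ex[of z "X0 u z"] bb B by auto
    show "\<bar>\<kappa> (X d u z) - \<kappa> (X0 u z) - (if X0 u z > 0 then \<kappa>1 (X0 u z) else 0) * (X d u z - X0 u z)\<bar>
      \<le> B * exp (- (a * l) * (norm z)\<^sup>2) * (X d u z - X0 u z)\<^sup>2"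
    proof (cases "z = 0")
      case True then show ?thesis using *(1) by (simp add: z0)
    next
      case False
      then have p: "l * (norm z)\<^sup>2 > 0" using l by simp
      then have "X0 u z > 0" using bb by linarith
      have "\<bar>\<kappa> (X d u z) - \<kappa> (X0 u z) - \<kappa>1 (X0 u z) * (X d u z - X0 u z)\<bar> \<le> B * exp (- (a * l) * (norm z)\<^sup>2) * (X d u z - X0 u z)\<^sup>2"
      proof (rule second_order_real[where ?f2.0 = \<kappa>2])
        fix t assume t: "min (X0 u z) (X d u z) \<le> t" "t \<le> max (X0 u z) (X d u z)"
        then have t1: "t \<ge> l * (norm z)\<^sup>2" using bb by linarith
        then have t2: "t > 0" using p by linarith
        show "(\<kappa> has_real_derivative \<kappa>1 t) (at t)" "(\<kappa>1 has_real_derivative \<kappa>2 t) (at t)" using k t2 by auto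
        show "\<bar>\<kappa>2 t\<bar> \<le> B * exp (- (a * l) * (norm z)\<^sup>2)"
          using k(4)[OF t2] ex[OF t1] by linarith
      qed
      then show ?thesis using \<open>X0 u z > 0\<close> by simp
    qed
  qed
qed

text \<open>Halving R for the base point and for the displacement keeps u + d z, and the segment
  leading to it, inside the ball of radius R, on which the derivatives are bounded.\<close>

lemma expand_value:
  fixes F :: "'a::euclidean_space \<Rightarrow> real"
  assumes "open U" "C_k_on 2 U F" "cball u0 R \<subseteq> U"
  shows "expand (cball u0 (R/2)) (R/2) 0 (\<lambda>d u z. F (u + d *\<^sub>R z)) (\<lambda>u z. F u)"
proof -
  have "\<exists>C\<ge>0. \<forall>z. \<forall>x\<in>cball u0 R. \<bar>dirders k F z x\<bar> \<le> C * norm z ^ k" if "k \<le> 2" for k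
    using assms C_k_on_le[OF assms(2) that] by (intro dirders_bound[of U]) auto
  then obtain C where C: "\<And>k. k \<le> 2 \<Longrightarrow> C k \<ge> 0" "\<And>k z x. k \<le> 2 \<Longrightarrow> x \<in> cball u0 R \<Longrightarrow> \<bar>dirders k F z x\<bar> \<le> C k * norm z ^ k"
    by metis
  define D where "D = C 0 + C 1 + C 2"
  have pw: "C k * norm z ^ k \<le> wt D 2 0 z" if "k \<le> 2" for k and z :: 'a
  proof -
    have "C k \<le> D" using C(1)[of 0] C(1)[of 1] C(1)[of 2] that unfolding D_def
      by (auto simp: le_Suc_eq numeral_2_eq_2)
    moreover have "norm z ^ k \<le> (1 + norm z) ^ 2"
      using that by (intro order_trans[OF power_mono[of _ "1 + norm z"] power_increasing]) auto
    ultimately show ?thesis using C(1)[OF that] by (auto simp: wt_def intro!: mult_mono)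
  qed
  show ?thesis
  proof (rule expandI[where C = D and m = 2 and ?X1.0 = "\<lambda>u z. dirders 1 F z u"])
    show "D \<ge> 0" using C(1) by (simp add: D_def)
    fix u and z :: 'a and d :: real assume *: "u \<in> cball u0 (R/2)" "d \<noteq> 0" "\<bar>d\<bar> \<le> 1" "\<bar>d\<bar> * norm z < R / 2"
    have "norm (u - u0) \<le> R / 2" using * by (simp add: dist_norm norm_minus_commute)
    moreover have "R \<ge> 0" using \<open>norm (u - u0) \<le> R / 2\<close> norm_ge_zero[of "u - u0"] by linarith
    ultimately have u: "u \<in> cball u0 R" by (simp add: dist_norm norm_minus_commute)
    have line: "u + t *\<^sub>R z \<in> cball u0 R" if "\<bar>t\<bar> \<le> \<bar>d\<bar>" for t
    proof -
      have "norm (u + t *\<^sub>R z - u0) \<le> norm (u - u0) + \<bar>t\<bar> * norm z"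
        using norm_triangle_ineq[of "u - u0" "t *\<^sub>R z"] by (simp add: algebra_simps)
      also have "\<bar>t\<bar> * norm z \<le> \<bar>d\<bar> * norm z" using that by (intro mult_right_mono) auto
      finally show ?thesis using * by (simp add: dist_norm norm_minus_commute)
    qed
    show "\<bar>F u\<bar> \<le> wt D 2 0 z" using C(2)[OF _ u, of 0 z] pw[of 0 z] by simp
    show "\<bar>dirders 1 F z u\<bar> \<le> wt D 2 0 z" using C(2)[OF _ u, of 1 z] pw[of 1 z] by simp
    have "\<exists>t. \<bar>t\<bar> \<le> \<bar>d\<bar> \<and> F (u + d *\<^sub>R z) = (\<Sum>m<Suc 1. dirders m F z u / fact m * d ^ m)
            + dirders (Suc 1) F z (u + t *\<^sub>R z) / fact (Suc 1) * d ^ Suc 1"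
      using assms line u * by (intro dirders_taylor[of _ U]) (auto simp: numeral_2_eq_2 simp del: C_k_on.simps)
    then obtain t where t: "\<bar>t\<bar> \<le> \<bar>d\<bar>" "F (u + d *\<^sub>R z) = F u + dirders 1 F z u * d + dirders 2 F z (u + t *\<^sub>R z) / 2 * d\<^sup>2"
      by (auto simp: numeral_2_eq_2)
    have "\<bar>dirders 2 F z (u + t *\<^sub>R z)\<bar> \<le> wt D 2 0 z"
      using C(2)[OF _ line[OF t(1)], of 2 z] pw[of 2 z] by simp
    then have "\<bar>dirders 2 F z (u + t *\<^sub>R z) / 2\<bar> \<le> wt D 2 0 z" by linarith
    moreover have "F (u + d *\<^sub>R z) - F u - d * dirders 1 F z u = d\<^sup>2 * (dirders 2 F z (u + t *\<^sub>R z) / 2)"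
      using t(2) by (simp add: algebra_simps)
    ultimately show "\<bar>F (u + d *\<^sub>R z) - F u - d * dirders 1 F z u\<bar> \<le> d\<^sup>2 * wt D 2 0 z"
      by (simp only: abs_mult abs_power2) (intro mult_left_mono, auto)
  qed
qed

text \<open>Division by d costs one order, hence three derivatives instead of two. The constant term
  of the quotient is the directional derivative.\<close>

lemma expand_quotient:
  fixes F :: "'a::euclidean_space \<Rightarrow> real"
  assumes "open U" "C_k_on 3 U F" "cball u0 R \<subseteq> U"
  shows "expand (cball u0 (R/2)) (R/2) 0 (\<lambda>d u z. (F (u + d *\<^sub>R z) - F u) / d) (\<lambda>u z. dirder F z u)"
proof -
  have "\<exists>C\<ge>0. \<forall>z. \<forall>x\<in>cball u0 R. \<bar>dirders k F z x\<bar> \<le> C * norm z ^ k" if "k \<le> 3" for k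
    using assms C_k_on_le[OF assms(2) that] by (intro dirders_bound[of U]) auto
  then obtain C where C: "\<And>k. k \<le> 3 \<Longrightarrow> C k \<ge> 0" "\<And>k z x. k \<le> 3 \<Longrightarrow> x \<in> cball u0 R \<Longrightarrow> \<bar>dirders k F z x\<bar> \<le> C k * norm z ^ k"
    by metis
  define D where "D = C 0 + C 1 + C 2 + C 3"
  have pw: "C k * norm z ^ k \<le> wt D 3 0 z" if "k \<le> 3" for k and z :: 'a
  proof -
    have "C k \<le> D" using C(1)[of 0] C(1)[of 1] C(1)[of 2] C(1)[of 3] that unfolding D_def
      by (auto simp: le_Suc_eq numeral_2_eq_2 numeral_3_eq_3)
    moreover have "norm z ^ k \<le> (1 + norm z) ^ 3"
      using that by (intro order_trans[OF power_mono[of _ "1 + norm z"] power_increasing]) auto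
    ultimately show ?thesis using C(1)[OF that] by (auto simp: wt_def intro!: mult_mono)
  qed
  show ?thesis
  proof (rule expandI[where C = D and m = 3 and ?X1.0 = "\<lambda>u z. dirders 2 F z u / 2"])
    show "D \<ge> 0" using C(1) by (simp add: D_def)
    fix u and z :: 'a and d :: real assume *: "u \<in> cball u0 (R/2)" "d \<noteq> 0" "\<bar>d\<bar> \<le> 1" "\<bar>d\<bar> * norm z < R / 2"
    have "norm (u - u0) \<le> R / 2" using * by (simp add: dist_norm norm_minus_commute)
    moreover have "R \<ge> 0" using \<open>norm (u - u0) \<le> R / 2\<close> norm_ge_zero[of "u - u0"] by linarith
    ultimately have u: "u \<in> cball u0 R" by (simp add: dist_norm norm_minus_commute)
    have line: "u + t *\<^sub>R z \<in> cball u0 R" if "\<bar>t\<bar> \<le> \<bar>d\<bar>" for t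
    proof -
      have "norm (u + t *\<^sub>R z - u0) \<le> norm (u - u0) + \<bar>t\<bar> * norm z"
        using norm_triangle_ineq[of "u - u0" "t *\<^sub>R z"] by (simp add: algebra_simps)
      also have "\<bar>t\<bar> * norm z \<le> \<bar>d\<bar> * norm z" using that by (intro mult_right_mono) auto
      finally show ?thesis using * by (simp add: dist_norm norm_minus_commute)
    qed
    show "\<bar>dirder F z u\<bar> \<le> wt D 3 0 z" using C(2)[OF _ u, of 1 z] pw[of 1 z] by (simp add: dirders_Suc)
    have "\<bar>dirders 2 F z u\<bar> \<le> wt D 3 0 z" using C(2)[OF _ u, of 2 z] pw[of 2 z] by simp
    then show "\<bar>dirders 2 F z u / 2\<bar> \<le> wt D 3 0 z" by linarith
    have "\<exists>t. \<bar>t\<bar> \<le> \<bar>d\<bar> \<and> F (u + d *\<^sub>R z) = (\<Sum>m<Suc 2. dirders m F z u / fact m * d ^ m)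
            + dirders (Suc 2) F z (u + t *\<^sub>R z) / fact (Suc 2) * d ^ Suc 2"
      using assms line u * by (intro dirders_taylor[of _ U]) (auto simp: numeral_3_eq_3 numeral_2_eq_2 simp del: C_k_on.simps)
    then obtain t where t: "\<bar>t\<bar> \<le> \<bar>d\<bar>" "F (u + d *\<^sub>R z) = F u + dirder F z u * d + dirders 2 F z u / 2 * d\<^sup>2
       + dirders 3 F z (u + t *\<^sub>R z) / 6 * d ^ 3"
      by (auto simp: numeral_2_eq_2 numeral_3_eq_3 dirders_Suc)
    have "\<bar>dirders 3 F z (u + t *\<^sub>R z)\<bar> \<le> wt D 3 0 z"
      using C(2)[OF _ line[OF t(1)], of 3 z] pw[of 3 z] by simp
    then have "\<bar>dirders 3 F z (u + t *\<^sub>R z) / 6\<bar> \<le> wt D 3 0 z" by linarith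
    moreover have "(F (u + d *\<^sub>R z) - F u) / d - dirder F z u - d * (dirders 2 F z u / 2) = d\<^sup>2 * (dirders 3 F z (u + t *\<^sub>R z) / 6)"
      using *(2) unfolding t(2) by (simp add: field_simps power2_eq_square power3_eq_cube)
    ultimately show "\<bar>(F (u + d *\<^sub>R z) - F u) / d - dirder F z u - d * (dirders 2 F z u / 2)\<bar> \<le> d\<^sup>2 * wt D 3 0 z"
      by (simp only: abs_mult abs_power2) (intro mult_left_mono, auto)
  qed
qed

text \<open>The linear coefficients at d and -d cancel, so they never have to be identified, and the
  remainder of order d^2 is all that is left.\<close>

lemma expand_symmetric:
  assumes "expand K \<rho> c X X0"
  shows "\<exists>C\<ge>0. \<exists>m. \<forall>u\<in>K. \<forall>z. \<forall>d. 0 < d \<and> d \<le> 1 \<and> d * norm z < \<rho> \<longrightarrow> 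
    \<bar>X d u z + X (- d) u z - 2 * X0 u z\<bar> \<le> d\<^sup>2 * wt C m c z"
proof -
  obtain X1 C m where X: "C \<ge> 0"
    "\<And>u z d. u \<in> K \<Longrightarrow> d \<noteq> 0 \<Longrightarrow> \<bar>d\<bar> \<le> 1 \<Longrightarrow> \<bar>d\<bar> * norm z < \<rho> \<Longrightarrow> 
      \<bar>X d u z - X0 u z - d * X1 u z\<bar> \<le> d\<^sup>2 * wt C m c z"
    by (rule expandE[OF assms]) blast
  have "\<bar>X d u z + X (- d) u z - 2 * X0 u z\<bar> \<le> d\<^sup>2 * wt (2 * C) m c z" if "u \<in> K" "0 < d" "d \<le> 1" "d * norm z < \<rho>" for u z d
    using X(2)[of u d z] X(2)[of u "-d" z] that by (simp add: wt_scale[symmetric])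
  then show ?thesis using X(1) by (intro exI[of _ "2 * C"] conjI exI[of _ m]) auto
qed

section \<open>Gaussian weights and linear changes of variables\<close>

lemma integrable_gaussian:
  fixes c :: real
  assumes "c > 0"
  shows "integrable lborel (\<lambda>z::'a::euclidean_space. exp (- c * (norm z)\<^sup>2))"
proof (rule integrableI_bounded)
  \<comment> \<open>With this standard deviation the normal density is a multiple of
    \<open>exp (- c * x\<^sup>2)\<close>; the Gaussian on the whole space is the product of such
    one-dimensional factors.\<close>
  define s where "s = sqrt (1 / (2 * c))"
  have s: "s > 0" "2 * s\<^sup>2 = 1 / c" using assms by (auto simp: s_def)
  have "integrable lborel (\<lambda>x::real. sqrt (2 * pi * s\<^sup>2) * normal_density 0 s x)"
    using integrable_normal_density[OF s(1)] by (intro integrable_mult_right) simp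
  also have "(\<lambda>x. sqrt (2 * pi * s\<^sup>2) * normal_density 0 s x) = (\<lambda>x. exp (- c * x\<^sup>2))"
    using s by (auto simp: normal_density_def fun_eq_iff field_simps)
  finally have fin: "(\<integral>\<^sup>+(x::real). ennreal (exp (- c * x\<^sup>2)) \<partial>lborel) < \<infinity>"
    unfolding integrable_iff_bounded by simp
  have e: "ennreal (exp (- c * (norm z)\<^sup>2)) = (\<Prod>b\<in>Basis. ennreal (exp (- c * (z \<bullet> b)\<^sup>2)))" for z :: 'a
  proof -
    have "(norm z)\<^sup>2 = (\<Sum>b\<in>Basis. (z \<bullet> b)\<^sup>2)"
      unfolding power2_norm_eq_inner euclidean_inner[of z z] by (simp add: power2_eq_square)
    then show ?thesis by (simp add: sum_distrib_left exp_sum prod_ennreal sum_negf[symmetric])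
  qed
  have "(\<integral>\<^sup>+(z::'a). ennreal (norm (exp (- c * (norm z)\<^sup>2))) \<partial>lborel) = (\<integral>\<^sup>+(z::'a). (\<Prod>b\<in>Basis. ennreal (exp (- c * (z \<bullet> b)\<^sup>2))) \<partial>lborel)"
    using e by simp
  also have "\<dots> = (\<Prod>b\<in>(Basis::'a set). (\<integral>\<^sup>+(x::real). ennreal (exp (- c * x\<^sup>2)) \<partial>lborel))"
    by (rule nn_integral_lborel_prod) auto
  also have "\<dots> < \<infinity>" using fin by (simp add: power_less_top_ennreal)
  finally show "(\<integral>\<^sup>+(z::'a). ennreal (norm (exp (- c * (norm z)\<^sup>2))) \<partial>lborel) < \<infinity>" .
qed measurable

text \<open>Half of the Gaussian pays for the polynomial: (1 + |z|)^m \<le> exp (m |z|), and m |z|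
  \<le> m^2 / (2 c) + (c / 2) |z|^2 because (m - c |z|)^2 is nonnegative.\<close>

lemma integrable_wt:
  assumes "c > 0"
  shows "integrable lborel (wt C m c :: 'a::euclidean_space \<Rightarrow> real)"
proof (rule Bochner_Integration.integrable_bound)
  show "integrable lborel (\<lambda>z::'a. \<bar>C\<bar> * exp ((real m)\<^sup>2 / (2 * c)) * exp (- (c / 2) * (norm z)\<^sup>2))"
    using assms by (intro integrable_mult_right integrable_gaussian) auto
  show "AE z in (lborel :: 'a measure). norm (wt C m c z) \<le> norm (\<bar>C\<bar> * exp ((real m)\<^sup>2 / (2 * c)) * exp (- (c / 2) * (norm z)\<^sup>2))"
  proof (rule AE_I2)
    fix z :: 'a
    have "(1 + norm z) ^ m \<le> exp (norm z) ^ m"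
      by (intro power_mono) auto
    also have "\<dots> = exp (real m * norm z)" by (simp add: exp_of_nat_mult)
    also have "real m * norm z \<le> (real m)\<^sup>2 / (2 * c) + (c / 2) * (norm z)\<^sup>2"
    proof -
      have "0 \<le> (real m - c * norm z)\<^sup>2 / (2 * c)" using assms by simp
      also have "\<dots> = (real m)\<^sup>2 / (2 * c) + (c / 2) * (norm z)\<^sup>2 - real m * norm z"
        using assms by (simp add: field_simps power2_eq_square)
      finally show ?thesis by simp
    qed
    finally have "(1 + norm z) ^ m * exp (- c * (norm z)\<^sup>2) \<le> exp ((real m)\<^sup>2 / (2 * c) + (c / 2) * (norm z)\<^sup>2) * exp (- c * (norm z)\<^sup>2)"
      by (intro mult_right_mono) auto
    also have "\<dots> = exp ((real m)\<^sup>2 / (2 * c)) * exp (- (c / 2) * (norm z)\<^sup>2)"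
      unfolding exp_add[symmetric] by (simp add: field_simps)
    finally show "norm (wt C m c z) \<le> norm (\<bar>C\<bar> * exp ((real m)\<^sup>2 / (2 * c)) * exp (- (c / 2) * (norm z)\<^sup>2))"
      by (simp add: wt_def abs_mult mult.assoc mult_left_mono)
  qed
qed (simp add: wt_def[abs_def])

text \<open>With all coordinates but m fixed, the shear translates coordinate m by the constant x_n.
  Integrating that coordinate first reduces the claim to translation invariance on the line.\<close>

lemma nn_integral_shear:
  fixes h :: "real ^ 'n::finite \<Rightarrow> ennreal"
  assumes mn: "m \<noteq> n" and [measurable]: "h \<in> borel_measurable borel"
  shows "(\<integral>\<^sup>+x. h (\<chi> i. if i = m then x $ m + x $ n else x $ i) \<partial>lborel) = (\<integral>\<^sup>+x. h x \<partial>lborel)"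
proof -
  interpret product_sigma_finite "\<lambda>_::real^'n. lborel :: real measure" by standard
  define e where "e i = (axis i 1 :: real^'n)" for i
  have inje: "e i = e j \<longleftrightarrow> i = j" for i j by (simp add: e_def axis_eq_axis)
  have eB: "e i \<in> Basis" for i by (auto simp: e_def Basis_vec_def)
  let ?B = "Basis - {e m}"
  have Beq: "(Basis :: (real^'n) set) = insert (e m) ?B"
    by (auto simp: e_def Basis_vec_def)
  let ?S = "\<lambda>x. \<Sum>b\<in>Basis. x b *\<^sub>R b :: real^'n"
  let ?T = "\<lambda>x::real^'n. (\<chi> i. if i = m then x $ m + x $ n else x $ i) :: real^'n"
  have S: "?S x $ i = x (e i)" for x i
  proof -
    have "?S x \<bullet> e i = x (e i)" by (simp add: inner_sum_left inner_Basis eB if_distrib cong: if_cong)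
    then show ?thesis by (simp add: e_def inner_axis)
  qed
  have T: "?T = (\<lambda>x. x + (x $ n) *\<^sub>R e m)"
    by (auto simp: fun_eq_iff vec_eq_iff e_def axis_def)
  have [measurable]: "?T \<in> borel_measurable borel"
    unfolding T by (intro borel_measurable_continuous_onI continuous_intros)
  have key: "?T (?S (x(e m := y))) = ?S (x(e m := x (e n) + y))" for x y
    unfolding vec_eq_iff by (simp only: vec_lambda_beta S) (auto simp: inje mn[symmetric])
  have meas: "(\<lambda>x. g (?S x)) \<in> borel_measurable (Pi\<^sub>M (insert (e m) ?B) (\<lambda>_. lborel))" if [measurable]: "g \<in> borel_measurable borel" for g :: "real ^ 'n \<Rightarrow> ennreal"
    unfolding Beq[symmetric] by measurable
  have lb: "(\<integral>\<^sup>+x. g x \<partial>lborel) = (\<integral>\<^sup>+x. (\<integral>\<^sup>+y. g (?S (x(e m := y))) \<partial>lborel) \<partial>(Pi\<^sub>M ?B (\<lambda>_. lborel)))" 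
    if [measurable]: "g \<in> borel_measurable borel" for g :: "real ^ 'n \<Rightarrow> ennreal"
  proof -
    have "(\<integral>\<^sup>+x. g x \<partial>lborel) = (\<integral>\<^sup>+x. g (?S x) \<partial>(Pi\<^sub>M (insert (e m) ?B) (\<lambda>_. lborel)))"
      unfolding Beq[symmetric] by (subst lborel_def) (simp add: nn_integral_distr lborel_eq_real)
    also have "\<dots> = (\<integral>\<^sup>+x. (\<integral>\<^sup>+y. g (?S (x(e m := y))) \<partial>lborel) \<partial>(Pi\<^sub>M ?B (\<lambda>_. lborel)))"
      by (rule product_nn_integral_insert) (use meas[OF that] in auto)
    finally show ?thesis .
  qed
  have "(\<integral>\<^sup>+y. h (?S (x(e m := x (e n) + y))) \<partial>lborel) = (\<integral>\<^sup>+y. h (?S (x(e m := y))) \<partial>lborel)" for x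
  proof -
    have eq: "?S (x(e m := y)) = (\<Sum>b\<in>?B. x b *\<^sub>R b) + y *\<^sub>R e m" for y
      by (subst Beq, subst sum.insert) (auto intro!: sum.cong)
    have [measurable]: "(\<lambda>y::real. h (?S (x(e m := y)))) \<in> borel_measurable borel"
      unfolding eq by measurable
    show ?thesis using nn_integral_real_affine[of "\<lambda>y. h (?S (x(e m := y)))" 1 "x (e n)"] by simp
  qed
  then show ?thesis
    by (subst lb, simp, subst lb, simp) (simp only: key)
qed

text \<open>The change of variables theorem of the library requires a well-ordered index type.\<close>

lemma nn_integral_linear_det:
  fixes f :: "real ^ 'n::finite \<Rightarrow> real ^ 'n" and h :: "real ^ 'n \<Rightarrow> ennreal"
  assumes "linear f" "det (matrix f) \<noteq> 0" "h \<in> borel_measurable borel"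
  shows "(\<integral>\<^sup>+x. h x \<partial>lborel) = ennreal \<bar>det (matrix f)\<bar> * (\<integral>\<^sup>+x. h (f x) \<partial>lborel)"
proof -
  \<comment> \<open>The induction over elementary maps also meets singular ones. Keeping the
    determinant condition inside the claim makes those cases vacuous, and for a composition it
    passes to both factors.\<close>
  have "det (matrix f) \<noteq> 0 \<longrightarrow> (\<forall>h::real ^ 'n \<Rightarrow> ennreal. h \<in> borel_measurable borel \<longrightarrow>
     (\<integral>\<^sup>+x. h x \<partial>lborel) = ennreal \<bar>det (matrix f)\<bar> * (\<integral>\<^sup>+x. h (f x) \<partial>lborel))" (is "?P f")
  proof (rule induct_linear_elementary[OF assms(1)])
    fix f g :: "real ^ 'n \<Rightarrow> real ^ 'n"
    assume l: "linear f" "linear g" and P: "?P f" "?P g"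
    show "?P (f \<circ> g)"
    proof (intro impI allI)
      fix h :: "real ^ 'n \<Rightarrow> ennreal" assume d: "det (matrix (f \<circ> g)) \<noteq> 0" and [measurable]: "h \<in> borel_measurable borel"
      have m: "matrix (f \<circ> g) = matrix f ** matrix g" using l by (simp add: matrix_compose)
      have [measurable]: "f \<in> borel_measurable borel"
        using l by (intro borel_measurable_continuous_onI linear_continuous_on) (simp add: linear_conv_bounded_linear)
      have nz: "det (matrix f) \<noteq> 0" "det (matrix g) \<noteq> 0" using d by (auto simp: m det_mul)
      have "(\<integral>\<^sup>+x. h x \<partial>lborel) = ennreal \<bar>det (matrix f)\<bar> * (\<integral>\<^sup>+x. h (f x) \<partial>lborel)"
        by (rule P(1)[rule_format, OF nz(1)]) measurable
      also have "(\<integral>\<^sup>+x. h (f x) \<partial>lborel) = ennreal \<bar>det (matrix g)\<bar> * (\<integral>\<^sup>+x. h (f (g x)) \<partial>lborel)"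
        by (rule P(2)[rule_format, OF nz(2)]) measurable
      finally show "(\<integral>\<^sup>+x. h x \<partial>lborel) = ennreal \<bar>det (matrix (f \<circ> g))\<bar> * (\<integral>\<^sup>+x. h ((f \<circ> g) x) \<partial>lborel)"
        by (simp add: m det_mul abs_mult ennreal_mult mult.assoc)
    qed
  next
    fix f :: "real ^ 'n \<Rightarrow> real ^ 'n" and i
    assume "linear f" "\<And>x. f x $ i = 0"
    then have "row i (matrix f) = 0" by (simp add: row_def matrix_def vec_eq_iff)
    then have "det (matrix f) = 0" by (rule det_zero_row)
    then show "?P f" by simp
  next
    fix c :: "'n \<Rightarrow> real"
    let ?f = "\<lambda>x::real^'n. \<chi> i. c i * x $ i"
    have dt: "det (matrix ?f) = (\<Prod>i\<in>UNIV. c i)"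
      by (subst det_diagonal) (auto simp: matrix_def axis_def)
    show "?P ?f"
    proof (intro impI allI)
      fix h :: "real ^ 'n \<Rightarrow> ennreal" assume d: "det (matrix ?f) \<noteq> 0" and [measurable]: "h \<in> borel_measurable borel"
      have c0: "c i \<noteq> 0" for i using d unfolding dt by simp
      define k where "k b = c (THE i. b = axis i 1)" for b :: "real^'n"
      have k: "k (axis i 1) = c i" for i by (simp add: k_def axis_eq_axis)
      have B: "(Basis :: (real^'n) set) = (\<lambda>i. axis i 1) ` UNIV" by (auto simp: Basis_vec_def)
      have inj: "inj (\<lambda>i::'n. axis i (1::real))" by (auto simp: inj_on_def axis_eq_axis)
      have T: "0 + (\<Sum>j\<in>Basis. (k j * (x \<bullet> j)) *\<^sub>R j) = ?f x" for x :: "real^'n"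
        unfolding B sum.reindex[OF inj]
        by (simp add: vec_eq_iff k inner_axis) (simp add: axis_def if_distrib cong: if_cong)
      have k0: "k j \<noteq> 0" if "j \<in> Basis" for j using that c0 unfolding B by (auto simp: k)
      have pr: "(\<Prod>j\<in>Basis. \<bar>k j\<bar>) = \<bar>det (matrix ?f)\<bar>"
        unfolding B prod.reindex[OF inj] by (simp add: k dt abs_prod)
      have [measurable]: "?f \<in> borel_measurable borel"
        unfolding T[symmetric] by measurable
      have "(\<integral>\<^sup>+x. h x \<partial>lborel) = (\<integral>\<^sup>+x. h x \<partial>(density (distr lborel borel ?f) (\<lambda>_. ennreal \<bar>det (matrix ?f)\<bar>)))"
        using lborel_affine_euclidean[of k 0, OF k0] unfolding T pr by simp
      also have "\<dots> = ennreal \<bar>det (matrix ?f)\<bar> * (\<integral>\<^sup>+x. h (?f x) \<partial>lborel)"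
        by (simp add: nn_integral_density nn_integral_distr nn_integral_cmult)
      finally show "(\<integral>\<^sup>+x. h x \<partial>lborel) = ennreal \<bar>det (matrix ?f)\<bar> * (\<integral>\<^sup>+x. h (?f x) \<partial>lborel)" .
    qed
  next
    fix m n :: 'n assume mn: "m \<noteq> n"
    let ?p = "Transposition.transpose m n"
    let ?f = "\<lambda>x::real^'n. \<chi> i. x $ ?p i"
    have "matrix ?f = (\<chi> i. mat 1 $ ?p i)"
      by (auto simp: matrix_def axis_def mat_def vec_eq_iff)
    then have "det (matrix ?f) = of_int (sign ?p) * det (mat 1 :: real^'n^'n)"
      by (simp only:) (rule det_permute_rows, rule permutes_swap_id, auto)
    then have dt: "\<bar>det (matrix ?f)\<bar> = 1"
      by (simp add: sign_swap_id mn)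
    have [measurable]: "?f \<in> borel_measurable borel"
      by (intro borel_measurable_continuous_onI continuous_intros)
    have "lborel = distr lborel borel ?f"
    proof (rule lborel_eqI)
      fix l u :: "real^'n" assume lu: "\<And>b. b \<in> Basis \<Longrightarrow> l \<bullet> b \<le> u \<bullet> b"
      have B: "(Basis :: (real^'n) set) = (\<lambda>i. axis i 1) ` UNIV" by (auto simp: Basis_vec_def)
      have inj: "inj (\<lambda>i::'n. axis i (1::real))" by (auto simp: inj_on_def axis_eq_axis)
      have le: "l $ i \<le> u $ i" for i using lu[of "axis i 1"] by (auto simp: inner_axis Basis_vec_def)
      have pp: "?p (?p i) = i" for i by simp
      have vi: "?f -` box l u = box (?f l) (?f u)"
        unfolding box_def B by (auto simp: inner_axis) (metis pp)+
      have bij: "bij ?p" by (rule bij_transpose)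
      have "emeasure (distr lborel borel ?f) (box l u) = emeasure lborel (box (?f l) (?f u))"
        by (subst emeasure_distr) (auto simp: vi)
      also have "\<dots> = ennreal (\<Prod>i\<in>UNIV. (u - l) $ ?p i)"
        unfolding emeasure_lborel_box_eq B prod.reindex[OF inj] by (auto simp: inner_axis le)
      also have "(\<Prod>i\<in>UNIV. (u - l) $ ?p i) = (\<Prod>i\<in>UNIV. (u - l) $ i)"
        by (rule prod.reindex_bij_betw[OF bij])
      also have "\<dots> = (\<Prod>b\<in>Basis. (u - l) \<bullet> b)"
        unfolding B prod.reindex[OF inj] by (simp add: inner_axis)
      finally show "emeasure (distr lborel borel ?f) (box l u) = ennreal (\<Prod>b\<in>Basis. (u - l) \<bullet> b)" .
    qed simp
    then have "(\<integral>\<^sup>+x. h x \<partial>lborel) = (\<integral>\<^sup>+x. h x \<partial>distr lborel borel ?f)" for h :: "real ^ 'n \<Rightarrow> ennreal"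
      by (rule arg_cong)
    also have "(\<integral>\<^sup>+x. h x \<partial>distr lborel borel ?f) = (\<integral>\<^sup>+x. h (?f x) \<partial>lborel)" if "h \<in> borel_measurable borel" for h :: "real ^ 'n \<Rightarrow> ennreal"
      using that by (intro nn_integral_distr) auto
    finally have eq: "(\<integral>\<^sup>+x. h x \<partial>lborel) = (\<integral>\<^sup>+x. h (?f x) \<partial>lborel)" if "h \<in> borel_measurable borel" for h :: "real ^ 'n \<Rightarrow> ennreal"
      using that by blast
    show "?P ?f"
    proof (intro impI allI)
      fix h :: "real ^ 'n \<Rightarrow> ennreal" assume "h \<in> borel_measurable borel"
      then show "(\<integral>\<^sup>+x. h x \<partial>lborel) = ennreal \<bar>det (matrix ?f)\<bar> * (\<integral>\<^sup>+x. h (?f x) \<partial>lborel)"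
        unfolding dt using eq[of h] by (simp only: ennreal_1 mult_1_left)
    qed
  next
    fix m n :: 'n assume mn: "m \<noteq> n"
    let ?f = "\<lambda>x::real^'n. \<chi> i. if i = m then x $ m + x $ n else x $ i"
    have "matrix ?f = (\<chi> k. if k = m then row m (mat 1) + 1 *s row n (mat 1) else row k (mat 1))"
      by (auto simp: matrix_def axis_def mat_def vec_eq_iff row_def)
    then have "det (matrix ?f) = det (mat 1 :: real^'n^'n)"
      by (simp only: det_row_operation[OF mn])
    then have dt: "\<bar>det (matrix ?f)\<bar> = 1" by simp
    show "?P ?f"
    proof (intro impI allI)
      fix h :: "real ^ 'n \<Rightarrow> ennreal" assume "h \<in> borel_measurable borel"
      then show "(\<integral>\<^sup>+x. h x \<partial>lborel) = ennreal \<bar>det (matrix ?f)\<bar> * (\<integral>\<^sup>+x. h (?f x) \<partial>lborel)"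
        unfolding dt using nn_integral_shear[OF mn, of h] by (simp only: ennreal_1 mult_1_left)
    qed
  qed
  then show ?thesis using assms by blast
qed

lemma lborel_linear:
  fixes f :: "real ^ 'n::finite \<Rightarrow> real ^ 'n"
  assumes "linear f" "det (matrix f) \<noteq> 0"
  shows "lborel = density (distr lborel borel f) (\<lambda>_. ennreal \<bar>det (matrix f)\<bar>)"
proof (rule measure_eqI)
  have [measurable]: "f \<in> borel_measurable borel"
    using assms by (intro borel_measurable_continuous_onI linear_continuous_on) (simp add: linear_conv_bounded_linear)
  fix A :: "(real^'n) set" assume "A \<in> sets lborel"
  then have [measurable]: "A \<in> sets borel" by simp
  have "emeasure lborel A = ennreal \<bar>det (matrix f)\<bar> * (\<integral>\<^sup>+x. indicator A (f x) \<partial>lborel)"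
    using nn_integral_linear_det[OF assms, of "indicator A"] by simp
  also have "\<dots> = emeasure (density (distr lborel borel f) (\<lambda>_. ennreal \<bar>det (matrix f)\<bar>)) A"
  proof -
    have "emeasure (density (distr lborel borel f) (\<lambda>_. ennreal \<bar>det (matrix f)\<bar>)) A
      = (\<integral>\<^sup>+x. ennreal \<bar>det (matrix f)\<bar> * indicator A x \<partial>(distr lborel borel f))"
      by (subst emeasure_density) auto
    also have "\<dots> = (\<integral>\<^sup>+x. ennreal \<bar>det (matrix f)\<bar> * indicator A (f x) \<partial>lborel)"
      by (subst nn_integral_distr) auto
    finally show ?thesis by (simp add: nn_integral_cmult)
  qed
  finally show "emeasure lborel A = \<dots>" .
qed simp

lemma integral_linear_det:
  fixes f :: "real ^ 'n::finite \<Rightarrow> real ^ 'n" and h :: "real ^ 'n \<Rightarrow> real"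
  assumes f: "linear f" "det (matrix f) \<noteq> 0" and [measurable]: "h \<in> borel_measurable borel"
  shows "(\<integral>x. h x \<partial>lborel) = \<bar>det (matrix f)\<bar> * (\<integral>x. h (f x) \<partial>lborel)"
proof -
  have [measurable]: "f \<in> borel_measurable borel"
    using assms by (intro borel_measurable_continuous_onI linear_continuous_on) (simp add: linear_conv_bounded_linear)
  have "(\<integral>x. h x \<partial>lborel) = (\<integral>x. h x \<partial>(density (distr lborel borel f) (\<lambda>_. ennreal \<bar>det (matrix f)\<bar>)))"
    using lborel_linear[OF f] by simp
  then show ?thesis by (simp add: integral_density integral_distr)
qed

text \<open>The points of T with nonzero value form an open set, and a nonempty open set is not
  negligible.\<close>

lemma continuous_AE_zero:
  fixes h :: "'a::euclidean_space \<Rightarrow> real"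
  assumes T: "open T" "continuous_on T h" and ae: "AE x in lborel. x \<in> T \<longrightarrow> h x = 0" and x: "x \<in> T"
  shows "h x = 0"
proof (rule ccontr)
  assume "h x \<noteq> 0"
  define T' where "T' = T \<inter> h -` (- {0})"
  have "open T'" unfolding T'_def by (rule continuous_open_preimage[OF T(2,1)]) auto
  moreover have "x \<in> T'" using x \<open>h x \<noteq> 0\<close> by (simp add: T'_def)
  ultimately have "\<not> negligible T'" using open_not_negligible by blast
  moreover have "AE x in lebesgue. x \<notin> T'"
    using AE_completion[OF ae] by eventually_elim (auto simp: T'_def)
  then have "negligible T'"
    unfolding negligible_iff_null_sets using \<open>open T'\<close>
    by (subst (asm) AE_iff_null_sets[symmetric]) auto
  ultimately show False by simp
qed

section \<open>Kernel moments\<close>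

text \<open>The vector \<open>axis undefined 1\<close> is an arbitrary unit vector; by rotation
  invariance any other would give the same number. The moments used later are n = 2 for the kernel
  and n = 4 for its square.\<close>

definition kernel_moment :: "'d::finite itself \<Rightarrow> (real \<Rightarrow> real) \<Rightarrow> nat \<Rightarrow> real" where
  "kernel_moment _ \<kappa> n = (\<integral>(v::real^'d). \<kappa> ((norm v)\<^sup>2) * (axis undefined 1 \<bullet> v) ^ n \<partial>lborel)"

lemma continuous_radial:
  assumes "continuous_on {0..} \<kappa>" "continuous_on S g" "\<And>x. x \<in> S \<Longrightarrow> g x \<ge> (0::real)"
  shows "continuous_on S (\<lambda>x. \<kappa> (g x) :: real)"
  by (rule continuous_on_compose2[OF assms(1,2)]) (use assms(3) in auto)

text \<open>An orthogonal map takes the reference axis to w / |w| and preserves both norms and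
  volume. For w = 0 both sides vanish since n > 0.\<close>

lemma kernel_moment_rotate:
  fixes w :: "real ^ 'd::finite"
  assumes \<kappa>: "continuous_on {0..} \<kappa>" and n: "n > 0"
  shows "(\<integral>v. \<kappa> ((norm v)\<^sup>2) * (w \<bullet> v) ^ n \<partial>lborel) = norm w ^ n * kernel_moment TYPE('d) \<kappa> n"
proof (cases "w = 0")
  case True then show ?thesis using n by simp
next
  case False
  let ?e = "axis undefined 1 :: real^'d"
  obtain f :: "real^'d \<Rightarrow> real^'d" where f: "orthogonal_transformation f" "f ?e = w /\<^sub>R norm w"
    by (rule orthogonal_transformation_exists_1[of ?e "w /\<^sub>R norm w"]) (use False in auto)
  have lin: "linear f" using f by (simp add: orthogonal_transformation_def)
  have nrm: "norm (f v) = norm v" for v using f(1) by (rule orthogonal_transformation_norm)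
  have inn: "f u \<bullet> f v = u \<bullet> v" for u v using f(1) by (simp add: orthogonal_transformation_def)
  have det: "\<bar>det (matrix f)\<bar> = 1"
    using f(1) orthogonal_transformation_det by blast
  have w: "w = norm w *\<^sub>R f ?e" using f(2) False by simp
  have m: "(\<lambda>v::real^'d. \<kappa> ((norm v)\<^sup>2) * (w \<bullet> v) ^ n) \<in> borel_measurable borel"
    by (intro borel_measurable_continuous_onI continuous_intros continuous_radial[OF \<kappa>]) auto
  have dnz: "det (matrix f) \<noteq> 0" using det by auto
  have "(\<integral>v. \<kappa> ((norm v)\<^sup>2) * (w \<bullet> v) ^ n \<partial>lborel) = (\<integral>v. \<kappa> ((norm v)\<^sup>2) * (w \<bullet> f v) ^ n \<partial>lborel)"
    using integral_linear_det[OF lin dnz m] det by (simp add: nrm)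
  also have "\<dots> = (\<integral>v. norm w ^ n * (\<kappa> ((norm v)\<^sup>2) * (?e \<bullet> v) ^ n) \<partial>lborel)"
    by (subst w) (simp add: inn power_mult_distrib mult_ac)
  finally show ?thesis by (simp add: kernel_moment_def)
qed

text \<open>L stands for the derivative of a chart and g for the metric tensor. An isometry T of the
  range of L onto coordinate space makes S = T o L a square map with transpose (S) S = g, so
  \<open>sqrt (det g)\<close> is exactly the Jacobian |det S| of the substitution v = S z. As w lies
  in the range, T also preserves its inner products with L z.\<close>

lemma kernel_moment_linear:
  fixes L :: "real ^ 'd::finite \<Rightarrow> real ^ 'D::finite"
  assumes \<kappa>: "continuous_on {0..} \<kappa>" and n: "n > 0" and L: "linear L" "inj L" and w: "w \<in> range L"
  defines "g \<equiv> (\<chi> i j. L (axis i 1) \<bullet> L (axis j 1)) :: real^'d^'d"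
  shows "det g > 0"
    and "(\<integral>z. \<kappa> ((norm (L z))\<^sup>2) * (w \<bullet> L z) ^ n \<partial>lborel) * sqrt (det g) = norm w ^ n * kernel_moment TYPE('d) \<kappa> n"
proof -
  have "dim (range L) = dim (UNIV :: (real^'d) set)"
    using L by (intro dim_image_eq) auto
  then obtain T where T: "linear T" "T ` range L = (UNIV :: (real^'d) set)" "\<And>x. x \<in> range L \<Longrightarrow> norm (T x) = norm x"
    using isometry_subspaces[of "range L" "UNIV :: (real^'d) set"] L(1) linear_subspace_image[OF L(1) subspace_UNIV] by auto
  have sub: "subspace (range L)" using linear_subspace_image[OF L(1) subspace_UNIV] .
  \<comment> \<open>Polarization: T is given only as norm preserving on the range of L.\<close>
  have inn: "T x \<bullet> T y = x \<bullet> y" if "x \<in> range L" "y \<in> range L" for x y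
  proof -
    have "x + y \<in> range L" using that sub by (simp add: subspace_add)
    have "x \<bullet> y = ((norm (x + y))\<^sup>2 - (norm x)\<^sup>2 - (norm y)\<^sup>2) / 2"
      by (simp add: dot_norm)
    also have "\<dots> = ((norm (T x + T y))\<^sup>2 - (norm (T x))\<^sup>2 - (norm (T y))\<^sup>2) / 2"
      using T(3)[OF that(1)] T(3)[OF that(2)] T(3)[OF \<open>x + y \<in> range L\<close>] by (simp add: linear_add[OF T(1)])
    also have "\<dots> = T x \<bullet> T y" by (simp add: dot_norm)
    finally show ?thesis by simp
  qed
  define S where "S = T \<circ> L"
  have S: "linear S" unfolding S_def using T(1) L(1) by (rule linear_compose[rotated])
  have Sn: "norm (S z) = norm (L z)" for z by (simp add: S_def T(3))
  have Si: "S x \<bullet> S y = L x \<bullet> L y" for x y by (simp add: S_def inn)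
  have surj: "surj S" using T(2) by (simp add: S_def image_comp)
  then have "det (matrix S) \<noteq> 0"
    using det_nz_iff_inj[OF S] linear_surj_imp_inj[OF S] by simp
  have g: "g = transpose (matrix S) ** matrix S"
    by (simp add: g_def vec_eq_iff matrix_matrix_mult_def transpose_def matrix_def Si[symmetric]) (simp add: inner_vec_def)
  then have dg: "det g = (det (matrix S))\<^sup>2"
    by (simp add: det_mul det_transpose power2_eq_square)
  then show "det g > 0" using \<open>det (matrix S) \<noteq> 0\<close> by simp
  have [simp]: "sqrt (det g) = \<bar>det (matrix S)\<bar>" by (simp add: dg)
  have wn: "norm (T w) = norm w" using w by (rule T(3))
  have m: "(\<lambda>v::real^'d. \<kappa> ((norm v)\<^sup>2) * (T w \<bullet> v) ^ n) \<in> borel_measurable borel"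
    by (intro borel_measurable_continuous_onI continuous_intros continuous_radial[OF \<kappa>]) auto
  have "(\<integral>z. \<kappa> ((norm (L z))\<^sup>2) * (w \<bullet> L z) ^ n \<partial>lborel) = (\<integral>z. \<kappa> ((norm (S z))\<^sup>2) * (T w \<bullet> S z) ^ n \<partial>lborel)"
    using w by (simp add: inn S_def T(3))
  then have "(\<integral>z. \<kappa> ((norm (L z))\<^sup>2) * (w \<bullet> L z) ^ n \<partial>lborel) * sqrt (det g) = (\<integral>v. \<kappa> ((norm v)\<^sup>2) * (T w \<bullet> v) ^ n \<partial>lborel)"
    using integral_linear_det[OF S \<open>det (matrix S) \<noteq> 0\<close> m] by simp
  then show "(\<integral>z. \<kappa> ((norm (L z))\<^sup>2) * (w \<bullet> L z) ^ n \<partial>lborel) * sqrt (det g) = norm w ^ n * kernel_moment TYPE('d) \<kappa> n"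
    by (simp add: kernel_moment_rotate[OF \<kappa> n] wn)
qed

lemma integrable_kernel_power:
  fixes w :: "real ^ 'd::finite"
  assumes "decaying_kernel \<kappa> a B"
  shows "integrable lborel (\<lambda>v. \<kappa> ((norm v)\<^sup>2) * (w \<bullet> v) ^ n)"
proof (rule Bochner_Integration.integrable_bound)
  have a: "a > 0" "B \<ge> 0" "continuous_on {0..} \<kappa>" using assms by (auto simp: decaying_kernel_def)
  show "integrable lborel (wt (B * norm w ^ n) n a :: real^'d \<Rightarrow> real)"
    using a by (intro integrable_wt)
  show "AE v in lborel. norm (\<kappa> ((norm v)\<^sup>2) * (w \<bullet> v) ^ n) \<le> norm (wt (B * norm w ^ n) n a v)"
  proof (rule AE_I2)
    fix v :: "real^'d"
    have "\<bar>w \<bullet> v\<bar> ^ n \<le> (norm w * (1 + norm v)) ^ n"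
      by (intro power_mono order_trans[OF Cauchy_Schwarz_ineq2] mult_left_mono) auto
    then have "\<bar>\<kappa> ((norm v)\<^sup>2)\<bar> * \<bar>w \<bullet> v\<bar> ^ n \<le> (B * exp (- a * (norm v)\<^sup>2)) * (norm w * (1 + norm v)) ^ n"
      using decaying_kernel_bound[OF assms, of "(norm v)\<^sup>2"] by (intro mult_mono) auto
    then show "norm (\<kappa> ((norm v)\<^sup>2) * (w \<bullet> v) ^ n) \<le> norm (wt (B * norm w ^ n) n a v)"
      using a by (simp add: abs_mult power_abs wt_def power_mult_distrib mult_ac)
  qed
  show "(\<lambda>v. \<kappa> ((norm v)\<^sup>2) * (w \<bullet> v) ^ n) \<in> borel_measurable lborel"
    by (simp, intro borel_measurable_continuous_onI continuous_intros continuous_radial[OF a(3)]) auto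
qed

lemma kernel_moment_pos:
  assumes \<kappa>: "decaying_kernel \<kappa> a B" and nn: "\<And>\<xi>. \<xi> \<ge> 0 \<Longrightarrow> \<kappa> \<xi> \<ge> 0" and p: "\<xi>0 \<ge> 0" "\<kappa> \<xi>0 > 0" and n: "even n"
  shows "kernel_moment TYPE('d::finite) \<kappa> n > 0"
proof -
  have c: "continuous_on {0..} \<kappa>" using \<kappa> by (auto simp: decaying_kernel_def)
  \<comment> \<open>If positivity is known only at 0, right continuity moves it to some \<xi> > 0.
    This matters because at v = 0 the factor \<open>(?e \<bullet> v) ^ n\<close> may vanish.\<close>
  obtain \<xi> where \<xi>: "\<xi> > 0" "\<kappa> \<xi> > 0"
  proof (cases "\<xi>0 = 0")
    case True
    have "(\<kappa> \<longlongrightarrow> \<kappa> 0) (at_right 0)"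
      using c by (auto simp: continuous_on_def intro: tendsto_within_subset)
    then have "eventually (\<lambda>\<xi>. \<kappa> \<xi> > 0) (at_right 0)"
      using p True by (intro order_tendstoD(1)) auto
    moreover have "eventually (\<lambda>\<xi>::real. \<xi> > 0) (at_right 0)" by (simp add: eventually_at_right_less)
    ultimately have "eventually (\<lambda>\<xi>. \<xi> > 0 \<and> \<kappa> \<xi> > 0) (at_right 0)" by eventually_elim simp
    then show ?thesis using that eventually_happens'[OF trivial_limit_at_right_real] by blast
  next
    case False
    then show ?thesis using p that[of \<xi>0] by simp
  qed
  let ?e = "axis undefined 1 :: real^'d"
  let ?h = "\<lambda>v. \<kappa> ((norm v)\<^sup>2) * (?e \<bullet> v) ^ n"
  have int: "integrable lborel ?h" by (rule integrable_kernel_power[OF \<kappa>])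
  have h0: "?h v \<ge> 0" for v using nn n by (simp add: zero_le_even_power)
  have "kernel_moment TYPE('d) \<kappa> n \<noteq> 0"
  proof
    assume "kernel_moment TYPE('d) \<kappa> n = 0"
    then have "AE v in lborel. ?h v = 0"
      unfolding kernel_moment_def using integral_nonneg_eq_0_iff_AE[OF int] h0 by simp
    then have "?h (sqrt \<xi> *\<^sub>R ?e) = 0"
      by (intro continuous_AE_zero[of UNIV]) (auto intro!: continuous_intros continuous_radial[OF c])
    then show False using \<xi> by (simp add: power_mult_distrib inner_axis_axis)
  qed
  moreover have "kernel_moment TYPE('d) \<kappa> n \<ge> 0"
    unfolding kernel_moment_def using h0 by (intro Bochner_Integration.integral_nonneg) auto
  ultimately show ?thesis by simp
qed

text \<open>|u|^2 is the sum of the squared coordinates, each of which has the same moment by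
  rotation; the factor 1 / dim in \<open>kernel_m2\<close> cancels their number.\<close>

lemma kernel_m2_eq_moment:
  assumes "decaying_kernel \<kappa> a B"
  shows "kernel_m2 TYPE('d::finite) \<kappa> = kernel_moment TYPE('d) \<kappa> 2"
proof -
  have c: "continuous_on {0..} \<kappa>" using assms by (auto simp: decaying_kernel_def)
  have "(\<integral>u. (norm (u :: real ^ 'd))\<^sup>2 * \<kappa> ((norm u)\<^sup>2) \<partial>lborel)
    = (\<integral>(u::real^'d). (\<Sum>i\<in>UNIV. \<kappa> ((norm u)\<^sup>2) * (axis i 1 \<bullet> u)\<^sup>2) \<partial>lborel)"
  proof (intro Bochner_Integration.integral_cong refl)
    fix u :: "real^'d"
    have "(norm u)\<^sup>2 = (\<Sum>i\<in>UNIV. (axis i 1 \<bullet> u)\<^sup>2)"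
      unfolding power2_norm_eq_inner inner_vec_def[of u u] by (simp add: inner_axis' power2_eq_square)
    then show "(norm u)\<^sup>2 * \<kappa> ((norm u)\<^sup>2) = (\<Sum>i\<in>UNIV. \<kappa> ((norm u)\<^sup>2) * (axis i 1 \<bullet> u)\<^sup>2)"
      unfolding sum_distrib_left[symmetric] by simp
  qed
  also have "\<dots> = (\<Sum>i\<in>(UNIV::'d set). \<integral>(u::real^'d). \<kappa> ((norm u)\<^sup>2) * (axis i 1 \<bullet> u)\<^sup>2 \<partial>lborel)"
    by (rule Bochner_Integration.integral_sum) (rule integrable_kernel_power[OF assms])
  also have "\<dots> = real CARD('d) * kernel_moment TYPE('d) \<kappa> 2"
    by (simp add: kernel_moment_rotate[OF c])
  finally show ?thesis by (simp add: kernel_m2_def)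
qed

section \<open>Charts, gradients and the Riemannian volume\<close>

abbreviation dmap :: "('a::real_normed_vector \<Rightarrow> 'b::real_normed_vector) \<Rightarrow> 'a \<Rightarrow> 'a \<Rightarrow> 'b" where
  "dmap \<phi> u \<equiv> frechet_derivative \<phi> (at u)"

lemma C_inf_on_D: "C_inf_on U f \<Longrightarrow> C_k_on k U f"
  by (simp add: C_inf_on_def)

lemma C_inf_on_differentiable: "C_inf_on U f \<Longrightarrow> u \<in> U \<Longrightarrow> f differentiable (at u)"
  using C_inf_on_D[of U f 1] by simp

lemma C_inf_on_has_derivative: "C_inf_on U f \<Longrightarrow> u \<in> U \<Longrightarrow> (f has_derivative dmap f u) (at u)"
  using C_inf_on_differentiable frechet_derivative_works by blast

lemma C_inf_on_linear: "C_inf_on U f \<Longrightarrow> u \<in> U \<Longrightarrow> linear (dmap f u)"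
  using C_inf_on_differentiable linear_frechet_derivative by blast

lemma local_paramD:
  assumes "local_param M U \<phi>"
  shows "open U" "C_inf_on U \<phi>" "\<And>u. u \<in> U \<Longrightarrow> inj (dmap \<phi> u)" "openin (top_of_set M) (\<phi> ` U)"
    "inj_on \<phi> U" "\<phi> ` U \<subseteq> M" "continuous_on U \<phi>" "\<And>u. u \<in> U \<Longrightarrow> linear (dmap \<phi> u)"
proof -
  show "open U" and inf: "C_inf_on U \<phi>" and "\<And>u. u \<in> U \<Longrightarrow> inj (dmap \<phi> u)" and oi: "openin (top_of_set M) (\<phi> ` U)"
    using assms by (auto simp: local_param_def)
  show "\<phi> ` U \<subseteq> M" using oi openin_imp_subset by blast
  obtain \<psi> where "homeomorphism U (\<phi> ` U) \<phi> \<psi>" using assms by (auto simp: local_param_def)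
  then show "inj_on \<phi> U" unfolding homeomorphism_def by (metis inj_onI)
  show "continuous_on U \<phi>" using inf by (intro C_k_on_continuous[of 0] C_inf_on_D)
  show "\<And>u. u \<in> U \<Longrightarrow> linear (dmap \<phi> u)" using inf by (rule C_inf_on_linear)
qed

text \<open>The inverse of a chart is given only as a continuous map, so differentiability of a
  transition map must be proved. With \<Lambda> a left inverse of the derivative \<open>L1\<close>,
  the candidate is \<open>\<Lambda> \<circ> L2\<close>. Linearizing \<phi>1 shows that w = \<tau> y
  satisfies |w - u1| \<le> const * |y - u2| near u2, and this converts errors small against |w - u1|
  into errors small against |y - u2|.\<close>

lemma transition_derivative:
  fixes \<phi>1 \<phi>2 :: "real ^ 'd::finite \<Rightarrow> real ^ 'D::finite"
  assumes p1: "local_param M U1 \<phi>1" and p2: "local_param M U2 \<phi>2" and u: "u1 \<in> U1" "u2 \<in> U2" "\<phi>1 u1 = \<phi>2 u2"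
  obtains A \<tau> W where "(\<tau> has_derivative A) (at u2)" "open W" "u2 \<in> W" "W \<subseteq> U2" "\<tau> u2 = u1"
    "\<And>w. w \<in> W \<Longrightarrow> \<tau> w \<in> U1 \<and> \<phi>1 (\<tau> w) = \<phi>2 w"
proof -
  obtain \<psi> where \<psi>: "homeomorphism U1 (\<phi>1 ` U1) \<phi>1 \<psi>" using p1 by (auto simp: local_param_def)
  define \<tau> where "\<tau> = \<psi> \<circ> \<phi>2"
  define W where "W = U2 \<inter> \<phi>2 -` (\<phi>1 ` U1)"
  note l1 = local_paramD[OF p1] and l2 = local_paramD[OF p2]
  have "openin (top_of_set U2) W" unfolding W_def
    by (rule continuous_openin_preimage[OF l2(7) _ l1(4)]) (use l2(6) in auto)
  then have W: "open W" using l2(1) by (rule openin_open_trans)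
  have uW: "u2 \<in> W" unfolding W_def using u by (auto intro!: image_eqI[of _ _ u1])
  have \<tau>: "\<tau> w \<in> U1 \<and> \<phi>1 (\<tau> w) = \<phi>2 w" if "w \<in> W" for w
    using that \<psi> unfolding W_def \<tau>_def homeomorphism_def by auto
  have \<tau>u: "\<tau> u2 = u1"
    using \<tau>[OF uW] u l1(5) by (metis inj_onD)
  have "continuous_on W \<tau>" unfolding \<tau>_def W_def
    using \<psi> l2(7) by (intro continuous_on_compose) (auto simp: homeomorphism_def intro: continuous_on_subset)
  then have "isCont \<tau> u2" using W uW continuous_on_eq_continuous_at by blast
  define L1 where "L1 = dmap \<phi>1 u1"
  define L2 where "L2 = dmap \<phi>2 u2"
  have L1: "linear L1" "inj L1" using l1(8,3) u by (auto simp: L1_def)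
  have L2: "linear L2" using l2(8) u by (auto simp: L2_def)
  obtain \<Lambda> where \<Lambda>: "linear \<Lambda>" "\<Lambda> \<circ> L1 = id" using linear_injective_left_inverse[OF L1] by blast
  have \<Lambda>L: "\<Lambda> (L1 x) = x" for x using \<Lambda>(2) by (metis comp_apply id_apply)
  obtain B where B: "B > 0" "\<And>x. norm (\<Lambda> x) \<le> B * norm x" using linear_bounded_pos[OF \<Lambda>(1)] by blast
  obtain B2 where B2: "B2 > 0" "\<And>x. norm (L2 x) \<le> B2 * norm x" using linear_bounded_pos[OF L2] by blast
  have d1: "\<exists>d>0. \<forall>y. norm (y - u1) < d \<longrightarrow> norm (\<phi>1 y - \<phi>1 u1 - L1 (y - u1)) \<le> e * norm (y - u1)" if "e > 0" for e
    using C_inf_on_has_derivative[OF l1(2) u(1)] that unfolding has_derivative_at_alt L1_def by blast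
  have d2: "\<exists>d>0. \<forall>y. norm (y - u2) < d \<longrightarrow> norm (\<phi>2 y - \<phi>2 u2 - L2 (y - u2)) \<le> e * norm (y - u2)" if "e > 0" for e
    using C_inf_on_has_derivative[OF l2(2) u(2)] that unfolding has_derivative_at_alt L2_def by blast
  have "(\<tau> has_derivative (\<Lambda> \<circ> L2)) (at u2)"
    unfolding has_derivative_at_alt
  proof (intro conjI allI impI)
    show "bounded_linear (\<Lambda> \<circ> L2)"
      using L2 \<Lambda>(1) by (simp add: linear_conv_bounded_linear[symmetric] linear_compose)
    fix e :: real assume e: "e > 0"
    define e2 where "e2 = min 1 (e / (2 * B))"
    \<comment> \<open>The first bound lets half of |w - u1| be absorbed on the left-hand side; the
      second keeps the resulting error below half of e after |w - u1| \<le> 2 B (B2 + 1) |y - u2| is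
      inserted.\<close>
    define e1 where "e1 = min (1 / (2 * B)) (e / (4 * B\<^sup>2 * (B2 + 1)))"
    have e2: "e2 > 0" "e2 \<le> 1" "B * e2 \<le> e / 2" using e B(1) by (auto simp: e2_def min_def field_simps)
    have e1: "e1 > 0" using e B(1) B2(1) by (simp add: e1_def)
    have e1': "B * e1 \<le> 1 / 2" using B(1) by (auto simp: e1_def min_def field_simps)
    have "e1 \<le> e / (4 * B\<^sup>2 * (B2 + 1))" by (simp add: e1_def)
    then have "e1 * (4 * B\<^sup>2 * (B2 + 1)) \<le> e"
      using B(1) B2(1) by (subst (asm) pos_le_divide_eq) auto
    then have e1'': "B * e1 * (2 * B * (B2 + 1)) \<le> e / 2"
      by (simp add: power2_eq_square algebra_simps)
    obtain r1 where r1: "r1 > 0" "\<And>y. norm (y - u1) < r1 \<Longrightarrow> norm (\<phi>1 y - \<phi>1 u1 - L1 (y - u1)) \<le> e1 * norm (y - u1)"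
      using d1[OF e1] by blast
    obtain r2 where r2: "r2 > 0" "\<And>y. norm (y - u2) < r2 \<Longrightarrow> norm (\<phi>2 y - \<phi>2 u2 - L2 (y - u2)) \<le> e2 * norm (y - u2)"
      using d2[OF e2(1)] by blast
    obtain r3 where r3: "r3 > 0" "\<And>y. dist y u2 < r3 \<Longrightarrow> dist (\<tau> y) (\<tau> u2) < r1"
      using \<open>isCont \<tau> u2\<close> r1(1) unfolding continuous_at_eps_delta by blast
    obtain r4 where r4: "r4 > 0" "ball u2 r4 \<subseteq> W" using W uW openE by blast
    show "\<exists>d>0. \<forall>y. norm (y - u2) < d \<longrightarrow> norm (\<tau> y - \<tau> u2 - (\<Lambda> \<circ> L2) (y - u2)) \<le> e * norm (y - u2)"
    proof (intro exI conjI allI impI)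
      show "min r2 (min r3 r4) > 0" using r2 r3 r4 by simp
      fix y assume y: "norm (y - u2) < min r2 (min r3 r4)"
      define w where "w = \<tau> y"
      have yW: "y \<in> W" using y r4 by (auto simp: dist_norm norm_minus_commute subset_iff)
      have w: "norm (w - u1) < r1" using r3(2)[of y] y by (simp add: dist_norm \<tau>u w_def)
      have \<phi>w: "\<phi>1 w = \<phi>2 y" using \<tau>[OF yW] by (simp add: w_def)
      have a: "norm (\<Lambda> (\<phi>2 y - \<phi>2 u2) - (w - u1)) \<le> B * (e1 * norm (w - u1))"
      proof -
        have "\<Lambda> (\<phi>2 y - \<phi>2 u2) - (w - u1) = \<Lambda> (\<phi>1 w - \<phi>1 u1 - L1 (w - u1))"
          by (simp add: linear_diff[OF \<Lambda>(1)] \<Lambda>L \<phi>w u(3))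
        also have "norm \<dots> \<le> B * norm (\<phi>1 w - \<phi>1 u1 - L1 (w - u1))" by (rule B(2))
        also have "\<dots> \<le> B * (e1 * norm (w - u1))" using r1(2)[OF w] B(1) by (intro mult_left_mono) auto
        finally show ?thesis .
      qed
      have \<phi>2: "norm (\<phi>2 y - \<phi>2 u2 - L2 (y - u2)) \<le> e2 * norm (y - u2)" using r2(2)[of y] y by simp
      have \<phi>2': "norm (\<phi>2 y - \<phi>2 u2) \<le> (B2 + 1) * norm (y - u2)"
      proof -
        have "norm (\<phi>2 y - \<phi>2 u2) \<le> norm (\<phi>2 y - \<phi>2 u2 - L2 (y - u2)) + norm (L2 (y - u2))"
          by (metis add.commute diff_add_cancel norm_triangle_ineq)
        also have "\<dots> \<le> e2 * norm (y - u2) + B2 * norm (y - u2)" using \<phi>2 B2(2) by (intro add_mono) auto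
        also have "\<dots> \<le> 1 * norm (y - u2) + B2 * norm (y - u2)" using e2(2) by (intro add_mono mult_right_mono) auto
        finally show ?thesis by (simp add: algebra_simps)
      qed
      have "norm (w - u1) \<le> norm (\<Lambda> (\<phi>2 y - \<phi>2 u2)) + norm (\<Lambda> (\<phi>2 y - \<phi>2 u2) - (w - u1))"
        by (metis norm_minus_commute norm_triangle_sub)
      also have "\<dots> \<le> B * norm (\<phi>2 y - \<phi>2 u2) + B * (e1 * norm (w - u1))" using a B(2) by (intro add_mono) auto
      also have "B * (e1 * norm (w - u1)) \<le> 1 / 2 * norm (w - u1)"
        using mult_right_mono[OF e1', of "norm (w - u1)"] by (simp add: mult.assoc)
      finally have "norm (w - u1) \<le> 2 * B * norm (\<phi>2 y - \<phi>2 u2)" by simp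
      also have "\<dots> \<le> 2 * B * ((B2 + 1) * norm (y - u2))" using \<phi>2' B(1) by (intro mult_left_mono) auto
      finally have wn: "norm (w - u1) \<le> 2 * B * (B2 + 1) * norm (y - u2)" by simp
      have "norm ((w - u1) - \<Lambda> (L2 (y - u2))) \<le> norm (\<Lambda> (\<phi>2 y - \<phi>2 u2) - (w - u1)) + norm (\<Lambda> (\<phi>2 y - \<phi>2 u2 - L2 (y - u2)))"
      proof -
        have "(w - u1) - \<Lambda> (L2 (y - u2)) = \<Lambda> (\<phi>2 y - \<phi>2 u2 - L2 (y - u2)) - (\<Lambda> (\<phi>2 y - \<phi>2 u2) - (w - u1))"
          by (simp add: linear_diff[OF \<Lambda>(1)])
        then show ?thesis by (metis add.commute norm_triangle_ineq4)
      qed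
      also have "\<dots> \<le> B * (e1 * norm (w - u1)) + B * (e2 * norm (y - u2))"
        using a order_trans[OF B(2) mult_left_mono[OF \<phi>2]] B(1) by (intro add_mono) auto
      also have "B * (e1 * norm (w - u1)) \<le> B * e1 * (2 * B * (B2 + 1) * norm (y - u2))"
        using mult_left_mono[OF wn, of "B * e1"] B(1) e1 by (simp add: mult.assoc)
      also have "\<dots> \<le> e / 2 * norm (y - u2)"
        using mult_right_mono[OF e1'', of "norm (y - u2)"] by (simp add: mult.assoc)
      also have "B * (e2 * norm (y - u2)) \<le> e / 2 * norm (y - u2)"
        using mult_right_mono[OF e2(3), of "norm (y - u2)"] by (simp add: mult.assoc)
      finally show "norm (\<tau> y - \<tau> u2 - (\<Lambda> \<circ> L2) (y - u2)) \<le> e * norm (y - u2)"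
        by (simp add: w_def \<tau>u)
    qed
  qed
  moreover have "W \<subseteq> U2" by (simp add: W_def)
  ultimately show ?thesis using that[OF _ W uW _ \<tau>u \<tau>] by blast
qed

text \<open>The point is that one and the same A serves the embedding and every function f. A vector
  that represents the differential of f in one chart therefore does so in all charts.\<close>

lemma transition_chain:
  fixes \<phi>1 \<phi>2 :: "real ^ 'd::finite \<Rightarrow> real ^ 'D::finite"
  assumes p1: "local_param M U1 \<phi>1" and p2: "local_param M U2 \<phi>2" and u: "u1 \<in> U1" "u2 \<in> U2" "\<phi>1 u1 = \<phi>2 u2"
  shows "\<exists>A. \<forall>h. dmap \<phi>2 u2 h = dmap \<phi>1 u1 (A h) \<and> 
    (\<forall>f::real ^ 'D \<Rightarrow> real. (f \<circ> \<phi>1) differentiable (at u1) \<longrightarrow> dmap (f \<circ> \<phi>2) u2 h = dmap (f \<circ> \<phi>1) u1 (A h))"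
proof -
  obtain A \<tau> W where A: "(\<tau> has_derivative A) (at u2)" and W: "open W" "u2 \<in> W" "W \<subseteq> U2" and \<tau>: "\<tau> u2 = u1"
    "\<And>w. w \<in> W \<Longrightarrow> \<tau> w \<in> U1 \<and> \<phi>1 (\<tau> w) = \<phi>2 w"
    using transition_derivative[OF assms] by metis
  have d: "dmap (g \<circ> \<phi>2) u2 h = dmap (g \<circ> \<phi>1) u1 (A h)" if "(g \<circ> \<phi>1) differentiable (at u1)" for g :: "real^'D \<Rightarrow> 'c::real_normed_vector" and h
  proof -
    have "((g \<circ> \<phi>1) has_derivative dmap (g \<circ> \<phi>1) u1) (at (\<tau> u2))"
      using that \<tau>(1) frechet_derivative_works by metis
    then have "((\<lambda>w. (g \<circ> \<phi>1) (\<tau> w)) has_derivative (\<lambda>h. dmap (g \<circ> \<phi>1) u1 (A h))) (at u2)"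
      using A by (rule has_derivative_compose[rotated])
    then have "((g \<circ> \<phi>2) has_derivative (\<lambda>h. dmap (g \<circ> \<phi>1) u1 (A h))) (at u2)"
      by (rule has_derivative_transform_within_open[OF _ W(1,2)]) (use \<tau>(2) in auto)
    then show ?thesis by (subst frechet_derivative_at[symmetric]) (assumption, rule refl)
  qed
  have "\<phi>1 differentiable (at u1)" using C_inf_on_differentiable[OF local_paramD(2)[OF p1] u(1)] .
  then show ?thesis using d[of id] d by (intro exI[of _ A]) auto
qed

lemma tangent_space_chart:
  fixes \<phi> :: "real ^ 'd::finite \<Rightarrow> real ^ 'D::finite"
  assumes p: "local_param M U \<phi>" "u \<in> U"
  shows "tangent_space TYPE('d) M (\<phi> u) = range (dmap \<phi> u)"
proof (intro equalityI subsetI)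
  fix v assume "v \<in> tangent_space TYPE('d) M (\<phi> u)"
  then obtain U' \<phi>' u' h where q: "local_param M U' (\<phi>' :: real ^ 'd \<Rightarrow> real ^ 'D)" "u' \<in> U'" "\<phi>' u' = \<phi> u" "v = dmap \<phi>' u' h"
    unfolding tangent_space_def by blast
  then show "v \<in> range (dmap \<phi> u)"
    using transition_chain[OF p(1) q(1) p(2) q(2)] by auto
next
  fix v assume "v \<in> range (dmap \<phi> u)"
  then show "v \<in> tangent_space TYPE('d) M (\<phi> u)"
    unfolding tangent_space_def using p by blast
qed

text \<open>This makes the definite description in \<open>manifold_grad\<close> meaningful. A left
  inverse of the chart derivative extends the differential of f to an ambient linear form with
  vector \<open>v0\<close>, and the orthogonal projection of \<open>v0\<close> to the tangent space
  is the gradient. Two candidates differ by a tangent vector orthogonal to all tangent vectors,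
  hence by 0.\<close>

lemma manifold_grad_chart:
  fixes \<phi> :: "real ^ 'd::finite \<Rightarrow> real ^ 'D::finite"
  assumes p: "local_param M U \<phi>" "u \<in> U" and f: "smooth_function TYPE('d) M f"
  shows "manifold_grad TYPE('d) M f (\<phi> u) \<in> range (dmap \<phi> u)"
    and "manifold_grad TYPE('d) M f (\<phi> u) \<bullet> dmap \<phi> u h = dmap (f \<circ> \<phi>) u h"
proof -
  define L where "L = dmap \<phi> u"
  define l where "l = dmap (f \<circ> \<phi>) u"
  let ?P = "\<lambda>v. v \<in> tangent_space TYPE('d) M (\<phi> u) \<and>
        (\<forall>(U' :: (real ^ 'd) set) \<phi>' u' h. local_param M U' \<phi>' \<and> u' \<in> U' \<and> \<phi>' u' = \<phi> u \<longrightarrow>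
           v \<bullet> frechet_derivative \<phi>' (at u') h = frechet_derivative (f \<circ> \<phi>') (at u') h)"
  have L: "linear L" "inj L" using local_paramD[OF p(1)] p(2) by (auto simp: L_def)
  have cf: "C_inf_on U (f \<circ> \<phi>)" using f p unfolding smooth_function_def by blast
  have l: "linear l" unfolding l_def using C_inf_on_linear[OF cf p(2)] .
  obtain \<Lambda> where \<Lambda>: "linear \<Lambda>" "\<Lambda> \<circ> L = id" using linear_injective_left_inverse[OF L] by blast
  have \<Lambda>L: "\<Lambda> (L x) = x" for x using \<Lambda>(2) by (metis comp_apply id_apply)
  define v0 where "v0 = (\<Sum>b\<in>Basis. l (\<Lambda> b) *\<^sub>R b)"
  have v0: "v0 \<bullet> y = l (\<Lambda> y)" for y
  proof -
    have "l (\<Lambda> y) = l (\<Lambda> (\<Sum>b\<in>Basis. (y \<bullet> b) *\<^sub>R b))" by (simp add: euclidean_representation)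
    also have "\<dots> = (\<Sum>b\<in>Basis. (y \<bullet> b) * l (\<Lambda> b))"
      by (simp add: linear_sum[OF \<Lambda>(1)] linear_sum[OF l] linear_cmul[OF \<Lambda>(1)] linear_cmul[OF l])
    finally show ?thesis unfolding v0_def inner_sum_left inner_scaleR_left
      by (simp add: inner_commute[of y] mult.commute)
  qed
  have sub: "subspace (range L)" using linear_subspace_image[OF L(1) subspace_UNIV] .
  obtain v z where vz: "v \<in> span (range L)" "\<And>w. w \<in> span (range L) \<Longrightarrow> orthogonal z w" "v0 = v + z"
    using orthogonal_subspace_decomp_exists[of "range L" v0] by metis
  have sp: "span (range L) = range L" using sub by (rule span_eq_iff[THEN iffD2])
  have v: "v \<in> range L" using vz(1) sp by simp
  have vL: "v \<bullet> L h = l h" for h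
  proof -
    have "z \<bullet> L h = 0" using vz(2)[of "L h"] sp by (simp add: orthogonal_def)
    then have "v \<bullet> L h = v0 \<bullet> L h" by (simp add: vz(3) inner_add_left)
    then show ?thesis by (simp add: v0 \<Lambda>L)
  qed
  have Pv: "?P v"
  proof (intro conjI allI impI)
    show "v \<in> tangent_space TYPE('d) M (\<phi> u)" unfolding tangent_space_chart[OF p] using v by (simp add: L_def)
    fix U' :: "(real ^ 'd) set" and \<phi>' u' h assume q: "local_param M U' \<phi>' \<and> u' \<in> U' \<and> \<phi>' u' = \<phi> u"
    then obtain A where A: "dmap \<phi>' u' h = dmap \<phi> u (A h)" "dmap (f \<circ> \<phi>') u' h = dmap (f \<circ> \<phi>) u (A h)"
      using transition_chain[OF p(1) _ p(2), of U' \<phi>' u'] C_inf_on_differentiable[OF cf p(2)] by metis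
    show "v \<bullet> frechet_derivative \<phi>' (at u') h = frechet_derivative (f \<circ> \<phi>') (at u') h"
      using vL[of "A h"] A by (simp add: L_def l_def)
  qed
  have uniq: "v' = v" if "?P v'" for v'
  proof -
    have "v' \<in> range L" using that unfolding tangent_space_chart[OF p] by (simp add: L_def)
    moreover have "v' \<bullet> L h = l h" for h using that p by (auto simp: L_def l_def)
    ultimately have "v' - v \<in> range L" "\<And>h. (v' - v) \<bullet> L h = 0"
      using v sub by (auto simp: subspace_diff inner_diff_left vL)
    then have "(v' - v) \<bullet> (v' - v) = 0" by (metis rangeE)
    then show ?thesis by simp
  qed
  have "manifold_grad TYPE('d) M f (\<phi> u) = v"
    unfolding manifold_grad_def using Pv uniq by (rule the_equality)
  then show "manifold_grad TYPE('d) M f (\<phi> u) \<in> range (dmap \<phi> u)"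
    and "manifold_grad TYPE('d) M f (\<phi> u) \<bullet> dmap \<phi> u h = dmap (f \<circ> \<phi>) u h"
    using v vL by (auto simp: L_def l_def)
qed

section \<open>The volume measure in coordinates\<close>

abbreviation volume_element :: "(real ^ 'd::finite \<Rightarrow> real ^ 'D::finite) \<Rightarrow> real ^ 'd \<Rightarrow> real" where
  "volume_element \<phi> u \<equiv> sqrt (det (metric_tensor \<phi> u))"

text \<open>The metric tensor is the Gram matrix of an injective linear map, whose determinant was
  seen to be positive in \<open>kernel_moment_linear\<close>; the zero kernel and w = 0 are
  placeholders that satisfy its premises.\<close>

lemma det_metric_tensor_pos:
  assumes "local_param M U \<phi>" "u \<in> U"
  shows "det (metric_tensor \<phi> u) > 0"
  unfolding metric_tensor_def
  by (rule kernel_moment_linear(1)[where n = 1 and \<kappa> = "\<lambda>_. 0" and w = 0])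
     (use local_paramD[OF assms(1)] assms(2) in \<open>auto simp: linear_0 intro!: image_eqI[of _ _ 0]\<close>)

lemma continuous_on_dmap:
  assumes "C_inf_on U f"
  shows "continuous_on U (\<lambda>u. dmap f u v)"
  using C_inf_on_D[OF assms, of 1] by simp

lemma continuous_on_det_metric_tensor:
  assumes "local_param M U \<phi>"
  shows "continuous_on U (\<lambda>u. det (metric_tensor \<phi> u))"
  unfolding det_def metric_tensor_def
  by (simp, intro continuous_intros continuous_on_dmap local_paramD(2)[OF assms])

lemma continuous_on_volume_element:
  assumes "local_param M U \<phi>"
  shows "continuous_on U (volume_element \<phi>)"
  by (intro continuous_intros continuous_on_det_metric_tensor[OF assms])

lemma volume_sets:
  assumes "compact M" "riemannian_volume TYPE('d::finite) M V"
  shows "A \<in> sets V \<longleftrightarrow> A \<in> sets borel \<and> A \<subseteq> M" "space V = M" "M \<in> sets borel"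
proof -
  show M: "M \<in> sets borel" using assms(1) by (simp add: borel_compact)
  show "space V = M" using assms by (simp add: riemannian_volume_def)
  have "sets V = sets (restrict_space borel M)" using assms by (simp add: riemannian_volume_def)
  then show "A \<in> sets V \<longleftrightarrow> A \<in> sets borel \<and> A \<subseteq> M"
    using M by (auto simp: sets_restrict_space_iff)
qed

text \<open>The image is the preimage of S under the continuous inverse chart, whose domain is
  relatively open in the compact M and thus Borel.\<close>

lemma chart_image_borel:
  assumes "compact M" "local_param M U \<phi>" "S \<subseteq> U" "S \<in> sets borel"
  shows "\<phi> ` S \<in> sets borel"
proof -
  note l = local_paramD[OF assms(2)]
  obtain \<psi> where \<psi>: "homeomorphism U (\<phi> ` U) \<phi> \<psi>" using assms(2) by (auto simp: local_param_def)
  obtain T where T: "open T" "\<phi> ` U = M \<inter> T" using l(4) by (auto simp: openin_open)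
  have b: "\<phi> ` U \<in> sets borel" unfolding T(2) using T(1) borel_compact[OF assms(1)] by (intro sets.Int) auto
  have "\<psi> \<in> borel_measurable (restrict_space borel (\<phi> ` U))"
    using \<psi> by (intro borel_measurable_continuous_on_restrict) (auto simp: homeomorphism_def)
  then have "\<psi> -` S \<inter> space (restrict_space borel (\<phi> ` U)) \<in> sets (restrict_space borel (\<phi> ` U))"
    using assms(4) by (rule measurable_sets)
  moreover have "\<psi> -` S \<inter> space (restrict_space borel (\<phi> ` U)) = \<phi> ` S"
    using \<psi> assms(3) by (auto simp: homeomorphism_def space_restrict_space)
  ultimately show ?thesis using b by (simp add: sets_restrict_space_iff)
qed

text \<open>\<open>riemannian_volume\<close> prescribes only the measure of Borel sets inside a
  chart image. Restated as an equality of measures it transports integrals of arbitrary measurable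
  functions. The filler value \<open>x0\<close> makes the chart a total map into M; the density
  vanishes wherever it is used.\<close>

lemma chart_distr:
  fixes \<phi> :: "real ^ 'd::finite \<Rightarrow> real ^ 'D::finite"
  assumes M: "compact M" and V: "riemannian_volume TYPE('d) M V" and p: "local_param M U \<phi>" and x0: "x0 \<in> M"
  defines "\<phi>' \<equiv> (\<lambda>u. if u \<in> U then \<phi> u else x0)" 
  shows "\<phi>' \<in> borel \<rightarrow>\<^sub>M V"
    and "density V (indicator (\<phi> ` U)) = distr (density lborel (\<lambda>u. ennreal (indicator U u * volume_element \<phi> u))) V \<phi>'"
    and "(\<lambda>u. indicator U u * volume_element \<phi> u) \<in> borel_measurable borel"
proof -
  note l = local_paramD[OF p] and vs = volume_sets[OF M V]
  have Ub: "U \<in> sets borel" using l(1) by simp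
  have 1: "\<phi>' \<in> borel_measurable borel" unfolding \<phi>'_def
    using l(7) Ub by (intro measurable_If_restrict_space_iff[THEN iffD2]) (auto intro: borel_measurable_continuous_on_restrict)
  show m: "\<phi>' \<in> borel \<rightarrow>\<^sub>M V"
  proof (rule measurableI)
    fix u show "\<phi>' u \<in> space V" using l(6) x0 vs(2) by (auto simp: \<phi>'_def)
  next
    fix A assume "A \<in> sets V"
    then show "\<phi>' -` A \<inter> space borel \<in> sets borel" using measurable_sets[OF 1, of A] vs(1) by auto
  qed
  have "(\<lambda>u. indicator U u *\<^sub>R volume_element \<phi> u) \<in> borel_measurable borel"
    using l(1) continuous_on_volume_element[OF p]
    by (subst borel_measurable_restrict_space_iff[symmetric]) (auto intro: borel_measurable_continuous_on_restrict)
  then show J[measurable]: "(\<lambda>u. indicator U u * volume_element \<phi> u) \<in> borel_measurable borel" by simp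
  have IU: "\<phi> ` U \<in> sets V" using chart_image_borel[OF M p _ Ub] l(6) vs(1) by auto
  show "density V (indicator (\<phi> ` U)) = distr (density lborel (\<lambda>u. ennreal (indicator U u * volume_element \<phi> u))) V \<phi>'"
  proof (rule measure_eqI)
    fix A assume "A \<in> sets (density V (indicator (\<phi> ` U)))"
    then have A: "A \<in> sets V" by simp
    have "emeasure (density V (indicator (\<phi> ` U))) A = emeasure V (\<phi> ` U \<inter> A)"
      using IU A by (rule emeasure_restricted)
    also have "\<dots> = (\<integral>\<^sup>+ u. ennreal (volume_element \<phi> u) * indicator {u \<in> U. \<phi> u \<in> \<phi> ` U \<inter> A} u \<partial>lborel)"
    proof -
      have "\<phi> ` U \<inter> A \<in> sets borel \<and> \<phi> ` U \<inter> A \<subseteq> \<phi> ` U" using IU A vs(1) by auto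
      then show ?thesis using V p unfolding riemannian_volume_def by blast
    qed
    also have "\<dots> = (\<integral>\<^sup>+ u. ennreal (indicator U u * volume_element \<phi> u) * indicator (\<phi>' -` A \<inter> UNIV) u \<partial>lborel)"
      by (intro nn_integral_cong) (auto simp: \<phi>'_def indicator_def)
    also have "\<dots> = emeasure (distr (density lborel (\<lambda>u. ennreal (indicator U u * volume_element \<phi> u))) V \<phi>') A"
      using A m measurable_sets[OF m A] by (subst emeasure_distr) (auto simp: emeasure_density)
    finally show "emeasure (density V (indicator (\<phi> ` U))) A = \<dots>" .
  qed simp
qed

lemma chart_nn_integral:
  fixes \<phi> :: "real ^ 'd::finite \<Rightarrow> real ^ 'D::finite"
  assumes M: "compact M" and V: "riemannian_volume TYPE('d) M V" and p: "local_param M U \<phi>" 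
    and S: "S \<subseteq> U" "S \<in> sets borel" and h: "h \<in> borel_measurable V"
  shows "(\<integral>\<^sup>+x. indicator (\<phi> ` S) x * h x \<partial>V) = (\<integral>\<^sup>+u. indicator S u * ennreal (volume_element \<phi> u) * h (\<phi> u) \<partial>lborel)"
\<comment> \<open>Extending the chart outside U takes a point of M.\<close>
proof (cases "M = {}")
  case True
  then have "S = {}" using local_paramD(6)[OF p] S by auto
  then show ?thesis by simp
next
  case False
  then obtain x0 where x0: "x0 \<in> M" by blast
  define \<phi>' where "\<phi>' = (\<lambda>u. if u \<in> U then \<phi> u else x0)"
  note cd = chart_distr[OF M V p x0, folded \<phi>'_def]
  note l = local_paramD[OF p] and vs = volume_sets[OF M V]
  have IU[measurable]: "\<phi> ` U \<in> sets V" "\<phi> ` S \<in> sets V" 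
    using chart_image_borel[OF M p] l(1,6) vs(1) S by (auto simp: image_subset_iff subset_iff)
  note [measurable] = h cd(1,3) 
  have "(\<integral>\<^sup>+x. indicator (\<phi> ` S) x * h x \<partial>V) = (\<integral>\<^sup>+x. indicator (\<phi> ` U) x * (indicator (\<phi> ` S) x * h x) \<partial>V)"
    using S by (intro nn_integral_cong) (auto simp: indicator_def)
  also have "\<dots> = (\<integral>\<^sup>+x. indicator (\<phi> ` S) x * h x \<partial>density V (indicator (\<phi> ` U)))"
    by (subst nn_integral_density) auto
  also have "\<dots> = (\<integral>\<^sup>+u. ennreal (indicator U u * volume_element \<phi> u) * (indicator (\<phi> ` S) (\<phi>' u) * h (\<phi>' u)) \<partial>lborel)"
    unfolding cd(2) by (subst nn_integral_distr) (auto simp: nn_integral_density)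
  also have "\<dots> = (\<integral>\<^sup>+u. indicator S u * ennreal (volume_element \<phi> u) * h (\<phi> u) \<partial>lborel)"
    using S l(5) by (intro nn_integral_cong) (auto simp: \<phi>'_def indicator_def inj_on_def subset_iff)
  finally show ?thesis .
qed

lemma chart_integral:
  fixes \<phi> :: "real ^ 'd::finite \<Rightarrow> real ^ 'D::finite" and h :: "real ^ 'D \<Rightarrow> real"
  assumes M: "compact M" and V: "riemannian_volume TYPE('d) M V" and p: "local_param M U \<phi>" 
    and S: "S \<subseteq> U" "S \<in> sets borel" and h: "h \<in> borel_measurable V"
  shows "(\<integral>x. indicator (\<phi> ` S) x * h x \<partial>V) = (\<integral>u. indicator S u * (volume_element \<phi> u * h (\<phi> u)) \<partial>lborel)"
    and "(\<lambda>u. indicator S u * (volume_element \<phi> u * h (\<phi> u))) \<in> borel_measurable borel"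
proof -
  have "(\<integral>x. indicator (\<phi> ` S) x * h x \<partial>V) = (\<integral>u. indicator S u * (volume_element \<phi> u * h (\<phi> u)) \<partial>lborel) \<and>
    (\<lambda>u. indicator S u * (volume_element \<phi> u * h (\<phi> u))) \<in> borel_measurable borel"
  proof (cases "M = {}")
    case True
    then have "S = {}" using local_paramD(6)[OF p] S by auto
    then show ?thesis by simp
  next
    case False
    then obtain x0 where x0: "x0 \<in> M" by blast
    define \<phi>' where "\<phi>' = (\<lambda>u. if u \<in> U then \<phi> u else x0)"
    note cd = chart_distr[OF M V p x0, folded \<phi>'_def]
    note l = local_paramD[OF p] and vs = volume_sets[OF M V]
    have IU[measurable]: "\<phi> ` U \<in> sets V" "\<phi> ` S \<in> sets V" 
      using chart_image_borel[OF M p] l(1,6) vs(1) S by (auto simp: image_subset_iff subset_iff)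
    note [measurable] = h cd(1,3) S(2)
    have J: "indicator U u * volume_element \<phi> u \<ge> 0" for u
      using det_metric_tensor_pos[OF p, of u] by (auto simp: indicator_def)
    have eq: "indicator U u * volume_element \<phi> u * (indicator (\<phi> ` S) (\<phi>' u) * h (\<phi>' u)) = indicator S u * (volume_element \<phi> u * h (\<phi> u))" for u
      using S l(5) by (auto simp: \<phi>'_def indicator_def inj_on_def subset_iff)
    have "(\<lambda>u. indicator U u * volume_element \<phi> u * (indicator (\<phi> ` S) (\<phi>' u) * h (\<phi>' u))) \<in> borel_measurable borel"
      by measurable
    moreover have "(\<integral>x. indicator (\<phi> ` S) x * h x \<partial>V) = (\<integral>x. indicator (\<phi> ` U) x *\<^sub>R (indicator (\<phi> ` S) x * h x) \<partial>V)"
      using S by (intro Bochner_Integration.integral_cong) (auto simp: indicator_def)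
    moreover have "\<dots> = (\<integral>x. indicator (\<phi> ` S) x * h x \<partial>density V (\<lambda>x. ennreal (indicator (\<phi> ` U) x)))"
      by (subst integral_density) auto
    moreover have "(\<lambda>x. ennreal (indicator (\<phi> ` U) x)) = indicator (\<phi> ` U)"
      by (auto simp: indicator_def fun_eq_iff)
    moreover have "(\<integral>x. indicator (\<phi> ` S) x * h x \<partial>density V (indicator (\<phi> ` U))) = (\<integral>u. indicator U u * volume_element \<phi> u * (indicator (\<phi> ` S) (\<phi>' u) * h (\<phi>' u)) \<partial>lborel)"
      unfolding cd(2) using J by (subst integral_distr) (auto simp: integral_density)
    ultimately show ?thesis by (simp add: eq)
  qed
  then show "(\<integral>x. indicator (\<phi> ` S) x * h x \<partial>V) = (\<integral>u. indicator S u * (volume_element \<phi> u * h (\<phi> u)) \<partial>lborel)"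
    and "(\<lambda>u. indicator S u * (volume_element \<phi> u * h (\<phi> u))) \<in> borel_measurable borel" by auto
qed

text \<open>On a chart image f is the composition of f o \<phi> with the continuous inverse chart,
  and chart images are relatively open, so continuity there is continuity in M.\<close>

lemma smooth_function_continuous_on:
  assumes M: "compact_smooth_manifold TYPE('d::finite) M" and f: "smooth_function TYPE('d) M f"
  shows "continuous_on M f"
  unfolding continuous_on_eq_continuous_within
proof
  fix x assume "x \<in> M"
  then obtain U and \<phi> :: "real^'d \<Rightarrow> real^'a" where p: "local_param M U \<phi>" and x: "x \<in> \<phi> ` U"
    using M unfolding compact_smooth_manifold_def by blast
  note l = local_paramD[OF p]
  obtain \<psi> where \<psi>: "homeomorphism U (\<phi> ` U) \<phi> \<psi>" using p by (auto simp: local_param_def)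
  have "C_inf_on U (f \<circ> \<phi>)" using f p unfolding smooth_function_def by blast
  then have "continuous_on U (f \<circ> \<phi>)" by (intro C_k_on_continuous[of 0] C_inf_on_D)
  then have "continuous_on (\<phi> ` U) ((f \<circ> \<phi>) \<circ> \<psi>)"
    by - (rule continuous_on_compose, use \<psi> in \<open>simp_all add: homeomorphism_def\<close>)
  then have "continuous_on (\<phi> ` U) f"
    by (rule continuous_on_eq[of _ "(f \<circ> \<phi>) \<circ> \<psi>"]) (use \<psi> in \<open>auto simp: homeomorphism_def\<close>)
  then have "continuous (at x within \<phi> ` U) f" using x unfolding continuous_on_eq_continuous_within by blast
  moreover obtain T where T: "open T" "\<phi> ` U = M \<inter> T" using l(4) by (auto simp: openin_open)
  then have "at x within \<phi> ` U = at x within M"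
    using x by (intro at_within_nhd[of x T]) auto
  ultimately show "continuous (at x within M) f" by simp
qed

lemma borel_measurable_volume:
  assumes "compact M" "riemannian_volume TYPE('d::finite) M V" "continuous_on M f"
  shows "f \<in> borel_measurable V"
proof -
  have "sets V = sets (restrict_space borel M)" using assms by (simp add: riemannian_volume_def)
  then show ?thesis
    using borel_measurable_continuous_on_restrict[OF assms(3)] measurable_cong_sets by blast
qed

text \<open>The two lower bounds concern secants and tangents of the embedding. They give Gaussian
  decay of the kernel for positive d and in the limit, respectively, with a common c.\<close>

definition good_chart :: "(real ^ 'D::finite) set \<Rightarrow> (real ^ 'd::finite) set \<Rightarrow> (real ^ 'd \<Rightarrow> real ^ 'D) \<Rightarrow> real ^ 'd \<Rightarrow> real \<Rightarrow> real \<Rightarrow> bool" where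
  "good_chart M U \<phi> u0 R c \<longleftrightarrow> local_param M U \<phi> \<and> 0 < R \<and> cball u0 R \<subseteq> U \<and> 0 < c \<and>
     (\<forall>u\<in>cball u0 R. \<forall>w\<in>cball u0 R. c * norm (u - w) \<le> norm (\<phi> u - \<phi> w)) \<and>
     (\<forall>u\<in>cball u0 R. \<forall>z. c * norm z \<le> norm (dmap \<phi> u z))"

text \<open>An injective derivative at u0 has a lower bound c. On a small ball the derivative
  differs from it by at most c / 2, so half of the bound survives, for tangents directly and for
  secants by the mean value inequality on the convex ball.\<close>

lemma good_chart_exists:
  fixes \<phi> :: "real ^ 'd::finite \<Rightarrow> real ^ 'D::finite"
  assumes p: "local_param M U \<phi>" and u0: "u0 \<in> U"
  shows "\<exists>R c. good_chart M U \<phi> u0 R c"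
proof -
  note l = local_paramD[OF p]
  define L where "L = dmap \<phi> u0"
  have L: "linear L" "inj L" using l(3,8) u0 by (auto simp: L_def)
  obtain c where c: "c > 0" "\<And>x. c * norm x \<le> norm (L x)" using linear_inj_bounded_below_pos[OF L] by blast
  \<comment> \<open>A sum over basis vectors dominates the operator norm of the difference and is
    visibly continuous, since smoothness is stated direction by direction.\<close>
  define G where "G u = (\<Sum>b\<in>Basis. norm (dmap \<phi> u b - L b))" for u
  have "continuous_on U G" unfolding G_def
    by (intro continuous_intros continuous_on_dmap l(2))
  then have "isCont G u0" using l(1) u0 continuous_on_eq_continuous_at by blast
  moreover have "G u0 = 0" by (simp add: G_def L_def)
  ultimately obtain r1 where r1: "r1 > 0" "\<And>u. dist u u0 < r1 \<Longrightarrow> \<bar>G u\<bar> < c / 2"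
    unfolding continuous_at_eps_delta using c(1) by (force simp: dist_real_def dest: spec[of _ "c/2"])
  obtain r2 where r2: "r2 > 0" "ball u0 r2 \<subseteq> U" using l(1) u0 openE by blast
  define R where "R = min r1 r2 / 2"
  have R: "R > 0" "R < r1" "R < r2" using r1(1) r2(1) by (auto simp: R_def)
  have R: "R > 0" "cball u0 R \<subseteq> U" "\<And>u. u \<in> cball u0 R \<Longrightarrow> G u \<le> c / 2"
  proof -
    show "R > 0" by fact
    show "cball u0 R \<subseteq> U" using R r2(2) by (auto simp: subset_iff)
    show "G u \<le> c / 2" if "u \<in> cball u0 R" for u
      using r1(2)[of u] that R by (simp add: dist_commute)
  qed
  have dL: "norm (dmap \<phi> u z - L z) \<le> c / 2 * norm z" if u: "u \<in> cball u0 R" for u z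
  proof -
    have lin: "linear (\<lambda>z. dmap \<phi> u z - L z)" using l(8) u R(2) L(1) by (intro linear_compose_sub) auto
    have "norm (dmap \<phi> u z - L z) = norm (\<Sum>b\<in>Basis. (z \<bullet> b) *\<^sub>R (dmap \<phi> u b - L b))"
      using linear_sum[OF lin, of "\<lambda>b. (z \<bullet> b) *\<^sub>R b" Basis] linear_cmul[OF lin] by (simp add: euclidean_representation)
    also have "\<dots> \<le> (\<Sum>b\<in>Basis. norm z * norm (dmap \<phi> u b - L b))"
      by (intro order_trans[OF norm_sum] sum_mono) (auto intro!: mult_right_mono Basis_le_norm)
    also have "\<dots> = norm z * G u" by (simp add: G_def sum_distrib_left)
    also have "\<dots> \<le> norm z * (c / 2)" using R(3)[OF u] by (intro mult_left_mono) auto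
    finally show ?thesis by (simp add: mult.commute)
  qed
  have 1: "c / 2 * norm z \<le> norm (dmap \<phi> u z)" if u: "u \<in> cball u0 R" for u z
  proof -
    have "c * norm z \<le> norm (L z)" by (rule c(2))
    also have "\<dots> \<le> norm (dmap \<phi> u z) + norm (dmap \<phi> u z - L z)"
      by (metis norm_minus_commute norm_triangle_sub)
    finally show ?thesis using dL[OF u, of z] by (simp add: field_simps)
  qed
  have 2: "c / 2 * norm (u - w) \<le> norm (\<phi> u - \<phi> w)" if u: "u \<in> cball u0 R" and w: "w \<in> cball u0 R" for u w
  proof -
    have seg: "w + t *\<^sub>R (u - w) \<in> cball u0 R" if "t \<in> {0..1}" for t
    proof -
      have "(1 - t) *\<^sub>R w + t *\<^sub>R u \<in> cball u0 R"
        using convex_cball[of u0 R] u w that by (intro convexD) auto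
      then show ?thesis by (simp add: algebra_simps)
    qed
    have "norm (\<phi> u - \<phi> w - dmap \<phi> u0 (u - w)) \<le> norm (u - w) * (c / 2)"
    proof (rule differentiable_bound_linearization[OF seg])
      fix x assume x: "x \<in> cball u0 R"
      show "(\<phi> has_derivative dmap \<phi> x) (at x within cball u0 R)"
        using C_inf_on_has_derivative[OF l(2)] x R(2) by (blast intro: has_derivative_at_withinI)
      show "onorm (dmap \<phi> x - dmap \<phi> u0) \<le> c / 2"
        using dL[OF x] by (intro onorm_le) (simp add: L_def)
    qed (use R in auto)
    moreover have "c * norm (u - w) \<le> norm (L (u - w))" by (rule c(2))
    moreover have "norm (L (u - w)) \<le> norm (\<phi> u - \<phi> w) + norm (\<phi> u - \<phi> w - L (u - w))"
      by (metis norm_minus_commute norm_triangle_sub)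
    ultimately show ?thesis by (simp add: L_def field_simps)
  qed
  show ?thesis unfolding good_chart_def using p R c(1) 1 2 by (intro exI[of _ R] exI[of _ "c / 2"]) auto
qed

text \<open>Balls of half radius already cover, because the expansions hold for base points in the
  half ball and need the full ball as room. Numbering the charts allows their constants to be added
  up later.\<close>

lemma good_chart_cover:
  fixes M :: "(real ^ 'D::finite) set"
  assumes M: "compact_smooth_manifold TYPE('d::finite) M"
  shows "\<exists>(n::nat) U (\<phi> :: nat \<Rightarrow> real ^ 'd \<Rightarrow> real ^ 'D) u0 R c. (\<forall>i<n. good_chart M (U i) (\<phi> i) (u0 i) (R i) (c i)) \<and> 
     M = (\<Union>i<n. \<phi> i ` ball (u0 i) (R i / 2))"
proof -
  have "\<forall>x\<in>M. \<exists>U (\<phi> :: real ^ 'd \<Rightarrow> real ^ 'D) u0 R c. good_chart M U \<phi> u0 R c \<and> \<phi> u0 = x"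
  proof
    fix x assume "x \<in> M"
    then obtain U and \<phi> :: "real^'d \<Rightarrow> real^'D" where "local_param M U \<phi>" "x \<in> \<phi> ` U"
      using M unfolding compact_smooth_manifold_def by blast
    then show "\<exists>U (\<phi> :: real ^ 'd \<Rightarrow> real ^ 'D) u0 R c. good_chart M U \<phi> u0 R c \<and> \<phi> u0 = x"
      using good_chart_exists by blast
  qed
  then obtain U and \<phi> :: "real ^ 'D \<Rightarrow> real ^ 'd \<Rightarrow> real ^ 'D" and u0 R c where g: "\<And>x. x \<in> M \<Longrightarrow> good_chart M (U x) (\<phi> x) (u0 x) (R x) (c x)" "\<And>x. x \<in> M \<Longrightarrow> \<phi> x (u0 x) = x"
    by metis
  define N where "N x = \<phi> x ` ball (u0 x) (R x / 2)" for x
  have oi: "openin (top_of_set M) (N x)" if "x \<in> M" for x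
  proof -
    have gx: "local_param M (U x) (\<phi> x)" "cball (u0 x) (R x) \<subseteq> U x" "R x > 0" using g(1)[OF that] by (auto simp: good_chart_def)
    obtain \<psi> where \<psi>: "homeomorphism (U x) (\<phi> x ` U x) (\<phi> x) \<psi>" using gx(1) by (auto simp: local_param_def)
    have "ball (u0 x) (R x / 2) \<subseteq> U x" using gx(2,3) by (auto simp: subset_iff)
    then have "openin (top_of_set (U x)) (ball (u0 x) (R x / 2))" by (simp add: openin_open_eq local_paramD(1)[OF gx(1)])
    then have "openin (top_of_set (\<phi> x ` U x)) (N x)" unfolding N_def using homeomorphism_imp_open_map[OF \<psi>] by blast
    then show ?thesis using local_paramD(4)[OF gx(1)] openin_trans by blast
  qed
  have mem: "x \<in> N x" if "x \<in> M" for x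
    using g[OF that] that unfolding N_def good_chart_def by (intro image_eqI[of _ _ "u0 x"]) auto
  have "compact M" using M by (simp add: compact_smooth_manifold_def)
  have "\<forall>x\<in>M. \<exists>T. open T \<and> N x = M \<inter> T" using oi by (simp add: openin_open)
  then obtain T where T: "\<And>x. x \<in> M \<Longrightarrow> open (T x) \<and> N x = M \<inter> T x" by metis
  have "M \<subseteq> (\<Union>x\<in>M. T x)" using mem T by blast
  then obtain F where F: "F \<subseteq> M" "finite F" "M \<subseteq> (\<Union>x\<in>F. T x)"
    using compactE_image[OF \<open>compact M\<close>, of M T] T by metis
  have MF: "M = (\<Union>x\<in>F. N x)" 
  proof (intro equalityI subsetI)
    fix x assume x: "x \<in> M"
    then obtain y where "y \<in> F" "x \<in> T y" using F(3) by blast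
    then show "x \<in> (\<Union>x\<in>F. N x)" using x T[of y] F(1) by blast
  next
    fix x assume "x \<in> (\<Union>x\<in>F. N x)"
    then show "x \<in> M" using F(1) T by blast
  qed
  obtain e where e: "bij_betw e {..<card F} F" using ex_bij_betw_nat_finite[OF F(2)] by (auto simp: atLeast0LessThan)
  then have "F = e ` {..<card F}" by (simp add: bij_betw_def)
  then have MF': "M = (\<Union>i<card F. N (e i))" unfolding MF by (metis image_image)
  have "good_chart M (U (e i)) (\<phi> (e i)) (u0 (e i)) (R (e i)) (c (e i))" if "i < card F" for i
    using that \<open>F = e ` {..<card F}\<close> F(1) by (intro g(1)) blast
  then show ?thesis using MF' unfolding N_def
    by (intro exI[of _ "card F"] exI[of _ "\<lambda>i. U (e i)"] exI[of _ "\<lambda>i. \<phi> (e i)"] exI[of _ "\<lambda>i. u0 (e i)"] exI[of _ "\<lambda>i. R (e i)"] exI[of _ "\<lambda>i. c (e i)"]) auto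
qed

section \<open>The mean of the graph Dirichlet form\<close>

text \<open>For factors frozen at the base point: they do not depend on d, but they still need a
  bound uniform in u.\<close>

lemma expand_base:
  assumes "expand K \<rho> c X X0"
  shows "expand K \<rho> c (\<lambda>d. X0) X0"
proof -
  obtain X1 C m where X: "C \<ge> 0"
    "\<And>u z d. u \<in> K \<Longrightarrow> d \<noteq> 0 \<Longrightarrow> \<bar>d\<bar> \<le> 1 \<Longrightarrow> \<bar>d\<bar> * norm z < \<rho> \<Longrightarrow> \<bar>X0 u z\<bar> \<le> wt C m c z"
    by (rule expandE[OF assms]) blast
  show ?thesis
    by (rule expandI[where C = C and m = m and ?X1.0 = "\<lambda>u z. 0"]) (use X in auto)
qed

lemma good_chartD:
  assumes "good_chart M U \<phi> u0 R c"
  shows "local_param M U \<phi>" "0 < R" "cball u0 R \<subseteq> U" "0 < c"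
     "\<And>u w. u \<in> cball u0 R \<Longrightarrow> w \<in> cball u0 R \<Longrightarrow> c * norm (u - w) \<le> norm (\<phi> u - \<phi> w)"
     "\<And>u z. u \<in> cball u0 R \<Longrightarrow> c * norm z \<le> norm (dmap \<phi> u z)"
  using assms by (auto simp: good_chart_def)

lemma half_cball_shift:
  fixes u :: "'a::real_normed_vector"
  assumes "u \<in> cball u0 (R/2)" "\<bar>d\<bar> * norm z < R / 2"
  shows "u + d *\<^sub>R z \<in> ball u0 R" "u \<in> ball u0 R"
proof -
  have n: "norm (u - u0) \<le> R / 2" using assms by (simp add: dist_norm norm_minus_commute)
  moreover have "norm (u + d *\<^sub>R z - u0) \<le> norm (u - u0) + \<bar>d\<bar> * norm z"
    using norm_triangle_ineq[of "u - u0" "d *\<^sub>R z"] by (simp add: algebra_simps)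
  moreover have "0 \<le> \<bar>d\<bar> * norm z" by simp
  then have "0 < R" using assms(2) by linarith
  ultimately show "u + d *\<^sub>R z \<in> ball u0 R" "u \<in> ball u0 R" 
    using assms(2) by (auto simp: dist_norm norm_minus_commute)
qed

text \<open>The argument of the kernel, |\<phi>(u + d z) - \<phi>(u)|^2 / d^2, is a sum over ambient
  coordinates of squared difference quotients, so \<open>expand_quotient\<close> and the algebra of
  expansions cover it. Its limit is the squared length of the pushed-forward vector z.\<close>

lemma expand_integrand:
  fixes \<phi> :: "real ^ 'd::finite \<Rightarrow> real ^ 'D::finite"
  assumes gc: "good_chart M U \<phi> u0 R c" and F: "C_inf_on U F" and \<kappa>: "decaying_kernel \<kappa> a B"
    and Q: "expand (cball u0 (R/2)) (R/2) 0 (\<lambda>d u z. Q (u + d *\<^sub>R z)) (\<lambda>u z. Q u)"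
    and q: "expand (cball u0 (R/2)) (R/2) 0 (\<lambda>d u (z::real^'d). q u) (\<lambda>u z. q u)"
  shows "expand (cball u0 (R/2)) (R/2) (a * c\<^sup>2)
    (\<lambda>d u z. \<kappa> ((norm (\<phi> (u + d *\<^sub>R z) - \<phi> u))\<^sup>2 / d\<^sup>2) * ((F (u + d *\<^sub>R z) - F u) / d) ^ n * (q u * Q (u + d *\<^sub>R z)))
    (\<lambda>u z. \<kappa> ((norm (dmap \<phi> u z))\<^sup>2) * (dirder F z u) ^ n * (q u * Q u))"
proof -
  note g = good_chartD[OF gc]
  note l = local_paramD[OF g(1)]
  let ?K = "cball u0 (R/2)"
  let ?\<phi> = "\<lambda>b u. \<phi> u \<bullet> b"
  have KU: "?K \<subseteq> cball u0 R" using g(2) by auto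
  define X where "X d u z = (\<Sum>b\<in>Basis. ((?\<phi> b (u + d *\<^sub>R z) - ?\<phi> b u) / d)\<^sup>2)" for d u z
  define X0 where "X0 u z = (\<Sum>b\<in>Basis. (dirder (?\<phi> b) z u)\<^sup>2)" for u z
  have X: "X d u z = (norm (\<phi> (u + d *\<^sub>R z) - \<phi> u))\<^sup>2 / d\<^sup>2" for d u z
    unfolding X_def power2_norm_eq_inner euclidean_inner[of "\<phi> (u + d *\<^sub>R z) - \<phi> u" "\<phi> (u + d *\<^sub>R z) - \<phi> u"]
    by (simp add: power_divide sum_divide_distrib inner_diff_left power2_eq_square)
  have X0: "X0 u z = (norm (dmap \<phi> u z))\<^sup>2" if "u \<in> ?K" for u z
  proof -
    have "\<phi> differentiable (at u)" using C_inf_on_differentiable[OF l(2)] that KU g(3) by blast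
    then show ?thesis
      unfolding X0_def power2_norm_eq_inner euclidean_inner[of "dmap \<phi> u z" "dmap \<phi> u z"] dirder_def
      by (simp add: frechet_derivative_inner power2_eq_square)
  qed
  have eX: "expand ?K (R/2) 0 X X0"
    unfolding X_def[abs_def] X0_def[abs_def]
    by (intro expand_sum expand_power expand_quotient[of U] C_k_on_inner C_inf_on_D l g) auto
  have ek: "expand ?K (R/2) (a * c\<^sup>2) (\<lambda>d u z. \<kappa> (X d u z)) (\<lambda>u z. \<kappa> (X0 u z))"
  proof (rule expand_kernel[OF \<kappa> eX])
    show "c\<^sup>2 > 0" using g(4) by simp
    fix u and z :: "real^'d" and d :: real assume *: "u \<in> ?K" "d \<noteq> 0" "\<bar>d\<bar> \<le> 1" "\<bar>d\<bar> * norm z < R / 2"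
    have u: "u \<in> cball u0 R" using * KU by blast
    have "(c * norm z)\<^sup>2 \<le> X0 u z"
      unfolding X0[OF *(1)] using g(6)[OF u] g(4) by (intro power_mono) auto
    moreover have "c * norm (d *\<^sub>R z) \<le> norm (\<phi> (u + d *\<^sub>R z) - \<phi> u)"
      using g(5)[OF _ u, of "u + d *\<^sub>R z"] half_cball_shift(1)[OF *(1,4)] by auto
    then have "(c * norm (d *\<^sub>R z))\<^sup>2 \<le> (norm (\<phi> (u + d *\<^sub>R z) - \<phi> u))\<^sup>2" using g(4) by (intro power_mono) auto
    then have "(c * norm z)\<^sup>2 \<le> X d u z" unfolding X using *(2) by (simp add: field_simps power_mult_distrib)
    ultimately show "X d u z \<ge> c\<^sup>2 * (norm z)\<^sup>2 \<and> X0 u z \<ge> c\<^sup>2 * (norm z)\<^sup>2" by (simp add: power_mult_distrib)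
  next
    fix u d assume u: "u \<in> ?K"
    show "X d u 0 = 0" by (simp add: X_def)
    have "u \<in> U" using u KU g(3) by blast
    then show "X0 u 0 = 0" unfolding X0[OF u] using linear_0[OF l(8)] by simp
  qed
  have eF: "expand ?K (R/2) 0 (\<lambda>d u z. ((F (u + d *\<^sub>R z) - F u) / d) ^ n) (\<lambda>u z. (dirder F z u) ^ n)"
    by (intro expand_power expand_quotient[of U] C_inf_on_D l g F)
  have "expand ?K (R/2) (a * c\<^sup>2) (\<lambda>d u z. \<kappa> (X d u z) * ((F (u + d *\<^sub>R z) - F u) / d) ^ n * (q u * Q (u + d *\<^sub>R z)))
     (\<lambda>u z. \<kappa> (X0 u z) * dirder F z u ^ n * (q u * Q u))"
    using expand_mult[OF expand_mult[OF ek eF] expand_mult[OF q Q]] by simp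
  then show ?thesis by (rule expand_cong) (auto simp: X X0)
qed

text \<open>By the Leibniz formula the determinant is a polynomial in inner products of partial
  derivatives. Compactness confines it to an interval of positive numbers, on which the square root
  is smooth.\<close>

lemma expand_volume_element:
  fixes \<phi> :: "real ^ 'd::finite \<Rightarrow> real ^ 'D::finite"
  assumes gc: "good_chart M U \<phi> u0 R c"
  shows "expand (cball u0 (R/2)) (R/2) 0 (\<lambda>d u z. volume_element \<phi> (u + d *\<^sub>R z)) (\<lambda>u z. volume_element \<phi> u)"
proof -
  note g = good_chartD[OF gc]
  note l = local_paramD[OF g(1)]
  let ?K = "cball u0 (R/2)"
  let ?g = "\<lambda>b i u. dmap \<phi> u (axis i 1) \<bullet> b"
  have C2: "C_k_on 2 U (?g b i)" for b i
    using C_inf_on_D[OF l(2), of 3] by (intro C_k_on_inner l(1)) (simp add: numeral_3_eq_3 numeral_2_eq_2)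
  have mt: "metric_tensor \<phi> w $ i $ j = (\<Sum>b\<in>Basis. ?g b i w * ?g b j w)" for w i j
    unfolding metric_tensor_def by (simp add: euclidean_inner[of "dmap \<phi> w (axis i 1)" "dmap \<phi> w (axis j 1)"])
  have e1: "expand ?K (R/2) 0 (\<lambda>d u z. \<Sum>b\<in>Basis. ?g b i (u + d *\<^sub>R z) * ?g b j (u + d *\<^sub>R z)) (\<lambda>u z. \<Sum>b\<in>Basis. ?g b i u * ?g b j u)" for i j
  proof (rule expand_sum)
    fix b :: "real ^ 'D"
    show "expand ?K (R/2) 0 (\<lambda>d u z. ?g b i (u + d *\<^sub>R z) * ?g b j (u + d *\<^sub>R z)) (\<lambda>u z. ?g b i u * ?g b j u)"
      using expand_mult[OF expand_value[OF l(1) C2[where b=b and i=i] g(3)] expand_value[OF l(1) C2[where b=b and i=j] g(3)]] by simp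
  qed simp
  have e2: "expand ?K (R/2) 0 (\<lambda>d u z. of_int (sign p) * (\<Prod>i\<in>UNIV. metric_tensor \<phi> (u + d *\<^sub>R z) $ i $ p i)) (\<lambda>u z. of_int (sign p) * (\<Prod>i\<in>UNIV. metric_tensor \<phi> u $ i $ p i))" for p
    using expand_mult[OF expand_const[of ?K "R/2" "of_int (sign p)"] expand_prod[of "UNIV::'d set", OF _ e1]] unfolding mt by simp
  have e3: "expand ?K (R/2) 0 (\<lambda>d u z. det (metric_tensor \<phi> (u + d *\<^sub>R z))) (\<lambda>u z. det (metric_tensor \<phi> u))"
    unfolding det_def by (intro expand_sum e2) simp
  have cont: "continuous_on (cball u0 R) (\<lambda>u. det (metric_tensor \<phi> u))"
    using continuous_on_det_metric_tensor[OF g(1)] g(3) continuous_on_subset by blast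
  obtain x1 where x1: "x1 \<in> cball u0 R" "\<And>x. x \<in> cball u0 R \<Longrightarrow> det (metric_tensor \<phi> x1) \<le> det (metric_tensor \<phi> x)"
    using continuous_attains_inf[OF compact_cball _ cont] g(2) by (auto simp: not_less)
  obtain x2 where x2: "\<And>x. x \<in> cball u0 R \<Longrightarrow> det (metric_tensor \<phi> x) \<le> det (metric_tensor \<phi> x2)"
    using continuous_attains_sup[OF compact_cball _ cont] g(2) by (metis cball_eq_empty not_less less_imp_le)
  have pos: "det (metric_tensor \<phi> x1) > 0" using det_metric_tensor_pos[OF g(1)] x1(1) g(3) by blast
  have dpos: "det (metric_tensor \<phi> x) > 0" if "x \<in> ball u0 R" for x 
    using det_metric_tensor_pos[OF g(1), of x] that g(3) by (auto simp: subset_iff)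
  have "expand ?K (R/2) 0 (\<lambda>d u z. det (metric_tensor \<phi> (u + d *\<^sub>R z)) powr (1/2)) (\<lambda>u z. det (metric_tensor \<phi> u) powr (1/2))"
  proof (rule expand_powr[OF e3 pos])
    fix u and z :: "real^'d" and d :: real assume *: "u \<in> ?K" "d \<noteq> 0" "\<bar>d\<bar> \<le> 1" "\<bar>d\<bar> * norm z < R / 2"
    show "det (metric_tensor \<phi> (u + d *\<^sub>R z)) \<in> {det (metric_tensor \<phi> x1)..det (metric_tensor \<phi> x2)} \<and>
       det (metric_tensor \<phi> u) \<in> {det (metric_tensor \<phi> x1)..det (metric_tensor \<phi> x2)}"
      using half_cball_shift[OF *(1,4)] x1(2) x2 by auto
  qed
  then show ?thesis
  proof (rule expand_cong)
    fix u and z :: "real^'d" and d :: real assume *: "u \<in> ?K" "d \<noteq> 0" "\<bar>d\<bar> \<le> 1" "\<bar>d\<bar> * norm z < R / 2"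
    show "det (metric_tensor \<phi> (u + d *\<^sub>R z)) powr (1/2) = volume_element \<phi> (u + d *\<^sub>R z)"
      using dpos[OF half_cball_shift(1)[OF *(1,4)]] by (simp add: powr_half_sqrt)
  next
    fix u and z :: "real^'d" assume "u \<in> ?K"
    then have "u \<in> ball u0 R" using g(2) by auto
    then show "det (metric_tensor \<phi> u) powr (1/2) = volume_element \<phi> u" 
      using dpos by (simp add: powr_half_sqrt less_imp_le)
  qed
qed

lemma expand_density:
  fixes \<phi> :: "real ^ 'd::finite \<Rightarrow> real ^ 'D::finite"
  assumes gc: "good_chart M U \<phi> u0 R c" and p: "smooth_function TYPE('d) M p" 
    and b: "0 < lo" "\<And>x. x \<in> M \<Longrightarrow> lo \<le> p x \<and> p x \<le> hi"
  shows "expand (cball u0 (R/2)) (R/2) 0 (\<lambda>d u z. p (\<phi> (u + d *\<^sub>R z)) powr s) (\<lambda>u z. p (\<phi> u) powr s)"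
proof -
  note g = good_chartD[OF gc]
  note l = local_paramD[OF g(1)]
  have "C_inf_on U (p \<circ> \<phi>)" using p g(1) unfolding smooth_function_def by blast
  then have "expand (cball u0 (R/2)) (R/2) 0 (\<lambda>d u z. (p \<circ> \<phi>) (u + d *\<^sub>R z)) (\<lambda>u z. (p \<circ> \<phi>) u)"
    by (intro expand_value[of U] C_inf_on_D l g)
  from expand_powr[OF this b(1), of hi s] show ?thesis
  proof (simp, elim meta_mp, goal_cases)
    case (1 u z d)
    have "\<phi> x \<in> M" if "x \<in> ball u0 R" for x using that g(3) l(6) by (auto simp: subset_iff image_subset_iff)
    then show ?case using half_cball_shift[of u u0 R d z] 1 b(2) by auto
  qed
qed

lemma lipschitz_on_ball:
  fixes F :: "'a::euclidean_space \<Rightarrow> real"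
  assumes "open U" "C_k_on 1 U F" "cball u0 R \<subseteq> U"
  shows "\<exists>C\<ge>0. (\<forall>u\<in>cball u0 R. \<forall>z. \<bar>dirder F z u\<bar> \<le> C * norm z) \<and> 
    (\<forall>u\<in>cball u0 R. \<forall>w\<in>cball u0 R. \<bar>F w - F u\<bar> \<le> C * norm (w - u))"
proof -
  obtain C where C: "C \<ge> 0" "\<And>z x. x \<in> cball u0 R \<Longrightarrow> \<bar>dirders 1 F z x\<bar> \<le> C * norm z ^ 1"
    using dirders_bound[OF assms(1,2) compact_cball assms(3)] by metis
  have "\<bar>F w - F u\<bar> \<le> C * norm (w - u)" if "u \<in> cball u0 R" "w \<in> cball u0 R" for u w
  proof -
    have seg: "u + t *\<^sub>R (w - u) \<in> cball u0 R" if "0 \<le> t" "t \<le> 1" for t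
    proof -
      have "(1 - t) *\<^sub>R u + t *\<^sub>R w \<in> cball u0 R"
        using convex_cball[of u0 R] \<open>u \<in> _\<close> \<open>w \<in> _\<close> that by (intro convexD) auto
      then show ?thesis by (simp add: algebra_simps)
    qed
    have "\<exists>t. 0 < t \<and> t < 1 \<and> F (u + 1 *\<^sub>R (w - u)) - F (u + 0 *\<^sub>R (w - u)) = (1 - 0) * dirders (Suc 0) F (w - u) (u + t *\<^sub>R (w - u))"
      using DERIV_dirders_line[of 0 U F u _ "w - u"] assms(2,3) seg by (intro MVT2) (auto simp: subset_iff)
    then obtain t where t: "0 < t" "t < 1" "F w - F u = dirders 1 F (w - u) (u + t *\<^sub>R (w - u))" by auto
    then show ?thesis using C(2)[OF seg[of t]] by simp
  qed
  then show ?thesis using C by (intro exI[of _ C]) (auto simp: dirders_Suc)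
qed

text \<open>The cutoff to the ball is not smooth in d, so the expansion is used only for d |z| < R /
  2, where the cutoff equals 1. For larger z one has 1 \<le> (2 d |z| / R)^2, so the crude Gaussian
  bound gains the factor d^2 at the price of two polynomial degrees.\<close>

lemma chart_estimate:
  fixes \<phi> :: "real ^ 'd::finite \<Rightarrow> real ^ 'D::finite"
  assumes gc: "good_chart M U \<phi> u0 R c" and F: "C_inf_on U F" and \<kappa>: "decaying_kernel \<kappa> a B"
    and Q: "expand (cball u0 (R/2)) (R/2) 0 (\<lambda>d u z. Q (u + d *\<^sub>R z)) (\<lambda>u z. Q u)"
    and q: "expand (cball u0 (R/2)) (R/2) 0 (\<lambda>d u (z::real^'d). q u) (\<lambda>u z. q u)"
    and Qc: "continuous_on U Q" "continuous_on U q" and n: "even n"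
  defines "H \<equiv> (\<lambda>d u z. indicator (ball u0 R) (u + d *\<^sub>R z) * (\<kappa> ((norm (\<phi> (u + d *\<^sub>R z) - \<phi> u))\<^sup>2 / d\<^sup>2) * ((F (u + d *\<^sub>R z) - F u) / d) ^ n * (q u * Q (u + d *\<^sub>R z))))"
    and "H0 \<equiv> (\<lambda>u z. \<kappa> ((norm (dmap \<phi> u z))\<^sup>2) * (dirder F z u) ^ n * (q u * Q u))"
  shows "\<exists>C\<ge>0. \<forall>u\<in>cball u0 (R/2). \<forall>d. 0 < d \<and> d \<le> 1 \<longrightarrow> 
    \<bar>(\<integral>z. H d u z \<partial>lborel) - (\<integral>z. H0 u z \<partial>lborel)\<bar> \<le> C * d\<^sup>2"
proof -
  note g = good_chartD[OF gc]
  note l = local_paramD[OF g(1)]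
  let ?K = "cball u0 (R/2)"
  let ?c = "a * c\<^sup>2"
  have ab: "a > 0" "B \<ge> 0" "continuous_on {0..} \<kappa>" using \<kappa> by (auto simp: decaying_kernel_def)
  have cpos: "?c > 0" using ab g by simp
  have KU: "?K \<subseteq> cball u0 R" using g(2) by auto
  obtain Lp where Lp: "Lp \<ge> 0" "\<And>u z. u \<in> cball u0 R \<Longrightarrow> \<bar>dirder F z u\<bar> \<le> Lp * norm z"
    "\<And>u w. u \<in> cball u0 R \<Longrightarrow> w \<in> cball u0 R \<Longrightarrow> \<bar>F w - F u\<bar> \<le> Lp * norm (w - u)"
    using lipschitz_on_ball[OF l(1) C_inf_on_D[OF F] g(3)] by metis
  have bdd: "\<exists>C\<ge>0. \<forall>u\<in>cball u0 R. \<bar>G u\<bar> \<le> C" if "continuous_on U G" for G :: "real^'d \<Rightarrow> real"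
    using dirders_bound[of U 0 G "cball u0 R"] that l(1) g(3) by auto
  obtain Q1 where Q1: "Q1 \<ge> 0" "\<And>u. u \<in> cball u0 R \<Longrightarrow> \<bar>Q u\<bar> \<le> Q1" using bdd[OF Qc(1)] by blast
  obtain Q2 where Q2: "Q2 \<ge> 0" "\<And>u. u \<in> cball u0 R \<Longrightarrow> \<bar>q u\<bar> \<le> Q2" using bdd[OF Qc(2)] by blast
  define C1 where "C1 = B * Lp ^ n * (Q2 * Q1)"
  have C1: "C1 \<ge> 0" using ab Lp Q1 Q2 by (simp add: C1_def)
  have bound: "\<bar>\<kappa> \<xi> * y ^ n * (q u * Q w)\<bar> \<le> wt C1 n ?c z" 
    if "u \<in> cball u0 R" "w \<in> cball u0 R" "\<xi> \<ge> c\<^sup>2 * (norm z)\<^sup>2" "\<bar>y\<bar> \<le> Lp * norm z" for \<xi> y u w and z :: "real^'d"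
  proof -
    have "0 \<le> c\<^sup>2 * (norm z)\<^sup>2" by simp
    then have x0: "\<xi> \<ge> 0" using that(3) by linarith
    have "\<bar>\<kappa> \<xi>\<bar> \<le> B * exp (- a * \<xi>)" by (rule decaying_kernel_bound[OF \<kappa> x0])
    also have "\<dots> \<le> B * exp (- ?c * (norm z)\<^sup>2)"
      using mult_left_mono[OF that(3), of a] ab by (intro mult_left_mono) (auto simp: algebra_simps)
    finally have 1: "\<bar>\<kappa> \<xi>\<bar> \<le> B * exp (- ?c * (norm z)\<^sup>2)" .
    have "\<bar>y\<bar> ^ n \<le> (Lp * (1 + norm z)) ^ n"
      using that(4) Lp(1) by (intro power_mono) (auto simp: algebra_simps)
    then have 2: "\<bar>y ^ n\<bar> \<le> Lp ^ n * (1 + norm z) ^ n" by (simp add: power_abs power_mult_distrib)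
    have 3: "\<bar>q u * Q w\<bar> \<le> Q2 * Q1" unfolding abs_mult using Q1 Q2 that by (intro mult_mono) auto
    have "\<bar>\<kappa> \<xi> * y ^ n * (q u * Q w)\<bar> \<le> B * exp (- ?c * (norm z)\<^sup>2) * (Lp ^ n * (1 + norm z) ^ n) * (Q2 * Q1)"
      unfolding abs_mult[of "\<kappa> \<xi> * y ^ n"] abs_mult[of "\<kappa> \<xi>"] using 1 2 3 ab Lp(1) by (intro mult_mono) auto
    then show ?thesis by (simp add: wt_def C1_def mult_ac)
  qed
  have Hb: "\<bar>H d u z\<bar> \<le> wt C1 n ?c z" if "u \<in> ?K" "0 < d" for d u z
  proof (cases "u + d *\<^sub>R z \<in> ball u0 R")
    case True
    then have w: "u + d *\<^sub>R z \<in> cball u0 R" by auto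
    have u: "u \<in> cball u0 R" using that KU by blast
    have "c * norm (d *\<^sub>R z) \<le> norm (\<phi> (u + d *\<^sub>R z) - \<phi> u)" using g(5)[OF w u] by simp
    then have "(c * norm (d *\<^sub>R z))\<^sup>2 \<le> (norm (\<phi> (u + d *\<^sub>R z) - \<phi> u))\<^sup>2" using g(4) by (intro power_mono) auto
    then have 1: "c\<^sup>2 * (norm z)\<^sup>2 \<le> (norm (\<phi> (u + d *\<^sub>R z) - \<phi> u))\<^sup>2 / d\<^sup>2" using that by (simp add: field_simps power_mult_distrib)
    have 2: "\<bar>(F (u + d *\<^sub>R z) - F u) / d\<bar> \<le> Lp * norm z" using Lp(3)[OF u w] that by (simp add: field_simps)
    show ?thesis using bound[OF u w 1 2] True by (simp add: H_def)
  qed (use C1 in \<open>simp add: H_def\<close>)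
  have H0b: "\<bar>H0 u z\<bar> \<le> wt C1 n ?c z" if "u \<in> ?K" for u z
  proof -
    have u: "u \<in> cball u0 R" using that KU by blast
    have "(c * norm z)\<^sup>2 \<le> (norm (dmap \<phi> u z))\<^sup>2"
      using g(6)[OF u] g(4) by (intro power_mono) auto
    then show ?thesis using bound[OF u u _ Lp(2)[OF u], of z "(norm (dmap \<phi> u z))\<^sup>2"] by (simp add: H0_def power_mult_distrib)
  qed
  have Hm: "(\<lambda>z. H d u z) \<in> borel_measurable borel" if "u \<in> ?K" "0 < d" for d u
  proof -
    let ?k = "\<lambda>w. indicator (ball u0 R) w *\<^sub>R (\<kappa> ((norm (\<phi> w - \<phi> u))\<^sup>2 / d\<^sup>2) * ((F w - F u) / d) ^ n * (q u * Q w))"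
    have bU: "ball u0 R \<subseteq> U" using g(3) by auto
    have "continuous_on (ball u0 R) F" using C_k_on_continuous[OF C_inf_on_D[OF F]] bU continuous_on_subset by blast
    moreover have "continuous_on (ball u0 R) \<phi>" "continuous_on (ball u0 R) Q" using l(7) Qc(1) bU continuous_on_subset by blast+
    ultimately have "continuous_on (ball u0 R) (\<lambda>w. \<kappa> ((norm (\<phi> w - \<phi> u))\<^sup>2 / d\<^sup>2) * ((F w - F u) / d) ^ n * (q u * Q w))"
      using that by (intro continuous_intros continuous_radial[OF ab(3)]) auto
    then have [measurable]: "?k \<in> borel_measurable borel" by (intro borel_measurable_continuous_on_indicator) auto
    have "(\<lambda>z. ?k (u + d *\<^sub>R z)) \<in> borel_measurable borel" by measurable
    then show ?thesis by (simp add: H_def)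
  qed
  have H0m: "H0 u \<in> borel_measurable borel" if "u \<in> ?K" for u
  proof -
    have uU: "u \<in> U" using that KU g(3) by auto
    have "linear (dmap \<phi> u)" "linear (dmap F u)" using l(8) uU C_inf_on_linear[OF F] by auto
    then have "continuous_on UNIV (dmap \<phi> u)" "continuous_on UNIV (\<lambda>z. dirder F z u)"
      by (auto simp: dirder_def linear_continuous_on linear_conv_bounded_linear)
    then show ?thesis unfolding H0_def
      by (intro borel_measurable_continuous_onI continuous_intros continuous_radial[OF ab(3)]) auto
  qed
  have wint: "integrable lborel (wt C m ?c :: real^'d \<Rightarrow> real)" for C m by (rule integrable_wt[OF cpos])
  have Hi: "integrable lborel (H d u)" if "u \<in> ?K" "0 < d" for d u
    by (rule Bochner_Integration.integrable_bound[OF wint[of C1 n]])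
       (use Hm[OF that] Hb[OF that] C1 in auto)
  have H0i: "integrable lborel (H0 u)" if "u \<in> ?K" for u
    by (rule Bochner_Integration.integrable_bound[OF wint[of C1 n]])
       (use H0m[OF that] H0b[OF that] C1 in auto)
  obtain C2 m where C2: "C2 \<ge> 0" and sym: "\<And>u z d. u \<in> ?K \<Longrightarrow> 0 < d \<Longrightarrow> d \<le> 1 \<Longrightarrow> d * norm z < R/2 \<Longrightarrow>
     \<bar>H d u z + H d u (- z) - 2 * H0 u z\<bar> \<le> d\<^sup>2 * wt C2 m ?c z"
  proof -
    let ?X = "\<lambda>d u z. \<kappa> ((norm (\<phi> (u + d *\<^sub>R z) - \<phi> u))\<^sup>2 / d\<^sup>2) * ((F (u + d *\<^sub>R z) - F u) / d) ^ n * (q u * Q (u + d *\<^sub>R z))"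
    obtain C2 m where C2: "C2 \<ge> 0" "\<And>u z d. u \<in> ?K \<Longrightarrow> 0 < d \<Longrightarrow> d \<le> 1 \<Longrightarrow> d * norm z < R/2 \<Longrightarrow>
      \<bar>?X d u z + ?X (- d) u z - 2 * H0 u z\<bar> \<le> d\<^sup>2 * wt C2 m ?c z"
      using expand_symmetric[OF expand_integrand[OF gc F \<kappa> Q q, of n]] unfolding H0_def by metis
    show ?thesis
    proof (rule that[of C2 m])
      fix u z :: "real^'d" and d :: real assume *: "u \<in> ?K" "0 < d" "d \<le> 1" "d * norm z < R/2"
      have "u + d *\<^sub>R z \<in> ball u0 R" "u + d *\<^sub>R (- z) \<in> ball u0 R"
        using half_cball_shift(1)[of u u0 R d z] half_cball_shift(1)[of u u0 R d "-z"] * by auto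
      \<comment> \<open>Reflecting z keeps the divisor d, while passing to -d changes its sign;
        evenness of n makes the two agree.\<close>
      moreover have "((F (u - d *\<^sub>R z) - F u) / - d) ^ n = ((F (u - d *\<^sub>R z) - F u) / d) ^ n"
        using n by (simp add: power_divide)
      ultimately have "H d u z = ?X d u z" "H d u (- z) = ?X (- d) u z"
        by (simp_all add: H_def)
      then show "\<bar>H d u z + H d u (- z) - 2 * H0 u z\<bar> \<le> d\<^sup>2 * wt C2 m ?c z" using C2(2)[OF *] by simp
    qed (rule C2)
  qed
  \<comment> \<open>C2 serves the inner region. In the outer one the triangle inequality gives four
    copies of the bound C1: one for H, one for its reflection, two for twice H0.\<close>
  define C3 where "C3 = C2 + 4 * C1 * (2 / R)\<^sup>2"
  define k where "k = max m (n + 2)"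
  have C3: "C3 \<ge> 0" "C2 \<le> C3" "4 * C1 * (2 / R)\<^sup>2 \<le> C3" using C1 C2 by (auto simp: C3_def)
  have all: "\<bar>H d u z + H d u (- z) - 2 * H0 u z\<bar> \<le> d\<^sup>2 * wt C3 k ?c z" if u: "u \<in> ?K" and d: "0 < d" "d \<le> 1" for u d z
  proof (cases "d * norm z < R / 2")
    case True
    have "d\<^sup>2 * wt C2 m ?c z \<le> d\<^sup>2 * wt C3 k ?c z"
      using C2 C3 by (intro mult_left_mono wt_mono) (auto simp: k_def)
    then show ?thesis using sym[OF u d True] by linarith
  next
    case False
    then have "1 \<le> 2 / R * (d * norm z)" using g(2) by (simp add: field_simps)
    then have "1\<^sup>2 \<le> (2 / R * (d * norm z))\<^sup>2" by (intro power_mono) auto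
    also have "\<dots> = (2 / R)\<^sup>2 * d\<^sup>2 * (norm z)\<^sup>2" by (simp add: power_mult_distrib power_divide)
    also have "\<dots> \<le> (2 / R)\<^sup>2 * d\<^sup>2 * (1 + norm z)\<^sup>2" by (intro mult_left_mono power_mono) auto
    finally have one: "1 \<le> (2 / R)\<^sup>2 * d\<^sup>2 * (1 + norm z)\<^sup>2" by simp
    have wz: "wt C1 n ?c (- z) = wt C1 n ?c z" by (simp add: wt_def)
    have "\<bar>H d u z + H d u (- z) - 2 * H0 u z\<bar> \<le> 4 * wt C1 n ?c z"
      using Hb[OF u d(1), of z] Hb[OF u d(1), of "- z"] H0b[OF u, of z] wz by linarith
    also have "\<dots> \<le> 4 * wt C1 n ?c z * ((2 / R)\<^sup>2 * d\<^sup>2 * (1 + norm z)\<^sup>2)"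
      using mult_left_mono[OF one, of "4 * wt C1 n ?c z"] C1 by simp
    also have "\<dots> = d\<^sup>2 * wt (4 * C1 * (2 / R)\<^sup>2) (n + 2) ?c z"
      by (simp add: wt_def power_add power2_eq_square mult_ac)
    also have "\<dots> \<le> d\<^sup>2 * wt C3 k ?c z"
      using C1 C3 by (intro mult_left_mono wt_mono) (auto simp: k_def)
    finally show ?thesis .
  qed
  define C where "C = (\<integral>z. wt C3 k ?c z \<partial>(lborel :: (real^'d) measure))"
  have "C \<ge> 0" unfolding C_def using C3 by (intro Bochner_Integration.integral_nonneg) auto
  moreover have "\<bar>(\<integral>z. H d u z \<partial>lborel) - (\<integral>z. H0 u z \<partial>lborel)\<bar> \<le> C * d\<^sup>2" if u: "u \<in> ?K" and d: "0 < d" "d \<le> 1" for u d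
  proof -
    have dist: "lborel = distr (lborel :: (real^'d) measure) borel uminus"
      using lborel_affine[of "-1::real" "0::real^'d"] by (simp add: density_1)
    have refl: "(\<integral>z. H d u (- z) \<partial>lborel) = (\<integral>z. H d u z \<partial>lborel)"
      by (subst (2) dist, subst integral_distr) (use Hm[OF u d(1)] in auto)
    have Hi': "integrable lborel (\<lambda>z. H d u (- z))"
      by (rule Bochner_Integration.integrable_bound[OF wint[of C1 n]])
         (use measurable_compose[OF _ Hm[OF u d(1)], of uminus lborel] Hb[OF u d(1), of "- _"] C1 in \<open>auto simp: wt_def\<close>)
    \<comment> \<open>Lebesgue measure is invariant under reflection, so twice the integral of H is
      the integral of its symmetrization, to which the second-order bound applies.\<close>
    have "\<bar>2 * ((\<integral>z. H d u z \<partial>lborel) - (\<integral>z. H0 u z \<partial>lborel))\<bar> = \<bar>\<integral>z. H d u z + H d u (- z) - 2 * H0 u z \<partial>lborel\<bar>"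
      using Hi[OF u d(1)] Hi' H0i[OF u] refl by simp
    also have "\<dots> \<le> (\<integral>z. d\<^sup>2 * wt C3 k ?c z \<partial>(lborel :: (real^'d) measure))"
      using all[OF u d] Hi[OF u d(1)] Hi' H0i[OF u] wint
      by (intro integral_abs_bound[THEN order_trans] integral_mono) auto
    also have "\<dots> = C * d\<^sup>2" by (simp add: C_def)
    finally show ?thesis using \<open>C \<ge> 0\<close> by (simp add: abs_mult)
  qed
  ultimately show ?thesis by blast
qed

text \<open>With d the square root of the bandwidth, n = 2 gives one summand of the graph form up to
  normalization; its square is again of this shape, with n = 4 and the squared kernel. The weight q
  is p^(-\<beta>) under the sampling measure and p^(1-\<beta>) once the sampling densities are
  absorbed.\<close>

definition pair_energy :: "(real \<Rightarrow> real) \<Rightarrow> nat \<Rightarrow> ('a::real_normed_vector \<Rightarrow> real) \<Rightarrow> ('a \<Rightarrow> real) \<Rightarrow> real \<Rightarrow> 'a \<Rightarrow> 'a \<Rightarrow> real" where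
  "pair_energy \<kappa> n f q d x y = \<kappa> ((norm (x - y))\<^sup>2 / d\<^sup>2) * ((f x - f y) / d) ^ n * (q x * q y)"

text \<open>Comparing exp x at x = s / d^2 with the single term of degree k + 2 of its series gives
  the power 2 (k + 2) of d; dividing by d^k leaves d^(k+4), which is at most d^2.\<close>

lemma exp_decay_small:
  fixes s :: real
  assumes s: "s > 0"
  shows "\<exists>C\<ge>0. \<forall>d. 0 < d \<and> d \<le> 1 \<longrightarrow> exp (- s / d\<^sup>2) / d ^ k \<le> C * d\<^sup>2"
proof (intro exI conjI allI impI)
  show "fact (k + 2) / s ^ (k + 2) \<ge> (0::real)" using s by simp
  fix d :: real assume d: "0 < d \<and> d \<le> 1"
  define x where "x = s / d\<^sup>2"
  have x: "x > 0" using s d by (simp add: x_def)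
  have "x ^ (k + 2) / fact (k + 2) \<le> exp x"
  proof -
    have "(\<Sum>m\<in>{k+2}. inverse (fact m) * x ^ m) \<le> (\<Sum>m. inverse (fact m) * x ^ m)"
      using x summable_exp[of x] by (intro sum_le_suminf) auto
    then show ?thesis by (simp add: exp_def scaleR_conv_of_real field_simps)
  qed
  then have "inverse (exp x) \<le> inverse (x ^ (k + 2) / fact (k + 2))"
    using x by (intro le_imp_inverse_le) (auto intro: divide_pos_pos)
  then have "exp (- x) \<le> fact (k + 2) / x ^ (k + 2)" by (simp only: exp_minus inverse_divide)
  also have "\<dots> = fact (k + 2) / s ^ (k + 2) * d ^ (2 * (k + 2))" unfolding x_def power_divide power_mult by (simp only: divide_divide_eq_right times_divide_eq_left)
  finally have "exp (- s / d\<^sup>2) / d ^ k \<le> fact (k + 2) / s ^ (k + 2) * d ^ (2 * (k + 2)) / d ^ k"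
    using d by (intro divide_right_mono) (auto simp: x_def)
  also have "\<dots> = fact (k + 2) / s ^ (k + 2) * d ^ (k + 4)"
  proof -
    have "d ^ (2 * (k + 2)) = d ^ (k + 4) * d ^ k" unfolding power_add[symmetric] by (rule arg_cong[of _ _ "power d"]) simp
    then show ?thesis using d by simp
  qed
  also have "\<dots> \<le> fact (k + 2) / s ^ (k + 2) * d\<^sup>2"
    using d s by (intro mult_left_mono power_decreasing) auto
  finally show "exp (- s / d\<^sup>2) / d ^ k \<le> fact (k + 2) / s ^ (k + 2) * d\<^sup>2" .
qed

text \<open>At distance at least r the kernel is of order exp (- a r^2 / d^2), which outweighs every
  negative power of d coming from the difference quotient and from the normalization.\<close>

lemma pair_energy_far:
  assumes \<kappa>: "decaying_kernel \<kappa> a B" and r: "r > 0"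
    and f: "\<And>x. x \<in> M \<Longrightarrow> \<bar>f x\<bar> \<le> Fm" and q: "\<And>x. x \<in> M \<Longrightarrow> \<bar>q x\<bar> \<le> qm"
  shows "\<exists>C\<ge>0. \<forall>x\<in>M. \<forall>y\<in>M. \<forall>d. r \<le> norm (x - y) \<and> 0 < d \<and> d \<le> 1 \<longrightarrow> \<bar>pair_energy \<kappa> n f q d x y\<bar> / d ^ k \<le> C * d\<^sup>2"
proof -
  have ab: "a > 0" "B \<ge> 0" using \<kappa> by (auto simp: decaying_kernel_def)
  obtain C where C: "C \<ge> 0" "\<And>d. 0 < d \<Longrightarrow> d \<le> 1 \<Longrightarrow> exp (- (a * r\<^sup>2) / d\<^sup>2) / d ^ (n + k) \<le> C * d\<^sup>2"
    using exp_decay_small[of "a * r\<^sup>2" "n + k"] ab r by auto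
  show ?thesis
  proof (intro exI conjI ballI allI impI)
    show "B * (2 * \<bar>Fm\<bar>) ^ n * (\<bar>qm\<bar> * \<bar>qm\<bar>) * C \<ge> 0" using ab C by simp
    fix x y d assume x: "x \<in> M" and y: "y \<in> M" and d: "r \<le> norm (x - y) \<and> 0 < d \<and> d \<le> (1::real)"
    have "r\<^sup>2 \<le> (norm (x - y))\<^sup>2" using d r by (intro power_mono) auto
    then have "- a * ((norm (x - y))\<^sup>2 / d\<^sup>2) \<le> - (a * r\<^sup>2) / d\<^sup>2"
      using ab d by (simp add: field_simps)
    then have "B * exp (- a * ((norm (x - y))\<^sup>2 / d\<^sup>2)) \<le> B * exp (- (a * r\<^sup>2) / d\<^sup>2)"
      using ab by (intro mult_left_mono) auto
    then have 1: "\<bar>\<kappa> ((norm (x - y))\<^sup>2 / d\<^sup>2)\<bar> \<le> B * exp (- (a * r\<^sup>2) / d\<^sup>2)"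
      using decaying_kernel_bound[OF \<kappa>, of "(norm (x - y))\<^sup>2 / d\<^sup>2"] by simp
    have "\<bar>f x - f y\<bar> \<le> 2 * \<bar>Fm\<bar>" using f[OF x] f[OF y] by linarith
    then have "\<bar>f x - f y\<bar> ^ n \<le> (2 * \<bar>Fm\<bar>) ^ n" by (intro power_mono) auto
    then have 2: "\<bar>((f x - f y) / d) ^ n\<bar> \<le> (2 * \<bar>Fm\<bar>) ^ n / d ^ n"
      using d by (simp add: power_abs power_divide divide_right_mono)
    have 3: "\<bar>q x * q y\<bar> \<le> \<bar>qm\<bar> * \<bar>qm\<bar>" unfolding abs_mult
      using q[OF x] q[OF y] by (intro mult_mono) auto
    have "\<bar>pair_energy \<kappa> n f q d x y\<bar> \<le> B * exp (- (a * r\<^sup>2) / d\<^sup>2) * ((2 * \<bar>Fm\<bar>) ^ n / d ^ n) * (\<bar>qm\<bar> * \<bar>qm\<bar>)"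
      unfolding pair_energy_def abs_mult[of "_ * _ ^ n"] abs_mult[of "\<kappa> _"] using 1 2 3 ab d by (intro mult_mono) auto
    then have "\<bar>pair_energy \<kappa> n f q d x y\<bar> / d ^ k \<le> B * exp (- (a * r\<^sup>2) / d\<^sup>2) * ((2 * \<bar>Fm\<bar>) ^ n / d ^ n) * (\<bar>qm\<bar> * \<bar>qm\<bar>) / d ^ k"
      using d by (intro divide_right_mono) auto
    also have "\<dots> = B * (2 * \<bar>Fm\<bar>) ^ n * (\<bar>qm\<bar> * \<bar>qm\<bar>) * (exp (- (a * r\<^sup>2) / d\<^sup>2) / d ^ (n + k))"
      using d by (simp add: power_add field_simps)
    also have "\<dots> \<le> B * (2 * \<bar>Fm\<bar>) ^ n * (\<bar>qm\<bar> * \<bar>qm\<bar>) * (C * d\<^sup>2)"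
      using C(2)[of d] d ab by (intro mult_left_mono) auto
    finally show "\<bar>pair_energy \<kappa> n f q d x y\<bar> / d ^ k \<le> B * (2 * \<bar>Fm\<bar>) ^ n * (\<bar>qm\<bar> * \<bar>qm\<bar>) * C * d\<^sup>2"
      by (simp add: mult.assoc)
  qed
qed

text \<open>Points outside a chart might come close to it in the ambient space. They do not: the
  closed half ball has compact image, and what the open ball misses is closed, because its image is
  relatively open in M.\<close>

lemma chart_separation:
  assumes M: "compact M" and gc: "good_chart M U \<phi> u0 R c"
  shows "\<exists>r>0. \<forall>x\<in>\<phi> ` cball u0 (R/2). \<forall>y\<in>M - \<phi> ` ball u0 R. r \<le> norm (x - y)"
proof -
  note g = good_chartD[OF gc]
  note l = local_paramD[OF g(1)]
  have sub: "ball u0 R \<subseteq> U" "cball u0 (R/2) \<subseteq> ball u0 R" using g(2,3) by auto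
  obtain \<psi> where \<psi>: "homeomorphism U (\<phi> ` U) \<phi> \<psi>" using g(1) by (auto simp: local_param_def)
  have "openin (top_of_set U) (ball u0 R)" using sub by (simp add: openin_open_eq l(1))
  then have "openin (top_of_set (\<phi> ` U)) (\<phi> ` ball u0 R)" using homeomorphism_imp_open_map[OF \<psi>] by blast
  then have "openin (top_of_set M) (\<phi> ` ball u0 R)" using l(4) openin_trans by blast
  then obtain T where T: "open T" "\<phi> ` ball u0 R = M \<inter> T" by (auto simp: openin_open)
  have "M - \<phi> ` ball u0 R = M \<inter> - T" unfolding T(2) by auto
  then have cl: "closed (M - \<phi> ` ball u0 R)" using T(1) M compact_imp_closed by auto
  have co: "compact (\<phi> ` cball u0 (R/2))"
    using l(7) sub by (intro compact_continuous_image) (auto intro: continuous_on_subset)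
  have "\<phi> ` cball u0 (R/2) \<inter> (M - \<phi> ` ball u0 R) = {}" using sub by auto
  from separate_compact_closed[OF co cl this] show ?thesis by (auto simp: dist_norm)
qed

text \<open>The description of the volume in charts does not mention finiteness; it follows from a
  finite cover by balls on which the volume element is bounded.\<close>

lemma volume_finite:
  fixes M :: "(real ^ 'D::finite) set"
  assumes M: "compact_smooth_manifold TYPE('d::finite) M" and V: "riemannian_volume TYPE('d) M V"
  shows "finite_measure V"
proof
  have cM: "compact M" using M by (simp add: compact_smooth_manifold_def)
  note vs = volume_sets[OF cM V]
  obtain n :: nat and U and \<phi> :: "nat \<Rightarrow> real ^ 'd \<Rightarrow> real ^ 'D" and u0 R c where
    gc: "\<And>i. i < n \<Longrightarrow> good_chart M (U i) (\<phi> i) (u0 i) (R i) (c i)" and cov: "M = (\<Union>i<n. \<phi> i ` ball (u0 i) (R i / 2))"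
    using good_chart_cover[OF M] by blast
  have fin: "emeasure V (\<phi> i ` ball (u0 i) (R i / 2)) < \<infinity> \<and> \<phi> i ` ball (u0 i) (R i / 2) \<in> sets V" if i: "i < n" for i
  proof -
    note g = good_chartD[OF gc[OF i]]
    let ?S = "ball (u0 i) (R i / 2)"
    have S: "?S \<subseteq> U i" using g(2,3) by (auto simp: subset_iff)
    have im: "\<phi> i ` ?S \<in> sets V"
      using chart_image_borel[OF cM g(1) S] vs(1) local_paramD(6)[OF g(1)] S by (auto simp: image_subset_iff subset_iff)
    obtain C where C: "\<And>u. u \<in> cball (u0 i) (R i) \<Longrightarrow> \<bar>volume_element (\<phi> i) u\<bar> \<le> C"
    proof -
      have "\<exists>C\<ge>0. \<forall>z. \<forall>x\<in>cball (u0 i) (R i). \<bar>dirders 0 (volume_element (\<phi> i)) z x\<bar> \<le> C * norm z ^ 0"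
        using continuous_on_volume_element[OF g(1)] by (intro dirders_bound[OF local_paramD(1)[OF g(1)] _ compact_cball g(3)]) simp
      then obtain C where "\<forall>u\<in>cball (u0 i) (R i). \<bar>volume_element (\<phi> i) u\<bar> \<le> C" by auto
      then show ?thesis by (intro that) blast
    qed
    have "emeasure V (\<phi> i ` ?S) = (\<integral>\<^sup>+x. indicator (\<phi> i ` ?S) x * 1 \<partial>V)" using im by simp
    also have "\<dots> = (\<integral>\<^sup>+u. indicator ?S u * ennreal (volume_element (\<phi> i) u) * 1 \<partial>lborel)"
      by (rule chart_nn_integral[OF cM V g(1) S, where h = "\<lambda>_. 1"]) simp_all
    also have "\<dots> \<le> (\<integral>\<^sup>+u. ennreal C * indicator ?S u \<partial>lborel)"
    proof (rule nn_integral_mono)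
      fix u
      have "ennreal (volume_element (\<phi> i) u) \<le> ennreal C" if "u \<in> ?S"
        using order_trans[OF abs_ge_self C[of u]] that g(2) by (intro ennreal_leI) auto
      then show "indicator ?S u * ennreal (volume_element (\<phi> i) u) * 1 \<le> ennreal C * indicator ?S u"
        by (simp add: indicator_def)
    qed
    also have "\<dots> = ennreal C * emeasure lborel ?S" by (simp add: nn_integral_cmult_indicator)
    also have "\<dots> < \<infinity>" using emeasure_bounded_finite[OF bounded_ball, of "u0 i" "R i / 2"] by (simp add: ennreal_mult_less_top)
    finally show ?thesis using im by simp
  qed
  have "emeasure V M \<le> (\<Sum>i<n. emeasure V (\<phi> i ` ball (u0 i) (R i / 2)))"
    by (subst cov) (rule emeasure_subadditive_finite, use fin in auto)
  also have "\<dots> < \<infinity>" using fin by (simp add: ennreal_sum_less_top less_top)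
  finally show "emeasure V (space V) \<noteq> \<infinity>" using vs(2) by simp
qed

lemma pair_energy_continuous:
  assumes "continuous_on {0..} \<kappa>" "continuous_on M f" "continuous_on M q" "d > 0"
  shows "continuous_on (M \<times> M) (\<lambda>(x, y). pair_energy \<kappa> n f q d x y)"
    and "x \<in> M \<Longrightarrow> continuous_on M (pair_energy \<kappa> n f q d x)"
proof -
  have 1: "continuous_on (M \<times> M) (\<lambda>z. f (fst z))" "continuous_on (M \<times> M) (\<lambda>z. f (snd z))" 
    "continuous_on (M \<times> M) (\<lambda>z. q (fst z))" "continuous_on (M \<times> M) (\<lambda>z. q (snd z))" 
  proof -
    have "continuous_on (M \<times> M) (\<lambda>z. g (fst z))" "continuous_on (M \<times> M) (\<lambda>z. g (snd z))" if "continuous_on M g" for g :: "'a \<Rightarrow> real"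
      by (rule continuous_on_compose2[OF that continuous_on_fst[OF continuous_on_id]], force)
         (rule continuous_on_compose2[OF that continuous_on_snd[OF continuous_on_id]], force)
    then show "continuous_on (M \<times> M) (\<lambda>z. f (fst z))" "continuous_on (M \<times> M) (\<lambda>z. f (snd z))" 
      "continuous_on (M \<times> M) (\<lambda>z. q (fst z))" "continuous_on (M \<times> M) (\<lambda>z. q (snd z))" using assms by blast+
  qed
  show "continuous_on (M \<times> M) (\<lambda>(x, y). pair_energy \<kappa> n f q d x y)"
    unfolding pair_energy_def case_prod_unfold using assms(4)
    by (intro continuous_intros continuous_radial[OF assms(1)] 1) auto
  show "x \<in> M \<Longrightarrow> continuous_on M (pair_energy \<kappa> n f q d x)"
    unfolding pair_energy_def[abs_def] using assms(4)
    by (intro continuous_intros continuous_radial[OF assms(1)] assms(2,3)) auto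
qed

text \<open>The substitution w = u + d z produces the factor d^dim that the normalization removes,
  and merging the volume element with the weight at the moving point brings the integral into the
  form of \<open>chart_estimate\<close>.\<close>

lemma chart_pointwise:
  fixes M :: "(real ^ 'D::finite) set" and s :: real
  assumes M: "compact_smooth_manifold TYPE('d::finite) M" and V: "riemannian_volume TYPE('d) M V"
    and gc: "good_chart M U (\<phi> :: real ^ 'd \<Rightarrow> real ^ 'D) u0 R c"
    and f: "smooth_function TYPE('d) M f" and p: "smooth_function TYPE('d) M p"
    and b: "0 < lo" "\<And>x. x \<in> M \<Longrightarrow> lo \<le> p x \<and> p x \<le> hi" and \<kappa>: "decaying_kernel \<kappa> a B" and n: "even n" "n > 0"
  defines "q \<equiv> (\<lambda>x. p x powr s)"
  shows "\<exists>C\<ge>0. \<forall>u\<in>cball u0 (R/2). \<forall>d. 0 < d \<and> d \<le> 1 \<longrightarrow>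
    \<bar>(\<integral>y. indicator (\<phi> ` ball u0 R) y * pair_energy \<kappa> n f q d (\<phi> u) y \<partial>V) / d ^ CARD('d)
      - kernel_moment TYPE('d) \<kappa> n * ((q (\<phi> u))\<^sup>2 * norm (manifold_grad TYPE('d) M f (\<phi> u)) ^ n)\<bar> \<le> C * d\<^sup>2"
proof -
  have cM: "compact M" using M by (simp add: compact_smooth_manifold_def)
  note vs = volume_sets[OF cM V]
  note g = good_chartD[OF gc]
  note l = local_paramD[OF g(1)]
  have ab: "a > 0" "B \<ge> 0" "continuous_on {0..} \<kappa>" using \<kappa> by (auto simp: decaying_kernel_def)
  have pc: "continuous_on M p" and fc: "continuous_on M f"
    using smooth_function_continuous_on[OF M] p f by auto
  have qc: "continuous_on M q" unfolding q_def using pc b by (intro continuous_on_powr continuous_intros) force+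
  define F where "F = f \<circ> \<phi>"
  have F: "C_inf_on U F" using f g(1) unfolding smooth_function_def F_def by blast
  define q' where "q' u = q (\<phi> u)" for u
  define Q where "Q u = q' u * volume_element \<phi> u" for u
  have q'c: "continuous_on U q'" unfolding q'_def
    using l(6,7) by (intro continuous_on_compose2[OF qc]) auto
  have Qc: "continuous_on U Q" unfolding Q_def
    by (intro continuous_intros q'c continuous_on_volume_element[OF g(1)])
  have eq: "expand (cball u0 (R/2)) (R/2) 0 (\<lambda>d u z. q' (u + d *\<^sub>R z)) (\<lambda>u z. q' u)"
    unfolding q'_def q_def by (rule expand_density[OF gc p b])
  have eQ: "expand (cball u0 (R/2)) (R/2) 0 (\<lambda>d u z. Q (u + d *\<^sub>R z)) (\<lambda>u z. Q u)"
    using expand_mult[OF eq expand_volume_element[OF gc]] by (simp add: Q_def)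
  from chart_estimate[OF gc F \<kappa> eQ expand_base[OF eq] Qc q'c n(1)]
  obtain C where C: "C \<ge> 0" "\<And>u d. u \<in> cball u0 (R/2) \<Longrightarrow> 0 < d \<Longrightarrow> d \<le> 1 \<Longrightarrow>
    \<bar>(\<integral>z. indicator (ball u0 R) (u + d *\<^sub>R z) * (\<kappa> ((norm (\<phi> (u + d *\<^sub>R z) - \<phi> u))\<^sup>2 / d\<^sup>2) * ((F (u + d *\<^sub>R z) - F u) / d) ^ n * (q' u * Q (u + d *\<^sub>R z))) \<partial>lborel)
     - (\<integral>z. \<kappa> ((norm (dmap \<phi> u z))\<^sup>2) * (dirder F z u) ^ n * (q' u * Q u) \<partial>lborel)\<bar> \<le> C * d\<^sup>2"
    by auto
  show ?thesis
  proof (intro exI[of _ C] conjI ballI allI impI)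
    show "C \<ge> 0" by (rule C)
    fix u and d :: real assume u: "u \<in> cball u0 (R/2)" and d: "0 < d \<and> d \<le> 1"
    have uU: "u \<in> U" using u g(2,3) by (auto simp: subset_iff)
    have uM: "\<phi> u \<in> M" using l(6) uU by auto
    have S: "ball u0 R \<subseteq> U" "ball u0 R \<in> sets borel" using g(3) by auto
    define k where "k w = indicator (ball u0 R) w * (\<kappa> ((norm (\<phi> w - \<phi> u))\<^sup>2 / d\<^sup>2) * ((F w - F u) / d) ^ n * (q' u * Q w))" for w
    \<comment> \<open>The energy takes f at the base point minus f at the moving point, the chart
      computation the opposite; the even power does not see the sign.\<close>
    have keq: "indicator (ball u0 R) w * (volume_element \<phi> w * pair_energy \<kappa> n f q d (\<phi> u) (\<phi> w)) = k w" for w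
    proof -
      have "((f (\<phi> u) - f (\<phi> w)) / d) ^ n = ((F w - F u) / d) ^ n"
        using n(1) by (metis F_def comp_apply minus_diff_eq minus_divide_left power_minus_even)
      then show ?thesis by (simp add: k_def pair_energy_def q'_def Q_def norm_minus_commute mult_ac)
    qed
    have pm: "pair_energy \<kappa> n f q d (\<phi> u) \<in> borel_measurable V"
      using d by (intro borel_measurable_volume[OF cM V] pair_energy_continuous(2)[OF ab(3) fc qc _ uM]) simp
    have I: "(\<integral>y. indicator (\<phi> ` ball u0 R) y * pair_energy \<kappa> n f q d (\<phi> u) y \<partial>V) = (\<integral>w. k w \<partial>lborel)"
      and km: "k \<in> borel_measurable borel"
      using chart_integral[OF cM V g(1) S pm] unfolding keq by auto
    have "(\<integral>w. k w \<partial>lborel) = (\<integral>w. k w \<partial>density (distr lborel borel (\<lambda>z. u + d *\<^sub>R z)) (\<lambda>_. ennreal (d ^ CARD('d))))"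
      using lborel_affine[of d u] d by simp
    also have "\<dots> = d ^ CARD('d) * (\<integral>z. k (u + d *\<^sub>R z) \<partial>lborel)"
      using km d by (subst integral_density) (auto simp: integral_distr)
    finally have I2: "(\<integral>y. indicator (\<phi> ` ball u0 R) y * pair_energy \<kappa> n f q d (\<phi> u) y \<partial>V) / d ^ CARD('d) = (\<integral>z. k (u + d *\<^sub>R z) \<partial>lborel)"
      using I d by simp
    define w where "w = manifold_grad TYPE('d) M f (\<phi> u)"
    have w: "w \<in> range (dmap \<phi> u)" "\<And>z. w \<bullet> dmap \<phi> u z = dirder F z u"
      using manifold_grad_chart[OF g(1) uU f] by (auto simp: w_def F_def dirder_def)
    have "(\<integral>z. \<kappa> ((norm (dmap \<phi> u z))\<^sup>2) * (dirder F z u) ^ n * (q' u * Q u) \<partial>lborel) 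
      = (\<integral>z. \<kappa> ((norm (dmap \<phi> u z))\<^sup>2) * (w \<bullet> dmap \<phi> u z) ^ n \<partial>lborel) * (q' u * Q u)"
      unfolding w(2) by simp
    also have "\<dots> = (\<integral>z. \<kappa> ((norm (dmap \<phi> u z))\<^sup>2) * (w \<bullet> dmap \<phi> u z) ^ n \<partial>lborel) * volume_element \<phi> u * (q' u)\<^sup>2"
      by (simp add: Q_def power2_eq_square)
    also have "(\<integral>z. \<kappa> ((norm (dmap \<phi> u z))\<^sup>2) * (w \<bullet> dmap \<phi> u z) ^ n \<partial>lborel) * volume_element \<phi> u = norm w ^ n * kernel_moment TYPE('d) \<kappa> n"
      unfolding metric_tensor_def by (rule kernel_moment_linear(2)[OF ab(3) n(2) l(8)[OF uU] l(3)[OF uU] w(1)])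
    finally have I0: "(\<integral>z. \<kappa> ((norm (dmap \<phi> u z))\<^sup>2) * (dirder F z u) ^ n * (q' u * Q u) \<partial>lborel) = kernel_moment TYPE('d) \<kappa> n * ((q (\<phi> u))\<^sup>2 * norm w ^ n)"
      by (simp add: q'_def mult_ac)
    show "\<bar>(\<integral>y. indicator (\<phi> ` ball u0 R) y * pair_energy \<kappa> n f q d (\<phi> u) y \<partial>V) / d ^ CARD('d)
      - kernel_moment TYPE('d) \<kappa> n * ((q (\<phi> u))\<^sup>2 * norm (manifold_grad TYPE('d) M f (\<phi> u)) ^ n)\<bar> \<le> C * d\<^sup>2"
      using C(2)[OF u, of d] d unfolding I2 I0[unfolded w_def, symmetric] k_def by simp
  qed
qed

lemma bounded_on_compact:
  fixes f :: "'a::topological_space \<Rightarrow> real"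
  assumes "compact M" "continuous_on M f"
  shows "\<exists>C. \<forall>x\<in>M. \<bar>f x\<bar> \<le> C"
  using compact_imp_bounded[OF compact_continuous_image[OF assms(2,1)]] unfolding bounded_iff by auto

text \<open>A chart whose half ball contains x takes care of the nearby points; all other points of
  M are at a distance of at least r from x and contribute O(d^2) times the finite volume.\<close>

lemma mean_pointwise:
  fixes M :: "(real ^ 'D::finite) set" and s :: real
  assumes M: "compact_smooth_manifold TYPE('d::finite) M" and V: "riemannian_volume TYPE('d) M V"
    and f: "smooth_function TYPE('d) M f" and p: "smooth_function TYPE('d) M p"
    and b: "0 < lo" "\<And>x. x \<in> M \<Longrightarrow> lo \<le> p x \<and> p x \<le> hi" and \<kappa>: "decaying_kernel \<kappa> a B" and n: "even n" "n > 0"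
  defines "q \<equiv> (\<lambda>x. p x powr s)"
  shows "\<exists>C\<ge>0. \<forall>x\<in>M. \<forall>d. 0 < d \<and> d \<le> 1 \<longrightarrow>
    \<bar>(\<integral>y. pair_energy \<kappa> n f q d x y \<partial>V) / d ^ CARD('d)
      - kernel_moment TYPE('d) \<kappa> n * ((q x)\<^sup>2 * norm (manifold_grad TYPE('d) M f x) ^ n)\<bar> \<le> C * d\<^sup>2"
proof -
  have cM: "compact M" using M by (simp add: compact_smooth_manifold_def)
  note vs = volume_sets[OF cM V]
  interpret V: finite_measure V by (rule volume_finite[OF M V])
  have ab: "a > 0" "B \<ge> 0" "continuous_on {0..} \<kappa>" using \<kappa> by (auto simp: decaying_kernel_def)
  have pc: "continuous_on M p" and fc: "continuous_on M f"
    using smooth_function_continuous_on[OF M] p f by auto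
  have qc: "continuous_on M q" unfolding q_def using pc b by (intro continuous_on_powr continuous_intros) force+
  obtain Fm where Fm: "\<And>x. x \<in> M \<Longrightarrow> \<bar>f x\<bar> \<le> Fm" using bounded_on_compact[OF cM fc] by blast
  obtain qm where qm: "\<And>x. x \<in> M \<Longrightarrow> \<bar>q x\<bar> \<le> qm" using bounded_on_compact[OF cM qc] by blast
  obtain N :: nat and U and \<phi> :: "nat \<Rightarrow> real ^ 'd \<Rightarrow> real ^ 'D" and u0 R c where
    gc: "\<And>i. i < N \<Longrightarrow> good_chart M (U i) (\<phi> i) (u0 i) (R i) (c i)" and cov: "M = (\<Union>i<N. \<phi> i ` ball (u0 i) (R i / 2))"
    using good_chart_cover[OF M] by blast
  have chart: "\<exists>C\<ge>0. \<forall>u\<in>cball (u0 i) (R i/2). \<forall>d. 0 < d \<and> d \<le> 1 \<longrightarrow>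
    \<bar>(\<integral>y. pair_energy \<kappa> n f q d (\<phi> i u) y \<partial>V) / d ^ CARD('d)
      - kernel_moment TYPE('d) \<kappa> n * ((q (\<phi> i u))\<^sup>2 * norm (manifold_grad TYPE('d) M f (\<phi> i u)) ^ n)\<bar> \<le> C * d\<^sup>2" if i: "i < N" for i
  proof -
    note g = good_chartD[OF gc[OF i]]
    note l = local_paramD[OF g(1)]
    let ?W = "\<phi> i ` ball (u0 i) (R i)"
    have S: "ball (u0 i) (R i) \<subseteq> U i" using g(3) by auto
    have W[measurable]: "?W \<in> sets V" using chart_image_borel[OF cM g(1) S] vs(1) l(6) S by (auto simp: image_subset_iff subset_iff)
    obtain C1 where C1: "C1 \<ge> 0" "\<And>u d. u\<in>cball (u0 i) (R i/2) \<Longrightarrow> 0 < d \<Longrightarrow> d \<le> 1 \<Longrightarrow>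
      \<bar>(\<integral>y. indicator ?W y * pair_energy \<kappa> n f q d (\<phi> i u) y \<partial>V) / d ^ CARD('d)
        - kernel_moment TYPE('d) \<kappa> n * ((q (\<phi> i u))\<^sup>2 * norm (manifold_grad TYPE('d) M f (\<phi> i u)) ^ n)\<bar> \<le> C1 * d\<^sup>2"
      using chart_pointwise[OF M V gc[OF i] f p b \<kappa> n, of s] unfolding q_def by blast
    obtain r where r: "r > 0" "\<And>x y. x\<in>\<phi> i ` cball (u0 i) (R i/2) \<Longrightarrow> y\<in>M - ?W \<Longrightarrow> r \<le> norm (x - y)"
      using chart_separation[OF cM gc[OF i]] by blast
    have "\<exists>C\<ge>0. \<forall>x\<in>M. \<forall>y\<in>M. \<forall>d. r \<le> norm (x - y) \<and> 0 < d \<and> d \<le> 1 \<longrightarrow> \<bar>pair_energy \<kappa> n f q d x y\<bar> / d ^ CARD('d) \<le> C * d\<^sup>2"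
      by (rule pair_energy_far[OF \<kappa> r(1) Fm qm])
    then obtain C2 where C2: "C2 \<ge> 0" "\<forall>x\<in>M. \<forall>y\<in>M. \<forall>d. r \<le> norm (x - y) \<and> 0 < d \<and> d \<le> 1 \<longrightarrow> \<bar>pair_energy \<kappa> n f q d x y\<bar> / d ^ CARD('d) \<le> C2 * d\<^sup>2"
      by (elim exE conjE)
    show ?thesis
    proof (intro exI[of _ "C1 + C2 * measure V M"] conjI ballI allI impI)
      show "C1 + C2 * measure V M \<ge> 0" using C1 C2 by simp
      fix u and d :: real assume u: "u\<in>cball (u0 i) (R i/2)" and d: "0 < d \<and> d \<le> 1"
      let ?k = "pair_energy \<kappa> n f q d (\<phi> i u)"
      have uU: "u \<in> U i" using u g(2,3) by (auto simp: subset_iff)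
      have uM: "\<phi> i u \<in> M" using l(6) uU by auto
      have kc: "continuous_on M ?k" using d by (intro pair_energy_continuous(2)[OF ab(3) fc qc _ uM]) simp
      have [measurable]: "?k \<in> borel_measurable V" by (intro borel_measurable_volume[OF cM V] kc)
      obtain Kb where Kb: "\<And>y. y \<in> M \<Longrightarrow> \<bar>?k y\<bar> \<le> Kb" using bounded_on_compact[OF cM kc] by blast
      have int: "integrable V ?k" by (rule V.integrable_const_bound[of _ Kb]) (use Kb vs(2) in auto)
      have int1: "integrable V (\<lambda>y. indicator ?W y * ?k y)" 
        using integrable_mult_indicator[OF W int] by simp
      have [simp]: "M - ?W \<in> sets V" using W vs(2) by (metis sets.compl_sets)
      have int2: "integrable V (\<lambda>y. indicator (M - ?W) y * ?k y)" 
        using integrable_mult_indicator[OF _ int, of "M - ?W"] by simp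
      have "(\<integral>y. ?k y \<partial>V) = (\<integral>y. indicator ?W y * ?k y + indicator (M - ?W) y * ?k y \<partial>V)"
        by (intro Bochner_Integration.integral_cong) (auto simp: vs(2) indicator_def)
      also have "\<dots> = (\<integral>y. indicator ?W y * ?k y \<partial>V) + (\<integral>y. indicator (M - ?W) y * ?k y \<partial>V)"
        by (rule Bochner_Integration.integral_add[OF int1 int2])
      finally have split: "(\<integral>y. ?k y \<partial>V) = \<dots>" .
      have "\<bar>\<integral>y. indicator (M - ?W) y * ?k y \<partial>V\<bar> \<le> (\<integral>y. C2 * d\<^sup>2 * d ^ CARD('d) \<partial>V)"
      proof (rule integral_abs_bound[THEN order_trans], rule integral_mono)
        show "integrable V (\<lambda>y. \<bar>indicator (M - ?W) y * ?k y\<bar>)" using int2 by simp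
        fix y assume "y \<in> space V"
        then have y: "y \<in> M" using vs(2) by simp
        have "\<bar>?k y\<bar> \<le> C2 * d\<^sup>2 * d ^ CARD('d)" if "y \<notin> ?W"
        proof -
          have "r \<le> norm (\<phi> i u - y)" using u y that by (intro r(2)) auto
          then have "\<bar>?k y\<bar> / d ^ CARD('d) \<le> C2 * d\<^sup>2" using C2(2) uM y d by blast
          then show ?thesis using d by (simp add: field_simps)
        qed
        then show "\<bar>indicator (M - ?W) y * ?k y\<bar> \<le> C2 * d\<^sup>2 * d ^ CARD('d)" 
          using C2(1) d by (auto simp: indicator_def)
      qed simp
      then have "\<bar>\<integral>y. indicator (M - ?W) y * ?k y \<partial>V\<bar> / d ^ CARD('d) \<le> C2 * measure V M * d\<^sup>2"
        using d vs(2) by (simp add: field_simps)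
      moreover have "(\<integral>y. ?k y \<partial>V) / d ^ CARD('d) = (\<integral>y. indicator ?W y * ?k y \<partial>V) / d ^ CARD('d) + (\<integral>y. indicator (M - ?W) y * ?k y \<partial>V) / d ^ CARD('d)"
        unfolding split by (simp add: add_divide_distrib)
      moreover have "\<bar>(\<integral>y. indicator (M - ?W) y * ?k y \<partial>V) / d ^ CARD('d)\<bar> = \<bar>\<integral>y. indicator (M - ?W) y * ?k y \<partial>V\<bar> / d ^ CARD('d)"
        using d by simp
      ultimately show "\<bar>(\<integral>y. ?k y \<partial>V) / d ^ CARD('d)
        - kernel_moment TYPE('d) \<kappa> n * ((q (\<phi> i u))\<^sup>2 * norm (manifold_grad TYPE('d) M f (\<phi> i u)) ^ n)\<bar> \<le> (C1 + C2 * measure V M) * d\<^sup>2"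
        unfolding distrib_right using C1(2)[OF u, of d] d by linarith
    qed
  qed
  then obtain C where C: "\<And>i. i < N \<Longrightarrow> C i \<ge> 0" "\<And>i u d. i < N \<Longrightarrow> u\<in>cball (u0 i) (R i/2) \<Longrightarrow> 0 < d \<Longrightarrow> d \<le> 1 \<Longrightarrow>
    \<bar>(\<integral>y. pair_energy \<kappa> n f q d (\<phi> i u) y \<partial>V) / d ^ CARD('d)
      - kernel_moment TYPE('d) \<kappa> n * ((q (\<phi> i u))\<^sup>2 * norm (manifold_grad TYPE('d) M f (\<phi> i u)) ^ n)\<bar> \<le> C i * d\<^sup>2"
    by metis
  show ?thesis
  \<comment> \<open>The sum of the nonnegative chart constants serves as a common upper bound for
    them.\<close>
  proof (intro exI[of _ "\<Sum>i<N. C i"] conjI ballI allI impI)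
    show "(\<Sum>i<N. C i) \<ge> 0" using C(1) by (auto intro: sum_nonneg)
    fix x and d :: real assume x: "x \<in> M" and d: "0 < d \<and> d \<le> 1"
    from x obtain i u where i: "i < N" and u: "u \<in> ball (u0 i) (R i / 2)" "x = \<phi> i u" unfolding cov by auto
    have "C i \<le> (\<Sum>i<N. C i)" using C(1) i by (intro member_le_sum) auto
    then have le: "C i * d\<^sup>2 \<le> (\<Sum>i<N. C i) * d\<^sup>2" by (intro mult_right_mono) auto
    have "u \<in> cball (u0 i) (R i / 2)" using u by auto
    then have "\<bar>(\<integral>y. pair_energy \<kappa> n f q d (\<phi> i u) y \<partial>V) / d ^ CARD('d)
      - kernel_moment TYPE('d) \<kappa> n * ((q (\<phi> i u))\<^sup>2 * norm (manifold_grad TYPE('d) M f (\<phi> i u)) ^ n)\<bar> \<le> C i * d\<^sup>2"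
      using C(2)[OF i] d by blast
    then show "\<bar>(\<integral>y. pair_energy \<kappa> n f q d x y \<partial>V) / d ^ CARD('d)
      - kernel_moment TYPE('d) \<kappa> n * ((q x)\<^sup>2 * norm (manifold_grad TYPE('d) M f x) ^ n)\<bar> \<le> (\<Sum>i<N. C i) * d\<^sup>2"
      unfolding u(2) using le by (rule order_trans)
  qed
qed

section \<open>Regularity of the gradient norm and integrated means\<close>

lemma C_k_on_const: "C_k_on k U (\<lambda>_. c)"
proof (induction k arbitrary: c)
  case (Suc k)
  then show ?case by (simp add: frechet_derivative_const)
qed simp

lemma smooth_function_const: "smooth_function T M (\<lambda>_. c)"
  unfolding smooth_function_def C_inf_on_def comp_def using C_k_on_const by blast

lemma pair_energy_measurable:
  assumes cM: "compact M" and V: "riemannian_volume TYPE('d::finite) M V"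
    and c: "continuous_on {0..} \<kappa>" "continuous_on M f" "continuous_on M q"
  shows "(\<lambda>(x, y). pair_energy \<kappa> n f q d x y) \<in> borel_measurable (V \<Otimes>\<^sub>M V)"
proof -
  \<comment> \<open>The kernel is continuous only on the nonnegative reals. Clamping its argument
    gives a function that is continuous on the whole line and agrees with it at every argument that
    occurs.\<close>
  define \<kappa>' where "\<kappa>' = (\<lambda>\<xi>. \<kappa> (max 0 \<xi>))"
  have "continuous_on UNIV \<kappa>'" unfolding \<kappa>'_def
    by (intro continuous_on_compose2[OF c(1)] continuous_intros) auto
  then have [measurable]: "\<kappa>' \<in> borel_measurable borel" by (rule borel_measurable_continuous_onI)
  have [measurable]: "f \<in> borel_measurable V" "q \<in> borel_measurable V" "(\<lambda>x. x) \<in> borel_measurable V"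
    using c by (auto intro!: borel_measurable_volume[OF cM V] continuous_intros)
  have "(\<lambda>(x, y). pair_energy \<kappa> n f q d x y) = (\<lambda>z. \<kappa>' ((norm (fst z - snd z))\<^sup>2 / d\<^sup>2) * ((f (fst z) - f (snd z)) / d) ^ n * (q (fst z) * q (snd z)))"
    by (simp add: pair_energy_def \<kappa>'_def fun_eq_iff)
  also have "\<dots> \<in> borel_measurable (V \<Otimes>\<^sub>M V)" by measurable
  finally show ?thesis .
qed

lemma pair_energy_bounded:
  assumes "compact M" "continuous_on {0..} \<kappa>" "continuous_on M f" "continuous_on M q" "d > 0"
  shows "\<exists>K. \<forall>x\<in>M. \<forall>y\<in>M. \<bar>pair_energy \<kappa> n f q d x y\<bar> \<le> K"
  using bounded_on_compact[OF compact_Times[OF assms(1,1)] pair_energy_continuous(1)[OF assms(2-5)]] by auto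

lemma grad_measurable_bounded:
  fixes M :: "(real ^ 'D::finite) set"
  assumes M: "compact_smooth_manifold TYPE('d::finite) M" and V: "riemannian_volume TYPE('d) M V"
    and f: "smooth_function TYPE('d) M f"
  shows "(\<lambda>x. norm (manifold_grad TYPE('d) M f x)) \<in> borel_measurable V"
    and "\<exists>G. \<forall>x\<in>M. norm (manifold_grad TYPE('d) M f x) \<le> G"
proof -
  let ?g = "\<lambda>x. norm (manifold_grad TYPE('d) M f x)"
  have cM: "compact M" using M by (simp add: compact_smooth_manifold_def)
  note vs = volume_sets[OF cM V]
  interpret V: finite_measure V by (rule volume_finite[OF M V])
  \<comment> \<open>Any decaying kernel with positive second moment would reveal the gradient. The
    weight \<open>1 powr 1\<close> below is the constant 1 in the shape \<open>p powr s\<close> that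
    \<open>mean_pointwise\<close> expects.\<close>
  define \<kappa> :: "real \<Rightarrow> real" where "\<kappa> = (\<lambda>\<xi>. exp (- \<xi>))"
  have \<kappa>: "decaying_kernel \<kappa> 1 1" unfolding decaying_kernel_def \<kappa>_def
    by (intro conjI exI[of _ "\<lambda>\<xi>. - exp (- \<xi>)"] exI[of _ "\<lambda>\<xi>. exp (- \<xi>)"] continuous_intros allI impI)
       (auto intro!: derivative_eq_intros)
  have kc: "continuous_on {0..} \<kappa>" using \<kappa> by (simp add: decaying_kernel_def)
  define m where "m = kernel_moment TYPE('d) \<kappa> 2"
  have m: "m > 0" unfolding m_def by (rule kernel_moment_pos[OF \<kappa>, of 0]) (auto simp: \<kappa>_def)
  define q :: "real ^ 'D \<Rightarrow> real" where "q = (\<lambda>_. 1 powr 1)"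
  have fc: "continuous_on M f" and qc: "continuous_on M q"
    using smooth_function_continuous_on[OF M f] by (auto simp: q_def)
  obtain C where C: "C \<ge> 0" "\<And>x d. x \<in> M \<Longrightarrow> 0 < d \<Longrightarrow> d \<le> 1 \<Longrightarrow> \<bar>(\<integral>y. pair_energy \<kappa> 2 f q d x y \<partial>V) / d ^ CARD('d) - m * (?g x)\<^sup>2\<bar> \<le> C * d\<^sup>2"
    using mean_pointwise[OF M V f smooth_function_const[of _ _ 1] _ _ \<kappa>, of 1 1 2 1] unfolding m_def q_def by auto
  define G where "G k x = (\<integral>y. pair_energy \<kappa> 2 f q (1 / real (Suc k)) x y \<partial>V) / (1 / real (Suc k)) ^ CARD('d)" for k x
  have [measurable]: "G k \<in> borel_measurable V" for k
  proof -
    have "(\<lambda>x. \<integral>y. pair_energy \<kappa> 2 f q (1 / real (Suc k)) x y \<partial>V) \<in> borel_measurable V"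
      by (rule V.borel_measurable_lebesgue_integral[OF pair_energy_measurable[OF cM V kc fc qc]])
    then show ?thesis unfolding G_def[abs_def] by simp
  qed
  have lim: "(\<lambda>k. G k x) \<longlonglongrightarrow> m * (?g x)\<^sup>2" if "x \<in> space V" for x
  proof -
    have x: "x \<in> M" using that vs(2) by simp
    have "(\<lambda>k. C * (1 / real (Suc k))\<^sup>2) \<longlonglongrightarrow> C * 0\<^sup>2" 
      by (intro tendsto_intros) (use LIMSEQ_inverse_real_of_nat in \<open>simp add: inverse_eq_divide\<close>)
    then have "(\<lambda>k. C * (1 / real (Suc k))\<^sup>2) \<longlonglongrightarrow> 0" by simp
    then have "(\<lambda>k. G k x - m * (?g x)\<^sup>2) \<longlonglongrightarrow> 0"
      by (rule Lim_null_comparison[rotated]) (use C(2)[OF x] in \<open>auto simp: G_def intro!: always_eventually\<close>)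
    then show ?thesis by (simp add: LIM_zero_iff)
  qed
  have "(\<lambda>x. m * (?g x)\<^sup>2) \<in> borel_measurable V"
    by (rule borel_measurable_LIMSEQ_real[OF lim]) auto
  then have "(\<lambda>x. sqrt (m * (?g x)\<^sup>2 / m)) \<in> borel_measurable V" by measurable
  then show "?g \<in> borel_measurable V" using m by simp
  obtain K where K: "\<And>x y. x \<in> M \<Longrightarrow> y \<in> M \<Longrightarrow> \<bar>pair_energy \<kappa> 2 f q 1 x y\<bar> \<le> K"
    using pair_energy_bounded[OF cM kc fc qc, of 1 2] by auto
  \<comment> \<open>Boundedness needs no limit: already at d = 1 the average is at most K times the
    volume, and the expansion error is at most C.\<close>
  have "?g x \<le> sqrt ((K * measure V M + C) / m)" if x: "x \<in> M" for x
  proof -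
    have "\<bar>\<integral>y. pair_energy \<kappa> 2 f q 1 x y \<partial>V\<bar> \<le> (\<integral>y. K \<partial>V)"
    proof (rule integral_abs_bound[THEN order_trans], rule integral_mono)
      have [measurable]: "pair_energy \<kappa> 2 f q 1 x \<in> borel_measurable V"
        by (intro borel_measurable_volume[OF cM V] pair_energy_continuous(2)[OF kc fc qc _ x]) simp
      show "integrable V (\<lambda>y. \<bar>pair_energy \<kappa> 2 f q 1 x y\<bar>)"
        by (intro integrable_abs V.integrable_const_bound[of _ K]) (use K x vs(2) in auto)
    qed (use K x vs(2) in auto)
    also have "\<dots> = K * measure V M" using vs(2) by simp
    finally have "m * (?g x)\<^sup>2 \<le> K * measure V M + C" using C(2)[OF x, of 1] by simp
    then have "(?g x)\<^sup>2 \<le> (K * measure V M + C) / m" using m by (simp add: field_simps)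
    then show ?thesis by (rule real_le_rsqrt)
  qed
  then show "\<exists>G. \<forall>x\<in>M. ?g x \<le> G" by blast
qed

lemma mean_integral:
  fixes M :: "(real ^ 'D::finite) set" and s :: real
  assumes M: "compact_smooth_manifold TYPE('d::finite) M" and V: "riemannian_volume TYPE('d) M V"
    and f: "smooth_function TYPE('d) M f" and p: "smooth_function TYPE('d) M p"
    and b: "0 < lo" "\<And>x. x \<in> M \<Longrightarrow> lo \<le> p x \<and> p x \<le> hi" and \<kappa>: "decaying_kernel \<kappa> a B" and n: "even n" "n > 0"
  defines "q \<equiv> (\<lambda>x. p x powr s)"
  shows "\<exists>C\<ge>0. \<forall>d. 0 < d \<and> d \<le> 1 \<longrightarrow>
    \<bar>(\<integral>x. (\<integral>y. pair_energy \<kappa> n f q d x y \<partial>V) \<partial>V) / d ^ CARD('d)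
      - kernel_moment TYPE('d) \<kappa> n * (\<integral>x. (q x)\<^sup>2 * norm (manifold_grad TYPE('d) M f x) ^ n \<partial>V)\<bar> \<le> C * d\<^sup>2"
proof -
  let ?g = "\<lambda>x. norm (manifold_grad TYPE('d) M f x)"
  have cM: "compact M" using M by (simp add: compact_smooth_manifold_def)
  note vs = volume_sets[OF cM V]
  interpret V: finite_measure V by (rule volume_finite[OF M V])
  have kc: "continuous_on {0..} \<kappa>" using \<kappa> by (auto simp: decaying_kernel_def)
  have pc: "continuous_on M p" and fc: "continuous_on M f"
    using smooth_function_continuous_on[OF M] p f by auto
  have qc: "continuous_on M q" unfolding q_def using pc b by (intro continuous_on_powr continuous_intros) force+
  obtain C where C: "C \<ge> 0" "\<And>x d. x \<in> M \<Longrightarrow> 0 < d \<Longrightarrow> d \<le> 1 \<Longrightarrow>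
    \<bar>(\<integral>y. pair_energy \<kappa> n f q d x y \<partial>V) / d ^ CARD('d) - kernel_moment TYPE('d) \<kappa> n * ((q x)\<^sup>2 * ?g x ^ n)\<bar> \<le> C * d\<^sup>2"
    using mean_pointwise[OF M V f p b \<kappa> n, of s] unfolding q_def by blast
  have [measurable]: "q \<in> borel_measurable V" by (rule borel_measurable_volume[OF cM V qc])
  note [measurable] = grad_measurable_bounded(1)[OF M V f]
  obtain G where G: "\<And>x. x \<in> M \<Longrightarrow> ?g x \<le> G" using grad_measurable_bounded(2)[OF M V f] by blast
  obtain qm where qm: "\<And>x. x \<in> M \<Longrightarrow> \<bar>q x\<bar> \<le> qm" using bounded_on_compact[OF cM qc] by blast
  have int0: "integrable V (\<lambda>x. (q x)\<^sup>2 * ?g x ^ n)"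
  proof (rule V.integrable_const_bound[of _ "qm\<^sup>2 * G ^ n"])
    show "AE x in V. norm ((q x)\<^sup>2 * ?g x ^ n) \<le> qm\<^sup>2 * G ^ n"
    proof (rule AE_I2)
      fix x assume "x \<in> space V"
      then have x: "x \<in> M" using vs(2) by simp
      have "(q x)\<^sup>2 \<le> qm\<^sup>2" using qm[OF x] by (metis abs_ge_zero power2_abs power_mono)
      moreover have "?g x ^ n \<le> G ^ n" using G[OF x] by (intro power_mono) auto
      ultimately show "norm ((q x)\<^sup>2 * ?g x ^ n) \<le> qm\<^sup>2 * G ^ n"
        by (simp add: abs_mult mult_mono)
    qed
  qed measurable
  show ?thesis
  proof (intro exI[of _ "C * measure V M"] conjI allI impI)
    show "C * measure V M \<ge> 0" using C by simp
    fix d :: real assume d: "0 < d \<and> d \<le> 1"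
    let ?I = "\<lambda>x. \<integral>y. pair_energy \<kappa> n f q d x y \<partial>V"
    have [measurable]: "?I \<in> borel_measurable V"
      by (rule V.borel_measurable_lebesgue_integral[OF pair_energy_measurable[OF cM V kc fc qc]])
    obtain K where K: "\<And>x y. x \<in> M \<Longrightarrow> y \<in> M \<Longrightarrow> \<bar>pair_energy \<kappa> n f q d x y\<bar> \<le> K"
      using pair_energy_bounded[OF cM kc fc qc, of d n] d by auto
    have "\<bar>?I x\<bar> \<le> K * measure V M" if x: "x \<in> M" for x
    proof -
      have "\<bar>?I x\<bar> \<le> (\<integral>y. K \<partial>V)"
      proof (rule integral_abs_bound[THEN order_trans], rule integral_mono)
        have [measurable]: "pair_energy \<kappa> n f q d x \<in> borel_measurable V"
          using d by (intro borel_measurable_volume[OF cM V] pair_energy_continuous(2)[OF kc fc qc _ x]) simp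
        show "integrable V (\<lambda>y. \<bar>pair_energy \<kappa> n f q d x y\<bar>)"
          by (intro integrable_abs V.integrable_const_bound[of _ K]) (use K x vs(2) in auto)
      qed (use K x vs(2) in auto)
      also have "\<dots> = K * measure V M" using vs(2) by simp
      finally show ?thesis .
    qed
    then have "integrable V ?I"
      by (intro V.integrable_const_bound[of _ "K * measure V M"]) (use vs(2) in auto)
    then have int1: "integrable V (\<lambda>x. ?I x / d ^ CARD('d))" by simp
    have "\<bar>(\<integral>x. ?I x \<partial>V) / d ^ CARD('d) - kernel_moment TYPE('d) \<kappa> n * (\<integral>x. (q x)\<^sup>2 * ?g x ^ n \<partial>V)\<bar>
      = \<bar>\<integral>x. ?I x / d ^ CARD('d) - kernel_moment TYPE('d) \<kappa> n * ((q x)\<^sup>2 * ?g x ^ n) \<partial>V\<bar>"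
      using int0 int1 by simp
    also have "\<dots> \<le> (\<integral>x. C * d\<^sup>2 \<partial>V)"
    proof (rule integral_abs_bound[THEN order_trans], rule integral_mono)
      show "integrable V (\<lambda>x. \<bar>?I x / d ^ CARD('d) - kernel_moment TYPE('d) \<kappa> n * ((q x)\<^sup>2 * ?g x ^ n)\<bar>)"
        by (intro integrable_abs Bochner_Integration.integrable_diff int1 integrable_mult_right int0)
    qed (use C d vs(2) in auto)
    finally show "\<bar>(\<integral>x. ?I x \<partial>V) / d ^ CARD('d) - kernel_moment TYPE('d) \<kappa> n * (\<integral>x. (q x)\<^sup>2 * ?g x ^ n \<partial>V)\<bar> \<le> C * measure V M * d\<^sup>2"
      using vs(2) by (simp add: mult_ac)
  qed
qed

text \<open>The volume element is positive, so the gradient vanishes almost everywhere in the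
  coordinates; by continuity the differential of f vanishes on the whole chart ball, and f is
  constant there by convexity. Pairs within one ball contribute 0 and all other pairs are far
  apart.\<close>

lemma pair_energy_locally_constant:
  fixes M :: "(real ^ 'D::finite) set"
  assumes M: "compact_smooth_manifold TYPE('d::finite) M" and V: "riemannian_volume TYPE('d) M V"
    and f: "smooth_function TYPE('d) M f" and ae: "AE x in V. manifold_grad TYPE('d) M f x = 0"
    and \<kappa>: "decaying_kernel \<kappa> a B" and n: "n > 0" and qc: "continuous_on M q"
  shows "\<exists>C\<ge>0. \<forall>x\<in>M. \<forall>y\<in>M. \<forall>d. 0 < d \<and> d \<le> 1 \<longrightarrow> \<bar>pair_energy \<kappa> n f q d x y\<bar> / d ^ k \<le> C * d\<^sup>2"
proof -
  let ?g = "\<lambda>x. norm (manifold_grad TYPE('d) M f x)"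
  have cM: "compact M" using M by (simp add: compact_smooth_manifold_def)
  note vs = volume_sets[OF cM V]
  have fc: "continuous_on M f" using smooth_function_continuous_on[OF M f] .
  obtain Fm where Fm: "\<And>x. x \<in> M \<Longrightarrow> \<bar>f x\<bar> \<le> Fm" using bounded_on_compact[OF cM fc] by blast
  obtain qm where qm: "\<And>x. x \<in> M \<Longrightarrow> \<bar>q x\<bar> \<le> qm" using bounded_on_compact[OF cM qc] by blast
  obtain N :: nat and U and \<phi> :: "nat \<Rightarrow> real ^ 'd \<Rightarrow> real ^ 'D" and u0 R c where
    gc: "\<And>i. i < N \<Longrightarrow> good_chart M (U i) (\<phi> i) (u0 i) (R i) (c i)" and cov: "M = (\<Union>i<N. \<phi> i ` ball (u0 i) (R i / 2))"
    using good_chart_cover[OF M] by blast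
  have eq: "f (\<phi> i u) = f (\<phi> i w)" if i: "i < N" and uw: "u \<in> ball (u0 i) (R i)" "w \<in> ball (u0 i) (R i)" for i u w
  proof -
    note g = good_chartD[OF gc[OF i]]
    note l = local_paramD[OF g(1)]
    let ?S = "ball (u0 i) (R i)"
    have S: "?S \<subseteq> U i" "?S \<in> sets borel" using g(3) by auto
    define F where "F = f \<circ> \<phi> i"
    have F: "C_inf_on (U i) F" using f g(1) unfolding smooth_function_def F_def by blast
    note gm = grad_measurable_bounded(1)[OF M V f]
    have "AE x in V. indicator (\<phi> i ` ?S) x * ennreal (?g x) = 0" using ae by eventually_elim simp
    then have "(\<integral>\<^sup>+x. indicator (\<phi> i ` ?S) x * ennreal (?g x) \<partial>V) = (\<integral>\<^sup>+x. 0 \<partial>V)"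
      by (rule nn_integral_cong_AE)
    also have "(\<integral>\<^sup>+x. indicator (\<phi> i ` ?S) x * ennreal (?g x) \<partial>V) = (\<integral>\<^sup>+u. indicator ?S u * ennreal (volume_element (\<phi> i) u) * ennreal (?g (\<phi> i u)) \<partial>lborel)"
      by (rule chart_nn_integral[OF cM V g(1) S, where h = "\<lambda>x. ennreal (?g x)"]) (use gm in measurable)
    also have "\<dots> = (\<integral>\<^sup>+u. ennreal (indicator ?S u * (volume_element (\<phi> i) u * ?g (\<phi> i u))) \<partial>lborel)"
      using det_metric_tensor_pos[OF g(1)] S(1)
      by (intro nn_integral_cong) (auto simp: indicator_def ennreal_mult less_imp_le subset_iff)
    finally have "(\<integral>\<^sup>+u. ennreal (indicator ?S u * (volume_element (\<phi> i) u * ?g (\<phi> i u))) \<partial>lborel) = 0" by simp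
    then have "AE u in lborel. ennreal (indicator ?S u * (volume_element (\<phi> i) u * ?g (\<phi> i u))) = 0"
      using chart_integral(2)[OF cM V g(1) S gm] by (subst (asm) nn_integral_0_iff_AE) auto
    \<comment> \<open>Null sets pass from V to Lebesgue measure because the volume element is
      strictly positive on the ball.\<close>
    then have ae': "AE u in lborel. u \<in> ?S \<longrightarrow> manifold_grad TYPE('d) M f (\<phi> i u) = 0"
    proof eventually_elim
      case (elim u)
      show ?case
      proof
        assume u: "u \<in> ?S"
        then have J: "volume_element (\<phi> i) u > 0" using det_metric_tensor_pos[OF g(1)] S(1) by auto
        then have "0 \<le> volume_element (\<phi> i) u * ?g (\<phi> i u)" by simp
        then have "volume_element (\<phi> i) u * ?g (\<phi> i u) = 0" using elim u by (simp add: ennreal_eq_0_iff)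
        then show "manifold_grad TYPE('d) M f (\<phi> i u) = 0" using J by simp
      qed
    qed
    have zero: "dmap F u z = 0" if u: "u \<in> ?S" for u z
    proof (rule continuous_AE_zero[of ?S "\<lambda>u. dmap F u z"])
      show "continuous_on ?S (\<lambda>u. dmap F u z)" using continuous_on_dmap[OF F] S(1) continuous_on_subset by blast
      show "AE u in lborel. u \<in> ?S \<longrightarrow> dmap F u z = 0"
        using ae'
      proof eventually_elim
        case (elim u)
        show ?case
        proof
          assume u: "u \<in> ?S"
          then have uU: "u \<in> U i" using S(1) by blast
          show "dmap F u z = 0"
            using elim u manifold_grad_chart(2)[OF g(1) uU f, of z, symmetric] by (simp add: F_def)
        qed
      qed
    qed (use u in auto)
    have "\<exists>c. \<forall>x\<in>?S. F x = c"
    proof (rule has_derivative_zero_constant[OF convex_ball])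
      fix x assume x: "x \<in> ?S"
      then have "(F has_derivative dmap F x) (at x within ?S)"
        using C_inf_on_has_derivative[OF F] S(1) by (blast intro: has_derivative_at_withinI)
      moreover have "dmap F x = (\<lambda>h. 0)" using zero[OF x] by auto
      ultimately show "(F has_derivative (\<lambda>h. 0)) (at x within ?S)" by simp
    qed
    then show ?thesis using uw by (auto simp: F_def)
  qed
  have "\<exists>C\<ge>0. \<forall>x\<in>\<phi> i ` ball (u0 i) (R i / 2). \<forall>y\<in>M. \<forall>d. 0 < d \<and> d \<le> 1 \<longrightarrow> \<bar>pair_energy \<kappa> n f q d x y\<bar> / d ^ k \<le> C * d\<^sup>2" if i: "i < N" for i
  proof -
    note g = good_chartD[OF gc[OF i]]
    let ?W = "\<phi> i ` ball (u0 i) (R i)"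
    obtain r where r: "r > 0" "\<And>x y. x\<in>\<phi> i ` cball (u0 i) (R i/2) \<Longrightarrow> y\<in>M - ?W \<Longrightarrow> r \<le> norm (x - y)"
      using chart_separation[OF cM gc[OF i]] by blast
    have "\<exists>C\<ge>0. \<forall>x\<in>M. \<forall>y\<in>M. \<forall>d. r \<le> norm (x - y) \<and> 0 < d \<and> d \<le> 1 \<longrightarrow> \<bar>pair_energy \<kappa> n f q d x y\<bar> / d ^ k \<le> C * d\<^sup>2"
      by (rule pair_energy_far[OF \<kappa> r(1) Fm qm])
    then obtain C where C: "C \<ge> 0" "\<forall>x\<in>M. \<forall>y\<in>M. \<forall>d. r \<le> norm (x - y) \<and> 0 < d \<and> d \<le> 1 \<longrightarrow> \<bar>pair_energy \<kappa> n f q d x y\<bar> / d ^ k \<le> C * d\<^sup>2"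
      by (elim exE conjE)
    show ?thesis
    proof (intro exI[of _ C] conjI ballI allI impI)
      fix x y and d :: real assume x: "x \<in> \<phi> i ` ball (u0 i) (R i / 2)" and y: "y \<in> M" and d: "0 < d \<and> d \<le> 1"
      have xM: "x \<in> M" using x i cov by blast
      show "\<bar>pair_energy \<kappa> n f q d x y\<bar> / d ^ k \<le> C * d\<^sup>2"
      proof (cases "y \<in> ?W")
        case True
        have "ball (u0 i) (R i / 2) \<subseteq> ball (u0 i) (R i)" using g(2) by auto
        then have "f x = f y" using eq[OF i] x True by blast
        then show ?thesis using n C(1) by (simp add: pair_energy_def zero_power)
      next
        case False
        have "r \<le> norm (x - y)" using x y False by (intro r(2)) auto
        then show ?thesis using C(2) xM y d by blast
      qed
    qed (rule C(1))
  qed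
  then obtain C where C: "\<And>i. i < N \<Longrightarrow> C i \<ge> 0" 
    "\<And>i x y d. i < N \<Longrightarrow> x\<in>\<phi> i ` ball (u0 i) (R i / 2) \<Longrightarrow> y\<in>M \<Longrightarrow> 0 < d \<and> d \<le> 1 \<Longrightarrow> \<bar>pair_energy \<kappa> n f q d x y\<bar> / d ^ k \<le> C i * d\<^sup>2"
    by metis
  show ?thesis
  proof (intro exI[of _ "\<Sum>i<N. C i"] conjI ballI allI impI)
    show "(\<Sum>i<N. C i) \<ge> 0" using C(1) by (auto intro: sum_nonneg)
    fix x y and d :: real assume x: "x \<in> M" and y: "y \<in> M" and d: "0 < d \<and> d \<le> 1"
    from x obtain i where i: "i < N" and u: "x \<in> \<phi> i ` ball (u0 i) (R i / 2)" unfolding cov by auto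
    have "C i \<le> (\<Sum>i<N. C i)" using C(1) i by (intro member_le_sum) auto
    then have le: "C i * d\<^sup>2 \<le> (\<Sum>i<N. C i) * d\<^sup>2" by (intro mult_right_mono) auto
    show "\<bar>pair_energy \<kappa> n f q d x y\<bar> / d ^ k \<le> (\<Sum>i<N. C i) * d\<^sup>2"
      using C(2)[OF i u y d] le by linarith
  qed
qed

section \<open>Concentration of two-sample averages\<close>

text \<open>For y = -x negative, exp x dominates 1 + x + x^2 / 2, and the reciprocal of the latter
  is at most 1 - x + x^2, since their product is 1 plus nonnegative terms.\<close>

lemma exp_le_quadratic:
  fixes y :: real
  assumes "\<bar>y\<bar> \<le> 1"
  shows "exp y \<le> 1 + y + y\<^sup>2"
proof (cases "0 \<le> y")
  case True then show ?thesis using assms exp_bound by simp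
next
  case False
  define x where "x = - y"
  have x: "0 \<le> x" using False by (simp add: x_def)
  have pos: "0 < 1 + x + x\<^sup>2 / 2" using x by (intro add_pos_nonneg) auto
  have "exp y = 1 / exp x" by (simp add: x_def exp_minus field_simps)
  also have "\<dots> \<le> 1 / (1 + x + x\<^sup>2 / 2)"
    using exp_lower_Taylor_quadratic[OF x] pos by (intro divide_left_mono) auto
  also have "\<dots> \<le> 1 - x + x\<^sup>2"
  proof -
    have "(1 - x + x\<^sup>2) * (1 + x + x\<^sup>2 / 2) = 1 + x\<^sup>2 / 2 + x ^ 3 / 2 + x ^ 4 / 2"
      by (simp add: field_simps power2_eq_square power3_eq_cube power4_eq_xxxx)
    then have "1 \<le> (1 - x + x\<^sup>2) * (1 + x + x\<^sup>2 / 2)" using x by simp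
    then show ?thesis using pos by (simp add: pos_divide_le_eq)
  qed
  finally show ?thesis by (simp add: x_def)
qed

definition residue_pairs :: "nat \<Rightarrow> nat \<Rightarrow> (nat \<times> nat) set" where
  "residue_pairs N c = {(i, j). i < j \<and> j < N \<and> (i + j) mod N = c}"

lemma residue_pairs_finite: "finite (residue_pairs N c)"
  by (rule finite_subset[of _ "{..<N} \<times> {..<N}"]) (auto simp: residue_pairs_def)

lemma residue_cancel:
  fixes i j k N :: nat
  assumes "j < N" "k < N" "(i + j) mod N = (i + k) mod N"
  shows "j = k"
proof -
  have *: "a = b" if "a \<le> b" "b < N" "(i + b) mod N = (i + a) mod N" for a b
  proof -
    have "N dvd (i + b) - (i + a)" using that by (subst mod_eq_dvd_iff_nat[symmetric]) auto
    then show ?thesis using that by (auto dest: dvd_imp_le)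
  qed
  show ?thesis using *[of j k] *[of k j] assms by (cases "j \<le> k") auto
qed

text \<open>Within a class one index determines the other modulo N. A coincidence of equal positions
  makes the two pairs equal; a crossed coincidence would make the pairs reverses of each other,
  against i < j and k < l.\<close>

lemma residue_pairs_disjoint:
  "disjoint_family_on (\<lambda>(i, j). {i, j}) (residue_pairs N c)"
  unfolding disjoint_family_on_def
proof (intro ballI impI)
  fix p q assume p: "p \<in> residue_pairs N c" and q: "q \<in> residue_pairs N c" and "p \<noteq> q"
  obtain i j where ij: "p = (i, j)" by (cases p)
  obtain k l where kl: "q = (k, l)" by (cases q)
  have 1: "i < j" "j < N" "(i + j) mod N = c" using p by (auto simp: residue_pairs_def ij)
  have 2: "k < l" "l < N" "(k + l) mod N = c" using q by (auto simp: residue_pairs_def kl)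
  have "i \<noteq> k" using residue_cancel[of j N l i] 1 2 \<open>p \<noteq> q\<close> ij kl by auto
  moreover have "j \<noteq> l" using residue_cancel[of i N k j] 1 2 \<open>p \<noteq> q\<close> ij kl by (auto simp: add.commute)
  moreover have "i \<noteq> l" using residue_cancel[of j N k i] 1 2 by (auto simp: add.commute)
  moreover have "j \<noteq> k" using residue_cancel[of i N l j] 1 2 by (auto simp: add.commute)
  ultimately show "(case p of (i, j) \<Rightarrow> {i, j}) \<inter> (case q of (i, j) \<Rightarrow> {i, j}) = {}" by (auto simp: ij kl)
qed

text \<open>The pairs of a class are disjoint two-element subsets of the N indices.\<close>

lemma residue_pairs_card: "2 * card (residue_pairs N c) \<le> N"
proof -
  have "card (\<Union>p\<in>residue_pairs N c. (\<lambda>(i, j). {i, j}) p) = (\<Sum>p\<in>residue_pairs N c. card ((\<lambda>(i, j). {i, j}) p))"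
    using residue_pairs_disjoint[of N c] by (intro card_UN_disjoint residue_pairs_finite) (auto simp: disjoint_family_on_def)
  also have "\<dots> = (\<Sum>p\<in>residue_pairs N c. 2)"
    by (intro sum.cong) (auto simp: residue_pairs_def)
  also have "\<dots> = 2 * card (residue_pairs N c)" by simp
  finally have "2 * card (residue_pairs N c) = card (\<Union>p\<in>residue_pairs N c. (\<lambda>(i, j). {i, j}) p)" by simp
  also have "\<dots> \<le> card {..<N}" by (intro card_mono) (auto simp: residue_pairs_def)
  finally show ?thesis by simp
qed

text \<open>The classes partition the pairs with i < j; symmetry accounts for the factor 2, and the
  diagonal vanishes.\<close>

lemma sum_off_diagonal:
  fixes g :: "nat \<Rightarrow> nat \<Rightarrow> real"
  assumes sym: "\<And>i j. i < N \<Longrightarrow> j < N \<Longrightarrow> g i j = g j i" and diag: "\<And>i. i < N \<Longrightarrow> g i i = 0"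
  shows "(\<Sum>i<N. \<Sum>j<N. g i j) = 2 * (\<Sum>c<N. \<Sum>(i, j)\<in>residue_pairs N c. g i j)"
proof -
  let ?A = "{(i, j). i < j \<and> j < N}" and ?B = "{(i, j). j < i \<and> i < N}" and ?D = "{(i, j). i = j \<and> j < N}"
  have fin: "finite ?A" "finite ?B" "finite ?D"
    by (rule finite_subset[of _ "{..<N} \<times> {..<N}"], auto)+
  have "(\<Sum>i<N. \<Sum>j<N. g i j) = (\<Sum>(i, j)\<in>{..<N} \<times> {..<N}. g i j)" by (simp add: sum.cartesian_product)
  also have "{..<N} \<times> {..<N} = (?A \<union> ?B) \<union> ?D" by auto
  also have "(\<Sum>(i, j)\<in>\<dots>. g i j) = (\<Sum>(i, j)\<in>?A \<union> ?B. g i j) + (\<Sum>(i, j)\<in>?D. g i j)"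
    using fin by (intro sum.union_disjoint) auto
  also have "(\<Sum>(i, j)\<in>?D. g i j) = 0" using diag by (intro sum.neutral) auto
  also have "(\<Sum>(i, j)\<in>?A \<union> ?B. g i j) = (\<Sum>(i, j)\<in>?A. g i j) + (\<Sum>(i, j)\<in>?B. g i j)"
    using fin by (intro sum.union_disjoint) auto
  also have "(\<Sum>(i, j)\<in>?B. g i j) = (\<Sum>(i, j)\<in>?A. g i j)"
    by (rule sum.reindex_bij_witness[of _ "\<lambda>(i, j). (j, i)" "\<lambda>(i, j). (j, i)"]) (auto simp: sym)
  also have "(\<Sum>(i, j)\<in>?A. g i j) = (\<Sum>c<N. \<Sum>(i, j)\<in>residue_pairs N c. g i j)"
  proof -
    have "?A = (\<Union>c<N. residue_pairs N c)" by (auto simp: residue_pairs_def)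
    then show ?thesis
      by (simp only:) (rule sum.UNION_disjoint, auto simp: residue_pairs_finite, auto simp: residue_pairs_def)
  qed
  finally show ?thesis by simp
qed

section \<open>Exponential moments and tails of one residue class\<close>

lemma (in prob_space) coordinates_indep:
  assumes I: "finite I" "I \<noteq> {}"
  shows "prob_space.indep_vars (PiM I (\<lambda>_. M)) (\<lambda>_. M) (\<lambda>i \<omega>. \<omega> i) I"
proof -
  interpret P: prob_space "PiM I (\<lambda>_. M)" by (intro prob_space_PiM prob_space_axioms)
  have "distr (PiM I (\<lambda>_. M)) (PiM I (\<lambda>_. M)) (\<lambda>x. \<lambda>i\<in>I. x i) = distr (PiM I (\<lambda>_. M)) (PiM I (\<lambda>_. M)) (\<lambda>x. x)"
    by (rule distr_cong) (auto simp: space_PiM PiE_restrict)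
  also have "\<dots> = PiM I (\<lambda>_. M)" by (rule distr_id)
  also have "\<dots> = PiM I (\<lambda>i. distr (PiM I (\<lambda>_. M)) M (\<lambda>\<omega>. \<omega> i))"
    using distr_PiM_component[of I "\<lambda>_. M"] prob_space_axioms by (intro PiM_cong) auto
  finally show ?thesis
    by (subst P.indep_vars_iff_distr_eq_PiM'[OF I(2)]) auto
qed

lemma (in prob_space) pair_distr:
  assumes I: "finite I" "i \<in> I" "j \<in> I" "i \<noteq> j"
  shows "distr (PiM I (\<lambda>_. M)) (M \<Otimes>\<^sub>M M) (\<lambda>\<omega>. (\<omega> i, \<omega> j)) = M \<Otimes>\<^sub>M M"
proof -
  interpret P: prob_space "PiM I (\<lambda>_. M)" by (intro prob_space_PiM prob_space_axioms)
  have "I \<noteq> {}" using I by auto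
  have "P.indep_var (PiM {i} (\<lambda>_. M)) (\<lambda>\<omega>. restrict (\<lambda>i. \<omega> i) {i}) (PiM {j} (\<lambda>_. M)) (\<lambda>\<omega>. restrict (\<lambda>i. \<omega> i) {j})"
    using I by (intro P.indep_var_restrict[OF coordinates_indep[OF I(1) \<open>I \<noteq> {}\<close>]]) auto
  then have "P.indep_var M ((\<lambda>f. f i) \<circ> (\<lambda>\<omega>. restrict (\<lambda>i. \<omega> i) {i})) M ((\<lambda>f. f j) \<circ> (\<lambda>\<omega>. restrict (\<lambda>i. \<omega> i) {j}))"
    by (rule P.indep_var_compose) auto
  then have "P.indep_var M (\<lambda>\<omega>. \<omega> i) M (\<lambda>\<omega>. \<omega> j)" by (simp add: comp_def)
  then have "distr (PiM I (\<lambda>_. M)) M (\<lambda>\<omega>. \<omega> i) \<Otimes>\<^sub>M distr (PiM I (\<lambda>_. M)) M (\<lambda>\<omega>. \<omega> j) = distr (PiM I (\<lambda>_. M)) (M \<Otimes>\<^sub>M M) (\<lambda>\<omega>. (\<omega> i, \<omega> j))"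
    by (simp add: P.indep_var_distribution_eq)
  then show ?thesis using distr_PiM_component[of I "\<lambda>_. M"] prob_space_axioms I by simp
qed

text \<open>For |g| \<le> 1 and mean 0, the quadratic bound on exp gives a moment generating
  function of at most 1 + v \<le> exp v for one pair. Disjoint pairs are independent, and a class
  has at most N / 2 of them.\<close>

lemma (in prob_space) residue_class_mgf:
  fixes g :: "'a \<Rightarrow> 'a \<Rightarrow> real" and N c :: nat
  assumes g: "(\<lambda>(x, y). g x y) \<in> borel_measurable (M \<Otimes>\<^sub>M M)"
    and b: "\<And>x y. x \<in> space M \<Longrightarrow> y \<in> space M \<Longrightarrow> \<bar>g x y\<bar> \<le> 1"
    and m0: "(\<integral>z. (case z of (x, y) \<Rightarrow> g x y) \<partial>(M \<Otimes>\<^sub>M M)) = 0"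
    and m2: "(\<integral>z. (case z of (x, y) \<Rightarrow> (g x y)\<^sup>2) \<partial>(M \<Otimes>\<^sub>M M)) \<le> v"
  defines "P \<equiv> PiM {..<N} (\<lambda>_. M)"
  defines "S \<equiv> (\<lambda>\<omega>. \<Sum>(i, j)\<in>residue_pairs N c. g (\<omega> i) (\<omega> j))"
  shows "integrable P (\<lambda>\<omega>. exp (S \<omega>))" "(\<integral>\<omega>. exp (S \<omega>) \<partial>P) \<le> exp (real N * v / 2)" "S \<in> borel_measurable P"
proof -
  interpret P: prob_space P unfolding P_def by (intro prob_space_PiM prob_space_axioms)
  interpret MM: pair_prob_space M M by standard
  let ?C = "residue_pairs N c"
  have comp[measurable]: "(\<lambda>\<omega>. \<omega> i) \<in> P \<rightarrow>\<^sub>M M" if "i < N" for i using that unfolding P_def by simp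
  have sp: "\<omega> i \<in> space M" if "\<omega> \<in> space P" "i < N" for \<omega> i
    using that measurable_space[OF comp] by blast
  have ijN: "i < N \<and> j < N \<and> i \<noteq> j" if "(i, j) \<in> ?C" for i j using that by (auto simp: residue_pairs_def)
  have gm: "(\<lambda>\<omega>. g (\<omega> i) (\<omega> j)) \<in> borel_measurable P" if "i < N" "j < N" for i j
  proof -
    have "(\<lambda>\<omega>. (\<omega> i, \<omega> j)) \<in> P \<rightarrow>\<^sub>M M \<Otimes>\<^sub>M M" using comp that by (intro measurable_Pair) auto
    from measurable_compose[OF this g] show ?thesis by simp
  qed
  show Sm: "S \<in> borel_measurable P" unfolding S_def
    by (intro borel_measurable_sum) (use gm ijN in auto)
  have gi: "integrable (M \<Otimes>\<^sub>M M) (\<lambda>(x, y). g x y)"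
    using g b by (intro MM.P.integrable_const_bound[of _ 1]) (auto simp: space_pair_measure intro!: AE_I2)
  have g2i: "integrable (M \<Otimes>\<^sub>M M) (\<lambda>z. (case z of (x, y) \<Rightarrow> g x y)\<^sup>2)"
    using g b by (intro MM.P.integrable_const_bound[of _ 1]) (auto simp: space_pair_measure abs_square_le_1 intro!: AE_I2)
  have one: "(\<integral>\<omega>. exp (g (\<omega> i) (\<omega> j)) \<partial>P) \<le> exp v" "0 \<le> (\<integral>\<omega>. exp (g (\<omega> i) (\<omega> j)) \<partial>P)" if ij: "(i, j) \<in> ?C" for i j
  proof -
    have e: "(\<lambda>z. exp (case z of (x, y) \<Rightarrow> g x y)) \<in> borel_measurable (M \<Otimes>\<^sub>M M)" using g by measurable
    have "(\<integral>\<omega>. exp (g (\<omega> i) (\<omega> j)) \<partial>P) = (\<integral>z. exp (case z of (x, y) \<Rightarrow> g x y) \<partial>distr P (M \<Otimes>\<^sub>M M) (\<lambda>\<omega>. (\<omega> i, \<omega> j)))"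
      using e comp ijN[OF ij] by (subst integral_distr) auto
    also have "distr P (M \<Otimes>\<^sub>M M) (\<lambda>\<omega>. (\<omega> i, \<omega> j)) = M \<Otimes>\<^sub>M M" unfolding P_def using ijN[OF ij] by (intro pair_distr) auto
    also have "(\<integral>z. exp (case z of (x, y) \<Rightarrow> g x y) \<partial>(M \<Otimes>\<^sub>M M)) \<le> (\<integral>z. 1 + (case z of (x, y) \<Rightarrow> g x y) + (case z of (x, y) \<Rightarrow> g x y)\<^sup>2 \<partial>(M \<Otimes>\<^sub>M M))"
    proof (rule integral_mono)
      show "integrable (M \<Otimes>\<^sub>M M) (\<lambda>z. exp (case z of (x, y) \<Rightarrow> g x y))"
      proof (rule MM.P.integrable_const_bound[of _ "exp 1"])
        show "AE z in M \<Otimes>\<^sub>M M. norm (exp (case z of (x, y) \<Rightarrow> g x y)) \<le> exp 1"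
          using b by (intro AE_I2) (auto simp: space_pair_measure abs_le_iff)
      qed (rule e)
      show "integrable (M \<Otimes>\<^sub>M M) (\<lambda>z. 1 + (case z of (x, y) \<Rightarrow> g x y) + (case z of (x, y) \<Rightarrow> g x y)\<^sup>2)"
        by (intro Bochner_Integration.integrable_add gi g2i) simp
      fix z assume "z \<in> space (M \<Otimes>\<^sub>M M)"
      then show "exp (case z of (x, y) \<Rightarrow> g x y) \<le> 1 + (case z of (x, y) \<Rightarrow> g x y) + (case z of (x, y) \<Rightarrow> g x y)\<^sup>2"
        using b by (intro exp_le_quadratic) (auto simp: space_pair_measure)
    qed
    also have "\<dots> = 1 + (\<integral>z. (case z of (x, y) \<Rightarrow> (g x y)\<^sup>2) \<partial>(M \<Otimes>\<^sub>M M))"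
      using gi g2i m0 by (simp add: MM.P.prob_space case_prod_unfold)
    also have "\<dots> \<le> 1 + v" using m2 by simp
    also have "\<dots> \<le> exp v" by (rule exp_ge_add_one_self)
    finally show "(\<integral>\<omega>. exp (g (\<omega> i) (\<omega> j)) \<partial>P) \<le> exp v" .
    show "0 \<le> (\<integral>\<omega>. exp (g (\<omega> i) (\<omega> j)) \<partial>P)" by (intro Bochner_Integration.integral_nonneg) simp
  qed
  have v0: "0 \<le> v"
  proof -
    have "0 \<le> (\<integral>z. (case z of (x, y) \<Rightarrow> (g x y)\<^sup>2) \<partial>(M \<Otimes>\<^sub>M M))" by (intro Bochner_Integration.integral_nonneg) auto
    then show ?thesis using m2 by simp
  qed
  have Sb: "\<bar>S \<omega>\<bar> \<le> real (card ?C)" if "\<omega> \<in> space P" for \<omega>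
  proof -
    have "\<bar>S \<omega>\<bar> \<le> (\<Sum>(i, j)\<in>?C. \<bar>g (\<omega> i) (\<omega> j)\<bar>)" unfolding S_def case_prod_unfold by (rule sum_abs)
    also have "\<dots> \<le> (\<Sum>p\<in>?C. 1)"
    proof (rule sum_mono)
      fix p assume p: "p \<in> ?C"
      obtain i j where ij: "p = (i, j)" by (cases p)
      have "i < N" "j < N" using ijN p by (auto simp: ij)
      then show "(case p of (i, j) \<Rightarrow> \<bar>g (\<omega> i) (\<omega> j)\<bar>) \<le> 1" using b sp[OF that] by (simp add: ij)
    qed
    finally show ?thesis by simp
  qed
  show "integrable P (\<lambda>\<omega>. exp (S \<omega>))"
  proof (rule P.integrable_const_bound[of _ "exp (real (card ?C))"])
    show "AE \<omega> in P. norm (exp (S \<omega>)) \<le> exp (real (card ?C))"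
      using Sb by (intro AE_I2) (auto simp: abs_le_iff)
  qed (use Sm in measurable)
  show "(\<integral>\<omega>. exp (S \<omega>) \<partial>P) \<le> exp (real N * v / 2)"
  proof (cases "?C = {}")
    case True
    then show ?thesis using v0 by (simp add: S_def P.prob_space)
  next
    case False
    then have N: "{..<N} \<noteq> {}" by (auto simp: residue_pairs_def)
    let ?K = "\<lambda>(i, j). {i, j}"
    have "P.indep_vars (\<lambda>p. PiM (?K p) (\<lambda>_. M)) (\<lambda>p \<omega>. restrict (\<lambda>i. \<omega> i) (?K p)) ?C"
      using coordinates_indep[OF _ N] residue_pairs_disjoint unfolding P_def[symmetric]
      by (intro P.indep_vars_restrict) (auto simp: residue_pairs_def)
    then have "P.indep_vars (\<lambda>_. borel) (\<lambda>p. (\<lambda>f. exp (g (f (fst p)) (f (snd p)))) \<circ> (\<lambda>\<omega>. restrict (\<lambda>i. \<omega> i) (?K p))) ?C"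
    proof (rule P.indep_vars_compose)
      fix p assume "p \<in> ?C"
      obtain i j where p: "p = (i, j)" by (cases p)
      have "(\<lambda>f. (f i, f j)) \<in> PiM {i, j} (\<lambda>_. M) \<rightarrow>\<^sub>M M \<Otimes>\<^sub>M M" by (intro measurable_Pair) auto
      from measurable_compose[OF this g] show "(\<lambda>f. exp (g (f (fst p)) (f (snd p)))) \<in> borel_measurable (PiM (?K p) (\<lambda>_. M))"
        by (simp add: p)
    qed
    then have ind: "P.indep_vars (\<lambda>_. borel) (\<lambda>p \<omega>. exp (g (\<omega> (fst p)) (\<omega> (snd p)))) ?C"
      by (simp add: comp_def case_prod_unfold)
    have ei: "integrable P (\<lambda>\<omega>. exp (g (\<omega> (fst p)) (\<omega> (snd p))))" if p: "p \<in> ?C" for p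
    proof (rule P.integrable_const_bound[of _ "exp 1"])
      show "AE \<omega> in P. norm (exp (g (\<omega> (fst p)) (\<omega> (snd p)))) \<le> exp 1"
      proof (rule AE_I2)
        fix \<omega> assume "\<omega> \<in> space P"
        then have "\<bar>g (\<omega> (fst p)) (\<omega> (snd p))\<bar> \<le> 1" using p ijN[of "fst p" "snd p"] by (intro b sp) auto
        then show "norm (exp (g (\<omega> (fst p)) (\<omega> (snd p)))) \<le> exp 1" by simp
      qed
      show "(\<lambda>\<omega>. exp (g (\<omega> (fst p)) (\<omega> (snd p)))) \<in> borel_measurable P"
        using gm[of "fst p" "snd p"] p ijN[of "fst p" "snd p"] by (auto intro: measurable_compose)
    qed
    have "(\<integral>\<omega>. exp (S \<omega>) \<partial>P) = (\<integral>\<omega>. (\<Prod>p\<in>?C. exp (g (\<omega> (fst p)) (\<omega> (snd p)))) \<partial>P)"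
      unfolding S_def by (simp add: exp_sum[OF residue_pairs_finite] case_prod_unfold)
    also have "\<dots> = (\<Prod>p\<in>?C. \<integral>\<omega>. exp (g (\<omega> (fst p)) (\<omega> (snd p))) \<partial>P)"
      by (rule P.indep_vars_lebesgue_integral[OF residue_pairs_finite ind ei])
    also have "\<dots> \<le> (\<Prod>p\<in>?C. exp v)"
      by (intro prod_mono) (use one in auto)
    also have "\<dots> = exp (real (card ?C) * v)" by (simp add: exp_of_nat_mult)
    also have "\<dots> \<le> exp (real N * v / 2)"
    proof -
      have "real (2 * card ?C) \<le> real N" using residue_pairs_card by (simp only: of_nat_le_iff)
      then have "real (card ?C) \<le> real N / 2" by simp
      from mult_right_mono[OF this v0] show ?thesis by simp
    qed
    finally show ?thesis .
  qed
qed

text \<open>Markov's inequality with the multiplier l = t / v, which minimizes N l^2 v / 2 - l N t.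
  The condition t L \<le> v is precisely what makes l g bounded by 1.\<close>

lemma (in prob_space) residue_class_tail:
  fixes g :: "'a \<Rightarrow> 'a \<Rightarrow> real" and N c :: nat
  assumes g: "(\<lambda>(x, y). g x y) \<in> borel_measurable (M \<Otimes>\<^sub>M M)"
    and b: "\<And>x y. x \<in> space M \<Longrightarrow> y \<in> space M \<Longrightarrow> \<bar>g x y\<bar> \<le> L"
    and m0: "(\<integral>z. (case z of (x, y) \<Rightarrow> g x y) \<partial>(M \<Otimes>\<^sub>M M)) = 0"
    and m2: "(\<integral>z. (case z of (x, y) \<Rightarrow> (g x y)\<^sup>2) \<partial>(M \<Otimes>\<^sub>M M)) \<le> v"
    and t: "t > 0" "v > 0" "t * L \<le> v"
  defines "P \<equiv> PiM {..<N} (\<lambda>_. M)"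
  shows "measure P {\<omega>\<in>space P. (\<Sum>(i, j)\<in>residue_pairs N c. g (\<omega> i) (\<omega> j)) \<ge> real N * t} \<le> exp (- real N * t\<^sup>2 / (2 * v))"
proof -
  interpret P: prob_space P unfolding P_def by (intro prob_space_PiM prob_space_axioms)
  define l where "l = t / v"
  have l: "l > 0" using t by (simp add: l_def)
  let ?S = "\<lambda>\<omega>. \<Sum>(i, j)\<in>residue_pairs N c. l * g (\<omega> i) (\<omega> j)"
  have 1: "(\<lambda>(x, y). l * g x y) \<in> borel_measurable (M \<Otimes>\<^sub>M M)" using g by (simp add: case_prod_unfold)
  have 2: "\<bar>l * g x y\<bar> \<le> 1" if "x \<in> space M" "y \<in> space M" for x y
  proof -
    have "\<bar>l * g x y\<bar> \<le> l * L" using b[OF that] l by (simp add: abs_mult mult_left_mono)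
    also have "\<dots> \<le> 1" using t by (simp add: l_def field_simps)
    finally show ?thesis .
  qed
  have 3: "(\<integral>z. (case z of (x, y) \<Rightarrow> l * g x y) \<partial>(M \<Otimes>\<^sub>M M)) = 0" using m0 by (simp add: case_prod_unfold)
  have 4: "(\<integral>z. (case z of (x, y) \<Rightarrow> (l * g x y)\<^sup>2) \<partial>(M \<Otimes>\<^sub>M M)) \<le> l\<^sup>2 * v"
    using mult_left_mono[OF m2, of "l\<^sup>2"] by (simp add: case_prod_unfold power_mult_distrib)
  note mg = residue_class_mgf[OF 1 2 3 4, of N c, folded P_def]
  have eq: "?S \<omega> = l * (\<Sum>(i, j)\<in>residue_pairs N c. g (\<omega> i) (\<omega> j))" for \<omega>
    by (simp add: sum_distrib_left case_prod_unfold)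
  have "{\<omega>\<in>space P. (\<Sum>(i, j)\<in>residue_pairs N c. g (\<omega> i) (\<omega> j)) \<ge> real N * t} = {\<omega>\<in>space P. exp (?S \<omega>) \<ge> exp (l * (real N * t))}"
    unfolding eq using l by auto
  also have "measure P \<dots> \<le> (\<integral>\<omega>. exp (?S \<omega>) \<partial>P) / exp (l * (real N * t))"
    by (rule integral_Markov_inequality_measure[OF mg(1) sets.top]) auto
  also have "\<dots> \<le> exp (real N * (l\<^sup>2 * v) / 2) / exp (l * (real N * t))"
    using mg(2) by (intro divide_right_mono) auto
  also have "\<dots> = exp (- real N * t\<^sup>2 / (2 * v))"
  proof -
    have "real N * (l\<^sup>2 * v) / 2 - l * (real N * t) = - real N * t\<^sup>2 / (2 * v)"
      using t by (simp add: l_def field_simps power2_eq_square)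
    then show ?thesis by (simp add: exp_diff[symmetric])
  qed
  finally show ?thesis .
qed

text \<open>The factor 2 N counts two signs and N classes. On the good event each class sum is at
  most N t, so twice their total is at most 2 N^2 t. The centering is N (N - 1) E because the
  diagonal summands are 0 instead of having mean E.\<close>

lemma (in prob_space) u_statistic_concentration:
  fixes h :: "'a \<Rightarrow> 'a \<Rightarrow> real" and N :: nat
  assumes h: "(\<lambda>(x, y). h x y) \<in> borel_measurable (M \<Otimes>\<^sub>M M)"
    and b: "\<And>x y. x \<in> space M \<Longrightarrow> y \<in> space M \<Longrightarrow> 0 \<le> h x y \<and> h x y \<le> L"
    and sym: "\<And>x y. h x y = h y x" and diag: "\<And>x. h x x = 0"
    and m2: "(\<integral>z. (case z of (x, y) \<Rightarrow> (h x y)\<^sup>2) \<partial>(M \<Otimes>\<^sub>M M)) \<le> v"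
    and t: "t > 0" "v > 0" "t * L \<le> v" and N: "N > 0"
  defines "E \<equiv> (\<integral>z. (case z of (x, y) \<Rightarrow> h x y) \<partial>(M \<Otimes>\<^sub>M M))"
  defines "P \<equiv> PiM {..<N} (\<lambda>_. M)"
  shows "\<exists>A\<in>sets P. measure P A \<ge> 1 - 2 * real N * exp (- real N * t\<^sup>2 / (2 * v)) \<and>
    (\<forall>\<omega>\<in>A. \<bar>(\<Sum>i<N. \<Sum>j<N. h (\<omega> i) (\<omega> j)) - real N * (real N - 1) * E\<bar> \<le> 2 * (real N)\<^sup>2 * t)"
proof -
  interpret P: prob_space P unfolding P_def by (intro prob_space_PiM prob_space_axioms)
  interpret MM: pair_prob_space M M by standard
  have hi: "integrable (M \<Otimes>\<^sub>M M) (\<lambda>z. case z of (x, y) \<Rightarrow> h x y)"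
    using h b by (intro MM.P.integrable_const_bound[of _ L]) (auto simp: space_pair_measure intro!: AE_I2)
  have L0: "0 \<le> L" 
  proof -
    obtain x where "x \<in> space M" using not_empty by blast
    then show ?thesis using b[of x x] by linarith
  qed
  have h2i: "integrable (M \<Otimes>\<^sub>M M) (\<lambda>z. (case z of (x, y) \<Rightarrow> h x y)\<^sup>2)"
    using h b by (intro MM.P.integrable_const_bound[of _ "L\<^sup>2"]) (auto simp: space_pair_measure intro!: AE_I2 power_mono)
  have "E \<le> (\<integral>z. L \<partial>(M \<Otimes>\<^sub>M M))" unfolding E_def using hi b by (intro integral_mono) (auto simp: space_pair_measure)
  also have "\<dots> = L" using MM.P.prob_space by (simp del: space_pair_measure)
  finally have E: "0 \<le> E" "E \<le> L"
    unfolding E_def using b by (auto simp: space_pair_measure intro!: integral_nonneg_AE AE_I2)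
  define g where "g = (\<lambda>x y. h x y - E)"
  have g1: "(\<lambda>(x, y). g x y) \<in> borel_measurable (M \<Otimes>\<^sub>M M)" "(\<lambda>(x, y). - g x y) \<in> borel_measurable (M \<Otimes>\<^sub>M M)"
    using h by (auto simp: g_def case_prod_unfold)
  have g2: "\<bar>g x y\<bar> \<le> L" "\<bar>- g x y\<bar> \<le> L" if "x \<in> space M" "y \<in> space M" for x y
    using b[OF that] E by (auto simp: g_def)
  have g3: "(\<integral>z. (case z of (x, y) \<Rightarrow> g x y) \<partial>(M \<Otimes>\<^sub>M M)) = 0" 
    using hi by (simp add: g_def case_prod_unfold E_def MM.P.prob_space)
  then have g3': "(\<integral>z. (case z of (x, y) \<Rightarrow> - g x y) \<partial>(M \<Otimes>\<^sub>M M)) = 0" by (simp add: case_prod_unfold)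
  have g4: "(\<integral>z. (case z of (x, y) \<Rightarrow> (g x y)\<^sup>2) \<partial>(M \<Otimes>\<^sub>M M)) \<le> v" 
  proof -
    \<comment> \<open>Centering lowers the second moment by E^2, so v still bounds it.\<close>
    have "(\<integral>z. (case z of (x, y) \<Rightarrow> (g x y)\<^sup>2) \<partial>(M \<Otimes>\<^sub>M M)) = (\<integral>z. (case z of (x, y) \<Rightarrow> h x y)\<^sup>2 + E\<^sup>2 - 2 * E * (case z of (x, y) \<Rightarrow> h x y) \<partial>(M \<Otimes>\<^sub>M M))"
      by (intro Bochner_Integration.integral_cong) (auto simp: g_def power2_diff)
    also have "\<dots> = (\<integral>z. (case z of (x, y) \<Rightarrow> h x y)\<^sup>2 \<partial>(M \<Otimes>\<^sub>M M)) + E\<^sup>2 - 2 * E * E"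
      using hi h2i by (simp add: MM.P.prob_space E_def)
    also have "\<dots> \<le> v"
    proof -
      have "(\<integral>z. (case z of (x, y) \<Rightarrow> h x y)\<^sup>2 \<partial>(M \<Otimes>\<^sub>M M)) \<le> v" using m2 by (simp add: case_prod_unfold)
      moreover have "E\<^sup>2 - 2 * E * E \<le> 0" by (simp add: power2_eq_square)
      ultimately show ?thesis by linarith
    qed
    finally show ?thesis .
  qed
  then have g4': "(\<integral>z. (case z of (x, y) \<Rightarrow> (- g x y)\<^sup>2) \<partial>(M \<Otimes>\<^sub>M M)) \<le> v" by simp
  let ?S = "\<lambda>c \<omega>. \<Sum>(i, j)\<in>residue_pairs N c. g (\<omega> i) (\<omega> j)"
  let ?S' = "\<lambda>c \<omega>. \<Sum>(i, j)\<in>residue_pairs N c. - g (\<omega> i) (\<omega> j)"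
  have S': "?S' c \<omega> = - ?S c \<omega>" for c \<omega> by (simp add: sum_negf case_prod_unfold)
  have comp[measurable]: "(\<lambda>\<omega>. \<omega> i) \<in> P \<rightarrow>\<^sub>M M" if "i < N" for i using that unfolding P_def by simp
  have [measurable]: "?S c \<in> borel_measurable P" for c
  proof (rule borel_measurable_sum)
    fix p assume p: "p \<in> residue_pairs N c"
    obtain i j where ij: "p = (i, j)" by (cases p)
    have "(\<lambda>\<omega>. (\<omega> i, \<omega> j)) \<in> P \<rightarrow>\<^sub>M M \<Otimes>\<^sub>M M" using comp p by (intro measurable_Pair) (auto simp: ij residue_pairs_def)
    from measurable_compose[OF this g1(1)] show "(\<lambda>\<omega>. case p of (i, j) \<Rightarrow> g (\<omega> i) (\<omega> j)) \<in> borel_measurable P" by (simp add: ij)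
  qed
  let ?e = "exp (- real N * t\<^sup>2 / (2 * v))"
  define B where "B c = {\<omega>\<in>space P. ?S c \<omega> \<ge> real N * t} \<union> {\<omega>\<in>space P. ?S' c \<omega> \<ge> real N * t}" for c
  have Bm[measurable]: "B c \<in> sets P" for c unfolding B_def S' by measurable
  have Bp: "measure P (B c) \<le> 2 * ?e" for c
  proof -
    have "measure P (B c) \<le> measure P {\<omega>\<in>space P. ?S c \<omega> \<ge> real N * t} + measure P {\<omega>\<in>space P. ?S' c \<omega> \<ge> real N * t}"
      unfolding B_def by (rule measure_Un_le) (unfold S', measurable)
    also have "\<dots> \<le> ?e + ?e"
      unfolding P_def
      by (intro add_mono residue_class_tail[OF g1(1) g2(1) g3 g4 t] residue_class_tail[OF g1(2) g2(2) g3' g4' t])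
    finally show ?thesis by simp
  qed
  define A where "A = space P - (\<Union>c<N. B c)"
  show ?thesis
  proof (intro bexI[of _ A] conjI ballI)
    show "A \<in> sets P" unfolding A_def by measurable
    have "measure P (\<Union>c<N. B c) \<le> (\<Sum>c<N. measure P (B c))"
      by (rule P.finite_measure_subadditive_finite) auto
    also have "\<dots> \<le> (\<Sum>c<N. 2 * ?e)" by (intro sum_mono Bp)
    also have "\<dots> = 2 * real N * ?e" by simp
    finally show "measure P A \<ge> 1 - 2 * real N * ?e"
      unfolding A_def by (subst P.prob_compl) auto
    fix \<omega> assume w: "\<omega> \<in> A"
    then have ws: "\<omega> \<in> space P" by (simp add: A_def)
    have Sc: "\<bar>?S c \<omega>\<bar> \<le> real N * t" if "c < N" for c
      using w that unfolding A_def B_def S' by (auto simp: abs_le_iff not_le less_imp_le)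
    \<comment> \<open>On the diagonal the centered kernel is -E, not 0, so it is set to 0 there
      before the classes are summed; the N copies of E are put back afterwards.\<close>
    define G where "G i j = (if i = j then 0 else g (\<omega> i) (\<omega> j))" for i j
    have "(\<Sum>(i, j)\<in>residue_pairs N c. G i j) = ?S c \<omega>" for c
      by (intro sum.cong) (auto simp: G_def residue_pairs_def)
    then have G1: "(\<Sum>i<N. \<Sum>j<N. G i j) = 2 * (\<Sum>c<N. ?S c \<omega>)"
      using sum_off_diagonal[of N G] by (simp add: G_def g_def sym)
    have "G i j = h (\<omega> i) (\<omega> j) - E + (if i = j then E else 0)" for i j
      by (simp add: G_def g_def diag)
    then have "(\<Sum>i<N. \<Sum>j<N. G i j) = (\<Sum>i<N. \<Sum>j<N. h (\<omega> i) (\<omega> j)) - real N * real N * E + real N * E"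
      by (simp add: sum.distrib sum_subtractf)
    then have eq: "(\<Sum>i<N. \<Sum>j<N. h (\<omega> i) (\<omega> j)) - real N * (real N - 1) * E = 2 * (\<Sum>c<N. ?S c \<omega>)"
      unfolding G1 by (simp add: algebra_simps)
    have "\<bar>\<Sum>c<N. ?S c \<omega>\<bar> \<le> (\<Sum>c<N. real N * t)"
      by (rule order_trans[OF sum_abs sum_mono]) (use Sc in auto)
    then show "\<bar>(\<Sum>i<N. \<Sum>j<N. h (\<omega> i) (\<omega> j)) - real N * (real N - 1) * E\<bar> \<le> 2 * (real N)\<^sup>2 * t"
      unfolding eq by (simp add: abs_mult power2_eq_square mult_ac)
  qed
qed

section \<open>The graph Dirichlet form\<close>

text \<open>The square decays at rate 2 a, but one exponential is bounded by 1 so that both kernels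
  share the rate a. The constant 4 B^2 is dictated by the second derivative of the square, 2 (k0'^2
  + k0 k0''). The positive supremum yields a point where the kernel is positive.\<close>

lemma admissible_kernel_decaying:
  assumes "admissible_kernel k0"
  obtains a B \<xi>0 where "decaying_kernel k0 a B" "decaying_kernel (\<lambda>\<xi>. (k0 \<xi>)\<^sup>2) a (4 * B\<^sup>2)"
    "\<And>\<xi>. \<xi> \<ge> 0 \<Longrightarrow> k0 \<xi> \<ge> 0" "\<xi>0 \<ge> 0" "k0 \<xi>0 > 0"
proof -
  note ak = assms[unfolded admissible_kernel_def]
  have c: "continuous_on {0..} k0" using ak by (rule conjunct1)
  note ak = ak[THEN conjunct2]
  have d: "((deriv ^^ l) k0) differentiable (at \<xi>)" if "l < 4" "\<xi> > 0" for l :: nat and \<xi>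
    using ak[THEN conjunct1, rule_format] that by blast
  note ak = ak[THEN conjunct2, THEN conjunct2]
  have nn: "k0 \<xi> \<ge> 0" if "\<xi> \<ge> 0" for \<xi> using ak[THEN conjunct1] that by blast
  note ak = ak[THEN conjunct2]
  have s: "(SUP \<xi>\<in>{0..}. ereal \<bar>k0 \<xi>\<bar>) > 0" using ak by (rule conjunct1)
  obtain a :: real and al :: "nat \<Rightarrow> real" where a: "a > 0"
    and all: "\<forall>l\<le>4. al l > 0 \<and> (\<forall>\<xi>>0. \<bar>(deriv ^^ l) k0 \<xi>\<bar> \<le> al l * exp (- a * \<xi>))"
    using ak[THEN conjunct2] by (elim exE conjE)
  have al: "al l > 0" "\<And>\<xi>. \<xi> > 0 \<Longrightarrow> \<bar>(deriv ^^ l) k0 \<xi>\<bar> \<le> al l * exp (- a * \<xi>)" if "l \<le> 4" for l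
    using all that by auto
  from s obtain \<xi>0 where x0: "\<xi>0 \<ge> 0" "0 < ereal \<bar>k0 \<xi>0\<bar>" unfolding less_SUP_iff by auto
  then have x0': "k0 \<xi>0 > 0" using nn[of \<xi>0] by simp
  define B where "B = al 0 + al 1 + al 2"
  have B: "B \<ge> 0" "al 0 \<le> B" "al 1 \<le> B" "al 2 \<le> B" using al(1)[of 0] al(1)[of 1] al(1)[of 2] by (auto simp: B_def)
  let ?k1 = "deriv k0" and ?k2 = "deriv (deriv k0)"
  have D1: "(k0 has_real_derivative ?k1 \<xi>) (at \<xi>)" if "\<xi> > 0" for \<xi>
    using d[of 0 \<xi>] that by (simp add: DERIV_deriv_iff_real_differentiable)
  have D2: "(?k1 has_real_derivative ?k2 \<xi>) (at \<xi>)" if "\<xi> > 0" for \<xi>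
    using d[of 1 \<xi>] that by (simp add: DERIV_deriv_iff_real_differentiable)
  have b: "\<bar>k0 \<xi>\<bar> \<le> B * exp (- a * \<xi>)" "\<bar>?k1 \<xi>\<bar> \<le> B * exp (- a * \<xi>)" "\<bar>?k2 \<xi>\<bar> \<le> B * exp (- a * \<xi>)" if "\<xi> > 0" for \<xi>
  proof -
    have m: "x * exp (- a * \<xi>) \<le> B * exp (- a * \<xi>)" if "x \<le> B" for x using that by (intro mult_right_mono) auto
    show "\<bar>k0 \<xi>\<bar> \<le> B * exp (- a * \<xi>)" using order_trans[OF al(2)[of 0 \<xi>] m[OF B(2)]] that by simp
    show "\<bar>?k1 \<xi>\<bar> \<le> B * exp (- a * \<xi>)" using order_trans[OF al(2)[of 1 \<xi>] m[OF B(3)]] that by simp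
    show "\<bar>?k2 \<xi>\<bar> \<le> B * exp (- a * \<xi>)" using order_trans[OF al(2)[of 2 \<xi>] m[OF B(4)]] that by (simp add: numeral_2_eq_2)
  qed
  have dk: "decaying_kernel k0 a B" unfolding decaying_kernel_def
    using a B c D1 D2 b by blast
  have dk2: "decaying_kernel (\<lambda>\<xi>. (k0 \<xi>)\<^sup>2) a (4 * B\<^sup>2)" unfolding decaying_kernel_def
  proof (intro conjI, goal_cases)
    case 3
    show "continuous_on {0..} (\<lambda>\<xi>. (k0 \<xi>)\<^sup>2)" using c by (intro continuous_intros)
  next
    case 4
    show ?case
    proof (rule exI[of _ "\<lambda>\<xi>. 2 * (k0 \<xi> * ?k1 \<xi>)"], rule exI[of _ "\<lambda>\<xi>. 2 * (?k1 \<xi> * ?k1 \<xi> + k0 \<xi> * ?k2 \<xi>)"], intro allI impI conjI)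
    fix \<xi> :: real assume x: "\<xi> > 0"
    show "((\<lambda>\<xi>. (k0 \<xi>)\<^sup>2) has_real_derivative 2 * (k0 \<xi> * ?k1 \<xi>)) (at \<xi>)"
      using D1[OF x] by (auto intro!: derivative_eq_intros)
    show "((\<lambda>\<xi>. 2 * (k0 \<xi> * ?k1 \<xi>)) has_real_derivative 2 * (?k1 \<xi> * ?k1 \<xi> + k0 \<xi> * ?k2 \<xi>)) (at \<xi>)"
      using D1[OF x] D2[OF x] by (auto intro!: derivative_eq_intros)
    define E where "E = exp (- a * \<xi>)"
    have E: "0 < E" "E \<le> 1" using a x by (auto simp: E_def)
    have pr: "\<bar>y * z\<bar> \<le> B\<^sup>2 * E" if "\<bar>y\<bar> \<le> B * E" "\<bar>z\<bar> \<le> B * E" for y z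
    proof -
      have "\<bar>y * z\<bar> \<le> (B * E) * (B * E)" unfolding abs_mult using that by (intro mult_mono) auto
      also have "\<dots> \<le> (B * E) * (B * 1)" using E B by (intro mult_left_mono) auto
      finally show ?thesis by (simp add: power2_eq_square mult_ac)
    qed
    note bb = b[OF x, folded E_def]
    have nn2: "0 \<le> B\<^sup>2 * E" using E by simp
    show "\<bar>(k0 \<xi>)\<^sup>2\<bar> \<le> 4 * B\<^sup>2 * exp (- a * \<xi>)"
      using pr[OF bb(1) bb(1)] nn2 unfolding E_def[symmetric] power2_eq_square[of "k0 \<xi>"] by linarith
    show "\<bar>2 * (k0 \<xi> * ?k1 \<xi>)\<bar> \<le> 4 * B\<^sup>2 * exp (- a * \<xi>)"
      using pr[OF bb(1) bb(2)] nn2 unfolding E_def[symmetric] by linarith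
    show "\<bar>2 * (?k1 \<xi> * ?k1 \<xi> + k0 \<xi> * ?k2 \<xi>)\<bar> \<le> 4 * B\<^sup>2 * exp (- a * \<xi>)"
    proof -
      have "\<bar>2 * (x + y)\<bar> \<le> 4 * z" if "\<bar>x\<bar> \<le> z" "\<bar>y\<bar> \<le> z" for x y z :: real using that unfolding abs_le_iff by auto
      from this[OF pr[OF bb(2) bb(2)] pr[OF bb(1) bb(3)]] show ?thesis unfolding E_def[symmetric] by (simp only: mult.assoc)
    qed
    qed
  qed (use a B in auto)
  show ?thesis by (rule that[OF dk dk2 nn x0(1) x0'])
qed

text \<open>Uniformity in d is the point: normalized summands are then of order d^(-dim), the same
  order as their second moment, so the condition t L \<le> v of the tail bound only asks t to be
  small. Within a chart ball f is Lipschitz in the ambient distance, so the squared difference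
  quotient is at most a constant times the kernel argument.\<close>

lemma pair_energy_uniform_bound:
  fixes M :: "(real ^ 'D::finite) set"
  assumes M: "compact_smooth_manifold TYPE('d::finite) M" 
    and f: "smooth_function TYPE('d) M f" and \<kappa>: "decaying_kernel \<kappa> a B" and qc: "continuous_on M q"
  shows "\<exists>K\<ge>0. \<forall>x\<in>M. \<forall>y\<in>M. \<forall>d. 0 < d \<and> d \<le> 1 \<longrightarrow> \<bar>pair_energy \<kappa> 2 f q d x y\<bar> \<le> K"
proof -
  have cM: "compact M" using M by (simp add: compact_smooth_manifold_def)
  have ab: "a > 0" "B \<ge> 0" using \<kappa> by (auto simp: decaying_kernel_def)
  have fc: "continuous_on M f" using smooth_function_continuous_on[OF M f] .
  obtain Fm where Fm: "\<And>x. x \<in> M \<Longrightarrow> \<bar>f x\<bar> \<le> Fm" using bounded_on_compact[OF cM fc] by blast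
  obtain qm where qm: "\<And>x. x \<in> M \<Longrightarrow> \<bar>q x\<bar> \<le> qm" using bounded_on_compact[OF cM qc] by blast
  obtain N :: nat and U and \<phi> :: "nat \<Rightarrow> real ^ 'd \<Rightarrow> real ^ 'D" and u0 R c where
    gc: "\<And>i. i < N \<Longrightarrow> good_chart M (U i) (\<phi> i) (u0 i) (R i) (c i)" and cov: "M = (\<Union>i<N. \<phi> i ` ball (u0 i) (R i / 2))"
    using good_chart_cover[OF M] by blast
  have "\<exists>K\<ge>0. \<forall>x\<in>\<phi> i ` ball (u0 i) (R i / 2). \<forall>y\<in>M. \<forall>d. 0 < d \<and> d \<le> 1 \<longrightarrow> \<bar>pair_energy \<kappa> 2 f q d x y\<bar> \<le> K" if i: "i < N" for i
  proof -
    note g = good_chartD[OF gc[OF i]]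
    note l = local_paramD[OF g(1)]
    let ?W = "\<phi> i ` ball (u0 i) (R i)"
    have F: "C_inf_on (U i) (f \<circ> \<phi> i)" using f g(1) unfolding smooth_function_def by blast
    obtain Lp where Lp: "Lp \<ge> 0" "\<And>u w. u \<in> cball (u0 i) (R i) \<Longrightarrow> w \<in> cball (u0 i) (R i) \<Longrightarrow> \<bar>(f \<circ> \<phi> i) w - (f \<circ> \<phi> i) u\<bar> \<le> Lp * norm (w - u)"
      using lipschitz_on_ball[OF l(1) C_inf_on_D[OF F] g(3)] by metis
    obtain r where r: "r > 0" "\<And>x y. x\<in>\<phi> i ` cball (u0 i) (R i/2) \<Longrightarrow> y\<in>M - ?W \<Longrightarrow> r \<le> norm (x - y)"
      using chart_separation[OF cM gc[OF i]] by blast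
    have "\<exists>C\<ge>0. \<forall>x\<in>M. \<forall>y\<in>M. \<forall>d. r \<le> norm (x - y) \<and> 0 < d \<and> d \<le> 1 \<longrightarrow> \<bar>pair_energy \<kappa> 2 f q d x y\<bar> / d ^ 0 \<le> C * d\<^sup>2"
      by (rule pair_energy_far[OF \<kappa> r(1) Fm qm])
    then obtain C where C: "C \<ge> 0" "\<forall>x\<in>M. \<forall>y\<in>M. \<forall>d. r \<le> norm (x - y) \<and> 0 < d \<and> d \<le> 1 \<longrightarrow> \<bar>pair_energy \<kappa> 2 f q d x y\<bar> / d ^ 0 \<le> C * d\<^sup>2"
      by (elim exE conjE)
    define K where "K = B * (Lp / c i)\<^sup>2 / a * (\<bar>qm\<bar> * \<bar>qm\<bar>)"
    have K: "K \<ge> 0" using ab by (simp add: K_def)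
    show ?thesis
    proof (intro exI[of _ "C + K"] conjI ballI allI impI)
      show "C + K \<ge> 0" using C K by simp
      fix x y and d :: real assume x: "x \<in> \<phi> i ` ball (u0 i) (R i / 2)" and y: "y \<in> M" and d: "0 < d \<and> d \<le> 1"
      have xM: "x \<in> M" using x i cov by blast
      show "\<bar>pair_energy \<kappa> 2 f q d x y\<bar> \<le> C + K"
      proof (cases "y \<in> ?W")
        case True
        then obtain w where w: "w \<in> ball (u0 i) (R i)" "y = \<phi> i w" by blast
        obtain u where u: "u \<in> ball (u0 i) (R i / 2)" "x = \<phi> i u" using x by blast
        have uw: "u \<in> cball (u0 i) (R i)" "w \<in> cball (u0 i) (R i)" using u w g(2) by auto
        have "\<bar>f x - f y\<bar> \<le> Lp * norm (u - w)" using Lp(2)[OF uw(2,1)] u w by simp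
        also have "\<dots> \<le> Lp * (norm (x - y) / c i)"
          using g(5)[OF uw] g(4) Lp(1) u w by (intro mult_left_mono) (auto simp: field_simps)
        finally have "\<bar>f x - f y\<bar> / d \<le> Lp / c i * (norm (x - y) / d)" using d by (simp add: field_simps)
        then have "(\<bar>f x - f y\<bar> / d)\<^sup>2 \<le> (Lp / c i * (norm (x - y) / d))\<^sup>2" using d by (intro power_mono) auto
        then have 1: "\<bar>((f x - f y) / d)\<^sup>2\<bar> \<le> (Lp / c i)\<^sup>2 * ((norm (x - y))\<^sup>2 / d\<^sup>2)"
          by (simp add: power_mult_distrib power_divide)
        define \<xi> where "\<xi> = (norm (x - y))\<^sup>2 / d\<^sup>2"
        have \<xi>: "\<xi> \<ge> 0" by (simp add: \<xi>_def)
        \<comment> \<open>The decay of the kernel beats the quadratic growth of the difference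
          quotient, since \<xi> exp (- a \<xi>) \<le> 1 / a.\<close>
        have "a * \<xi> \<le> exp (a * \<xi>)" using exp_ge_add_one_self[of "a * \<xi>"] by linarith
        then have e: "exp (- a * \<xi>) * \<xi> \<le> 1 / a" using ab by (simp add: exp_minus field_simps)
        have 3: "\<bar>q x * q y\<bar> \<le> \<bar>qm\<bar> * \<bar>qm\<bar>" unfolding abs_mult
          using qm[OF xM] qm[OF y] by (intro mult_mono) auto
        have "\<bar>pair_energy \<kappa> 2 f q d x y\<bar> \<le> (B * exp (- a * \<xi>)) * ((Lp / c i)\<^sup>2 * \<xi>) * (\<bar>qm\<bar> * \<bar>qm\<bar>)"
          unfolding pair_energy_def abs_mult[of "_ * _ ^ 2"] abs_mult[of "\<kappa> _"] \<xi>_def[symmetric]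
          using decaying_kernel_bound[OF \<kappa> \<xi>] 1 3 ab \<xi> by (intro mult_mono) (auto simp: \<xi>_def)
        also have "\<dots> = (B * (Lp / c i)\<^sup>2 * (\<bar>qm\<bar> * \<bar>qm\<bar>)) * (exp (- a * \<xi>) * \<xi>)" by (simp add: mult_ac)
        also have "\<dots> \<le> (B * (Lp / c i)\<^sup>2 * (\<bar>qm\<bar> * \<bar>qm\<bar>)) * (1 / a)" using e ab by (intro mult_left_mono) auto
        also have "\<dots> = K" by (simp add: K_def)
        finally show ?thesis using C(1) by linarith
      next
        case False
        have "r \<le> norm (x - y)" using x y False by (intro r(2)) auto
        then have "\<bar>pair_energy \<kappa> 2 f q d x y\<bar> / d ^ 0 \<le> C * d\<^sup>2" using C(2) xM y d by blast
        moreover have "C * d\<^sup>2 \<le> C" using C(1) d by (intro mult_left_le) (auto simp: power_le_one)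
        ultimately show ?thesis using K by simp
      qed
    qed
  qed
  then obtain K where K: "\<And>i. i < N \<Longrightarrow> K i \<ge> 0" 
    "\<And>i x y d. i < N \<Longrightarrow> x\<in>\<phi> i ` ball (u0 i) (R i / 2) \<Longrightarrow> y\<in>M \<Longrightarrow> 0 < d \<and> d \<le> 1 \<Longrightarrow> \<bar>pair_energy \<kappa> 2 f q d x y\<bar> \<le> K i"
    by metis
  show ?thesis
  proof (intro exI[of _ "\<Sum>i<N. K i"] conjI ballI allI impI)
    show "(\<Sum>i<N. K i) \<ge> 0" using K(1) by (auto intro: sum_nonneg)
    fix x y and d :: real assume x: "x \<in> M" and y: "y \<in> M" and d: "0 < d \<and> d \<le> 1"
    from x obtain i where i: "i < N" and u: "x \<in> \<phi> i ` ball (u0 i) (R i / 2)" unfolding cov by auto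
    have "K i \<le> (\<Sum>i<N. K i)" using K(1) i by (intro member_le_sum) auto
    then show "\<bar>pair_energy \<kappa> 2 f q d x y\<bar> \<le> (\<Sum>i<N. K i)" using K(2)[OF i u y d] by linarith
  qed
qed

section \<open>Sampling measure and reduction to pair energies\<close>

lemma smooth_densityD:
  fixes M :: "(real ^ 'D::finite) set"
  assumes M: "compact_smooth_manifold TYPE('d::finite) M" and V: "riemannian_volume TYPE('d) M V"
    and p: "smooth_density TYPE('d) M V p"
  shows "smooth_function TYPE('d) M p" "\<exists>lo hi. 0 < lo \<and> (\<forall>x\<in>M. lo \<le> p x \<and> p x \<le> hi)"
    "prob_space (density V (\<lambda>x. ennreal (p x)))" "\<And>x. x \<in> M \<Longrightarrow> p x > 0" "p \<in> borel_measurable V" "continuous_on M p"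
proof -
  have cM: "compact M" using M by (simp add: compact_smooth_manifold_def)
  note vs = volume_sets[OF cM V]
  interpret V: finite_measure V by (rule volume_finite[OF M V])
  show s: "smooth_function TYPE('d) M p" and lh: "\<exists>lo hi. 0 < lo \<and> (\<forall>x\<in>M. lo \<le> p x \<and> p x \<le> hi)"
    using p by (auto simp: smooth_density_def)
  then obtain lo hi where b: "0 < lo" "\<And>x. x \<in> M \<Longrightarrow> lo \<le> p x \<and> p x \<le> hi" by blast
  show pos: "\<And>x. x \<in> M \<Longrightarrow> p x > 0" using b by force
  show pc: "continuous_on M p" by (rule smooth_function_continuous_on[OF M s])
  show pm: "p \<in> borel_measurable V" by (rule borel_measurable_volume[OF cM V pc])
  have "integrable V p" by (rule V.integrable_const_bound[of _ hi]) (use b vs(2) pm in force)+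
  then have "(\<integral>\<^sup>+x. ennreal (p x) \<partial>V) = ennreal (\<integral>x. p x \<partial>V)"
    using pos vs(2) by (intro nn_integral_eq_integral) (auto intro!: AE_I2 less_imp_le)
  also have "\<dots> = 1" using p by (simp add: smooth_density_def)
  finally show "prob_space (density V (\<lambda>x. ennreal (p x)))"
    using pm by (intro prob_spaceI) (simp add: emeasure_density cong: nn_integral_cong)
qed

lemma integral_pair_density:
  fixes M :: "(real ^ 'D::finite) set" and g :: "real ^ 'D \<Rightarrow> real ^ 'D \<Rightarrow> real"
  assumes M: "compact_smooth_manifold TYPE('d::finite) M" and V: "riemannian_volume TYPE('d) M V"
    and p: "smooth_density TYPE('d) M V p"
    and g: "(\<lambda>(x, y). g x y) \<in> borel_measurable (V \<Otimes>\<^sub>M V)" and b: "\<And>x y. x \<in> M \<Longrightarrow> y \<in> M \<Longrightarrow> \<bar>g x y\<bar> \<le> K"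
  defines "\<mu> \<equiv> density V (\<lambda>x. ennreal (p x))"
  shows "(\<integral>z. (case z of (x, y) \<Rightarrow> g x y) \<partial>(\<mu> \<Otimes>\<^sub>M \<mu>)) = (\<integral>x. (\<integral>y. g x y * (p x * p y) \<partial>V) \<partial>V)"
proof -
  have cM: "compact M" using M by (simp add: compact_smooth_manifold_def)
  note vs = volume_sets[OF cM V]
  note pd = smooth_densityD[OF M V p]
  interpret prob_space \<mu> unfolding \<mu>_def by (rule pd(3))
  interpret MM: pair_prob_space \<mu> \<mu> by standard
  interpret V: finite_measure V by (rule volume_finite[OF M V])
  have s[measurable_cong]: "sets \<mu> = sets V" by (simp add: \<mu>_def)
  have sp: "space \<mu> = M" by (simp add: \<mu>_def vs(2))
  note [measurable] = g pd(5)
  have p0: "AE x in V. 0 \<le> p x" using pd(4) vs(2) by (intro AE_I2) (auto intro: less_imp_le)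
  have gm: "(\<lambda>z. case z of (x, y) \<Rightarrow> g x y) \<in> borel_measurable (\<mu> \<Otimes>\<^sub>M \<mu>)" by measurable
  have int: "integrable (\<mu> \<Otimes>\<^sub>M \<mu>) (\<lambda>z. case z of (x, y) \<Rightarrow> g x y)"
    by (rule MM.P.integrable_const_bound[of _ K]) (use b gm sp in \<open>auto simp: space_pair_measure intro!: AE_I2\<close>)
  have "(\<integral>z. (case z of (x, y) \<Rightarrow> g x y) \<partial>(\<mu> \<Otimes>\<^sub>M \<mu>)) = (\<integral>x. (\<integral>y. g x y \<partial>\<mu>) \<partial>\<mu>)"
    using MM.integral_fst'[OF int] by simp
  also have "\<dots> = (\<integral>x. (\<integral>y. p y * g x y \<partial>V) \<partial>\<mu>)"
  proof (rule Bochner_Integration.integral_cong[OF refl])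
    fix x assume x: "x \<in> space \<mu>"
    have "(\<lambda>y. g x y) \<in> borel_measurable V" using measurable_Pair2[OF g, of x] x sp vs(2) by simp
    then show "(\<integral>y. g x y \<partial>\<mu>) = (\<integral>y. p y * g x y \<partial>V)"
      unfolding \<mu>_def using p0 pd(5) by (subst integral_density) auto
  qed
  also have "\<dots> = (\<integral>x. p x * (\<integral>y. p y * g x y \<partial>V) \<partial>V)"
  proof -
    have "(\<lambda>x. \<integral>y. p y * g x y \<partial>V) \<in> borel_measurable V"
      by (rule V.borel_measurable_lebesgue_integral) measurable
    then show ?thesis unfolding \<mu>_def using p0 pd(5) by (subst integral_density) auto
  qed
  also have "\<dots> = (\<integral>x. (\<integral>y. g x y * (p x * p y) \<partial>V) \<partial>V)"
    by (rule Bochner_Integration.integral_cong[OF refl]) (simp add: mult_ac flip: integral_mult_right_zero)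
  finally show ?thesis .
qed

lemma sqrt_power_eq_powr:
  assumes "\<epsilon> > 0"
  shows "sqrt \<epsilon> ^ k = \<epsilon> powr (real k / 2)"
proof -
  have "sqrt \<epsilon> ^ k = sqrt \<epsilon> powr real k" using assms by (simp add: powr_realpow)
  also have "\<dots> = (\<epsilon> powr (1/2)) powr real k" using assms by (simp add: powr_half_sqrt)
  finally show ?thesis by (simp add: powr_powr)
qed

text \<open>The factor 1 / \<epsilon> goes into the squared difference quotient and the power of
  \<epsilon> into \<open>sqrt \<epsilon> ^ CARD('d)\<close>. Positivity of p makes
  \<open>p powr 0\<close> equal to 1, so the case \<beta> = 0 of the weight fits the same
  formula.\<close>

lemma graph_dirichlet_pair_energy:
  fixes x :: "nat \<Rightarrow> real ^ 'D::finite"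
  assumes "\<epsilon> > 0" and p: "\<And>i. i < N \<Longrightarrow> p (x i) > 0"
  shows "graph_dirichlet TYPE('d::finite) k0 \<beta> p \<epsilon> N x f =
    1 / (real N)\<^sup>2 * (\<Sum>i<N. \<Sum>j<N. pair_energy k0 2 f (\<lambda>y. p y powr (- \<beta>)) (sqrt \<epsilon>) (x i) (x j) / (kernel_m2 TYPE('d) k0 * sqrt \<epsilon> ^ CARD('d)))"
proof -
  have e: "\<epsilon> powr (- real CARD('d) / 2) = 1 / sqrt \<epsilon> ^ CARD('d)"
    unfolding sqrt_power_eq_powr[OF assms(1)] by (simp add: powr_minus_divide)
  have t: "1 / (\<epsilon> * kernel_m2 TYPE('d) k0) * (\<epsilon> powr (- real CARD('d) / 2) * graph_weight k0 \<beta> p \<epsilon> (x i) (x j) * (f (x i) - f (x j))\<^sup>2)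
    = pair_energy k0 2 f (\<lambda>y. p y powr (- \<beta>)) (sqrt \<epsilon>) (x i) (x j) / (kernel_m2 TYPE('d) k0 * sqrt \<epsilon> ^ CARD('d))" if "i < N" "j < N" for i j
  proof -
    have w: "graph_weight k0 \<beta> p \<epsilon> (x i) (x j) = k0 ((norm (x i - x j))\<^sup>2 / \<epsilon>) * (p (x i) powr (- \<beta>) * p (x j) powr (- \<beta>))"
      unfolding graph_weight_def using p[OF that(1)] p[OF that(2)] by (simp add: powr_minus_divide)
    have s: "(sqrt \<epsilon>)\<^sup>2 = \<epsilon>" using assms(1) by simp
    show ?thesis unfolding w e pair_energy_def power_divide s
      by (simp add: field_simps)
  qed
  have "graph_dirichlet TYPE('d::finite) k0 \<beta> p \<epsilon> N x f = 1 / (real N)\<^sup>2 * (\<Sum>i<N. \<Sum>j<N. 1 / (\<epsilon> * kernel_m2 TYPE('d) k0) * (\<epsilon> powr (- real CARD('d) / 2) * graph_weight k0 \<beta> p \<epsilon> (x i) (x j) * (f (x i) - f (x j))\<^sup>2))"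
    unfolding graph_dirichlet_def sum_distrib_left[symmetric] by (simp add: mult_ac)
  also have "\<dots> = 1 / (real N)\<^sup>2 * (\<Sum>i<N. \<Sum>j<N. pair_energy k0 2 f (\<lambda>y. p y powr (- \<beta>)) (sqrt \<epsilon>) (x i) (x j) / (kernel_m2 TYPE('d) k0 * sqrt \<epsilon> ^ CARD('d)))"
    by (intro arg_cong[of _ _ "(*) (1 / (real N)\<^sup>2)"] sum.cong refl t) auto
  finally show ?thesis .
qed

text \<open>Absorbing the two sampling densities raises the exponent from s to s + 1, and both
  points merge in the limit, whence 2 s + 2. The values s = -\<beta> and s = -2 \<beta> produce the
  exponents 2 - 2 \<beta> and 2 - 4 \<beta> of the theorem.\<close>

lemma mean_density:
  fixes M :: "(real ^ 'D::finite) set" and s :: real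
  assumes M: "compact_smooth_manifold TYPE('d::finite) M" and V: "riemannian_volume TYPE('d) M V"
    and f: "smooth_function TYPE('d) M f" and p: "smooth_density TYPE('d) M V p"
    and \<kappa>: "decaying_kernel \<kappa> a B" and n: "even n" "n > 0"
  defines "\<mu> \<equiv> density V (\<lambda>x. ennreal (p x))"
  shows "\<exists>C\<ge>0. \<forall>d. 0 < d \<and> d \<le> 1 \<longrightarrow>
    \<bar>(\<integral>z. (case z of (x, y) \<Rightarrow> pair_energy \<kappa> n f (\<lambda>x. p x powr s) d x y) \<partial>(\<mu> \<Otimes>\<^sub>M \<mu>)) / d ^ CARD('d)
      - kernel_moment TYPE('d) \<kappa> n * (\<integral>x. p x powr (2 * s + 2) * norm (manifold_grad TYPE('d) M f x) ^ n \<partial>V)\<bar> \<le> C * d\<^sup>2"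
proof -
  have cM: "compact M" using M by (simp add: compact_smooth_manifold_def)
  note vs = volume_sets[OF cM V] and pd = smooth_densityD[OF M V p]
  obtain lo hi where b: "0 < lo" "\<And>x. x \<in> M \<Longrightarrow> lo \<le> p x \<and> p x \<le> hi" using pd(2) by blast
  have kc: "continuous_on {0..} \<kappa>" using \<kappa> by (auto simp: decaying_kernel_def)
  have fc: "continuous_on M f" by (rule smooth_function_continuous_on[OF M f])
  have qc: "continuous_on M (\<lambda>x. p x powr s)" using pd(4,6) by (intro continuous_on_powr continuous_intros) force+
  have eq1: "(\<integral>z. (case z of (x, y) \<Rightarrow> pair_energy \<kappa> n f (\<lambda>x. p x powr s) d x y) \<partial>(\<mu> \<Otimes>\<^sub>M \<mu>))
    = (\<integral>x. (\<integral>y. pair_energy \<kappa> n f (\<lambda>x. p x powr (s + 1)) d x y \<partial>V) \<partial>V)" if d: "d > 0" for d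
  proof -
    obtain K where K: "\<And>x y. x \<in> M \<Longrightarrow> y \<in> M \<Longrightarrow> \<bar>pair_energy \<kappa> n f (\<lambda>x. p x powr s) d x y\<bar> \<le> K"
      using pair_energy_bounded[OF cM kc fc qc d, of n] by blast
    have "(\<integral>z. (case z of (x, y) \<Rightarrow> pair_energy \<kappa> n f (\<lambda>x. p x powr s) d x y) \<partial>(\<mu> \<Otimes>\<^sub>M \<mu>))
      = (\<integral>x. (\<integral>y. pair_energy \<kappa> n f (\<lambda>x. p x powr s) d x y * (p x * p y) \<partial>V) \<partial>V)"
      unfolding \<mu>_def by (rule integral_pair_density[OF M V p pair_energy_measurable[OF cM V kc fc qc] K])
    also have "\<dots> = (\<integral>x. (\<integral>y. pair_energy \<kappa> n f (\<lambda>x. p x powr (s + 1)) d x y \<partial>V) \<partial>V)"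
    proof (rule Bochner_Integration.integral_cong[OF refl], rule Bochner_Integration.integral_cong[OF refl])
      fix x y assume "x \<in> space V" "y \<in> space V"
      then have "p x > 0" "p y > 0" using pd(4) vs(2) by auto
      then show "pair_energy \<kappa> n f (\<lambda>x. p x powr s) d x y * (p x * p y) = pair_energy \<kappa> n f (\<lambda>x. p x powr (s + 1)) d x y"
        by (simp add: pair_energy_def powr_add mult_ac)
    qed
    finally show ?thesis .
  qed
  have eq2: "(\<integral>x. (p x powr (s + 1))\<^sup>2 * norm (manifold_grad TYPE('d) M f x) ^ n \<partial>V)
     = (\<integral>x. p x powr (2 * s + 2) * norm (manifold_grad TYPE('d) M f x) ^ n \<partial>V)"
    by (rule Bochner_Integration.integral_cong[OF refl]) (simp add: power2_eq_square powr_add[symmetric] algebra_simps)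
  show ?thesis
    using mean_integral[OF M V f pd(1) b \<kappa> n, of "s + 1"] unfolding eq2 using eq1 by auto
qed

lemma pair_energy_sqr:
  assumes "\<And>z. z = x \<or> z = y \<Longrightarrow> p z > 0"
  shows "(pair_energy \<kappa> 2 f (\<lambda>x. p x powr s) d x y)\<^sup>2 = pair_energy (\<lambda>\<xi>. (\<kappa> \<xi>)\<^sup>2) 4 f (\<lambda>x. p x powr (2 * s)) d x y"
proof -
  have "(p z powr s)\<^sup>2 = p z powr (2 * s)" for z
    by (simp add: power2_eq_square powr_add[symmetric])
  then show ?thesis by (simp add: pair_energy_def power_mult_distrib flip: power_mult)
qed

text \<open>The result for weights built from p itself. The event also records that the samples lie
  in M, since p is known to be positive and the estimate to be accurate only there.\<close>

lemma graph_dirichlet_exact: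
  fixes M :: "(real ^ 'D::finite) set" and \<beta> :: real
  assumes M: "compact_smooth_manifold TYPE('d::finite) M" and V: "riemannian_volume TYPE('d) M V"
    and k0: "decaying_kernel k0 a B" "decaying_kernel (\<lambda>\<xi>. (k0 \<xi>)\<^sup>2) a' B'" 
    and nn: "\<And>\<xi>. \<xi> \<ge> 0 \<Longrightarrow> k0 \<xi> \<ge> 0" and \<xi>0: "\<xi>0 \<ge> 0" "k0 \<xi>0 > 0"
    and p: "smooth_density TYPE('d) M V p" and f: "smooth_function TYPE('d) M f"
  defines "m2 \<equiv> kernel_moment TYPE('d) k0 2" and "m4 \<equiv> kernel_moment TYPE('d) (\<lambda>\<xi>. (k0 \<xi>)\<^sup>2) 4"
  shows "\<exists>C>0. \<forall>\<epsilon>. (\<forall>N. \<epsilon> N > 0) \<and> \<epsilon> \<in> o(\<lambda>_. 1) \<and>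
       (\<lambda>N. \<epsilon> N powr (real CARD('d) / 2) * real N) \<in> \<omega>(\<lambda>N. ln (real N)) \<longrightarrow>
       (\<forall>\<^sub>F N in sequentially. \<exists>A\<in>sets (iid_samples V p N). measure (iid_samples V p N) A > 1 - 2 / real N ^ 10 \<and>
          (\<forall>x\<in>A. (\<forall>i<N. x i \<in> M) \<and>
            \<bar>graph_dirichlet TYPE('d) k0 \<beta> p (\<epsilon> N) N x f - manifold_dirichlet TYPE('d) M V (\<lambda>y. p y powr (2 - 2 * \<beta>)) f\<bar>
            \<le> C * \<epsilon> N + 3 * sqrt (48 * m4) / m2 * sqrt (ln (real N) / (real N * \<epsilon> N powr (real CARD('d) / 2)) *
                (\<integral>y. norm (manifold_grad TYPE('d) M f y) ^ 4 * p y powr (2 - 4 * \<beta>) \<partial>V))))"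
proof -
  have cM: "compact M" using M by (simp add: compact_smooth_manifold_def)
  note vs = volume_sets[OF cM V] and pd = smooth_densityD[OF M V p]
  interpret V: finite_measure V by (rule volume_finite[OF M V])
  define \<mu> where "\<mu> = density V (\<lambda>x. ennreal (p x))"
  interpret \<mu>: prob_space \<mu> unfolding \<mu>_def by (rule pd(3))
  have s\<mu>[measurable_cong]: "sets \<mu> = sets V" by (simp add: \<mu>_def)
  have sp\<mu>: "space \<mu> = M" by (simp add: \<mu>_def vs(2))
  have iid: "iid_samples V p N = PiM {..<N} (\<lambda>_. \<mu>)" for N by (simp add: iid_samples_def \<mu>_def)
  interpret P: prob_space "iid_samples V p N" for N unfolding iid by (intro prob_space_PiM \<mu>.prob_space_axioms)
  have inM: "x i \<in> M" if "x \<in> space (iid_samples V p N)" "i < N" for x N i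
    using that unfolding iid by (auto simp: space_PiM sp\<mu>)
  let ?g = "\<lambda>x. norm (manifold_grad TYPE('d) M f x)"
  note [measurable] = pd(5) grad_measurable_bounded(1)[OF M V f]
  have kc: "continuous_on {0..} k0" using k0(1) by (auto simp: decaying_kernel_def)
  have fc: "continuous_on M f" by (rule smooth_function_continuous_on[OF M f])
  define q where "q = (\<lambda>x. p x powr (- \<beta>))"
  have qc: "continuous_on M q" unfolding q_def using pd(4,6) by (intro continuous_on_powr continuous_intros) force+
  have m2: "m2 > 0" unfolding m2_def by (rule kernel_moment_pos[OF k0(1) nn \<xi>0]) auto
  have m4: "m4 > 0" unfolding m4_def by (rule kernel_moment_pos[OF k0(2) _ \<xi>0(1)]) (use \<xi>0 in auto)
  have km2: "kernel_m2 TYPE('d) k0 = m2" unfolding m2_def by (rule kernel_m2_eq_moment[OF k0(1)])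
  define D where "D = manifold_dirichlet TYPE('d) M V (\<lambda>y. p y powr (2 - 2 * \<beta>)) f"
  define I4 where "I4 = (\<integral>y. ?g y ^ 4 * p y powr (2 - 4 * \<beta>) \<partial>V)"
  have I4_0: "I4 \<ge> 0" unfolding I4_def by (intro Bochner_Integration.integral_nonneg) simp
  obtain K where K0: "K \<ge> 0" and K: "\<And>x y d. x \<in> M \<Longrightarrow> y \<in> M \<Longrightarrow> 0 < d \<Longrightarrow> d \<le> 1 \<Longrightarrow> \<bar>pair_energy k0 2 f q d x y\<bar> \<le> K"
    using pair_energy_uniform_bound[OF M f k0(1) qc] by blast
  have pe0: "pair_energy k0 2 f q d x y \<ge> 0" for d x y
    unfolding pair_energy_def q_def using nn by (intro mult_nonneg_nonneg) auto
  have sym: "pair_energy k0 2 f q d x y = pair_energy k0 2 f q d y x" for d x y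
    unfolding pair_energy_def by (simp add: norm_minus_commute[of x y] power_divide power2_commute[of "f x" "f y"] mult.commute[of "q x" "q y"])
  have gd: "graph_dirichlet TYPE('d) k0 \<beta> p \<epsilon> N x f = 1 / (real N)\<^sup>2 * (\<Sum>i<N. \<Sum>j<N. pair_energy k0 2 f q (sqrt \<epsilon>) (x i) (x j) / (m2 * sqrt \<epsilon> ^ CARD('d)))"
    if "\<epsilon> > 0" "\<And>i. i < N \<Longrightarrow> x i \<in> M" for \<epsilon> N x
    using graph_dirichlet_pair_energy[OF that(1), of N p x, where 'd = 'd] that(2) pd(4) unfolding km2[symmetric] q_def by blast
  show ?thesis
  proof (cases "I4 = 0")
    case True
    obtain G where G: "\<And>x. x \<in> M \<Longrightarrow> ?g x \<le> G" using grad_measurable_bounded(2)[OF M V f] by blast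
    have q4: "continuous_on M (\<lambda>x. p x powr (2 - 4 * \<beta>))" using pd(4,6) by (intro continuous_on_powr continuous_intros) force+
    obtain Q where Q: "\<And>x. x \<in> M \<Longrightarrow> \<bar>p x powr (2 - 4 * \<beta>)\<bar> \<le> Q" using bounded_on_compact[OF cM q4] by blast
    have "integrable V (\<lambda>y. ?g y ^ 4 * p y powr (2 - 4 * \<beta>))"
    proof (rule V.integrable_const_bound[of _ "G ^ 4 * Q"])
      show "AE y in V. norm (?g y ^ 4 * p y powr (2 - 4 * \<beta>)) \<le> G ^ 4 * Q"
      proof (rule AE_I2)
        fix y assume "y \<in> space V"
        then have y: "y \<in> M" using vs(2) by simp
        have "?g y ^ 4 \<le> G ^ 4" using G[OF y] by (intro power_mono) auto
        then show "norm (?g y ^ 4 * p y powr (2 - 4 * \<beta>)) \<le> G ^ 4 * Q"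
          using Q[OF y] by (simp add: abs_mult mult_mono)
      qed
    qed measurable
    then have "AE y in V. ?g y ^ 4 * p y powr (2 - 4 * \<beta>) = 0"
      using True unfolding I4_def by (subst (asm) integral_nonneg_eq_0_iff_AE) auto
    then have ae: "AE y in V. manifold_grad TYPE('d) M f y = 0"
    proof (rule AE_mp, intro AE_I2 impI)
      fix y assume "y \<in> space V" "?g y ^ 4 * p y powr (2 - 4 * \<beta>) = 0"
      moreover have "p y > 0" using \<open>y \<in> space V\<close> vs(2) pd(4) by simp
      ultimately show "manifold_grad TYPE('d) M f y = 0" by simp
    qed
    have D0: "D = 0" unfolding D_def manifold_dirichlet_def
      by (rule integral_eq_zero_AE) (use ae in \<open>eventually_elim, simp\<close>)
    obtain C where C: "C \<ge> 0" "\<forall>x\<in>M. \<forall>y\<in>M. \<forall>d. 0 < d \<and> d \<le> 1 \<longrightarrow> \<bar>pair_energy k0 2 f q d x y\<bar> / d ^ CARD('d) \<le> C * d\<^sup>2"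
      using pair_energy_locally_constant[OF M V f ae k0(1) _ qc, of 2 "CARD('d)"] by auto
    show ?thesis
    \<comment> \<open>The added 1 keeps the constant strictly positive even if C = 0.\<close>
    proof (intro exI[of _ "C / m2 + 1"] conjI allI impI)
      show "C / m2 + 1 > 0" using C(1) m2 by (simp add: add_nonneg_pos)
      fix \<epsilon> :: "nat \<Rightarrow> real" assume e: "(\<forall>N. \<epsilon> N > 0) \<and> \<epsilon> \<in> o(\<lambda>_. 1) \<and> (\<lambda>N. \<epsilon> N powr (real CARD('d) / 2) * real N) \<in> \<omega>(\<lambda>N. ln (real N))"
      then have "(\<epsilon> \<longlongrightarrow> 0) sequentially" using smalloD_tendsto[of \<epsilon> sequentially "\<lambda>_. 1"] by simp
      then have "\<forall>\<^sub>F N in sequentially. \<epsilon> N < 1" by (rule order_tendstoD(2)) simp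
      then show "\<forall>\<^sub>F N in sequentially. \<exists>A\<in>sets (iid_samples V p N). measure (iid_samples V p N) A > 1 - 2 / real N ^ 10 \<and>
          (\<forall>x\<in>A. (\<forall>i<N. x i \<in> M) \<and> \<bar>graph_dirichlet TYPE('d) k0 \<beta> p (\<epsilon> N) N x f - manifold_dirichlet TYPE('d) M V (\<lambda>y. p y powr (2 - 2 * \<beta>)) f\<bar>
            \<le> (C / m2 + 1) * \<epsilon> N + 3 * sqrt (48 * m4) / m2 * sqrt (ln (real N) / (real N * \<epsilon> N powr (real CARD('d) / 2)) *
                (\<integral>y. ?g y ^ 4 * p y powr (2 - 4 * \<beta>) \<partial>V)))"
        using eventually_gt_at_top[of 0]
      proof eventually_elim
        case (elim N)
        let ?d = "sqrt (\<epsilon> N)"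
        have eN: "\<epsilon> N > 0" using e by blast
        have d: "0 < ?d" "?d \<le> 1" using eN elim by auto
        have bd: "\<bar>graph_dirichlet TYPE('d) k0 \<beta> p (\<epsilon> N) N x f\<bar> \<le> C / m2 * \<epsilon> N" if x: "\<And>i. i < N \<Longrightarrow> x i \<in> M" for x
        proof -
          have t: "\<bar>pair_energy k0 2 f q ?d (x i) (x j) / (m2 * ?d ^ CARD('d))\<bar> \<le> C / m2 * \<epsilon> N" if "i < N" "j < N" for i j
          proof -
            have "\<bar>pair_energy k0 2 f q ?d (x i) (x j)\<bar> / ?d ^ CARD('d) \<le> C * ?d\<^sup>2" using C(2) x that d by blast
            then have "\<bar>pair_energy k0 2 f q ?d (x i) (x j)\<bar> / ?d ^ CARD('d) / m2 \<le> C * \<epsilon> N / m2"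
              using m2 eN by (intro divide_right_mono) auto
            then show ?thesis using m2 d by (simp add: abs_mult field_simps)
          qed
          have "\<bar>\<Sum>i<N. \<Sum>j<N. pair_energy k0 2 f q ?d (x i) (x j) / (m2 * ?d ^ CARD('d))\<bar> \<le> (\<Sum>i<N. \<Sum>j<N. C / m2 * \<epsilon> N)"
            by (rule order_trans[OF sum_abs sum_mono], rule order_trans[OF sum_abs sum_mono]) (use t in auto)
          also have "\<dots> = (real N)\<^sup>2 * (C / m2 * \<epsilon> N)" by (simp add: power2_eq_square)
          finally have s: "\<bar>\<Sum>i<N. \<Sum>j<N. pair_energy k0 2 f q ?d (x i) (x j) / (m2 * ?d ^ CARD('d))\<bar> \<le> (real N)\<^sup>2 * (C / m2 * \<epsilon> N)" .
          have "\<bar>graph_dirichlet TYPE('d) k0 \<beta> p (\<epsilon> N) N x f\<bar> = 1 / (real N)\<^sup>2 * \<bar>\<Sum>i<N. \<Sum>j<N. pair_energy k0 2 f q ?d (x i) (x j) / (m2 * ?d ^ CARD('d))\<bar>"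
            using gd[of "\<epsilon> N" N x, OF eN x] by (simp only: abs_mult abs_divide) simp
          also have "\<dots> \<le> 1 / (real N)\<^sup>2 * ((real N)\<^sup>2 * (C / m2 * \<epsilon> N))" using s by (intro mult_left_mono) auto
          also have "\<dots> = C / m2 * \<epsilon> N" using elim by simp
          finally show ?thesis .
        qed
        show ?case
        proof (intro bexI[of _ "space (iid_samples V p N)"] conjI ballI allI impI)
          show "measure (iid_samples V p N) (space (iid_samples V p N)) > 1 - 2 / real N ^ 10" using elim by (simp add: P.prob_space)
          fix x assume x: "x \<in> space (iid_samples V p N)"
          show "\<And>i. i < N \<Longrightarrow> x i \<in> M" using inM[OF x] .
          have "C / m2 * \<epsilon> N \<le> (C / m2 + 1) * \<epsilon> N" using eN by (intro mult_right_mono) auto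
          then show "\<bar>graph_dirichlet TYPE('d) k0 \<beta> p (\<epsilon> N) N x f - manifold_dirichlet TYPE('d) M V (\<lambda>y. p y powr (2 - 2 * \<beta>)) f\<bar>
            \<le> (C / m2 + 1) * \<epsilon> N + 3 * sqrt (48 * m4) / m2 * sqrt (ln (real N) / (real N * \<epsilon> N powr (real CARD('d) / 2)) *
                (\<integral>y. ?g y ^ 4 * p y powr (2 - 4 * \<beta>) \<partial>V))"
            using bd[of x] inM[OF x] D0 True unfolding D_def[symmetric] I4_def[symmetric] by fastforce
        qed simp
      qed
    qed
  next
    case False
    then have I4: "I4 > 0" using I4_0 by simp
    define E where "E d = (\<integral>z. (case z of (x, y) \<Rightarrow> pair_energy k0 2 f q d x y / (m2 * d ^ CARD('d))) \<partial>(\<mu> \<Otimes>\<^sub>M \<mu>))" for d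
    obtain C1 where C1: "C1 \<ge> 0" "\<And>d. 0 < d \<Longrightarrow> d \<le> 1 \<Longrightarrow> \<bar>E d - D\<bar> \<le> C1 * d\<^sup>2"
    proof -
      obtain C where C: "C \<ge> 0" "\<And>d. 0 < d \<Longrightarrow> d \<le> 1 \<Longrightarrow> 
        \<bar>(\<integral>z. (case z of (x, y) \<Rightarrow> pair_energy k0 2 f q d x y) \<partial>(\<mu> \<Otimes>\<^sub>M \<mu>)) / d ^ CARD('d) - m2 * D\<bar> \<le> C * d\<^sup>2"
        using mean_density[OF M V f p k0(1), of 2 "- \<beta>"] unfolding q_def m2_def D_def \<mu>_def manifold_dirichlet_def by auto
      show ?thesis
      proof (rule that[of "C / m2"])
        fix d :: real assume d: "0 < d" "d \<le> 1"
        have "E d = (\<integral>z. (case z of (x, y) \<Rightarrow> pair_energy k0 2 f q d x y) \<partial>(\<mu> \<Otimes>\<^sub>M \<mu>)) / d ^ CARD('d) / m2"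
          unfolding E_def by (simp add: case_prod_unfold divide_divide_eq_left' mult.commute)
        then have "E d - D = ((\<integral>z. (case z of (x, y) \<Rightarrow> pair_energy k0 2 f q d x y) \<partial>(\<mu> \<Otimes>\<^sub>M \<mu>)) / d ^ CARD('d) - m2 * D) / m2"
          using m2 by (simp add: diff_divide_distrib)
        then have "\<bar>E d - D\<bar> = \<bar>(\<integral>z. (case z of (x, y) \<Rightarrow> pair_energy k0 2 f q d x y) \<partial>(\<mu> \<Otimes>\<^sub>M \<mu>)) / d ^ CARD('d) - m2 * D\<bar> / m2"
          using m2 by simp
        also have "\<dots> \<le> C * d\<^sup>2 / m2" using C(2)[OF d] m2 by (intro divide_right_mono) auto
        finally show "\<bar>E d - D\<bar> \<le> C / m2 * d\<^sup>2" by simp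
      qed (use C m2 in auto)
    qed
    obtain C2 where C2: "C2 \<ge> 0" "\<And>d. 0 < d \<Longrightarrow> d \<le> 1 \<Longrightarrow> 
      (\<integral>z. (case z of (x, y) \<Rightarrow> (pair_energy k0 2 f q d x y / (m2 * d ^ CARD('d)))\<^sup>2) \<partial>(\<mu> \<Otimes>\<^sub>M \<mu>)) \<le> (m4 * I4 + C2 * d\<^sup>2) / (m2\<^sup>2 * d ^ CARD('d))"
    proof -
      obtain C where C: "C \<ge> 0" "\<And>d. 0 < d \<Longrightarrow> d \<le> 1 \<Longrightarrow> 
        \<bar>(\<integral>z. (case z of (x, y) \<Rightarrow> pair_energy (\<lambda>\<xi>. (k0 \<xi>)\<^sup>2) 4 f (\<lambda>x. p x powr (2 * - \<beta>)) d x y) \<partial>(\<mu> \<Otimes>\<^sub>M \<mu>)) / d ^ CARD('d) - m4 * I4\<bar> \<le> C * d\<^sup>2"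
        using mean_density[OF M V f p k0(2), of 4 "2 * - \<beta>"] unfolding m4_def I4_def \<mu>_def by (auto simp: mult.commute)
      show ?thesis
      proof (rule that[of C])
        fix d :: real assume d: "0 < d" "d \<le> 1"
        let ?J = "\<integral>z. (case z of (x, y) \<Rightarrow> pair_energy (\<lambda>\<xi>. (k0 \<xi>)\<^sup>2) 4 f (\<lambda>x. p x powr (2 * - \<beta>)) d x y) \<partial>(\<mu> \<Otimes>\<^sub>M \<mu>)"
        have "(\<integral>z. (case z of (x, y) \<Rightarrow> (pair_energy k0 2 f q d x y / (m2 * d ^ CARD('d)))\<^sup>2) \<partial>(\<mu> \<Otimes>\<^sub>M \<mu>))
          = (\<integral>z. (case z of (x, y) \<Rightarrow> pair_energy (\<lambda>\<xi>. (k0 \<xi>)\<^sup>2) 4 f (\<lambda>x. p x powr (2 * - \<beta>)) d x y) / (m2 * d ^ CARD('d))\<^sup>2 \<partial>(\<mu> \<Otimes>\<^sub>M \<mu>))"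
        proof (rule Bochner_Integration.integral_cong[OF refl])
          fix z assume z: "z \<in> space (\<mu> \<Otimes>\<^sub>M \<mu>)"
          obtain x y where xy: "z = (x, y)" by (cases z)
          have "x \<in> M" "y \<in> M" using z sp\<mu> by (auto simp: xy space_pair_measure)
          then have "(pair_energy k0 2 f q d x y)\<^sup>2 = pair_energy (\<lambda>\<xi>. (k0 \<xi>)\<^sup>2) 4 f (\<lambda>x. p x powr (2 * - \<beta>)) d x y"
            unfolding q_def by (intro pair_energy_sqr) (use pd(4) in auto)
          then show "(case z of (x, y) \<Rightarrow> (pair_energy k0 2 f q d x y / (m2 * d ^ CARD('d)))\<^sup>2) = (case z of (x, y) \<Rightarrow> pair_energy (\<lambda>\<xi>. (k0 \<xi>)\<^sup>2) 4 f (\<lambda>x. p x powr (2 * - \<beta>)) d x y) / (m2 * d ^ CARD('d))\<^sup>2"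
            by (simp add: xy power_divide)
        qed
        also have "\<dots> = (?J / d ^ CARD('d)) / (m2\<^sup>2 * d ^ CARD('d))"
          by (simp add: power_mult_distrib power2_eq_square mult_ac)
        also have "\<dots> \<le> (m4 * I4 + C * d\<^sup>2) / (m2\<^sup>2 * d ^ CARD('d))"
          using C(2)[OF d] d by (intro divide_right_mono) (auto simp: abs_le_iff)
        finally show "(\<integral>z. (case z of (x, y) \<Rightarrow> (pair_energy k0 2 f q d x y / (m2 * d ^ CARD('d)))\<^sup>2) \<partial>(\<mu> \<Otimes>\<^sub>M \<mu>)) \<le> (m4 * I4 + C * d\<^sup>2) / (m2\<^sup>2 * d ^ CARD('d))" .
      qed (rule C(1))
    qed
    \<comment> \<open>Fixed by the exponent: with (t N)^2 = R * T N and v twice the limiting second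
      moment, N (t N)^2 / (2 v) is 12 ln N. After the factor 2 N of the union bound the failure
      probability is at most 2 N^(-11), which lies strictly below 2 N^(-10).\<close>
    define R where "R = 48 * m4 * I4 / m2\<^sup>2"
    have R: "R > 0" using m4 I4 m2 by (simp add: R_def)
    show ?thesis
    proof (intro exI[of _ "C1 + 1"] conjI allI impI)
      show "C1 + 1 > 0" using C1(1) by simp
      fix \<epsilon> :: "nat \<Rightarrow> real" assume e: "(\<forall>N. \<epsilon> N > 0) \<and> \<epsilon> \<in> o(\<lambda>_. 1) \<and> (\<lambda>N. \<epsilon> N powr (real CARD('d) / 2) * real N) \<in> \<omega>(\<lambda>N. ln (real N))"
      define T where "T N = ln (real N) / (real N * \<epsilon> N powr (real CARD('d) / 2))" for N
      define t where "t N = sqrt (R * T N)" for N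
      have elim0: "(\<epsilon> \<longlongrightarrow> 0) sequentially" using e smalloD_tendsto[of \<epsilon> sequentially "\<lambda>_. 1"] by simp
      have e1: "\<forall>\<^sub>F N in sequentially. \<epsilon> N < 1" using elim0 by (rule order_tendstoD(2)) simp
      \<comment> \<open>From here on the correction is at most the main term, so v = twice the main
        term bounds the second moment.\<close>
      have e2: "\<forall>\<^sub>F N in sequentially. C2 * \<epsilon> N < m4 * I4"
        by (rule order_tendstoD(2)[OF tendsto_mult_right_zero[OF elim0]]) (use m4 I4 in simp)
      have "(\<lambda>N. ln (real N)) \<in> o(\<lambda>N. \<epsilon> N powr (real CARD('d) / 2) * real N)" using e by (simp add: smallomega_iff_smallo)
      then have "(T \<longlongrightarrow> 0) sequentially" unfolding T_def[abs_def] by (simp only: mult.commute) (rule smalloD_tendsto)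
      then have "((\<lambda>N. sqrt (R * T N)) \<longlongrightarrow> sqrt (R * 0)) sequentially" by (intro tendsto_intros)
      then have "((\<lambda>N. t N * (K + 1)) \<longlongrightarrow> 0) sequentially" unfolding t_def by (intro tendsto_mult_left_zero) simp
      then have e3: "\<forall>\<^sub>F N in sequentially. t N * (K + 1) < 2 * m4 * I4 / m2" 
        by (rule order_tendstoD(2)) (use m4 I4 m2 in simp)
      \<comment> \<open>Makes \<open>R * N\<close> at least the square of a bound for the mean, as
        the diagonal defect below requires.\<close>
      have e4: "\<forall>\<^sub>F N in sequentially. real N > (\<bar>D\<bar> + C1)\<^sup>2 / R"
        using filterlim_real_sequentially by (simp add: filterlim_at_top_dense)
      show "\<forall>\<^sub>F N in sequentially. \<exists>A\<in>sets (iid_samples V p N). measure (iid_samples V p N) A > 1 - 2 / real N ^ 10 \<and>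
          (\<forall>x\<in>A. (\<forall>i<N. x i \<in> M) \<and> \<bar>graph_dirichlet TYPE('d) k0 \<beta> p (\<epsilon> N) N x f - manifold_dirichlet TYPE('d) M V (\<lambda>y. p y powr (2 - 2 * \<beta>)) f\<bar>
            \<le> (C1 + 1) * \<epsilon> N + 3 * sqrt (48 * m4) / m2 * sqrt (ln (real N) / (real N * \<epsilon> N powr (real CARD('d) / 2)) *
                (\<integral>y. ?g y ^ 4 * p y powr (2 - 4 * \<beta>) \<partial>V)))"
        using e1 e2 e3 e4 eventually_ge_at_top[of 3]
      proof eventually_elim
        case (elim N)
        define d where "d = sqrt (\<epsilon> N)"
        have eN: "\<epsilon> N > 0" using e by blast
        have d: "0 < d" "d \<le> 1" "d\<^sup>2 = \<epsilon> N" using eN elim by (auto simp: d_def)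
        have dd: "\<epsilon> N powr (real CARD('d) / 2) = d ^ CARD('d)" unfolding d_def using sqrt_power_eq_powr[OF eN] by simp
        have dpos: "0 < d ^ CARD('d)" "d ^ CARD('d) \<le> 1" using d by (auto simp: power_le_one)
        have ln1: "ln (real N) \<ge> 1"
        proof -
          have "exp 1 \<le> (3::real)" using exp_le by simp
          also have "3 \<le> real N" using elim by simp
          finally show ?thesis using elim by (simp add: ln_ge_iff)
        qed
        have N: "real N > 0" using elim by simp
        have T: "T N = ln (real N) / (real N * d ^ CARD('d))" by (simp add: T_def dd)
        have ln0: "ln (real N) > 0" using ln1 by linarith
        have Tpos: "T N > 0" unfolding T by (intro divide_pos_pos mult_pos_pos ln0 N dpos(1))
        have tpos: "t N > 0" using R Tpos by (simp add: t_def)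
        have tsq: "(t N)\<^sup>2 = R * T N" using R Tpos by (simp add: t_def)
        define h where "h x y = pair_energy k0 2 f q d x y / (m2 * d ^ CARD('d))" for x y
        define v where "v = 2 * m4 * I4 / (m2\<^sup>2 * d ^ CARD('d))"
        define L where "L = (K + 1) / (m2 * d ^ CARD('d))"
        have vpos: "v > 0" using m4 I4 m2 dpos by (simp add: v_def)
        have hm: "(\<lambda>(x, y). h x y) \<in> borel_measurable (\<mu> \<Otimes>\<^sub>M \<mu>)"
        proof -
          have "(\<lambda>(x, y). pair_energy k0 2 f q d x y) \<in> borel_measurable (\<mu> \<Otimes>\<^sub>M \<mu>)"
            using pair_energy_measurable[OF cM V kc fc qc, of 2 d] by (simp add: measurable_cong_sets[OF sets_pair_measure_cong[OF s\<mu> s\<mu>] refl])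
          then have "(\<lambda>z. (case z of (x, y) \<Rightarrow> pair_energy k0 2 f q d x y) / (m2 * d ^ CARD('d))) \<in> borel_measurable (\<mu> \<Otimes>\<^sub>M \<mu>)" by measurable
          then show ?thesis unfolding h_def by (simp add: case_prod_unfold)
        qed
        have hb: "0 \<le> h x y \<and> h x y \<le> L" if "x \<in> space \<mu>" "y \<in> space \<mu>" for x y
          unfolding h_def L_def using pe0[of d x y] K[of x y d] that sp\<mu> d m2 dpos by (auto intro!: divide_right_mono)
        have hsym: "h x y = h y x" for x y unfolding h_def by (simp add: sym[of d x y])
        have hdiag: "h x x = 0" for x unfolding h_def pair_energy_def by simp
        have hv: "(\<integral>z. (case z of (x, y) \<Rightarrow> (h x y)\<^sup>2) \<partial>(\<mu> \<Otimes>\<^sub>M \<mu>)) \<le> v"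
        proof -
          have "(\<integral>z. (case z of (x, y) \<Rightarrow> (h x y)\<^sup>2) \<partial>(\<mu> \<Otimes>\<^sub>M \<mu>)) \<le> (m4 * I4 + C2 * d\<^sup>2) / (m2\<^sup>2 * d ^ CARD('d))"
            unfolding h_def by (rule C2(2)[OF d(1,2)])
          also have "\<dots> \<le> v" unfolding v_def
          proof (rule divide_right_mono)
            show "m4 * I4 + C2 * d\<^sup>2 \<le> 2 * m4 * I4" unfolding d(3) mult.assoc using elim(2) by linarith
          qed (use dpos in simp)
          finally show ?thesis .
        qed
        have tL: "t N * L \<le> v"
        proof -
          have "t N * L = t N * (K + 1) / (m2 * d ^ CARD('d))" by (simp add: L_def)
          also have "\<dots> \<le> (2 * m4 * I4 / m2) / (m2 * d ^ CARD('d))" using elim(3) m2 dpos by (intro divide_right_mono) auto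
          also have "\<dots> = v" by (simp add: v_def power2_eq_square mult_ac)
          finally show ?thesis .
        qed
        have N0: "N > 0" using elim by simp
        obtain A where A: "A \<in> sets (iid_samples V p N)" "measure (iid_samples V p N) A \<ge> 1 - 2 * real N * exp (- real N * (t N)\<^sup>2 / (2 * v))"
          "\<And>\<omega>. \<omega> \<in> A \<Longrightarrow> \<bar>(\<Sum>i<N. \<Sum>j<N. h (\<omega> i) (\<omega> j)) - real N * (real N - 1) * E d\<bar> \<le> 2 * (real N)\<^sup>2 * t N"
          using \<mu>.u_statistic_concentration[OF hm hb hsym hdiag hv tpos vpos tL N0] unfolding iid E_def h_def by blast
        have ex: "- real N * (t N)\<^sup>2 / (2 * v) = - (12 * ln (real N))"
        proof -
          have "real N * (t N)\<^sup>2 = 12 * ln (real N) * (2 * v)"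
            unfolding tsq T R_def v_def using N dpos m2 by (simp add: field_simps)
          then show ?thesis using vpos by simp
        qed
        have "exp (- (12 * ln (real N))) = 1 / real N ^ 12"
        proof -
          have "12 * ln (real N) = ln (real N ^ 12)" using N by (simp add: ln_realpow)
          then show ?thesis using N by (simp add: exp_minus field_simps)
        qed
        then have "1 - 2 * real N * exp (- real N * (t N)\<^sup>2 / (2 * v)) = 1 - 2 / real N ^ 11"
          unfolding ex using N by (simp add: power_Suc[of _ 11, simplified] field_simps eval_nat_numeral)
        moreover have "2 / real N ^ 11 < 2 / real N ^ 10"
        proof (rule divide_strict_left_mono)
          show "real N ^ 10 < real N ^ 11" using elim by (intro power_strict_increasing) auto
        qed (use N in auto)
        ultimately have meas: "measure (iid_samples V p N) A > 1 - 2 / real N ^ 10" using A(2) by linarith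
        \<comment> \<open>Because the diagonal is missing, the mean of the double sum over N^2 falls
          short of \<open>E d\<close> by \<open>E d\<close> / N. That defect is of order 1 / N,
          while (t N)^2 \<ge> R / N since ln N \<ge> 1 and d \<le> 1; it is therefore swallowed by t
          N.\<close>
        have EN: "\<bar>E d\<bar> / real N \<le> t N"
        proof -
          have "C1 * d\<^sup>2 \<le> C1" unfolding d(3) using C1(1) elim(1) by (intro mult_left_le) auto
          then have b1: "\<bar>E d\<bar> \<le> \<bar>D\<bar> + C1" using C1(2)[OF d(1,2)] by linarith
          have "(\<bar>D\<bar> + C1)\<^sup>2 \<le> R * real N" using elim(4) R by (simp add: field_simps)
          then have "(\<bar>D\<bar> + C1)\<^sup>2 / (real N)\<^sup>2 \<le> R * real N / (real N)\<^sup>2" by (intro divide_right_mono) auto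
          then have "((\<bar>D\<bar> + C1) / real N)\<^sup>2 \<le> R * (1 / real N)"
            unfolding power_divide using N by (simp add: power2_eq_square[of "real N"])
          also have "\<dots> \<le> R * T N"
          proof (rule mult_left_mono)
            have "real N * d ^ CARD('d) \<le> real N" using N dpos by simp
            then show "1 / real N \<le> T N" unfolding T using ln1 N dpos by (intro frac_le) auto
          qed (use R in simp)
          also have "\<dots> = (t N)\<^sup>2" by (simp add: tsq)
          finally have "(\<bar>D\<bar> + C1) / real N \<le> t N" using less_imp_le[OF tpos] by (rule power2_le_imp_le)
          moreover have "\<bar>E d\<bar> / real N \<le> (\<bar>D\<bar> + C1) / real N" using b1 N by (intro divide_right_mono) auto
          ultimately show ?thesis by linarith
        qed
        \<comment> \<open>Of the three copies of t N, two come from the concentration bound and one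
          from the diagonal defect. Written this way, f and p enter only through \<open>I4\<close>,
          so the prefactor depends on the kernel and the dimension alone.\<close>
        have t3: "3 * t N = 3 * sqrt (48 * m4) / m2 * sqrt (T N * I4)"
        proof -
          have "R * T N = (48 * m4) / m2\<^sup>2 * (T N * I4)" by (simp add: R_def)
          then have "t N = sqrt (48 * m4) / sqrt (m2\<^sup>2) * sqrt (T N * I4)" unfolding t_def by (simp only: real_sqrt_mult real_sqrt_divide)
          then show ?thesis using m2 by simp
        qed
        show ?case
        proof (intro bexI[of _ A] conjI ballI allI impI)
          fix x assume x: "x \<in> A"
          then have xs: "x \<in> space (iid_samples V p N)" using A(1) sets.sets_into_space by blast
          show "\<And>i. i < N \<Longrightarrow> x i \<in> M" using inM[OF xs] .
          let ?G = "graph_dirichlet TYPE('d) k0 \<beta> p (\<epsilon> N) N x f"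
          have Geq: "(\<Sum>i<N. \<Sum>j<N. h (x i) (x j)) = (real N)\<^sup>2 * ?G"
            using gd[OF eN inM[OF xs]] N unfolding h_def d_def by simp
          have "\<bar>(real N)\<^sup>2 * ?G - real N * (real N - 1) * E d\<bar> \<le> 2 * (real N)\<^sup>2 * t N" using A(3)[OF x] unfolding Geq .
          moreover have "(real N)\<^sup>2 * ?G - real N * (real N - 1) * E d = (real N)\<^sup>2 * (?G - E d + E d / real N)"
            using N by (simp add: field_simps power2_eq_square)
          ultimately have "(real N)\<^sup>2 * \<bar>?G - E d + E d / real N\<bar> \<le> (real N)\<^sup>2 * (2 * t N)" by (simp add: abs_mult mult_ac)
          then have "\<bar>?G - E d + E d / real N\<bar> \<le> 2 * t N" using N by simp
          moreover have "\<bar>E d / real N\<bar> \<le> t N" using EN N by simp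
          moreover have "\<bar>E d - D\<bar> \<le> C1 * \<epsilon> N" using C1(2)[OF d(1,2)] d(3) by simp
          ultimately have "\<bar>?G - D\<bar> \<le> C1 * \<epsilon> N + 3 * t N" by linarith
          also have "\<dots> \<le> (C1 + 1) * \<epsilon> N + 3 * t N" using eN by (intro add_right_mono mult_right_mono) auto
          finally show "\<bar>?G - manifold_dirichlet TYPE('d) M V (\<lambda>y. p y powr (2 - 2 * \<beta>)) f\<bar>
            \<le> (C1 + 1) * \<epsilon> N + 3 * sqrt (48 * m4) / m2 * sqrt (ln (real N) / (real N * \<epsilon> N powr (real CARD('d) / 2)) *
                (\<integral>y. ?g y ^ 4 * p y powr (2 - 4 * \<beta>) \<partial>V))"
            unfolding t3 D_def[symmetric] I4_def[symmetric] T_def .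
        qed (use A meas in auto)
      qed
    qed
  qed
qed

section \<open>Estimated densities\<close>

lemma c_factor_pos: "c_factor \<beta> > 0"
  unfolding c_factor_def by (simp add: max_def)

text \<open>Origin of \<open>c_factor\<close>: the derivative of \<rho>^(-\<beta>) is -\<beta>
  \<rho>^(-\<beta>-1), and on [0.9, 1.1] this monotone power is largest at an endpoint.\<close>

lemma powr_ratio_bound:
  fixes \<rho> :: real
  assumes "\<bar>\<rho> - 1\<bar> \<le> e" "e \<le> 0.1"
  shows "\<bar>\<rho> powr (- \<beta>) - 1\<bar> \<le> \<bar>\<beta>\<bar> * c_factor \<beta> * e"
proof -
  let ?S = "{0.9..1.1} :: real set"
  have "norm (\<rho> powr (- \<beta>) - 1 powr (- \<beta>)) \<le> \<bar>\<beta>\<bar> * c_factor \<beta> * norm (\<rho> - 1)"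
  proof (rule field_differentiable_bound[of ?S])
    fix z :: real assume z: "z \<in> ?S"
    then have z0: "z > 0" by auto
    show "((\<lambda>\<rho>. \<rho> powr (- \<beta>)) has_field_derivative (- \<beta>) * z powr (- \<beta> - 1)) (at z within ?S)"
      by (rule has_field_derivative_at_within[OF has_real_derivative_powr[OF z0]])
    have "z powr (- \<beta> - 1) \<le> c_factor \<beta>"
    proof (cases "- \<beta> - 1 \<ge> 0")
      case True
      then have "z powr (- \<beta> - 1) \<le> 1.1 powr (- \<beta> - 1)" using z by (intro powr_mono2) auto
      then show ?thesis by (simp add: c_factor_def)
    next
      case False
      then have "z powr (- \<beta> - 1) \<le> 0.9 powr (- \<beta> - 1)" using z by (intro powr_mono2') auto
      then show ?thesis by (simp add: c_factor_def)
    qed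
    then show "norm ((- \<beta>) * z powr (- \<beta> - 1)) \<le> \<bar>\<beta>\<bar> * c_factor \<beta>"
      by (simp add: abs_mult mult_left_mono)
  qed (use assms in \<open>auto simp: abs_le_iff\<close>)
  also have "\<dots> \<le> \<bar>\<beta>\<bar> * c_factor \<beta> * e"
    using assms c_factor_pos[of \<beta>] by (intro mult_left_mono) auto
  finally show ?thesis by simp
qed

text \<open>All summands are nonnegative, so a relative error common to the terms is a relative
  error of the sum. Each weight contains two factors with relative error \<eta>, and \<eta> + \<eta>
  + \<eta>^2 \<le> 3 \<eta> because \<eta> \<le> 1.\<close>

lemma graph_dirichlet_ratio:
  fixes x :: "nat \<Rightarrow> real ^ 'D::finite" and \<epsilon> :: real
  assumes \<epsilon>: "\<epsilon> > 0" and k: "\<And>\<xi>. \<xi> \<ge> 0 \<Longrightarrow> k0 \<xi> \<ge> 0" and m2: "kernel_m2 TYPE('d::finite) k0 > 0"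
    and p: "\<And>i. i < N \<Longrightarrow> p (x i) > 0" and r: "\<And>i. i < N \<Longrightarrow> \<bar>ph (x i) - p (x i)\<bar> / p (x i) \<le> e" and e: "e \<le> 0.1"
    and \<eta>: "\<bar>\<beta>\<bar> * c_factor \<beta> * e \<le> \<eta>" "\<eta> \<le> 1" "0 \<le> \<eta>"
  shows "\<bar>graph_dirichlet TYPE('d) k0 \<beta> ph \<epsilon> N x f - graph_dirichlet TYPE('d) k0 \<beta> p \<epsilon> N x f\<bar> \<le> 3 * \<eta> * graph_dirichlet TYPE('d) k0 \<beta> p \<epsilon> N x f"
    "0 \<le> graph_dirichlet TYPE('d) k0 \<beta> p \<epsilon> N x f"
proof -
  define T where "T g i j = \<epsilon> powr (- real CARD('d) / 2) * graph_weight k0 \<beta> g \<epsilon> (x i) (x j) * (f (x i) - f (x j))\<^sup>2" for g i j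
  define c where "c = 1 / (\<epsilon> * kernel_m2 TYPE('d) k0) * (1 / (real N)\<^sup>2)"
  have c: "c \<ge> 0" using \<epsilon> m2 by (simp add: c_def)
  have G: "graph_dirichlet TYPE('d) k0 \<beta> g \<epsilon> N x f = c * (\<Sum>i<N. \<Sum>j<N. T g i j)" for g
    by (simp add: graph_dirichlet_def c_def T_def)
  have w0: "graph_weight k0 \<beta> p \<epsilon> (x i) (x j) \<ge> 0" for i j
    unfolding graph_weight_def using k[of "(norm (x i - x j))\<^sup>2 / \<epsilon>"] \<epsilon> by simp
  have T0: "T p i j \<ge> 0" for i j unfolding T_def using w0 by simp
  have Td: "\<bar>T ph i j - T p i j\<bar> \<le> 3 * \<eta> * T p i j" if "i < N" "j < N" for i j
  proof -
    define \<rho> where "\<rho> i = ph (x i) / p (x i)" for i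
    have \<rho>: "\<bar>\<rho> i - 1\<bar> \<le> e" "ph (x i) = p (x i) * \<rho> i" "\<rho> i > 0" if "i < N" for i
    proof -
      have "\<rho> i - 1 = (ph (x i) - p (x i)) / p (x i)" using p[OF that] by (simp add: \<rho>_def diff_divide_distrib)
      then show 1: "\<bar>\<rho> i - 1\<bar> \<le> e" using r[OF that] p[OF that] by simp
      show "ph (x i) = p (x i) * \<rho> i" using p[OF that] by (simp add: \<rho>_def)
      show "\<rho> i > 0" using 1 e by linarith
    qed
    have b: "\<bar>\<rho> i powr (- \<beta>) - 1\<bar> \<le> \<eta>" if "i < N" for i
      using powr_ratio_bound[OF \<rho>(1)[OF that] e, of \<beta>] \<eta>(1) by linarith
    have "graph_weight k0 \<beta> ph \<epsilon> (x i) (x j) = graph_weight k0 \<beta> p \<epsilon> (x i) (x j) * (\<rho> i powr (- \<beta>) * \<rho> j powr (- \<beta>))"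
      unfolding graph_weight_def \<rho>(2)[OF that(1)] \<rho>(2)[OF that(2)] using \<rho>(3)[OF that(1)] \<rho>(3)[OF that(2)] p[OF that(1)] p[OF that(2)]
      by (simp add: powr_mult powr_minus_divide)
    then have "T ph i j - T p i j = T p i j * (\<rho> i powr (- \<beta>) * \<rho> j powr (- \<beta>) - 1)"
      by (simp add: T_def algebra_simps)
    moreover have "\<bar>\<rho> i powr (- \<beta>) * \<rho> j powr (- \<beta>) - 1\<bar> \<le> 3 * \<eta>"
    proof -
      define a where "a = \<rho> i powr (- \<beta>) - 1"
      define b' where "b' = \<rho> j powr (- \<beta>) - 1"
      have ab: "\<bar>a\<bar> \<le> \<eta>" "\<bar>b'\<bar> \<le> \<eta>" using b that by (auto simp: a_def b'_def)
      have "\<bar>a * b'\<bar> \<le> \<eta> * 1" unfolding abs_mult using ab \<eta> by (intro mult_mono) auto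
      moreover have "\<rho> i powr (- \<beta>) * \<rho> j powr (- \<beta>) - 1 = a + b' + a * b'" by (simp add: a_def b'_def algebra_simps)
      ultimately show ?thesis using ab by linarith
    qed
    then have "T p i j * \<bar>\<rho> i powr (- \<beta>) * \<rho> j powr (- \<beta>) - 1\<bar> \<le> T p i j * (3 * \<eta>)"
      using T0 by (rule mult_left_mono)
    ultimately show ?thesis using T0[of i j] by (simp add: abs_mult mult.commute)
  qed
  show "0 \<le> graph_dirichlet TYPE('d) k0 \<beta> p \<epsilon> N x f"
    unfolding G using c T0 by (intro mult_nonneg_nonneg sum_nonneg) auto
  have "\<bar>(\<Sum>i<N. \<Sum>j<N. T ph i j) - (\<Sum>i<N. \<Sum>j<N. T p i j)\<bar> = \<bar>\<Sum>i<N. \<Sum>j<N. T ph i j - T p i j\<bar>"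
    by (simp add: sum_subtractf)
  also have "\<dots> \<le> (\<Sum>i<N. \<Sum>j<N. 3 * \<eta> * T p i j)"
    by (rule order_trans[OF sum_abs sum_mono], rule order_trans[OF sum_abs sum_mono]) (use Td in auto)
  also have "\<dots> = 3 * \<eta> * (\<Sum>i<N. \<Sum>j<N. T p i j)" by (simp add: sum_distrib_left)
  finally have "c * \<bar>(\<Sum>i<N. \<Sum>j<N. T ph i j) - (\<Sum>i<N. \<Sum>j<N. T p i j)\<bar> \<le> c * (3 * \<eta> * (\<Sum>i<N. \<Sum>j<N. T p i j))"
    using c by (rule mult_left_mono)
  moreover have "\<bar>graph_dirichlet TYPE('d) k0 \<beta> ph \<epsilon> N x f - graph_dirichlet TYPE('d) k0 \<beta> p \<epsilon> N x f\<bar> = c * \<bar>(\<Sum>i<N. \<Sum>j<N. T ph i j) - (\<Sum>i<N. \<Sum>j<N. T p i j)\<bar>"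
    unfolding G right_diff_distrib[symmetric] using c by (simp add: abs_mult)
  ultimately show "\<bar>graph_dirichlet TYPE('d) k0 \<beta> ph \<epsilon> N x f - graph_dirichlet TYPE('d) k0 \<beta> p \<epsilon> N x f\<bar> \<le> 3 * \<eta> * graph_dirichlet TYPE('d) k0 \<beta> p \<epsilon> N x f"
    unfolding G by (simp add: mult_ac)
qed

section \<open>Distribution of the total error over three terms\<close>

lemma graph_dirichlet_unweighted: "graph_dirichlet T k0 0 g \<epsilon> N x f = graph_dirichlet T k0 0 h \<epsilon> N x f"
  by (simp add: graph_dirichlet_def graph_weight_def)

text \<open>The first part is w clamped to [-a, a]; what is left over has size at most b.\<close>

lemma split_abs_bound:
  fixes w a b :: real
  assumes "\<bar>w\<bar> \<le> a + b" "0 \<le> a" "0 \<le> b"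
  shows "\<exists>r s. w = r + s \<and> \<bar>r\<bar> \<le> a \<and> \<bar>s\<bar> \<le> b"
  using assms by (intro exI[of _ "max (- a) (min a w)"] exI[of _ "w - max (- a) (min a w)"]) (auto simp: abs_le_iff max_def min_def)

text \<open>The relative error \<theta> of Gh is applied to D exactly, giving r1, while G - D gets
  multiplied by 1 + \<theta>, whose size is at most 1 + 3 \<eta> \<le> 4. If G = 0 the hypothesis
  forces Gh = 0, and \<theta> = 0 is consistent.\<close>

lemma perturbed_expansion:
  fixes G Gh D \<eta> a b :: real
  assumes G: "\<bar>G - D\<bar> \<le> a + b" "0 \<le> G" "0 \<le> a" "0 \<le> b" and \<eta>: "0 \<le> \<eta>" "\<eta> \<le> 1" and Gh: "\<bar>Gh - G\<bar> \<le> 3 * \<eta> * G"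
  shows "\<exists>r1 r2 r3. Gh = D * (1 + r1) + r2 + r3 \<and> \<bar>r1\<bar> \<le> 3 * \<eta> \<and> \<bar>r2\<bar> \<le> 4 * a \<and> \<bar>r3\<bar> \<le> 4 * b"
proof -
  define \<theta> where "\<theta> = (if G = 0 then 0 else (Gh - G) / G)"
  have \<theta>: "Gh = G * (1 + \<theta>)" using Gh by (auto simp: \<theta>_def field_simps)
  have \<theta>b: "\<bar>\<theta>\<bar> \<le> 3 * \<eta>" using Gh G(2) \<eta> by (auto simp: \<theta>_def field_simps abs_mult)
  have "\<bar>(G - D) * (1 + \<theta>)\<bar> \<le> (a + b) * 4"
    unfolding abs_mult using G \<theta>b \<eta> by (intro mult_mono) auto
  then have "\<bar>(G - D) * (1 + \<theta>)\<bar> \<le> 4 * a + 4 * b" by simp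
  then obtain r s where rs: "(G - D) * (1 + \<theta>) = r + s" "\<bar>r\<bar> \<le> 4 * a" "\<bar>s\<bar> \<le> 4 * b"
    using split_abs_bound[of "(G - D) * (1 + \<theta>)" "4 * a" "4 * b"] G by auto
  have "Gh = D * (1 + \<theta>) + (G - D) * (1 + \<theta>)" unfolding \<theta> by (simp add: algebra_simps)
  then have "Gh = D * (1 + \<theta>) + r + s" using rs(1) by simp
  then show ?thesis using \<theta>b rs by blast
qed

theorem theorem3p4:
  fixes M :: "(real ^ 'D::finite) set"
    and V :: "(real ^ 'D) measure"
    and k0 :: "real \<Rightarrow> real"
  assumes manifold: "compact_smooth_manifold TYPE('d::finite) M"
    and volume: "riemannian_volume TYPE('d) M V"
    and kernel: "admissible_kernel k0"
  shows "\<exists>C1>0. \<exists>C3>0. \<forall>p f. smooth_density TYPE('d) M V p \<and> smooth_function TYPE('d) M f \<longrightarrow>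
    (\<forall>\<beta>\<le>1. \<exists>C2>0. \<forall>(\<epsilon> :: nat \<Rightarrow> real) (ph :: nat \<Rightarrow> real ^ 'D \<Rightarrow> real) (\<epsilon>p :: nat \<Rightarrow> real).
       (\<forall>N. \<epsilon> N > 0) \<and>
       \<epsilon> \<in> o(\<lambda>_. 1) \<and>
       (\<lambda>N. \<epsilon> N powr (real CARD('d) / 2) * real N) \<in> \<omega>(\<lambda>N. ln (real N)) \<and>
       (\<beta> \<noteq> 0 \<longrightarrow>
          (\<forall>\<^sub>F N in sequentially.
             (SUP x\<in>M. ereal (\<bar>ph N x - p x\<bar> / p x)) < ereal (\<epsilon>p N) \<and> \<epsilon>p N < 0.1) \<and>
          \<epsilon>p \<in> o(\<lambda>_. 1))
       \<longrightarrow>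
       (\<forall>\<^sub>F N in sequentially.
          holds_with_prob_gt (iid_samples V p N) (1 - 2 / real N ^ 10) (\<lambda>x.
            \<exists>r1 r2 r3.
              graph_dirichlet TYPE('d) k0 \<beta> (ph N) (\<epsilon> N) N x f =
                manifold_dirichlet TYPE('d) M V (\<lambda>y. p y powr (2 - 2 * \<beta>)) f * (1 + r1) + r2 + r3 \<and>
              \<bar>r1\<bar> \<le> C1 * \<bar>\<beta> * c_factor \<beta> * \<epsilon>p N\<bar> \<and>
              \<bar>r2\<bar> \<le> C2 * \<epsilon> N \<and>
              \<bar>r3\<bar> \<le> C3 * sqrt (ln (real N) / (real N * \<epsilon> N powr (real CARD('d) / 2)) *
                (\<integral>y. norm (manifold_grad TYPE('d) M f y) ^ 4 * p y powr (2 - 4 * \<beta>) \<partial>V))))) \<and>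
    (\<exists>C2>0. \<forall>\<epsilon> :: nat \<Rightarrow> real.
       (\<forall>N. \<epsilon> N > 0) \<and>
       \<epsilon> \<in> o(\<lambda>_. 1) \<and>
       (\<lambda>N. \<epsilon> N powr (real CARD('d) / 2) * real N) \<in> \<omega>(\<lambda>N. ln (real N))
       \<longrightarrow>
       (\<forall>\<^sub>F N in sequentially.
          holds_with_prob_gt (iid_samples V p N) (1 - 2 / real N ^ 10) (\<lambda>x.
            \<exists>r2 r3.
              graph_dirichlet TYPE('d) k0 0 (\<lambda>_. 1) (\<epsilon> N) N x f =
                manifold_dirichlet TYPE('d) M V (\<lambda>y. (p y)\<^sup>2) f + r2 + r3 \<and>
              \<bar>r2\<bar> \<le> C2 * \<epsilon> N \<and>
              \<bar>r3\<bar> \<le> C3 * sqrt (ln (real N) / (real N * \<epsilon> N powr (real CARD('d) / 2)) *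
                (\<integral>y. norm (manifold_grad TYPE('d) M f y) ^ 4 * (p y)\<^sup>2 \<partial>V)))))"
proof -
  obtain a B \<xi>0 where k: "decaying_kernel k0 a B" "decaying_kernel (\<lambda>\<xi>. (k0 \<xi>)\<^sup>2) a (4 * B\<^sup>2)"
    and nn: "\<And>\<xi>. \<xi> \<ge> 0 \<Longrightarrow> k0 \<xi> \<ge> 0" and \<xi>0: "\<xi>0 \<ge> 0" "k0 \<xi>0 > 0"
    using admissible_kernel_decaying[OF kernel] by metis
  define m2 where "m2 = kernel_moment TYPE('d) k0 2"
  define m4 where "m4 = kernel_moment TYPE('d) (\<lambda>\<xi>. (k0 \<xi>)\<^sup>2) 4"
  have m2: "m2 > 0" unfolding m2_def by (rule kernel_moment_pos[OF k(1) nn \<xi>0]) auto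
  have m4: "m4 > 0" unfolding m4_def by (rule kernel_moment_pos[OF k(2) _ \<xi>0(1)]) (use \<xi>0 in auto)
  have km2: "kernel_m2 TYPE('d) k0 = m2" unfolding m2_def by (rule kernel_m2_eq_moment[OF k(1)])
  define K where "K = 3 * sqrt (48 * m4) / m2"
  have K: "K > 0" using m2 m4 by (simp add: K_def)
  have cM: "compact M" using manifold by (simp add: compact_smooth_manifold_def)
  note vs = volume_sets[OF cM volume]
  show ?thesis
  \<comment> \<open>C1 = 3 is the constant of \<open>graph_dirichlet_ratio\<close>, and C3 = 4 K
    carries the 4 of \<open>perturbed_expansion\<close>. K is built from two kernel moments, so both
    can be chosen before p, f and \<beta>.\<close>
  proof (rule exI[of _ "3::real"], rule conjI, simp, rule exI[of _ "4 * K"], rule conjI, simp add: K, intro allI impI, rule conjI, intro allI impI, goal_cases)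
    case (1 p f \<beta>)
    then have p: "smooth_density TYPE('d) M V p" and f: "smooth_function TYPE('d) M f" by auto
    note pd = smooth_densityD[OF manifold volume p]
    obtain C where C: "C > 0" and core: "\<And>\<epsilon>. (\<forall>N. \<epsilon> N > 0) \<and> \<epsilon> \<in> o(\<lambda>_. 1) \<and>
       (\<lambda>N. \<epsilon> N powr (real CARD('d) / 2) * real N) \<in> \<omega>(\<lambda>N. ln (real N)) \<Longrightarrow>
       (\<forall>\<^sub>F N in sequentially. \<exists>A\<in>sets (iid_samples V p N). measure (iid_samples V p N) A > 1 - 2 / real N ^ 10 \<and>
          (\<forall>x\<in>A. (\<forall>i<N. x i \<in> M) \<and>
            \<bar>graph_dirichlet TYPE('d) k0 \<beta> p (\<epsilon> N) N x f - manifold_dirichlet TYPE('d) M V (\<lambda>y. p y powr (2 - 2 * \<beta>)) f\<bar>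
            \<le> C * \<epsilon> N + K * sqrt (ln (real N) / (real N * \<epsilon> N powr (real CARD('d) / 2)) *
                (\<integral>y. norm (manifold_grad TYPE('d) M f y) ^ 4 * p y powr (2 - 4 * \<beta>) \<partial>V))))"
      using graph_dirichlet_exact[OF manifold volume k nn \<xi>0 p f, of \<beta>] unfolding K_def m2_def m4_def by blast
    show ?case
    proof (intro exI[of _ "4 * C"] conjI allI impI, goal_cases)
      case 1 show ?case using C by simp
    next
      case (2 \<epsilon> ph \<epsilon>p)
      then have e: "(\<forall>N. \<epsilon> N > 0) \<and> \<epsilon> \<in> o(\<lambda>_. 1) \<and> (\<lambda>N. \<epsilon> N powr (real CARD('d) / 2) * real N) \<in> \<omega>(\<lambda>N. ln (real N))"
        and est: "\<beta> \<noteq> 0 \<Longrightarrow> (\<forall>\<^sub>F N in sequentially. (SUP x\<in>M. ereal (\<bar>ph N x - p x\<bar> / p x)) < ereal (\<epsilon>p N) \<and> \<epsilon>p N < 0.1) \<and> \<epsilon>p \<in> o(\<lambda>_. 1)"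
        by blast+
      \<comment> \<open>For fixed \<beta> the factor in front of \<epsilon>p is a constant, so
        eventually \<eta> < 1, which the comparison of the two graph forms presupposes.\<close>
      have ev: "\<forall>\<^sub>F N in sequentially. \<beta> \<noteq> 0 \<longrightarrow> (SUP x\<in>M. ereal (\<bar>ph N x - p x\<bar> / p x)) < ereal (\<epsilon>p N) \<and> \<epsilon>p N < 0.1 \<and> \<bar>\<beta> * c_factor \<beta> * \<epsilon>p N\<bar> < 1"
      proof (cases "\<beta> = 0")
        case False
        have "(\<epsilon>p \<longlongrightarrow> 0) sequentially" using est[OF False] smalloD_tendsto[of \<epsilon>p sequentially "\<lambda>_. 1"] by simp
        then have "((\<lambda>N. \<bar>\<beta> * c_factor \<beta> * \<epsilon>p N\<bar>) \<longlongrightarrow> 0) sequentially"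
          by (intro tendsto_rabs_zero tendsto_mult_right_zero)
        then have "\<forall>\<^sub>F N in sequentially. \<bar>\<beta> * c_factor \<beta> * \<epsilon>p N\<bar> < 1" by (rule order_tendstoD(2)) simp
        then show ?thesis using est[OF False, THEN conjunct1] by eventually_elim simp
      qed simp
      show ?case
        using core[OF e] ev eventually_ge_at_top[of 1]
      proof eventually_elim
        case (elim N)
        let ?S = "sqrt (ln (real N) / (real N * \<epsilon> N powr (real CARD('d) / 2)) *
                (\<integral>y. norm (manifold_grad TYPE('d) M f y) ^ 4 * p y powr (2 - 4 * \<beta>) \<partial>V))"
        let ?D = "manifold_dirichlet TYPE('d) M V (\<lambda>y. p y powr (2 - 2 * \<beta>)) f"
        have eN: "\<epsilon> N > 0" using e by blast
        have S0: "?S \<ge> 0" using elim(3) by (intro real_sqrt_ge_zero mult_nonneg_nonneg divide_nonneg_nonneg Bochner_Integration.integral_nonneg) auto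
        obtain A where A: "A \<in> sets (iid_samples V p N)" "measure (iid_samples V p N) A > 1 - 2 / real N ^ 10"
          and Ax: "\<And>x. x \<in> A \<Longrightarrow> (\<forall>i<N. x i \<in> M) \<and> \<bar>graph_dirichlet TYPE('d) k0 \<beta> p (\<epsilon> N) N x f - ?D\<bar> \<le> C * \<epsilon> N + K * ?S"
          using elim(1) by blast
        define \<eta> where "\<eta> = \<bar>\<beta> * c_factor \<beta> * \<epsilon>p N\<bar>"
        have goal: "\<exists>r1 r2 r3. graph_dirichlet TYPE('d) k0 \<beta> (ph N) (\<epsilon> N) N x f = ?D * (1 + r1) + r2 + r3 \<and>
              \<bar>r1\<bar> \<le> 3 * \<eta> \<and> \<bar>r2\<bar> \<le> 4 * (C * \<epsilon> N) \<and> \<bar>r3\<bar> \<le> 4 * (K * ?S)" if x: "x \<in> A" for x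
        proof -
          have xM: "\<And>i. i < N \<Longrightarrow> x i \<in> M" using Ax[OF x] by blast
          have m: "kernel_m2 TYPE('d) k0 > 0" using m2 km2 by simp
          have px: "\<And>i. i < N \<Longrightarrow> p (x i) > 0" using xM pd(4) by blast
          have bd: "\<bar>graph_dirichlet TYPE('d) k0 \<beta> p (\<epsilon> N) N x f - ?D\<bar> \<le> C * \<epsilon> N + K * ?S" using Ax[OF x] by blast
          \<comment> \<open>Comparing p with itself, with zero error, yields the nonnegativity of
            the form.\<close>
          have G0: "0 \<le> graph_dirichlet TYPE('d) k0 \<beta> p (\<epsilon> N) N x f"
            by (rule graph_dirichlet_ratio(2)[where ph = p and e = 0 and \<eta> = 0]) (use eN nn m px in auto)
          show ?thesis
          proof (cases "\<beta> = 0")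
            case True
            show ?thesis
              by (rule perturbed_expansion[OF bd G0]) (use C K S0 eN True in \<open>auto simp: \<eta>_def graph_dirichlet_unweighted[of _ _ "ph N" _ _ _ _ p]\<close>)
          next
            case False
            then have sup: "(SUP x\<in>M. ereal (\<bar>ph N x - p x\<bar> / p x)) < ereal (\<epsilon>p N)" "\<epsilon>p N < 0.1" "\<bar>\<beta> * c_factor \<beta> * \<epsilon>p N\<bar> < 1"
              using elim(2) by auto
            \<comment> \<open>The supremum over M dominates the relative error at each sample point,
              since the event keeps the samples in M.\<close>
            have r: "\<bar>ph N (x i) - p (x i)\<bar> / p (x i) \<le> \<epsilon>p N" if "i < N" for i
            proof -
              have "ereal (\<bar>ph N (x i) - p (x i)\<bar> / p (x i)) \<le> (SUP x\<in>M. ereal (\<bar>ph N x - p x\<bar> / p x))"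
                using xM[OF that] by (intro SUP_upper)
              then have "ereal (\<bar>ph N (x i) - p (x i)\<bar> / p (x i)) < ereal (\<epsilon>p N)" using sup(1) by (rule le_less_trans)
              then show ?thesis by simp
            qed
            have le: "\<bar>\<beta>\<bar> * c_factor \<beta> * \<epsilon>p N \<le> \<eta>" 
              using c_factor_pos[of \<beta>] by (simp add: \<eta>_def abs_mult mult_left_mono)
            have "\<bar>graph_dirichlet TYPE('d) k0 \<beta> (ph N) (\<epsilon> N) N x f - graph_dirichlet TYPE('d) k0 \<beta> p (\<epsilon> N) N x f\<bar> \<le> 3 * \<eta> * graph_dirichlet TYPE('d) k0 \<beta> p (\<epsilon> N) N x f"
            proof (rule graph_dirichlet_ratio(1)[where e = "\<epsilon>p N"])
              show "\<bar>\<beta>\<bar> * c_factor \<beta> * \<epsilon>p N \<le> \<eta>" by (rule le)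
            qed (use eN nn m px r sup in \<open>auto simp: \<eta>_def\<close>)
            then show ?thesis
              by (intro perturbed_expansion[OF bd G0]) (use C K S0 eN sup(3) in \<open>auto simp: \<eta>_def\<close>)
          qed
        qed
        show ?case unfolding holds_with_prob_gt_def
          by (rule bexI[OF _ A(1)], rule conjI[OF A(2)], rule ballI) (use goal in \<open>simp add: \<eta>_def mult.assoc\<close>)
      qed
    qed
  next
    case (2 p f)
    then have p: "smooth_density TYPE('d) M V p" and f: "smooth_function TYPE('d) M f" by auto
    note pd = smooth_densityD[OF manifold volume p]
    \<comment> \<open>Positivity of p on M identifies \<open>powr 2\<close> with the square.\<close>
    have D: "manifold_dirichlet TYPE('d) M V (\<lambda>y. p y powr (2 - 2 * 0)) f = manifold_dirichlet TYPE('d) M V (\<lambda>y. (p y)\<^sup>2) f"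
      unfolding manifold_dirichlet_def using pd(4) vs(2) by (intro Bochner_Integration.integral_cong) (auto simp: less_imp_le)
    have I: "(\<integral>y. norm (manifold_grad TYPE('d) M f y) ^ 4 * p y powr (2 - 4 * 0) \<partial>V) = (\<integral>y. norm (manifold_grad TYPE('d) M f y) ^ 4 * (p y)\<^sup>2 \<partial>V)"
      using pd(4) vs(2) by (intro Bochner_Integration.integral_cong) (auto simp: less_imp_le)
    obtain C where C: "C > 0" and core: "\<And>\<epsilon>. (\<forall>N. \<epsilon> N > 0) \<and> \<epsilon> \<in> o(\<lambda>_. 1) \<and>
       (\<lambda>N. \<epsilon> N powr (real CARD('d) / 2) * real N) \<in> \<omega>(\<lambda>N. ln (real N)) \<Longrightarrow>
       (\<forall>\<^sub>F N in sequentially. \<exists>A\<in>sets (iid_samples V p N). measure (iid_samples V p N) A > 1 - 2 / real N ^ 10 \<and>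
          (\<forall>x\<in>A. (\<forall>i<N. x i \<in> M) \<and>
            \<bar>graph_dirichlet TYPE('d) k0 0 p (\<epsilon> N) N x f - manifold_dirichlet TYPE('d) M V (\<lambda>y. (p y)\<^sup>2) f\<bar>
            \<le> C * \<epsilon> N + K * sqrt (ln (real N) / (real N * \<epsilon> N powr (real CARD('d) / 2)) *
                (\<integral>y. norm (manifold_grad TYPE('d) M f y) ^ 4 * (p y)\<^sup>2 \<partial>V))))"
      using graph_dirichlet_exact[OF manifold volume k nn \<xi>0 p f, of 0] unfolding K_def m2_def m4_def D I by blast
    show ?case
    proof (intro exI[of _ C] conjI allI impI C, goal_cases)
      case (1 \<epsilon>)
      then have e: "\<And>N. \<epsilon> N > 0" by blast
      show ?case
        using core[OF 1] eventually_ge_at_top[of 1]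
      proof eventually_elim
        case (elim N)
        let ?S = "sqrt (ln (real N) / (real N * \<epsilon> N powr (real CARD('d) / 2)) *
                (\<integral>y. norm (manifold_grad TYPE('d) M f y) ^ 4 * (p y)\<^sup>2 \<partial>V))"
        let ?D = "manifold_dirichlet TYPE('d) M V (\<lambda>y. (p y)\<^sup>2) f"
        have S0: "?S \<ge> 0" using elim(2) e[of N] by (intro real_sqrt_ge_zero mult_nonneg_nonneg divide_nonneg_nonneg Bochner_Integration.integral_nonneg) auto
        obtain A where A: "A \<in> sets (iid_samples V p N)" "measure (iid_samples V p N) A > 1 - 2 / real N ^ 10"
          and Ax: "\<And>x. x \<in> A \<Longrightarrow> \<bar>graph_dirichlet TYPE('d) k0 0 p (\<epsilon> N) N x f - ?D\<bar> \<le> C * \<epsilon> N + K * ?S"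
          using elim(1) by blast
        have goal: "\<exists>r2 r3. graph_dirichlet TYPE('d) k0 0 (\<lambda>_. 1) (\<epsilon> N) N x f = ?D + r2 + r3 \<and>
              \<bar>r2\<bar> \<le> C * \<epsilon> N \<and> \<bar>r3\<bar> \<le> 4 * K * ?S" if x: "x \<in> A" for x
        proof -
          \<comment> \<open>Here K alone would do; it is enlarged because C3 is shared with the
            general case.\<close>
          have "K * ?S \<le> 4 * K * ?S" using K S0 by (intro mult_right_mono) auto
          then have "\<bar>graph_dirichlet TYPE('d) k0 0 p (\<epsilon> N) N x f - ?D\<bar> \<le> C * \<epsilon> N + 4 * K * ?S" using Ax[OF x] by linarith
          then obtain r s where "graph_dirichlet TYPE('d) k0 0 p (\<epsilon> N) N x f - ?D = r + s" "\<bar>r\<bar> \<le> C * \<epsilon> N" "\<bar>s\<bar> \<le> 4 * K * ?S"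
            using split_abs_bound[of _ "C * \<epsilon> N" "4 * K * ?S"] C K S0 e[of N] by force
          then show ?thesis
            unfolding graph_dirichlet_unweighted[of _ _ "\<lambda>_. 1" _ _ _ _ p]
            by (intro exI[of _ r] exI[of _ s]) simp
        qed
        show ?case unfolding holds_with_prob_gt_def
          by (rule bexI[OF _ A(1)], rule conjI[OF A(2)], rule ballI) (rule goal)
      qed
    qed
  qed
qed

end
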